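(* Let $\alpha>1$ and let $q\in W^{\alpha,2}(\mathbb{R}^3)$ be compactly supported. Let $q_B$ be the Born approximation of $q$ for backscattering data. Then $q-q_B$ is a continuous function.
   Context: Here $n=3$. Fourier transform: $\hat f(\xi)=\int_{\mathbb{R}^n}e^{-i\xi\cdot x}f(x)\,dx$. $W^{\alpha,2}(\mathbb{R}^n)=\{f\in\mathcal S'(\mathbb{R}^n): (1+|\cdot|^2)^{\alpha/2}\hat f\in L^2(\mathbb{R}^n)\}$. For $k>0$ the outgoing resolvent $R_k$ of the Laplacian is defined by $\widehat{R_k(f)}(\xi)=(-|\xi|^2+k^2+i0)^{-1}\hat f(\xi)$. For $\theta\in S^{n-1}$ the scattering solution $u(\cdot,\theta,k)$ is the solution of the Lippmann-Schwinger equation $$u(x,\theta,k)=e^{ikx\cdot\theta}+R_k\big(q(\cdot)u(\cdot,\theta,k)\big)(x),$$ which, for compactly supported $q\in L^r(\mathbb{R}^n)$ with $r>n/2$, exists, is unique and is given by the convergent Neumann-Born series for all $k>k_0$, where $k_0\geq 0$ depends on an a priori bound of $q$ (if $1/p-1/p'=1/r$ with $p'$ the conjugate exponent of $p$, then $R_k:L^p\to L^{p'}$ has norm tending to $0$ as $k\to\infty$). The scattering amplitude (far field pattern) is $$A(\theta',\theta,k)=\int_{\mathbb{R}^n}e^{-ik\theta'\cdot y}q(y)u(y,\theta,k)\,dy,\qquad \theta',\theta\in S^{n-1}.$$ The Born approximation for backscattering data $q_B$ is defined by $\hat q_B(\xi)=A(-\theta,\theta,k)$ where $\xi=-2k\theta$,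 i.e. $k=|\xi|/2$, $\theta=-\xi/|\xi|$. Only large frequencies matter: if $\chi^*\in C^\infty(\mathbb{R})$ vanishes for $t<C_0$ and equals $1$ for $t\ge 2C_0$, with $C_0$ large, and $\hat q_{B,H}(\xi)=A(-\theta,\theta,k)\chi^*(k)$, then $q_B$ and $q_{B,H}$ differ by a $C^\infty$ function, and $q_B$ may be taken to be $q_{B,H}$ modulo $C^\infty(\mathbb{R}^n)$. *)

theory Defs
  imports "HOL-Analysis.Analysis"
begin

section \<open>Test functions and Schwartz functions\<close>

primrec iter_partial ::
    "'a::euclidean_space list \<Rightarrow> ('a \<Rightarrow> 'b::real_normed_vector) \<Rightarrow> 'a \<Rightarrow> 'b" where
  "iter_partial [] f = f"
| "iter_partial (b # bs) f = (\<lambda>x. frechet_derivative (iter_partial bs f) (at x) b)"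

definition smooth :: "('a::euclidean_space \<Rightarrow> 'b::real_normed_vector) \<Rightarrow> bool" where
  "smooth f \<longleftrightarrow> (\<forall>bs\<in>lists Basis. \<forall>x. iter_partial bs f differentiable (at x))"

definition test_functions :: "('a::euclidean_space \<Rightarrow> complex) set" where
  "test_functions = {\<phi>. smooth \<phi> \<and> compact (closure {x. \<phi> x \<noteq> 0})}"

definition schwartz :: "('a::euclidean_space \<Rightarrow> complex) set" where
  "schwartz = {\<phi>. smooth \<phi> \<and>
     (\<forall>N. \<forall>bs\<in>lists Basis. bdd_above (range (\<lambda>x. (1 + norm x) ^ N * norm (iter_partial bs \<phi> x))))}"

definition schwartz_norm :: "nat \<Rightarrow> ('a::euclidean_space \<Rightarrow> complex) \<Rightarrow> real" where
  "schwartz_norm N \<phi> =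
     (\<Sum>bs | bs \<in> lists Basis \<and> length bs \<le> N. SUP x. (1 + norm x) ^ N * norm (iter_partial bs \<phi> x))"


section \<open>Tempered distributions\<close>

text \<open>A distribution is a functional on functions of which only the values on
  Schwartz functions matter.\<close>

type_synonym 'a functional = "('a \<Rightarrow> complex) \<Rightarrow> complex"

definition tempered_distribution :: "'a::euclidean_space functional \<Rightarrow> bool" where
  "tempered_distribution T \<longleftrightarrow>
     (\<forall>\<phi>\<in>schwartz. \<forall>\<psi>\<in>schwartz. T (\<lambda>x. \<phi> x + \<psi> x) = T \<phi> + T \<psi>) \<and>
     (\<forall>c. \<forall>\<phi>\<in>schwartz. T (\<lambda>x. c * \<phi> x) = c * T \<phi>) \<and>
     (\<exists>C N. \<forall>\<phi>\<in>schwartz. norm (T \<phi>) \<le> C * schwartz_norm N \<phi>)"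

definition locally_integrable :: "('a::euclidean_space \<Rightarrow> complex) \<Rightarrow> bool" where
  "locally_integrable f \<longleftrightarrow> (\<forall>K. compact K \<longrightarrow> f absolutely_integrable_on K)"

definition distr_of :: "('a::euclidean_space \<Rightarrow> complex) \<Rightarrow> 'a functional" where
  "distr_of f = (\<lambda>\<phi>. LINT x|lebesgue. f x * \<phi> x)"

text \<open>The distribution \<open>T\<close> is the function \<open>f\<close>. It suffices to test against compactly
  supported smooth functions, as these are dense in the Schwartz space.\<close>

definition is_function :: "'a::euclidean_space functional \<Rightarrow> ('a \<Rightarrow> complex) \<Rightarrow> bool" where
  "is_function T f \<longleftrightarrow> locally_integrable f \<and> (\<forall>\<phi>\<in>test_functions. T \<phi> = distr_of f \<phi>)"


section \<open>Fourier transform and Sobolev spaces\<close>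

definition fourier :: "('a::euclidean_space \<Rightarrow> complex) \<Rightarrow> 'a \<Rightarrow> complex" where
  "fourier f \<xi> = (LINT x|lebesgue. exp (- \<i> * complex_of_real (\<xi> \<bullet> x)) * f x)"

definition inv_fourier :: "('a::euclidean_space \<Rightarrow> complex) \<Rightarrow> 'a \<Rightarrow> complex" where
  "inv_fourier f x =
     (LINT \<xi>|lebesgue. exp (\<i> * complex_of_real (\<xi> \<bullet> x)) * f \<xi>) / complex_of_real ((2 * pi) ^ DIM('a))"

definition fourier_distr :: "'a::euclidean_space functional \<Rightarrow> 'a functional" where
  "fourier_distr T = (\<lambda>\<phi>. T (fourier \<phi>))"

definition inv_fourier_distr :: "'a::euclidean_space functional \<Rightarrow> 'a functional" where
  "inv_fourier_distr T = (\<lambda>\<phi>. T (inv_fourier \<phi>))"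

definition L2 :: "('a::euclidean_space \<Rightarrow> complex) set" where
  "L2 = {f. f \<in> borel_measurable lebesgue \<and> integrable lebesgue (\<lambda>x. (norm (f x))\<^sup>2)}"

definition sobolev :: "real \<Rightarrow> 'a::euclidean_space functional set" where
  "sobolev \<alpha> = {T. tempered_distribution T \<and>
     (\<exists>h. is_function (fourier_distr T) h \<and>
          (\<lambda>\<xi>. complex_of_real ((1 + (norm \<xi>)\<^sup>2) powr (\<alpha> / 2)) * h \<xi>) \<in> L2)}"

definition sobolev_fun :: "real \<Rightarrow> ('a::euclidean_space \<Rightarrow> complex) set" where
  "sobolev_fun \<alpha> = {f. \<exists>T\<in>sobolev \<alpha>. is_function T f}"

text \<open>Functions are considered up to null sets, hence the support is the essential one.\<close>

definition compactly_supported :: "('a::euclidean_space \<Rightarrow> complex) \<Rightarrow> bool" where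
  "compactly_supported f \<longleftrightarrow> (\<exists>K. compact K \<and> (AE x in lebesgue. x \<notin> K \<longrightarrow> f x = 0))"


section \<open>Scattering solutions and scattering amplitude\<close>

text \<open>The distribution \<open>(- |\<xi>|\<^sup>2 + k\<^sup>2 + i 0)\<^sup>-\<^sup>1\<close>.\<close>

definition outgoing_symbol :: "real \<Rightarrow> 'a::euclidean_space functional" where
  "outgoing_symbol k = (\<lambda>\<psi>. Lim (at_right 0)
     (\<lambda>\<epsilon>::real. LINT \<xi>|lebesgue. \<psi> \<xi> / (complex_of_real (- (norm \<xi>)\<^sup>2 + k\<^sup>2) + \<i> * complex_of_real \<epsilon>)))"

text \<open>For integrable \<open>f\<close> vanishing outside a compact set, \<open>fourier f\<close> is a smooth function all
  of whose derivatives are bounded; its product with the distribution \<^term>\<open>outgoing_symbol k\<close>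
  is therefore defined by transposition.\<close>

definition resolvent :: "real \<Rightarrow> ('a::euclidean_space \<Rightarrow> complex) \<Rightarrow> 'a functional" where
  "resolvent k f = inv_fourier_distr (\<lambda>\<psi>. outgoing_symbol k (\<lambda>\<xi>. fourier f \<xi> * \<psi> \<xi>))"

definition plane_wave :: "real \<Rightarrow> 'a::euclidean_space \<Rightarrow> 'a \<Rightarrow> complex" where
  "plane_wave k \<theta> x = exp (\<i> * complex_of_real (k * (x \<bullet> \<theta>)))"

text \<open>The equation \<open>u = plane_wave k \<theta> + resolvent k (q u)\<close>, as an identity of distributions,
  in the largest class of functions \<open>u\<close> in which both sides make sense.\<close>

definition lippmann_schwinger ::
    "('a::euclidean_space \<Rightarrow> complex) \<Rightarrow> 'a \<Rightarrow> real \<Rightarrow> ('a \<Rightarrow> complex) \<Rightarrow> bool" where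
  "lippmann_schwinger q \<theta> k u \<longleftrightarrow>
     locally_integrable u \<and> integrable lebesgue (\<lambda>y. q y * u y) \<and>
     is_function (resolvent k (\<lambda>y. q y * u y)) (\<lambda>x. u x - plane_wave k \<theta> x)"

text \<open>For compactly supported \<open>q\<close> in \<open>L\<^sup>r\<close>, where \<open>r > n/2\<close>, and large \<open>k\<close> the solution exists
  and is unique up to null sets, on which the amplitude below does not depend.\<close>

definition scattering_solution ::
    "('a::euclidean_space \<Rightarrow> complex) \<Rightarrow> 'a \<Rightarrow> real \<Rightarrow> 'a \<Rightarrow> complex" where
  "scattering_solution q \<theta> k = (SOME u. lippmann_schwinger q \<theta> k u)"

definition scattering_amplitude ::
    "('a::euclidean_space \<Rightarrow> complex) \<Rightarrow> 'a \<Rightarrow> 'a \<Rightarrow> real \<Rightarrow> complex" where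
  "scattering_amplitude q \<theta>' \<theta> k =
     (LINT y|lebesgue. exp (- \<i> * complex_of_real (k * (\<theta>' \<bullet> y))) * q y * scattering_solution q \<theta> k y)"


section \<open>Born approximation for backscattering data\<close>

definition high_freq_cutoff :: "real \<Rightarrow> (real \<Rightarrow> real) \<Rightarrow> bool" where
  "high_freq_cutoff C\<^sub>0 \<eta> \<longleftrightarrow> smooth \<eta> \<and> (\<forall>t<C\<^sub>0. \<eta> t = 0) \<and> (\<forall>t\<ge>2 * C\<^sub>0. \<eta> t = 1)"

definition backscattering_data ::
    "('a::euclidean_space \<Rightarrow> complex) \<Rightarrow> (real \<Rightarrow> real) \<Rightarrow> 'a \<Rightarrow> complex" where
  "backscattering_data q \<eta> \<xi> =
     (let k = norm \<xi> / 2; \<theta> = - (\<xi> /\<^sub>R norm \<xi>)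
      in scattering_amplitude q (- \<theta>) \<theta> k * complex_of_real (\<eta> k))"

text \<open>The Born approximation is only determined modulo smooth functions; the choice of
  the cutoff \<open>\<eta>\<close> fixes a representative.\<close>

definition born_approximation ::
    "('a::euclidean_space \<Rightarrow> complex) \<Rightarrow> (real \<Rightarrow> real) \<Rightarrow> 'a functional" where
  "born_approximation q \<eta> = inv_fourier_distr (distr_of (backscattering_data q \<eta>))"

end

theory Submission
  imports Defs "HOL-Probability.Probability"
begin

text \<open>Write \<open>F\<close> for the Fourier transform and \<open>J(\<xi>) = (1 + |\<xi>|^2)^(1/2)\<close>, and let \<open>q\<close> vanish outside the
  ball of radius \<open>\<rho>\<close>. The resolvent is the convolution with \<open>G(x) = - exp(i k |x|) / (4 \<pi> |x|)\<close>. On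
  the support of \<open>q\<close> this kernel may be replaced by its restriction \<open>K\<close> to the ball of radius \<open>2 \<rho>\<close>,
  and \<open>|F K(\<xi>)|^2 \<le> const / (k J(\<xi>))\<close>. Hence for the wave vector \<open>c\<close> of the incident wave the
  Lippmann-Schwinger equation becomes \<open>w(\<zeta>) = F q(\<zeta> - c) + T w(\<zeta>)\<close> for \<open>w = F (q u)\<close>, where \<open>T\<close> is
  multiplication by \<open>F K\<close> followed by convolution with \<open>F q\<close>. By the Cauchy-Schwarz inequality with
  weight \<open>J^\<alpha>\<close>, \<open>T\<close> is a contraction of the bounded functions for large \<open>k\<close>, so that \<open>w\<close> is the sum of
  the Born series with terms \<open>d\<^sub>n = T^n (F q(\<sqdot> - c))\<close>.

  The same inequality gives \<open>J(\<zeta>)^(2\<alpha>) |d\<^sub>n(\<zeta> + c)|^2 \<le> (b / k)^n \<sigma>\<^sub>n(\<zeta>)\<close>, where \<open>\<sigma>\<^sub>n\<close> is the iterated convolution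
  of \<open>n + 1\<close> copies of the integrable function \<open>J^(2\<alpha>) |F q|^2\<close> and depends neither on \<open>k\<close> nor on \<open>c\<close>.
  The backscattering amplitude at \<open>\<xi>\<close> is \<open>w(- c)\<close> with \<open>c = - \<xi> / 2\<close> and \<open>k = |\<xi>| / 2\<close>. Taking \<open>\<zeta> = \<xi>\<close>, the
  term \<open>n = 0\<close> is \<open>F q(\<xi>)\<close>, and by the inequality of arithmetic and geometric means the remaining sum
  is integrable over large \<open>\<xi>\<close>, because \<open>J^(- 2\<alpha> - 1)\<close> is integrable in dimension 3. Therefore
  \<open>F (q - q\<^sub>B)\<close> is integrable.

  All test functions are built from a given cutoff: if there were none, there would be nothing to prove.\<close>

section \<open>Smooth functions\<close>

text \<open>The symbol 1 / (k^2 - |\<xi>|^2) of the resolvent is singular on a sphere and has no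
  pointwise bound that a weighted estimate could use. Cutting the kernel off at distance D = 2
  \<rho> changes nothing where \<open>q\<close> lives and makes the symbol bounded: its size is at
  most 2 D / k and, after an integration by parts, D / |\<xi>|. The factors 1 / k and 1 / J come
  from multiplying two such bounds. The factor 1 / k is what lets \<alpha> go down to 1: the
  comparison of means produces J^(-2 \<alpha>) / k, and k = |\<xi>| / 2 supplies the missing power
  of J, so that 2 \<alpha> + 1 > 3 suffices.

  The scattering solution is an arbitrary choice from a large class of solutions, in which the
  product of \<open>q\<close> and the solution is merely integrable, so every solution has to be
  controlled. Uniqueness is proved after Fourier transform: the transform of this product is
  bounded, and T contracts bounded functions. To derive the transformed equation under mere
  integrability, \<open>q\<close> must be square integrable; this is recovered from its
  transform.\<close>

abbreviation partial_deriv ::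
    "'a::euclidean_space \<Rightarrow> ('a \<Rightarrow> 'b::real_normed_vector) \<Rightarrow> 'a \<Rightarrow> 'b" where
  "partial_deriv b f \<equiv> (\<lambda>x. frechet_derivative f (at x) b)"

text \<open>The recursion takes off the innermost derivative first, whereas
  \<open>iter_partial\<close> adds derivatives on the outside. Thus the sum, product and chain rules
  are applied once, and the induction hypothesis handles the functions that they produce.\<close>

primrec Ck :: "nat \<Rightarrow> ('a::euclidean_space \<Rightarrow> 'b::real_normed_vector) \<Rightarrow> bool" where
  "Ck 0 f \<longleftrightarrow> (\<forall>x. f differentiable (at x))"
| "Ck (Suc n) f \<longleftrightarrow> (\<forall>x. f differentiable (at x)) \<and> (\<forall>b\<in>Basis. Ck n (partial_deriv b f))"

lemma iter_partial_snoc: "iter_partial (bs @ [b]) f = iter_partial bs (partial_deriv b f)"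
  by (induction bs) auto

lemma Ck_differentiable: "Ck n f \<Longrightarrow> f differentiable (at x)"
  by (cases n) auto

lemma Ck_Suc_imp: "Ck (Suc n) f \<Longrightarrow> Ck n f"
proof (induction n arbitrary: f)
  case (Suc n)
  then show ?case by (simp only: Ck.simps(2)[of "Suc n"] Ck.simps(2)[of n]) blast
qed auto

lemma Ck_iff_iter_partial:
  "Ck n f \<longleftrightarrow> (\<forall>bs\<in>lists Basis. length bs \<le> n \<longrightarrow> (\<forall>x. iter_partial bs f differentiable (at x)))"
proof (induction n arbitrary: f)
  case 0
  then show ?case by auto
next
  case (Suc n)
  show ?case
  proof
    assume C: "Ck (Suc n) f"
    show "\<forall>bs\<in>lists Basis. length bs \<le> Suc n \<longrightarrow> (\<forall>x. iter_partial bs f differentiable (at x))"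
    proof (intro ballI impI allI)
      fix bs :: "'a list" and x
      assume bs: "bs \<in> lists Basis" "length bs \<le> Suc n"
      show "iter_partial bs f differentiable (at x)"
      \<comment> \<open>The last entry of the list is the derivative that is taken first, hence the
        split from the right.\<close>
      proof (cases bs rule: rev_cases)
        case Nil
        with C show ?thesis by auto
      next
        case (snoc ys y)
        with C Suc[of "partial_deriv y f"] bs show ?thesis by (auto simp: iter_partial_snoc)
      qed
    qed
  next
    assume R: "\<forall>bs\<in>lists Basis. length bs \<le> Suc n \<longrightarrow> (\<forall>x. iter_partial bs f differentiable (at x))"
    have "Ck n (partial_deriv b f)" if "b \<in> Basis" for b
    proof -
      have "iter_partial (bs @ [b]) f differentiable (at x)" if "bs \<in> lists Basis" "length bs \<le> n" for bs x
        using R \<open>b \<in> Basis\<close> that by (auto simp del: iter_partial.simps)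
      then show ?thesis using Suc[of "partial_deriv b f"] by (auto simp: iter_partial_snoc)
    qed
    moreover have "f differentiable (at x)" for x using R[rule_format, of "[]"] by auto
    ultimately show "Ck (Suc n) f" by auto
  qed
qed

lemma smooth_iff_Ck: "smooth f \<longleftrightarrow> (\<forall>n. Ck n f)"
  unfolding smooth_def Ck_iff_iter_partial by auto

lemma smooth_differentiable: "smooth f \<Longrightarrow> f differentiable (at x)"
  using Ck_differentiable smooth_iff_Ck by blast

lemma smooth_partial_deriv: "smooth f \<Longrightarrow> b \<in> Basis \<Longrightarrow> smooth (partial_deriv b f)"
  unfolding smooth_iff_Ck using Ck.simps(2) by blast

lemma smooth_iter_partial: "smooth f \<Longrightarrow> bs \<in> lists Basis \<Longrightarrow> smooth (iter_partial bs f)"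
  by (induction bs) (auto intro: smooth_partial_deriv)

lemma smooth_continuous_on: "smooth f \<Longrightarrow> continuous_on S f"
  by (meson continuous_at_imp_continuous_on differentiable_imp_continuous_within smooth_differentiable)

lemma smooth_borel: "smooth f \<Longrightarrow> f \<in> borel_measurable borel"
  by (intro borel_measurable_continuous_onI smooth_continuous_on)

lemma Ck_const: "Ck n (\<lambda>x. c)"
  by (induction n arbitrary: c) (auto simp: frechet_derivative_const)

lemma partial_deriv_add:
  assumes "\<And>x. f differentiable (at x)" "\<And>x. g differentiable (at x)"
  shows "partial_deriv b (\<lambda>x. f x + g x) = (\<lambda>x. partial_deriv b f x + partial_deriv b g x)"
proof
  fix x
  have "((\<lambda>x. f x + g x) has_derivative
      (\<lambda>h. frechet_derivative f (at x) h + frechet_derivative g (at x) h)) (at x)"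
    using assms by (intro has_derivative_add) (auto simp: frechet_derivative_works[symmetric])
  then show "partial_deriv b (\<lambda>x. f x + g x) x = partial_deriv b f x + partial_deriv b g x"
    by (simp add: frechet_derivative_at[symmetric])
qed

lemma Ck_add: "Ck n f \<Longrightarrow> Ck n g \<Longrightarrow> Ck n (\<lambda>x. f x + g x)"
proof (induction n arbitrary: f g)
  case (Suc n)
  then have d: "f differentiable (at x)" "g differentiable (at x)" for x by auto
  then show ?case
    using Suc.prems unfolding Ck.simps partial_deriv_add[OF d]
    by (intro conjI allI ballI differentiable_add Suc.IH) (auto simp: d)
qed auto

lemma partial_deriv_linear:
  assumes "\<And>x. f differentiable (at x)" "bounded_linear L"
  shows "partial_deriv b (\<lambda>x. L (f x)) = (\<lambda>x. L (partial_deriv b f x))"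
proof
  fix x
  have "((\<lambda>x. L (f x)) has_derivative (\<lambda>h. L (frechet_derivative f (at x) h))) (at x)"
    using assms by - (rule bounded_linear.has_derivative[OF assms(2)], auto simp: frechet_derivative_works[symmetric])
  then show "partial_deriv b (\<lambda>x. L (f x)) x = L (partial_deriv b f x)"
    by (simp add: frechet_derivative_at[symmetric])
qed

lemma Ck_linear: "bounded_linear L \<Longrightarrow> Ck n f \<Longrightarrow> Ck n (\<lambda>x. L (f x))"
proof (induction n arbitrary: f)
  case 0
  then show ?case
    by (auto simp: differentiable_def) (metis bounded_linear.has_derivative)
next
  case (Suc n)
  then have d: "f differentiable (at x)" for x by auto
  then have "(\<lambda>x. L (f x)) differentiable (at x)" for x
    using Suc.prems(1) bounded_linear.has_derivative unfolding differentiable_def by metis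
  with Suc.prems show ?case unfolding Ck.simps partial_deriv_linear[OF d Suc.prems(1)]
    by (intro conjI allI ballI Suc.IH) auto
qed

lemma partial_deriv_bilinear:
  assumes "\<And>x. f differentiable (at x)" "\<And>x. g differentiable (at x)" "bounded_bilinear B"
  shows "partial_deriv b (\<lambda>x. B (f x) (g x)) =
    (\<lambda>x. B (f x) (partial_deriv b g x) + B (partial_deriv b f x) (g x))"
proof
  fix x
  have "((\<lambda>x. B (f x) (g x)) has_derivative
      (\<lambda>h. B (f x) (frechet_derivative g (at x) h) + B (frechet_derivative f (at x) h) (g x))) (at x)"
    using assms by - (rule bounded_bilinear.FDERIV[OF assms(3)], auto simp: frechet_derivative_works[symmetric])
  then show "partial_deriv b (\<lambda>x. B (f x) (g x)) x = B (f x) (partial_deriv b g x) + B (partial_deriv b f x) (g x)"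
    by (simp add: frechet_derivative_at[symmetric])
qed

lemma bilinear_differentiable:
  assumes "f differentiable (at x)" "g differentiable (at x)" "bounded_bilinear B"
  shows "(\<lambda>x. B (f x) (g x)) differentiable (at x)"
  using assms bounded_bilinear.FDERIV[OF assms(3)] unfolding differentiable_def by metis

lemma Ck_bilinear:
  assumes B: "bounded_bilinear B"
  shows "Ck n f \<Longrightarrow> Ck n g \<Longrightarrow> Ck n (\<lambda>x. B (f x) (g x))"
proof (induction n arbitrary: f g)
  case 0
  then show ?case by (simp add: bilinear_differentiable[OF _ _ B])
next
  case (Suc n)
  then have d: "f differentiable (at x)" "g differentiable (at x)" for x by auto
  moreover have "Ck n f" "Ck n g" using Suc.prems Ck_Suc_imp by blast+
  moreover have "Ck n (partial_deriv b f)" "Ck n (partial_deriv b g)" if "b \<in> Basis" for b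
    using Suc.prems that by auto
  ultimately show ?case unfolding Ck.simps partial_deriv_bilinear[OF d B]
    by (intro conjI allI ballI Ck_add Suc.IH bilinear_differentiable[OF _ _ B]) auto
qed

lemma partial_deriv_compose_real:
  fixes h :: "real \<Rightarrow> 'b::real_normed_vector" and g :: "'a::euclidean_space \<Rightarrow> real"
  assumes "\<And>x. h differentiable (at x)" "\<And>x. g differentiable (at x)"
  shows "partial_deriv b (\<lambda>x. h (g x)) = (\<lambda>x. partial_deriv b g x *\<^sub>R partial_deriv 1 h (g x))"
proof
  fix x
  have D: "(h has_derivative frechet_derivative h (at (g x))) (at (g x))"
    using assms by (auto simp: frechet_derivative_works[symmetric])
  have "(h \<circ> g has_derivative frechet_derivative h (at (g x)) \<circ> frechet_derivative g (at x)) (at x)"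
    using assms by (intro diff_chain_at) (auto simp: frechet_derivative_works[symmetric])
  then have "partial_deriv b (\<lambda>x. h (g x)) x = frechet_derivative h (at (g x)) (partial_deriv b g x)"
    by (simp add: frechet_derivative_at[symmetric] o_def)
  also have "\<dots> = frechet_derivative h (at (g x)) (partial_deriv b g x *\<^sub>R 1)"
    by simp
  also have "\<dots> = partial_deriv b g x *\<^sub>R partial_deriv 1 h (g x)"
    using linear_frechet_derivative[OF assms(1)] linear_scale by blast
  finally show "partial_deriv b (\<lambda>x. h (g x)) x = partial_deriv b g x *\<^sub>R partial_deriv 1 h (g x)" .
qed

text \<open>Induction over the outer function only: the derivative is a scalar multiple of
  \<open>partial_deriv 1 h\<close> composed with the same \<open>g\<close>, so \<open>g\<close> can
  stay fixed.\<close>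

lemma Ck_compose_real:
  fixes h :: "real \<Rightarrow> 'b::real_normed_vector" and g :: "'a::euclidean_space \<Rightarrow> real"
  shows "Ck n h \<Longrightarrow> Ck n g \<Longrightarrow> Ck n (\<lambda>x. h (g x))"
proof (induction n arbitrary: h)
  case 0
  then show ?case by (auto intro: differentiable_compose)
next
  case (Suc n)
  then have d: "h differentiable (at x)" "g differentiable (at y)" for x y by auto
  have g: "Ck n g" using Suc.prems Ck_Suc_imp by blast
  have "Ck n (\<lambda>x. partial_deriv b g x *\<^sub>R partial_deriv 1 h (g x))" if "b \<in> Basis" for b
    using that Suc.prems g Suc.IH[of "partial_deriv 1 h"]
    by - (rule Ck_bilinear[OF bounded_bilinear_scaleR], auto)
  moreover have "(\<lambda>x. h (g x)) differentiable (at x)" for x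
    using differentiable_compose[where f=h and g=g, OF d(1)] d(2) by simp
  ultimately show ?case unfolding Ck.simps partial_deriv_compose_real[OF d] by simp
qed

lemma smooth_const [intro!]: "smooth (\<lambda>x. c)"
  by (simp add: smooth_iff_Ck Ck_const)

lemma smooth_add [intro!]: "smooth f \<Longrightarrow> smooth g \<Longrightarrow> smooth (\<lambda>x. f x + g x)"
  by (simp add: smooth_iff_Ck Ck_add)

lemma smooth_linear: "bounded_linear L \<Longrightarrow> smooth f \<Longrightarrow> smooth (\<lambda>x. L (f x))"
  by (simp add: smooth_iff_Ck Ck_linear)

lemma smooth_bilinear: "bounded_bilinear B \<Longrightarrow> smooth f \<Longrightarrow> smooth g \<Longrightarrow> smooth (\<lambda>x. B (f x) (g x))"
  by (simp add: smooth_iff_Ck Ck_bilinear)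

lemma smooth_compose_real [intro]:
  fixes h :: "real \<Rightarrow> 'b::real_normed_vector"
  shows "smooth h \<Longrightarrow> smooth g \<Longrightarrow> smooth (\<lambda>x. h (g x))"
  by (simp add: smooth_iff_Ck Ck_compose_real)

lemma smooth_mult [intro!]:
  fixes f g :: "_ \<Rightarrow> 'b::real_normed_algebra"
  shows "smooth f \<Longrightarrow> smooth g \<Longrightarrow> smooth (\<lambda>x. f x * g x)"
  by (rule smooth_bilinear[OF bounded_bilinear_mult])

lemma smooth_of_real [intro!]:
  fixes f :: "_ \<Rightarrow> real"
  shows "smooth f \<Longrightarrow> smooth (\<lambda>x. complex_of_real (f x))"
  by (rule smooth_linear[OF bounded_linear_of_real])

lemma smooth_minus [intro!]: "smooth f \<Longrightarrow> smooth (\<lambda>x. - f x)"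
  by (rule smooth_linear) (auto intro: bounded_linear_minus bounded_linear_ident)

lemma smooth_diff [intro!]: "smooth f \<Longrightarrow> smooth g \<Longrightarrow> smooth (\<lambda>x. f x - g x)"
  using smooth_add[OF _ smooth_minus, of f g] by simp

lemma smooth_sum: "(\<And>i. i \<in> I \<Longrightarrow> smooth (f i)) \<Longrightarrow> smooth (\<lambda>x. \<Sum>i\<in>I. f i x)"
  by (induction I rule: infinite_finite_induct) auto

lemma smooth_prod:
  fixes f :: "'i \<Rightarrow> 'a::euclidean_space \<Rightarrow> 'b::{real_normed_algebra, comm_ring_1}"
  shows "(\<And>i. i \<in> I \<Longrightarrow> smooth (f i)) \<Longrightarrow> smooth (\<lambda>x. \<Prod>i\<in>I. f i x)"
  by (induction I rule: infinite_finite_induct) auto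

lemma smooth_inner_left [intro!]: "smooth (\<lambda>x. x \<bullet> c)"
proof -
  have d: "(\<lambda>x. x \<bullet> c) differentiable (at x)" for x
    by (rule bounded_linear_imp_differentiable) (rule bounded_linear_inner_left)
  have "partial_deriv b (\<lambda>x. x \<bullet> c) = (\<lambda>x. b \<bullet> c)" for b
    by (rule ext, subst frechet_derivative_at[symmetric])
      (auto intro: bounded_linear_imp_has_derivative bounded_linear_inner_left)
  then have "Ck n (\<lambda>x. x \<bullet> c)" for n
    using d by (cases n) (auto simp: Ck_const)
  then show ?thesis by (simp add: smooth_iff_Ck)
qed

lemma smooth_inner_self [intro!]: "smooth (\<lambda>x. x \<bullet> x)"
proof -
  have "(\<lambda>x::'a. x \<bullet> x) = (\<lambda>x. \<Sum>b\<in>Basis. (x \<bullet> b) * (x \<bullet> b))"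
    by (rule ext, rule euclidean_inner)
  moreover have "smooth (\<lambda>x::'a. \<Sum>b\<in>Basis. (x \<bullet> b) * (x \<bullet> b))"
    by (intro smooth_sum) auto
  ultimately show ?thesis by simp
qed

text \<open>Derivatives at a point depend only on the values nearby. This gives the vanishing of
  derivatives off the support, and it makes the derivatives of a cutoff trivial where the cutoff is
  constant.\<close>

lemma iter_partial_local:
  assumes "open S" "\<And>x. x \<in> S \<Longrightarrow> f x = g x" "x \<in> S"
  shows "iter_partial bs f x = iter_partial bs g x"
  using assms(3)
proof (induction bs arbitrary: x)
  case (Cons b bs)
  have "(iter_partial bs f has_derivative D) (at x) \<longleftrightarrow> (iter_partial bs g has_derivative D) (at x)" for D
    using has_derivative_transform_within_open[OF _ assms(1) Cons.prems, of "iter_partial bs f" D UNIV "iter_partial bs g"]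
      has_derivative_transform_within_open[OF _ assms(1) Cons.prems, of "iter_partial bs g" D UNIV "iter_partial bs f"]
      Cons.IH by auto
  then show ?case by (simp add: frechet_derivative_def)
qed (auto simp: assms)

lemma iter_partial_zero: "iter_partial bs (\<lambda>x. 0) = (\<lambda>x. 0)"
  by (induction bs) (auto simp: frechet_derivative_const)

lemma iter_partial_add:
  assumes "bs \<in> lists Basis" "smooth f" "smooth g"
  shows "iter_partial bs (\<lambda>x. f x + g x) = (\<lambda>x. iter_partial bs f x + iter_partial bs g x)"
  using assms(1)
proof (induction bs)
  case (Cons b bs)
  then have "smooth (iter_partial bs f)" "smooth (iter_partial bs g)"
    using assms by (auto intro: smooth_iter_partial)
  with Cons show ?case by (simp add: partial_deriv_add smooth_differentiable)
qed auto

text \<open>Differentiating the product \<open>n\<close> times produces \<open>2 ^ n\<close> terms.\<close>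

lemma iter_partial_mult_bound:
  fixes f g :: "'a::euclidean_space \<Rightarrow> 'b::real_normed_algebra"
  assumes "bs \<in> lists Basis" "length bs \<le> n" "smooth f" "smooth g" "0 \<le> A" "\<And>x. 0 \<le> B x"
    and "\<And>bs x. bs \<in> lists Basis \<Longrightarrow> length bs \<le> n \<Longrightarrow> norm (iter_partial bs f x) \<le> A"
    and "\<And>bs x. bs \<in> lists Basis \<Longrightarrow> length bs \<le> n \<Longrightarrow> norm (iter_partial bs g x) \<le> B x"
  shows "norm (iter_partial bs (\<lambda>x. f x * g x) x) \<le> 2 ^ n * (A * B x)"
  using assms
proof (induction n arbitrary: bs f g)
  case 0
  then show ?case
    using mult_mono[OF "0"(7)[of "[]" x] "0"(8)[of "[]" x]] norm_mult_ineq[of "f x" "g x"] by auto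
next
  case (Suc n)
  show ?case
  proof (cases bs rule: rev_cases)
    case Nil
    have "norm (f x) * norm (g x) \<le> A * B x"
      using Suc.prems(7)[of "[]" x] Suc.prems(8)[of "[]" x] Suc.prems(5) by (auto intro!: mult_mono)
    moreover have "A * B x \<le> 2 ^ Suc n * (A * B x)"
      using Suc.prems(5) Suc.prems(6)[of x] mult_right_mono[OF one_le_power[of "2::real" "Suc n"], of "A * B x"]
      by simp
    ultimately show ?thesis using Nil norm_mult_ineq[of "f x" "g x"] by simp
  next
    case (snoc ys y)
    then have y: "y \<in> Basis" "ys \<in> lists Basis" "length ys \<le> n" using Suc.prems by auto
    have D: "iter_partial bs (\<lambda>x. f x * g x)
        = iter_partial ys (\<lambda>x. f x * partial_deriv y g x + partial_deriv y f x * g x)"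
      using Suc.prems snoc
      by (simp add: iter_partial_snoc partial_deriv_bilinear[OF _ _ bounded_bilinear_mult] smooth_differentiable)
    have f1: "norm (iter_partial cs f z) \<le> A" "norm (iter_partial cs (partial_deriv y f) z) \<le> A"
      if "cs \<in> lists Basis" "length cs \<le> n" for cs z
      using Suc.prems(7)[of cs z] Suc.prems(7)[of "cs @ [y]" z] that y by (auto simp: iter_partial_snoc)
    have g1: "norm (iter_partial cs g z) \<le> B z" "norm (iter_partial cs (partial_deriv y g) z) \<le> B z"
      if "cs \<in> lists Basis" "length cs \<le> n" for cs z
      using Suc.prems(8)[of cs z] Suc.prems(8)[of "cs @ [y]" z] that y by (auto simp: iter_partial_snoc)
    have s: "smooth f" "smooth g" "smooth (partial_deriv y f)" "smooth (partial_deriv y g)"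
      using Suc.prems y by (auto intro: smooth_partial_deriv)
    have "norm (iter_partial bs (\<lambda>x. f x * g x) x)
      = norm (iter_partial ys (\<lambda>x. f x * partial_deriv y g x) x + iter_partial ys (\<lambda>x. partial_deriv y f x * g x) x)"
      unfolding D using y s by (subst iter_partial_add) auto
    also have "\<dots> \<le> 2 ^ n * (A * B x) + 2 ^ n * (A * B x)"
      by (intro norm_triangle_mono Suc.IH y s Suc.prems(5,6) f1 g1)
    finally show ?thesis by (simp add: mult_ac)
  qed
qed

lemma iter_partial_scale:
  assumes "bs \<in> lists Basis" "smooth f"
  shows "iter_partial bs (\<lambda>x. f (c *\<^sub>R x)) = (\<lambda>x. c ^ length bs *\<^sub>R iter_partial bs f (c *\<^sub>R x))"
  using assms(1)
proof (induction bs)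
  case (Cons b bs)
  let ?g = "iter_partial bs f"
  have g: "?g differentiable (at x)" for x
    using Cons assms by (auto intro: smooth_iter_partial smooth_differentiable)
  have "((\<lambda>x. c ^ length bs *\<^sub>R ?g (c *\<^sub>R x)) has_derivative
      (\<lambda>h. c ^ length bs *\<^sub>R frechet_derivative ?g (at (c *\<^sub>R x)) (c *\<^sub>R h))) (at x)" for x
  proof -
    have "(?g has_derivative frechet_derivative ?g (at (c *\<^sub>R x))) (at (c *\<^sub>R x))"
      using g by (simp add: frechet_derivative_works[symmetric])
    then have "(?g \<circ> (\<lambda>x. c *\<^sub>R x) has_derivative frechet_derivative ?g (at (c *\<^sub>R x)) \<circ> (\<lambda>h. c *\<^sub>R h)) (at x)"
      by (intro diff_chain_at) (auto intro!: derivative_eq_intros)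
    then show ?thesis
      unfolding o_def by (intro has_derivative_scaleR_right)
  qed
  note D = this
  have "partial_deriv b (\<lambda>x. c ^ length bs *\<^sub>R ?g (c *\<^sub>R x)) x
      = c ^ length (b # bs) *\<^sub>R partial_deriv b ?g (c *\<^sub>R x)" for x
    unfolding frechet_derivative_at[OF D, symmetric]
    using linear_scale[OF linear_frechet_derivative[OF g], of "c *\<^sub>R x" c b] by simp
  then show ?case using Cons by auto
qed auto

section \<open>Test functions built from a cutoff\<close>

locale smooth_cutoff =
  fixes C :: real and \<eta> :: "real \<Rightarrow> real"
  assumes cutoff: "high_freq_cutoff C \<eta>" and C_pos: "0 < C"
begin

lemma smooth_eta: "smooth \<eta>"
  using cutoff by (simp add: high_freq_cutoff_def)

lemma continuous_eta: "continuous_on S \<eta>"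
  by (rule smooth_continuous_on[OF smooth_eta])

lemma borel_eta [measurable]: "\<eta> \<in> borel_measurable borel"
  by (rule smooth_borel[OF smooth_eta])

lemma eta_one: "2 * C \<le> t \<Longrightarrow> \<eta> t = 1"
  using cutoff by (simp add: high_freq_cutoff_def)

text \<open>The cutoff is given to vanish strictly below \<open>C\<close>; the endpoint follows by
  continuity from the left.\<close>

lemma eta_zero:
  assumes "t \<le> C" shows "\<eta> t = 0"
proof (cases "t < C")
  case True
  then show ?thesis using cutoff by (simp add: high_freq_cutoff_def)
next
  case False
  have "((\<lambda>t. \<eta> t) \<longlongrightarrow> \<eta> C) (at_left C)"
    using continuous_eta[of UNIV] by (auto simp: continuous_on_def intro: tendsto_within_subset)
  moreover have "((\<lambda>t. \<eta> t) \<longlongrightarrow> 0) (at_left C)"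
    using cutoff
    by (intro tendsto_eventually)
      (auto simp: high_freq_cutoff_def eventually_at_filter intro!: always_eventually)
  ultimately have "\<eta> C = 0" by (intro tendsto_unique[of "at_left C"]) auto
  with False assms show ?thesis by (metis antisym_conv2)
qed

definition eta_bound :: real where
  "eta_bound = (SOME M. 1 \<le> M \<and> (\<forall>t. \<bar>\<eta> t\<bar> \<le> M))"

text \<open>A cutoff need not take its values between 0 and 1. It is bounded because it is
  continuous on the interval from \<open>C\<close> to \<open>2 * C\<close> and constant on either
  side.\<close>

lemma eta_bound: "1 \<le> eta_bound" "\<bar>\<eta> t\<bar> \<le> eta_bound"
proof -
  have "bounded (\<eta> ` {C..2 * C})"
    by (intro compact_imp_bounded compact_continuous_image continuous_eta) auto
  then obtain B where B: "\<And>t. t \<in> {C..2 * C} \<Longrightarrow> \<bar>\<eta> t\<bar> \<le> B"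
    by (metis bounded_iff imageI real_norm_def)
  have "\<bar>\<eta> t\<bar> \<le> max 1 B" for t
  proof -
    consider "t \<le> C" | "2 * C \<le> t" | "t \<in> {C..2 * C}" by force
    then show ?thesis
    proof cases
      case 3
      then show ?thesis using B[of t] by linarith
    qed (auto simp: eta_zero eta_one)
  qed
  then have "1 \<le> max 1 B \<and> (\<forall>t. \<bar>\<eta> t\<bar> \<le> max 1 B)" by simp
  then have "1 \<le> eta_bound \<and> (\<forall>t. \<bar>\<eta> t\<bar> \<le> eta_bound)"
    unfolding eta_bound_def by (rule someI[where P="\<lambda>M. 1 \<le> M \<and> (\<forall>t. \<bar>\<eta> t\<bar> \<le> M)"])
  then show "1 \<le> eta_bound" "\<bar>\<eta> t\<bar> \<le> eta_bound" by auto
qed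

text \<open>Rescaled so that the transition from 0 to 1 takes place on the unit interval.\<close>

definition step :: "real \<Rightarrow> real" where "step t = \<eta> (C * (1 + t))"

lemma step_nonpos: "t \<le> 0 \<Longrightarrow> step t = 0"
  unfolding step_def using C_pos by (intro eta_zero) (auto simp: algebra_simps mult_le_0_iff)

lemma step_ge_1: "1 \<le> t \<Longrightarrow> step t = 1"
  unfolding step_def using C_pos by (intro eta_one) (auto simp: algebra_simps)

lemma step_bound: "\<bar>step t\<bar> \<le> eta_bound"
  unfolding step_def by (rule eta_bound)

lemma smooth_step:
  assumes "smooth g" shows "smooth (\<lambda>x. step (g x))"
  unfolding step_def by (rule smooth_compose_real[OF smooth_eta]) (intro smooth_mult smooth_add smooth_const assms)

lemma tendsto_step: "(\<lambda>n. step (real n * t)) \<longlonglongrightarrow> indicator {0<..} t"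
proof (cases "t \<le> 0")
  case True
  then have "step (real n * t) = 0" for n by (intro step_nonpos) (simp add: mult_nonneg_nonpos)
  with True show ?thesis by (simp add: indicator_def)
next
  case False
  then have "eventually (\<lambda>n. 1 \<le> real n * t) sequentially" by real_asymp
  then have "eventually (\<lambda>n. step (real n * t) = 1) sequentially"
    by eventually_elim (rule step_ge_1)
  with False show ?thesis by (auto simp: indicator_def intro: tendsto_eventually)
qed

text \<open>A smooth substitute for the indicator of \<open>box a b\<close>. In each coordinate one
  step rises and another one falls, both within distance \<open>1 / n\<close> of a face and on the
  inner side of it, so that nothing leaks out of the box.\<close>

definition box_bump :: "nat \<Rightarrow> 'a::euclidean_space \<Rightarrow> 'a \<Rightarrow> 'a \<Rightarrow> complex" where
  "box_bump n a b x =
     (\<Prod>i\<in>Basis. complex_of_real (step (real n * (x \<bullet> i - a \<bullet> i)) * step (real n * (b \<bullet> i - x \<bullet> i))))"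

lemma smooth_box_bump: "smooth (box_bump n a b)"
  unfolding box_bump_def
  by (intro smooth_prod smooth_of_real smooth_mult smooth_step smooth_diff smooth_inner_left smooth_const)

lemma box_bump_outside:
  assumes "x \<notin> box a b" shows "box_bump n a b x = 0"
proof -
  obtain i where i: "i \<in> Basis" "x \<bullet> i \<le> a \<bullet> i \<or> b \<bullet> i \<le> x \<bullet> i"
    using assms by (auto simp: mem_box not_less)
  then have "step (real n * (x \<bullet> i - a \<bullet> i)) = 0 \<or> step (real n * (b \<bullet> i - x \<bullet> i)) = 0"
    by (auto intro!: step_nonpos simp: mult_nonneg_nonpos)
  with i show ?thesis unfolding box_bump_def by (intro prod_zero) auto
qed

lemma box_bump_bound: "norm (box_bump n a b x) \<le> (eta_bound * eta_bound) ^ DIM('a)"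
  for x :: "'a::euclidean_space"
proof -
  have "norm (box_bump n a b x) \<le> (\<Prod>i\<in>(Basis::'a set). eta_bound * eta_bound)"
    unfolding box_bump_def prod_norm[symmetric]
    using eta_bound(1) by (intro prod_mono) (auto simp: norm_mult abs_mult intro!: mult_mono step_bound)
  then show ?thesis by simp
qed

lemma tendsto_box_bump: "(\<lambda>n. box_bump n a b x) \<longlonglongrightarrow> indicator (box a b) x"
proof -
  have "(\<lambda>n. box_bump n a b x) \<longlonglongrightarrow> (\<Prod>i\<in>Basis. complex_of_real
      (indicator {0<..} (x \<bullet> i - a \<bullet> i) * indicator {0<..} (b \<bullet> i - x \<bullet> i)))"
    unfolding box_bump_def by (intro tendsto_intros tendsto_step)
  also have "(\<Prod>i\<in>Basis. complex_of_real
      (indicator {0<..} (x \<bullet> i - a \<bullet> i) * indicator {0<..} (b \<bullet> i - x \<bullet> i))) = indicator (box a b) x"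
  proof (cases "x \<in> box a b")
    case True
    then show ?thesis by (auto simp: mem_box indicator_def)
  next
    case False
    then obtain i where "i \<in> Basis" "x \<bullet> i \<le> a \<bullet> i \<or> b \<bullet> i \<le> x \<bullet> i"
      by (auto simp: mem_box not_less)
    with False show ?thesis
      by (intro trans[OF prod_zero]) (auto simp: indicator_def intro!: bexI[of _ i])
  qed
  finally show ?thesis .
qed

end

lemma test_functionI:
  assumes "smooth \<phi>" "compact K" "\<And>x. x \<notin> K \<Longrightarrow> \<phi> x = 0"
  shows "\<phi> \<in> test_functions"
proof -
  have "closure {x. \<phi> x \<noteq> 0} \<subseteq> K"
    using assms by (intro closure_minimal) (auto intro: compact_imp_closed)
  moreover have "compact (closure {x. \<phi> x \<noteq> 0})"
    using compact_Int_closed[OF assms(2) closed_closure, of "{x. \<phi> x \<noteq> 0}"] calculation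
    by (simp add: Int_absorb1)
  ultimately show ?thesis using assms by (auto simp: test_functions_def)
qed

lemma test_functionE:
  assumes "\<phi> \<in> test_functions"
  obtains R where "0 < R" "\<And>x. R \<le> norm x \<Longrightarrow> \<phi> x = 0"
proof -
  have "bounded (closure {x. \<phi> x \<noteq> 0})"
    using assms by (auto simp: test_functions_def intro: compact_imp_bounded)
  then obtain B where B: "\<And>x. x \<in> closure {x. \<phi> x \<noteq> 0} \<Longrightarrow> norm x \<le> B"
    by (metis bounded_iff)
  have "\<phi> x = 0" if "\<bar>B\<bar> + 1 \<le> norm x" for x
    using B[of x] closure_subset[of "{x. \<phi> x \<noteq> 0}"] that by (cases "\<phi> x = 0") auto
  then show ?thesis using that[of "\<bar>B\<bar> + 1"] by auto
qed

lemma test_function_smooth: "\<phi> \<in> test_functions \<Longrightarrow> smooth \<phi>"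
  by (simp add: test_functions_def)

lemma test_function_borel: "\<phi> \<in> test_functions \<Longrightarrow> \<phi> \<in> borel_measurable borel"
  by (simp add: test_function_smooth smooth_borel)

lemma test_function_bounded:
  assumes "\<phi> \<in> test_functions"
  obtains M where "0 < M" "\<And>x. norm (\<phi> x) \<le> M"
proof -
  obtain R where R: "0 < R" "\<And>x. R \<le> norm x \<Longrightarrow> \<phi> x = 0"
    using assms by (rule test_functionE) blast
  have "bounded (\<phi> ` cball 0 R)"
    using assms by (intro compact_imp_bounded compact_continuous_image smooth_continuous_on test_function_smooth) auto
  then obtain B where B: "\<And>x. x \<in> cball 0 R \<Longrightarrow> norm (\<phi> x) \<le> B"
    by (metis bounded_iff imageI)
  have "norm (\<phi> x) \<le> \<bar>B\<bar> + 1" for x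
    using B[of x] R(2)[of x] by (cases "norm x \<le> R") auto
  then show ?thesis using that[of "\<bar>B\<bar> + 1"] by auto
qed

lemma integrable_of_bounded_compact:
  fixes f :: "'a::euclidean_space \<Rightarrow> 'b::{banach, second_countable_topology}"
  assumes [measurable]: "f \<in> borel_measurable borel" and "\<And>x. norm (f x) \<le> M"
    and "\<And>x. R \<le> norm x \<Longrightarrow> f x = 0"
  shows "integrable lborel f"
proof (rule Bochner_Integration.integrable_bound)
  show "integrable lborel (\<lambda>x. M * indicator (cball 0 R) x :: real)"
    using emeasure_lborel_cball_finite[of 0 R] by (intro integrable_mult_right) (auto simp: integrable_indicator_iff)
  show "AE x in lborel. norm (f x) \<le> norm (M * indicator (cball 0 R) x)"
    using assms(2,3) by (intro AE_I2) (auto simp: indicator_def order_trans[OF _ abs_ge_self])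
qed auto

lemma test_function_integrable:
  assumes "\<phi> \<in> test_functions" shows "integrable lborel \<phi>"
proof -
  obtain R where "\<And>x. R \<le> norm x \<Longrightarrow> \<phi> x = 0"
    using assms by (rule test_functionE) blast
  moreover obtain M where "\<And>x. norm (\<phi> x) \<le> M"
    using assms by (rule test_function_bounded) blast
  ultimately show ?thesis
    using assms by (intro integrable_of_bounded_compact test_function_borel) auto
qed

lemma lebesgue_ex_borel_complex:
  fixes f :: "'a::euclidean_space \<Rightarrow> complex"
  assumes "f \<in> borel_measurable lebesgue"
  obtains g where "g \<in> borel_measurable borel" "AE x in lborel. f x = g x"
proof -
  have "(\<lambda>x. Re (f x)) \<in> borel_measurable lebesgue" "(\<lambda>x. Im (f x)) \<in> borel_measurable lebesgue"
    using assms by measurable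
  then obtain g1 g2 where g: "g1 \<in> borel_measurable lborel" "AE x in lborel. Re (f x) = g1 x"
      "g2 \<in> borel_measurable lborel" "AE x in lborel. Im (f x) = g2 x"
    using completion_ex_borel_measurable_real by metis
  have "(\<lambda>x. Complex (g1 x) (g2 x)) \<in> borel_measurable borel"
    using g unfolding borel_measurable_complex_iff by simp
  moreover have "AE x in lborel. f x = Complex (g1 x) (g2 x)"
    using g(2,4) by eventually_elim (simp add: complex_eq_iff)
  ultimately show ?thesis using that by blast
qed

text \<open>A Dynkin system argument: boxes are stable under intersection and generate the Borel
  sets, so the integral of \<open>g\<close> vanishes over every Borel part of a large box. Real and
  imaginary part of \<open>g\<close> are then zero almost everywhere in it.\<close>

lemma integral_zero_on_boxes_imp_AE_zero:
  fixes g :: "'a::euclidean_space \<Rightarrow> complex"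
  assumes int: "\<And>a b. integrable lborel (\<lambda>x. indicator (box a b) x *\<^sub>R g x)"
    and zero: "\<And>a b. (LINT x|lborel. indicator (box a b) x *\<^sub>R g x) = 0"
    and [measurable]: "g \<in> borel_measurable borel"
  shows "AE x in lborel. g x = 0"
proof -
  \<comment> \<open>Passing to complements needs a finite total integral, which is why
    \<open>g\<close> is first restricted to one of countably many boxes that exhaust the
    space.\<close>
  define K :: "nat \<Rightarrow> 'a set" where "K n = box (- (real n *\<^sub>R One)) (real n *\<^sub>R One)" for n
  have "AE x in lborel. indicator (K n) x *\<^sub>R g x = 0" for n
  proof -
    define h where "h x = indicator (K n) x *\<^sub>R g x" for x
    have h: "integrable lborel h" unfolding h_def K_def by (rule int)
    have hA: "integrable lborel (\<lambda>x. indicator A x *\<^sub>R h x)" if "A \<in> sets borel" for A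
      using that h by (intro integrable_mult_indicator) auto
    have Z: "(LINT x|lborel. indicator A x *\<^sub>R h x) = 0" if "A \<in> sets borel" for A
    proof -
      have "Int_stable (range (\<lambda>(a, b). box a b :: 'a set))"
        by (auto simp: Int_stable_def box_Int_box)
      moreover have "range (\<lambda>(a, b). box a b) \<subseteq> Pow (UNIV :: 'a set)"
        by auto
      moreover have "A \<in> sigma_sets UNIV (range (\<lambda>(a, b). box a b))"
        using that by (simp add: borel_eq_box)
      ultimately show ?thesis
      proof (induction A rule: sigma_sets_induct_disjoint)
        case (basic A)
        then obtain a b where A: "A = box a b" by auto
        obtain c d where cd: "box a b \<inter> K n = box c d" unfolding K_def box_Int_box by blast
        have "indicator A x *\<^sub>R h x = indicator (box c d) x *\<^sub>R g x" for x
          unfolding A h_def cd[symmetric] by (auto simp: indicator_def)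
        then show ?case using zero by simp
      next
        case empty
        then show ?case by simp
      next
        case (compl A)
        then have [measurable]: "A \<in> sets borel" by (simp add: borel_eq_box)
        have "(LINT x|lborel. indicator (UNIV - A) x *\<^sub>R h x) = (LINT x|lborel. h x - indicator A x *\<^sub>R h x)"
          by (rule Bochner_Integration.integral_cong) (auto simp: indicator_def)
        also have "\<dots> = integral\<^sup>L lborel h - (LINT x|lborel. indicator A x *\<^sub>R h x)"
          using h hA[of A] by (intro Bochner_Integration.integral_diff) auto
        also have "integral\<^sup>L lborel h = 0"
          using zero[of "- (real n *\<^sub>R One)" "real n *\<^sub>R One"] unfolding h_def K_def .
        also have "0 - (LINT x|lborel. indicator A x *\<^sub>R h x) = 0"
          using compl by simp
        finally show ?case .
      next
        case (union A)
        then have [measurable]: "A i \<in> sets borel" for i by (auto simp: borel_eq_box)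
        have "(LINT x:(\<Union>i. A i)|lborel. h x) = (\<Sum>i. LINT x:A i|lborel. h x)"
          using union hA[of "\<Union>i. A i"]
          by (intro lebesgue_integral_countable_add) (auto simp: set_integrable_def disjoint_family_on_def)
        then show ?case using union by (simp add: set_lebesgue_integral_def)
      qed
    qed
    have "AE x in lborel. Re (h x) = 0"
      using h Z by (intro density_unique_real)
        (auto simp: set_lebesgue_integral_def integral_Re[symmetric] hA simp flip: scaleR_complex.sel)
    moreover have "AE x in lborel. Im (h x) = 0"
      using h Z by (intro density_unique_real)
        (auto simp: set_lebesgue_integral_def integral_Im[symmetric] hA simp flip: scaleR_complex.sel)
    ultimately show ?thesis by eventually_elim (simp add: complex_eq_iff h_def)
  qed
  then have "AE x in lborel. \<forall>n. indicator (K n) x *\<^sub>R g x = 0"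
    unfolding AE_all_countable by blast
  then show ?thesis
  proof eventually_elim
    case (elim x)
    have "x \<in> (\<Union>n. K n)" unfolding K_def UN_box_eq_UNIV by simp
    with elim show ?case by (auto simp: indicator_def)
  qed
qed

text \<open>The fundamental lemma of the calculus of variations. The indicator of a box is the
  pointwise limit of bumps; these need be neither monotone in \<open>n\<close> nor at most 1, but
  powers of \<open>eta_bound\<close> provide a dominating function.\<close>

lemma (in smooth_cutoff) fundamental_lemma:
  fixes g :: "'a::euclidean_space \<Rightarrow> complex"
  assumes [measurable]: "g \<in> borel_measurable borel"
    and int: "\<And>a b. integrable lborel (\<lambda>x. indicator (box a b) x *\<^sub>R g x)"
    and zero: "\<And>\<phi>. \<phi> \<in> test_functions \<Longrightarrow> (LINT x|lborel. g x * \<phi> x) = 0"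
  shows "AE x in lborel. g x = 0"
proof (rule integral_zero_on_boxes_imp_AE_zero[OF int])
  fix a b :: 'a
  have [measurable]: "box_bump n a b \<in> borel_measurable borel" for n
    by (rule smooth_borel[OF smooth_box_bump])
  have "(\<lambda>n. LINT x|lborel. g x * box_bump n a b x) \<longlonglongrightarrow> (LINT x|lborel. indicator (box a b) x *\<^sub>R g x)"
  proof (rule integral_dominated_convergence)
    show "integrable lborel (\<lambda>x. (eta_bound * eta_bound) ^ DIM('a) * norm (indicator (box a b) x *\<^sub>R g x))"
      by (intro integrable_mult_right integrable_norm int)
    show "AE x in lborel. (\<lambda>n. g x * box_bump n a b x) \<longlonglongrightarrow> indicator (box a b) x *\<^sub>R g x"
    proof (intro AE_I2)
      fix x
      show "(\<lambda>n. g x * box_bump n a b x) \<longlonglongrightarrow> indicator (box a b) x *\<^sub>R g x"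
        using tendsto_mult[OF tendsto_const tendsto_box_bump[of a b x], of "g x"]
        by (cases "x \<in> box a b") auto
    qed
    show "AE x in lborel. norm (g x * box_bump n a b x)
        \<le> (eta_bound * eta_bound) ^ DIM('a) * norm (indicator (box a b) x *\<^sub>R g x)" for n
      using box_bump_bound[of n a b] box_bump_outside[of _ a b n]
      by (intro AE_I2) (auto simp: norm_mult indicator_def mult.commute[of "cmod (g _)"] intro!: mult_right_mono)
  qed measurable
  moreover have "box_bump n a b \<in> test_functions" for n
    by (rule test_functionI[OF smooth_box_bump compact_cbox])
      (use box_subset_cbox box_bump_outside in blast)
  ultimately show "(LINT x|lborel. indicator (box a b) x *\<^sub>R g x) = 0"
    using zero by (simp add: LIMSEQ_const_iff)
qed fact

section \<open>The Fourier transform of integrable functions\<close>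

lemma borel_measurable_cis [measurable (raw)]:
  "f \<in> borel_measurable M \<Longrightarrow> (\<lambda>x. cis (f x)) \<in> borel_measurable M"
  by (rule measurable_compose[where N=borel, of f]) (auto intro!: borel_measurable_continuous_onI continuous_intros)

lemma exp_minus_i_eq_cis: "exp (- \<i> * complex_of_real r) = cis (- r)"
  by (simp add: cis_conv_exp)

lemma
  fixes f :: "'a::euclidean_space \<Rightarrow> 'b::euclidean_space \<Rightarrow> complex"
  assumes [measurable]: "case_prod f \<in> borel_measurable (borel \<Otimes>\<^sub>M borel)"
    and fin: "(\<integral>\<^sup>+x. \<integral>\<^sup>+y. ennreal (norm (f x y)) \<partial>lborel \<partial>lborel) < \<infinity>"
  shows lborel_Fubini_integrable: "integrable (lborel \<Otimes>\<^sub>M lborel) (case_prod f)"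
    and lborel_Fubini_swap: "(LINT x|lborel. LINT y|lborel. f x y) = (LINT y|lborel. LINT x|lborel. f x y)"
proof -
  have m: "case_prod f \<in> borel_measurable (lborel \<Otimes>\<^sub>M lborel)" by measurable
  show "integrable (lborel \<Otimes>\<^sub>M lborel) (case_prod f)"
  proof (rule integrableI_bounded[OF m])
    have "(\<lambda>p. ennreal (norm (case_prod f p))) \<in> borel_measurable (lborel \<Otimes>\<^sub>M lborel)"
      using m by measurable
    from lborel.nn_integral_fst[OF this] fin
    show "(\<integral>\<^sup>+p. ennreal (norm (case_prod f p)) \<partial>(lborel \<Otimes>\<^sub>M lborel)) < \<infinity>"
      by simp
  qed
  from lborel_pair.Fubini_integral[OF this]
  show "(LINT x|lborel. LINT y|lborel. f x y) = (LINT y|lborel. LINT x|lborel. f x y)" by simp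
qed

lemma nn_integral_norm_finite:
  fixes f :: "_ \<Rightarrow> 'b::{banach, second_countable_topology}"
  shows
  "integrable M f \<Longrightarrow> (\<integral>\<^sup>+x. ennreal (norm (f x)) \<partial>M) < \<infinity>"
  by (simp add: integrable_iff_bounded)

lemma lborel_Fubini_tensor:
  fixes f :: "'a::euclidean_space \<Rightarrow> complex" and g :: "'b::euclidean_space \<Rightarrow> complex"
  assumes f: "integrable lborel f" and g: "integrable lborel g"
    and [measurable]: "case_prod m \<in> borel_measurable (borel \<Otimes>\<^sub>M borel)"
    and m: "\<And>x y. norm (m x y) \<le> M"
  shows "(LINT x|lborel. LINT y|lborel. m x y * f x * g y) = (LINT y|lborel. LINT x|lborel. m x y * f x * g y)"
proof (rule lborel_Fubini_swap)
  have [measurable]: "f \<in> borel_measurable borel" "g \<in> borel_measurable borel"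
    using f g by auto
  show "(\<lambda>(x, y). m x y * f x * g y) \<in> borel_measurable (borel \<Otimes>\<^sub>M borel)" by measurable
  have "(\<integral>\<^sup>+x. \<integral>\<^sup>+y. ennreal (norm (m x y * f x * g y)) \<partial>lborel \<partial>lborel)
      \<le> (\<integral>\<^sup>+x. \<integral>\<^sup>+y. ennreal M * (ennreal (norm (f x)) * ennreal (norm (g y))) \<partial>lborel \<partial>lborel)"
    using m order_trans[OF norm_ge_zero m]
    by (intro nn_integral_mono)
      (auto simp: norm_mult mult.assoc simp flip: ennreal_mult' intro!: ennreal_leI mult_right_mono)
  also have "\<dots> = ennreal M * ((\<integral>\<^sup>+x. ennreal (norm (f x)) \<partial>lborel) * (\<integral>\<^sup>+y. ennreal (norm (g y)) \<partial>lborel))"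
    by (simp add: nn_integral_cmult nn_integral_multc)
  also have "\<dots> < \<infinity>"
    using nn_integral_norm_finite[OF f] nn_integral_norm_finite[OF g]
    by (simp add: ennreal_mult_less_top)
  finally show "(\<integral>\<^sup>+x. \<integral>\<^sup>+y. ennreal (norm (m x y * f x * g y)) \<partial>lborel \<partial>lborel) < \<infinity>" .
qed

section \<open>Affine changes of variables and basic properties of the transform\<close>

lemma nn_integral_lborel_affine:
  fixes f :: "'a::euclidean_space \<Rightarrow> ennreal"
  assumes [measurable]: "f \<in> borel_measurable borel" and c: "c \<noteq> 0"
  shows "(\<integral>\<^sup>+x. f x \<partial>lborel) = ennreal (\<bar>c\<bar> ^ DIM('a)) * (\<integral>\<^sup>+x. f (t + c *\<^sub>R x) \<partial>lborel)"
  by (subst lborel_affine[OF c, of t]) (simp add: nn_integral_density nn_integral_distr nn_integral_cmult)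

lemma integral_lborel_affine:
  fixes f :: "'a::euclidean_space \<Rightarrow> complex"
  assumes [measurable]: "f \<in> borel_measurable borel" and c: "c \<noteq> 0"
  shows "(LINT x|lborel. f x) = complex_of_real (\<bar>c\<bar> ^ DIM('a)) * (LINT x|lborel. f (t + c *\<^sub>R x))"
  by (subst lborel_affine[OF c, of t])
    (simp add: integral_density integral_distr scaleR_conv_of_real)

lemma nn_integral_lborel_translate:
  fixes f :: "'a::euclidean_space \<Rightarrow> ennreal"
  assumes "f \<in> borel_measurable borel"
  shows "(\<integral>\<^sup>+x. f (x + t) \<partial>lborel) = (\<integral>\<^sup>+x. f x \<partial>lborel)"
  using nn_integral_lborel_affine[OF assms, of 1 t] by (simp add: add.commute)

lemma nn_integral_lborel_reflect:
  fixes f :: "'a::euclidean_space \<Rightarrow> ennreal"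
  assumes "f \<in> borel_measurable borel"
  shows "(\<integral>\<^sup>+x. f (t - x) \<partial>lborel) = (\<integral>\<^sup>+x. f x \<partial>lborel)"
  using nn_integral_lborel_affine[OF assms, of "-1" t] by simp

lemma integral_lborel_translate:
  fixes f :: "'a::euclidean_space \<Rightarrow> complex"
  assumes "f \<in> borel_measurable borel"
  shows "(LINT x|lborel. f (x + t)) = (LINT x|lborel. f x)"
  using integral_lborel_affine[OF assms, of 1 t] by (simp add: add.commute)

lemma integral_lborel_reflect:
  fixes f :: "'a::euclidean_space \<Rightarrow> complex"
  assumes "f \<in> borel_measurable borel"
  shows "(LINT x|lborel. f (t - x)) = (LINT x|lborel. f x)"
  using integral_lborel_affine[OF assms, of "-1" t] by simp

lemma integrable_lborel_translate:
  fixes f :: "'a::euclidean_space \<Rightarrow> 'b::{banach, second_countable_topology}"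
  assumes "integrable lborel f"
  shows "integrable lborel (\<lambda>x. f (x + t))"
proof -
  have [measurable]: "f \<in> borel_measurable borel" using assms by auto
  show ?thesis
    using assms nn_integral_lborel_translate[of "\<lambda>x. ennreal (norm (f x))" t]
    by (auto simp: integrable_iff_bounded)
qed

lemma integrable_lborel_reflect:
  fixes f :: "'a::euclidean_space \<Rightarrow> 'b::{banach, second_countable_topology}"
  assumes "integrable lborel f"
  shows "integrable lborel (\<lambda>x. f (t - x))"
proof -
  have [measurable]: "f \<in> borel_measurable borel" using assms by auto
  show ?thesis
    using assms nn_integral_lborel_reflect[of "\<lambda>x. ennreal (norm (f x))" t]
    by (auto simp: integrable_iff_bounded)
qed

lemma fourier_lborel:
  assumes [measurable]: "f \<in> borel_measurable borel"
  shows "fourier f \<xi> = (LINT x|lborel. cis (- (\<xi> \<bullet> x)) * f x)"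
  unfolding fourier_def exp_minus_i_eq_cis by (rule integral_completion) measurable

lemma fourier_cong_AE:
  fixes f g :: "'a::euclidean_space \<Rightarrow> complex"
  assumes "AE x in lborel. f x = g x" "f \<in> borel_measurable lebesgue" "g \<in> borel_measurable lebesgue"
  shows "fourier f = fourier g"
proof
  fix \<xi> :: 'a
  let ?e = "\<lambda>x. exp (- \<i> * complex_of_real (\<xi> \<bullet> x))"
  have e: "?e \<in> borel_measurable lebesgue"
    by (rule measurable_completion) measurable
  have "AE x in lebesgue. f x = g x" using assms(1) by (rule AE_completion)
  then show "fourier f \<xi> = fourier g \<xi>"
    unfolding fourier_def
    by (intro integral_cong_AE borel_measurable_times e assms) (auto elim: eventually_mono)
qed

lemma inv_fourier_eq_fourier:
  fixes f :: "'a::euclidean_space \<Rightarrow> complex"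
  shows "inv_fourier f x = fourier f (- x) / complex_of_real ((2 * pi) ^ DIM('a))"
  by (simp add: inv_fourier_def fourier_def inner_commute)

lemma fourier_borel [measurable]:
  fixes f :: "'a::euclidean_space \<Rightarrow> complex"
  assumes [measurable]: "f \<in> borel_measurable borel"
  shows "fourier f \<in> borel_measurable borel"
  unfolding fourier_lborel[OF assms, abs_def] by measurable

lemma inv_fourier_borel [measurable]:
  fixes f :: "'a::euclidean_space \<Rightarrow> complex"
  assumes [measurable]: "f \<in> borel_measurable borel"
  shows "inv_fourier f \<in> borel_measurable borel"
  unfolding inv_fourier_eq_fourier[abs_def] by measurable

lemma integrable_cis_mult:
  fixes f :: "'a::euclidean_space \<Rightarrow> complex"
  assumes "integrable lborel f" and [measurable]: "g \<in> borel_measurable borel"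
  shows "integrable lborel (\<lambda>x. cis (g x) * f x)"
  using assms by (intro Bochner_Integration.integrable_bound[OF assms(1)]) (auto simp: norm_mult)

lemma norm_fourier_le:
  assumes "integrable lborel f"
  shows "norm (fourier f \<xi>) \<le> (LINT x|lborel. norm (f x))"
proof -
  have [measurable]: "f \<in> borel_measurable borel" using assms by auto
  have "norm (fourier f \<xi>) \<le> (LINT x|lborel. norm (cis (- (\<xi> \<bullet> x)) * f x))"
    unfolding fourier_lborel[OF \<open>f \<in> borel_measurable borel\<close>] by (rule integral_norm_bound)
  then show ?thesis by (simp add: norm_mult)
qed

lemma continuous_fourier:
  assumes "integrable lborel f"
  shows "continuous_on UNIV (fourier f)"
proof -
  have [measurable]: "f \<in> borel_measurable borel" using assms by auto
  show ?thesis
    unfolding continuous_on_sequentially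
  proof (intro allI impI ballI, unfold o_def)
    fix u :: "nat \<Rightarrow> 'a" and \<xi>
    assume "\<xi> \<in> UNIV" and "(\<forall>n. u n \<in> UNIV) \<and> u \<longlonglongrightarrow> \<xi>"
    then have u: "u \<longlonglongrightarrow> \<xi>" by simp
    show "(\<lambda>n. fourier f (u n)) \<longlonglongrightarrow> fourier f \<xi>"
      unfolding fourier_lborel[OF \<open>f \<in> borel_measurable borel\<close>]
    proof (rule integral_dominated_convergence[where w="\<lambda>x. norm (f x)"])
      show "AE x in lborel. (\<lambda>n. cis (- (u n \<bullet> x)) * f x) \<longlonglongrightarrow> cis (- (\<xi> \<bullet> x)) * f x"
        by (intro AE_I2 tendsto_intros u)
    qed (use assms in \<open>auto simp: norm_mult\<close>)
  qed
qed

lemma continuous_inv_fourier: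
  assumes "integrable lborel f"
  shows "continuous_on UNIV (inv_fourier f)"
  unfolding inv_fourier_eq_fourier[abs_def]
  by (intro continuous_intros continuous_on_compose2[OF continuous_fourier[OF assms]]) auto

lemma norm_inv_fourier_le:
  fixes f :: "'a::euclidean_space \<Rightarrow> complex"
  assumes "integrable lborel f"
  shows "norm (inv_fourier f x) \<le> (LINT x|lborel. norm (f x))"
proof -
  have "1 \<le> (2 * pi) ^ DIM('a)" using pi_gt3 by (intro one_le_power) auto
  then have "norm (inv_fourier f x) \<le> norm (fourier f (- x))"
    by (simp add: inv_fourier_eq_fourier norm_divide norm_power norm_mult divide_le_eq
        mult_le_cancel_left1 power_mult_distrib)
  then show ?thesis using norm_fourier_le[OF assms, of "- x"] by simp
qed

text \<open>The multiplication formula, which is Fubini's theorem for the bounded kernel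
  \<open>cis (- (x \<bullet> y))\<close>. It applies also when neither transform is
  integrable.\<close>

lemma fourier_multiplication:
  fixes f g :: "'a::euclidean_space \<Rightarrow> complex"
  assumes "integrable lborel f" "integrable lborel g"
  shows "(LINT x|lborel. fourier f x * g x) = (LINT x|lborel. f x * fourier g x)"
proof -
  have [measurable]: "f \<in> borel_measurable borel" "g \<in> borel_measurable borel" using assms by auto
  have "(LINT x|lborel. fourier f x * g x) = (LINT x|lborel. LINT y|lborel. cis (- (x \<bullet> y)) * g x * f y)"
    by (subst fourier_lborel) (auto simp flip: integral_mult_left_zero integral_mult_right_zero
        intro!: Bochner_Integration.integral_cong)
  also have "\<dots> = (LINT y|lborel. LINT x|lborel. cis (- (x \<bullet> y)) * g x * f y)"
    by (rule lborel_Fubini_tensor[OF assms(2,1), where M=1]) auto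
  also have "\<dots> = (LINT y|lborel. f y * fourier g y)"
    by (subst fourier_lborel) (auto simp flip: integral_mult_left_zero integral_mult_right_zero
        simp: inner_commute mult_ac intro!: Bochner_Integration.integral_cong)
  finally show ?thesis .
qed

lemma inv_fourier_multiplication:
  fixes f g :: "'a::euclidean_space \<Rightarrow> complex"
  assumes "integrable lborel f" "integrable lborel g"
  shows "(LINT x|lborel. inv_fourier f x * g x) = (LINT x|lborel. f x * inv_fourier g x)"
proof -
  let ?c = "complex_of_real ((2 * pi) ^ DIM('a))"
  have [measurable]: "f \<in> borel_measurable borel" "g \<in> borel_measurable borel" using assms by auto
  have 1: "fourier f (- x) = fourier (\<lambda>y. f (- y)) x" for x
    using integral_lborel_reflect[of "\<lambda>y. cis (x \<bullet> y) * f y" 0] by (simp add: fourier_lborel)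
  have "(LINT x|lborel. inv_fourier f x * g x) = (LINT x|lborel. fourier (\<lambda>y. f (- y)) x * g x) / ?c"
    by (simp add: inv_fourier_eq_fourier 1)
  also have "(LINT x|lborel. fourier (\<lambda>y. f (- y)) x * g x) = (LINT x|lborel. f (- x) * fourier g x)"
    using integrable_lborel_reflect[OF assms(1), of 0] assms(2) by (intro fourier_multiplication) auto
  also have "\<dots> = (LINT x|lborel. f x * fourier g (- x))"
    using integral_lborel_reflect[of "\<lambda>x. f x * fourier g (- x)" 0] by simp
  finally show ?thesis by (simp add: inv_fourier_eq_fourier)
qed

lemma fourier_cis_mult:
  assumes [measurable]: "f \<in> borel_measurable borel"
  shows "fourier (\<lambda>x. cis (c \<bullet> x) * f x) \<xi> = fourier f (\<xi> - c)"
  by (subst (1 2) fourier_lborel) (auto simp: cis_mult inner_diff_left simp flip: mult.assoc)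

lemma fourier_translate:
  assumes [measurable]: "f \<in> borel_measurable borel"
  shows "fourier (\<lambda>x. f (x - a)) \<xi> = cis (- (\<xi> \<bullet> a)) * fourier f \<xi>"
proof -
  have "fourier (\<lambda>x. f (x - a)) \<xi> = (LINT x|lborel. cis (- (\<xi> \<bullet> (x + a))) * f x)"
    using integral_lborel_translate[of "\<lambda>x. cis (- (\<xi> \<bullet> x)) * f (x - a)" a] by (simp add: fourier_lborel)
  also have "\<dots> = (LINT x|lborel. cis (- (\<xi> \<bullet> a)) * (cis (- (\<xi> \<bullet> x)) * f x))"
    by (simp add: cis_mult inner_add_right algebra_simps flip: mult.assoc)
  also have "\<dots> = cis (- (\<xi> \<bullet> a)) * fourier f \<xi>"
    by (simp add: fourier_lborel)
  finally show ?thesis .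
qed

section \<open>Convolution\<close>

definition conv :: "('a::euclidean_space \<Rightarrow> complex) \<Rightarrow> ('a \<Rightarrow> complex) \<Rightarrow> 'a \<Rightarrow> complex" where
  "conv f g x = (LINT y|lborel. f (x - y) * g y)"

lemma conv_borel [measurable]:
  assumes [measurable]: "f \<in> borel_measurable borel" "g \<in> borel_measurable borel"
  shows "conv f g \<in> borel_measurable borel"
  unfolding conv_def[abs_def] by measurable

lemma conv_nn_integral_finite:
  fixes f g :: "'a::euclidean_space \<Rightarrow> complex"
  assumes "integrable lborel f" "integrable lborel g"
  shows "(\<integral>\<^sup>+y. \<integral>\<^sup>+x. ennreal (norm (f (x - y) * g y)) \<partial>lborel \<partial>lborel) < \<infinity>"
proof -
  have [measurable]: "f \<in> borel_measurable borel" "g \<in> borel_measurable borel" using assms by auto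
  have "(\<integral>\<^sup>+y. \<integral>\<^sup>+x. ennreal (norm (f (x - y) * g y)) \<partial>lborel \<partial>lborel)
      = (\<integral>\<^sup>+y. (\<integral>\<^sup>+x. ennreal (norm (f (x + - y))) \<partial>lborel) * ennreal (norm (g y)) \<partial>lborel)"
    by (simp add: norm_mult ennreal_mult nn_integral_multc)
  also have "\<dots> = (\<integral>\<^sup>+x. ennreal (norm (f x)) \<partial>lborel) * (\<integral>\<^sup>+y. ennreal (norm (g y)) \<partial>lborel)"
    by (subst nn_integral_lborel_translate) (auto simp: nn_integral_cmult)
  also have "\<dots> < \<infinity>"
    using nn_integral_norm_finite[OF assms(1)] nn_integral_norm_finite[OF assms(2)]
    by (simp add: ennreal_mult_less_top)
  finally show ?thesis .
qed

lemma integrable_conv: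
  assumes "integrable lborel f" "integrable lborel g"
  shows "integrable lborel (conv f g)"
proof -
  have [measurable]: "f \<in> borel_measurable borel" "g \<in> borel_measurable borel" using assms by auto
  have "integrable (lborel \<Otimes>\<^sub>M lborel) (\<lambda>(y, x). f (x - y) * g y)"
    using conv_nn_integral_finite[OF assms] by (intro lborel_Fubini_integrable) auto
  from lborel_pair.integrable_snd[OF this] show ?thesis by (simp add: conv_def[abs_def])
qed

lemma fourier_conv:
  assumes "integrable lborel f" "integrable lborel g"
  shows "fourier (conv f g) \<xi> = fourier f \<xi> * fourier g \<xi>"
proof -
  have [measurable]: "f \<in> borel_measurable borel" "g \<in> borel_measurable borel" using assms by auto
  have "fourier (conv f g) \<xi> = (LINT x|lborel. LINT y|lborel. cis (- (\<xi> \<bullet> x)) * (f (x - y) * g y))"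
    by (subst fourier_lborel) (auto simp: conv_def simp flip: integral_mult_right_zero)
  also have "\<dots> = (LINT y|lborel. LINT x|lborel. cis (- (\<xi> \<bullet> x)) * (f (x - y) * g y))"
    using conv_nn_integral_finite[OF assms]
    by (intro lborel_Fubini_swap[symmetric]) (auto simp: norm_mult)
  also have "\<dots> = (LINT y|lborel. fourier (\<lambda>x. f (x - y)) \<xi> * g y)"
    by (subst fourier_lborel) (auto simp: mult.assoc simp flip: integral_mult_left_zero)
  also have "\<dots> = (LINT y|lborel. fourier f \<xi> * (cis (- (\<xi> \<bullet> y)) * g y))"
    by (subst fourier_translate) (auto simp: mult_ac)
  also have "\<dots> = fourier f \<xi> * fourier g \<xi>"
    by (simp add: fourier_lborel[of g])
  finally show ?thesis .
qed

section \<open>Polynomial weights\<close>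

text \<open>The Japanese bracket, written J in the overview. The constant \<open>J\<close> further
  below is something else, the integral of a power of this bracket.\<close>

definition jap :: "'a::euclidean_space \<Rightarrow> real" where
  "jap x = sqrt (1 + (norm x)\<^sup>2)"

lemma jap_ge_1: "1 \<le> jap x"
  by (simp add: jap_def)

lemma jap_pos: "0 < jap x"
  using jap_ge_1[of x] by linarith

lemma jap_borel [measurable]: "jap \<in> borel_measurable borel"
  unfolding jap_def by measurable

lemma norm_le_jap: "norm x \<le> jap x"
  by (simp add: jap_def real_le_rsqrt)

lemma jap_le: "jap x \<le> 1 + norm x"
  unfolding jap_def by (rule real_le_lsqrt) (auto simp: power2_eq_square algebra_simps)

lemma jap_powr: "jap x powr p = (1 + (norm x)\<^sup>2) powr (p / 2)"
  by (simp add: jap_def powr_half_sqrt[symmetric] powr_powr add_nonneg_nonneg)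

lemma jap_minus [simp]: "jap (- x) = jap x"
  by (simp add: jap_def)

lemma jap_triangle: "jap (x + y) \<le> jap x + jap y"
proof -
  have "jap (x + y) \<le> sqrt (1\<^sup>2 + (norm x + norm y)\<^sup>2)"
    unfolding jap_def by (intro real_sqrt_le_mono add_mono power_mono norm_triangle_ineq) auto
  \<comment> \<open>In the plane, (1, |x| + |y|) is the sum of (1, |x|) and (0, |y|).\<close>
  also have "\<dots> \<le> sqrt (1\<^sup>2 + (norm x)\<^sup>2) + sqrt (0\<^sup>2 + (norm y)\<^sup>2)"
    using real_sqrt_sum_squares_triangle_ineq[of 1 0 "norm x" "norm y"] by simp
  also have "\<dots> \<le> jap x + jap y" using norm_le_jap[of y] by (simp add: jap_def)
  finally show ?thesis .
qed

lemma jap_powr_borel [measurable]: "(\<lambda>x. jap x powr p) \<in> borel_measurable borel"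
  by measurable

lemma integrable_jap_powr:
  assumes "real DIM('a) < p"
  shows "integrable lborel (\<lambda>x::'a::euclidean_space. jap x powr (- p))"
proof (rule integrableI_bounded)
  let ?V = "unit_ball_vol (DIM('a))"
  define r where "r = 2 powr (real DIM('a) - p)"
  have "r < 2 powr 0" unfolding r_def using assms by (intro powr_less_mono) auto
  then have r: "0 \<le> r" "r < 1" by (auto simp: r_def)
  have p: "0 < p" using assms by (rule le_less_trans[rotated]) auto
  \<comment> \<open>Constants on dyadic balls. The constant for \<open>n\<close> is the value
    \<open>(2 ^ (n - 1)) powr (- p)\<close>, which bounds the weight outside the ball of half the
    radius; the masses of these functions form a geometric series with ratio
    \<open>r\<close>.\<close>
  define F :: "nat \<Rightarrow> 'a \<Rightarrow> ennreal"
    where "F n x = ennreal (2 powr p * 2 powr (- p * real n)) * indicator (ball 0 (2 ^ n)) x" for n x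
  have "F n \<in> borel_measurable borel" for n
    unfolding F_def by (intro borel_measurable_times_ennreal borel_measurable_indicator) auto
  then have F_borel: "F n \<in> borel_measurable lborel" for n by simp
  have le: "ennreal (jap x powr (- p)) \<le> (\<Sum>n. F n x)" for x :: 'a
  proof -
    obtain m where m: "norm x < 2 ^ m" using real_arch_pow[of 2 "norm x"] by auto
    define n where "n = (LEAST n. norm x < 2 ^ n)"
    have n: "norm x < 2 ^ n" unfolding n_def by (rule LeastI[of _ m]) fact
    have "jap x powr (- p) \<le> 2 powr p * 2 powr (- p * real n)"
    proof (cases n)
      case 0
      have "jap x powr (- p) \<le> 1" using jap_ge_1[of x] p by (simp add: powr_le1 powr_minus_divide ge_one_powr_ge_zero)
      also have "1 \<le> 2 powr p" using p by (simp add: ge_one_powr_ge_zero)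
      finally show ?thesis using 0 by simp
    next
      case (Suc k)
      have "\<not> norm x < 2 ^ k" using not_less_Least[of k "\<lambda>n. norm x < 2 ^ n"] Suc by (auto simp: n_def)
      then have "2 powr real k \<le> jap x" using norm_le_jap[of x] by (simp add: powr_realpow)
      then have "jap x powr (- p) \<le> (2 powr real k) powr (- p)"
        using p by (intro powr_mono2') auto
      also have "\<dots> = 2 powr p * 2 powr (- p * real n)"
        by (simp add: powr_powr Suc powr_add[symmetric] algebra_simps)
      finally show ?thesis .
    qed
    then have "ennreal (jap x powr (- p)) \<le> ennreal (2 powr p * 2 powr (- p * real n)) * indicator (ball 0 (2 ^ n)) x"
      using n by (simp add: ennreal_leI)
    also have "\<dots> \<le> (\<Sum>n. F n x)"
    proof -
      have "(\<Sum>n\<in>{n}. F n x) \<le> (\<Sum>n. F n x)" by (intro sum_le_suminf summableI) auto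
      then show ?thesis unfolding F_def[symmetric] by simp
    qed
    finally show ?thesis .
  qed
  have "(\<integral>\<^sup>+x. ennreal (norm (jap x powr (- p))) \<partial>(lborel::'a measure))
      \<le> (\<integral>\<^sup>+x. (\<Sum>n. F n x) \<partial>lborel)"
    using le by (intro nn_integral_mono) simp
  also have "\<dots> = (\<Sum>n. \<integral>\<^sup>+x. F n x \<partial>lborel)"
    by (intro nn_integral_suminf F_borel)
  also have "\<dots> = (\<Sum>n. ennreal (2 powr p * 2 powr (- p * real n)) * ennreal (?V * (2 ^ n) ^ DIM('a)))"
    unfolding F_def by (intro suminf_cong) (simp add: nn_integral_cmult_indicator emeasure_ball)
  also have "\<dots> = (\<Sum>n. ennreal (2 powr p * ?V * r ^ n))"
  proof (intro suminf_cong)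
    fix n
    have "2 powr (- p * real n) * (2 ^ n) ^ DIM('a) = r ^ n"
      by (simp add: r_def powr_realpow[symmetric] powr_powr powr_add[symmetric] algebra_simps)
    then show "ennreal (2 powr p * 2 powr (- p * real n)) * ennreal (?V * (2 ^ n) ^ DIM('a))
        = ennreal (2 powr p * ?V * r ^ n)"
      by (simp add: ennreal_mult'[symmetric] mult_ac)
  qed
  also have "\<dots> < \<infinity>"
    using r unit_ball_vol_nonneg[of "DIM('a)"]
    by (subst suminf_ennreal2) (auto intro!: summable_mult summable_geometric mult_nonneg_nonneg zero_le_power)
  finally show "(\<integral>\<^sup>+x. ennreal (norm (jap x powr (- p))) \<partial>(lborel::'a measure)) < \<infinity>" .
  show "(\<lambda>x::'a. jap x powr - p) \<in> borel_measurable lborel"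
    using jap_powr_borel by simp
qed

section \<open>The Fourier transform of test functions\<close>

lemma smooth_cis:
  assumes g: "smooth g" shows "smooth (\<lambda>x. cis (g x))"
proof -
  have D: "((\<lambda>t. c * cis t) has_vector_derivative c * \<i> * cis t) (at t)" for c t
    unfolding cis_conv_exp
    by (rule has_vector_derivative_real_field) (auto intro!: derivative_eq_intros)
  then have d: "(\<lambda>t. c * cis t) differentiable (at t)" for c t
    by (auto simp: has_vector_derivative_def differentiable_def)
  have pd: "partial_deriv 1 (\<lambda>t. c * cis t) = (\<lambda>t. c * \<i> * cis t)" for c
    using frechet_derivative_at[OF D[unfolded has_vector_derivative_def], symmetric]
    by (intro ext) (simp add: has_vector_derivative_def)
  have "Ck n (\<lambda>t::real. c * cis t)" for n c
  proof (induction n arbitrary: c)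
    case (Suc n)
    show ?case using d Suc[of "c * \<i>"] by (simp add: pd)
  qed (use d in auto)
  then have "smooth (\<lambda>t::real. 1 * cis t)" unfolding smooth_iff_Ck by blast
  then have "smooth cis" by simp
  from smooth_compose_real[OF this g] show ?thesis .
qed

lemma smooth_cis_inner: "smooth (\<lambda>x. cis (- (\<xi> \<bullet> x)))"
proof -
  have "smooth (\<lambda>x. x \<bullet> (- \<xi>))" by (rule smooth_inner_left)
  from smooth_cis[OF this] show ?thesis by (simp add: inner_commute)
qed

lemma test_functionI_norm:
  fixes \<phi> :: "'a::euclidean_space \<Rightarrow> complex"
  assumes "smooth \<phi>" "\<And>x. R \<le> norm x \<Longrightarrow> \<phi> x = 0"
  shows "\<phi> \<in> test_functions"
  using assms(2) by (intro test_functionI[OF assms(1) compact_cball, of 0 R]) simp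

lemma test_mult_smooth:
  assumes "\<phi> \<in> test_functions" "smooth f" shows "(\<lambda>x. f x * \<phi> x) \<in> test_functions"
proof -
  obtain R where "\<And>x. R \<le> norm x \<Longrightarrow> \<phi> x = 0"
    using assms(1) by (rule test_functionE) blast
  then show ?thesis
    using smooth_mult[OF assms(2) test_function_smooth[OF assms(1)]]
    by (intro test_functionI_norm[where R=R]) simp_all
qed

lemma test_add:
  assumes "\<phi> \<in> test_functions" "\<psi> \<in> test_functions" shows "(\<lambda>x. \<phi> x + \<psi> x) \<in> test_functions"
proof -
  obtain R where "\<And>x. R \<le> norm x \<Longrightarrow> \<phi> x = 0"
    using assms(1) by (rule test_functionE) blast
  moreover obtain R' where "\<And>x. R' \<le> norm x \<Longrightarrow> \<psi> x = 0"
    using assms(2) by (rule test_functionE) blast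
  ultimately show ?thesis
    using smooth_add[OF assms[THEN test_function_smooth]]
    by (intro test_functionI_norm[where R="max R R'"]) simp_all
qed

lemma test_zero: "(\<lambda>x. 0) \<in> test_functions"
  by (rule test_functionI[where K="{}"]) auto

lemma test_sum:
  "(\<And>i. i \<in> I \<Longrightarrow> \<phi> i \<in> test_functions) \<Longrightarrow> (\<lambda>x. \<Sum>i\<in>I. \<phi> i x) \<in> test_functions"
  by (induction I rule: infinite_finite_induct) (auto intro: test_add test_zero)

lemma test_diff:
  assumes "\<phi> \<in> test_functions" "\<psi> \<in> test_functions" shows "(\<lambda>x. \<phi> x - \<psi> x) \<in> test_functions"
  using test_add[OF assms(1) test_mult_smooth[OF assms(2) smooth_const[of "-1"]]] by simp

lemma test_partial_deriv:
  assumes "\<phi> \<in> test_functions" "b \<in> Basis" shows "partial_deriv b \<phi> \<in> test_functions"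
proof -
  obtain R where R: "\<And>x. R \<le> norm x \<Longrightarrow> \<phi> x = 0"
    using assms(1) by (rule test_functionE) blast
  show ?thesis
  proof (rule test_functionI[where K="cball 0 R"])
    fix x :: 'a assume "x \<notin> cball 0 R"
    then show "partial_deriv b \<phi> x = 0"
      using iter_partial_local[of "- cball 0 R" \<phi> "\<lambda>x. 0" x "[b]"] R by (auto simp: frechet_derivative_const)
  qed (use assms in \<open>auto intro: smooth_partial_deriv test_function_smooth\<close>)
qed

text \<open>The integral of \<open>\<phi> (x + b) - \<phi> x\<close> vanishes by translation
  invariance. The fundamental theorem of calculus on the segment from \<open>x\<close> to
  \<open>x + b\<close>, together with Fubini's theorem, writes it as an average of integrals of
  translates of the derivative, which are all equal. This way no coordinate has to be split
  off.\<close>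

lemma integral_partial_deriv_zero:
  fixes \<phi> :: "'a::euclidean_space \<Rightarrow> complex"
  assumes \<phi>: "\<phi> \<in> test_functions" and b: "b \<in> Basis"
  shows "(LINT x|lborel. partial_deriv b \<phi> x) = 0"
proof -
  define \<psi> where "\<psi> = partial_deriv b \<phi>"
  have \<psi>: "\<psi> \<in> test_functions" unfolding \<psi>_def by (rule test_partial_deriv[OF \<phi> b])
  note i\<phi> = test_function_integrable[OF \<phi>] and i\<psi> = test_function_integrable[OF \<psi>]
  have [measurable]: "\<phi> \<in> borel_measurable borel" "\<psi> \<in> borel_measurable borel"
    using \<phi> \<psi> by (auto intro: test_function_borel)
  have FTC: "(LINT t|lborel. indicator {0..1} t *\<^sub>R \<psi> (x + t *\<^sub>R b)) = \<phi> (x + b) - \<phi> x" for x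
  proof -
    have "(\<integral>t. indicator {0..1} t *\<^sub>R \<psi> (x + t *\<^sub>R b) \<partial>lborel) = \<phi> (x + 1 *\<^sub>R b) - \<phi> (x + 0 *\<^sub>R b)"
    proof (rule integral_FTC_atLeastAtMost)
      fix t :: real
      let ?D = "frechet_derivative \<phi> (at (x + t *\<^sub>R b))"
      have d: "\<phi> differentiable at (x + t *\<^sub>R b)"
        using \<phi> by (intro smooth_differentiable test_function_smooth)
      then have "(\<phi> \<circ> (\<lambda>t. x + t *\<^sub>R b) has_derivative ?D \<circ> (\<lambda>h. h *\<^sub>R b)) (at t)"
        by (intro diff_chain_at) (auto intro!: derivative_eq_intros simp: frechet_derivative_works[symmetric])
      moreover have "?D (h *\<^sub>R b) = h *\<^sub>R \<psi> (x + t *\<^sub>R b)" for h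
        unfolding \<psi>_def using linear_scale[OF linear_frechet_derivative[OF d]] by blast
      ultimately have "((\<lambda>t. \<phi> (x + t *\<^sub>R b)) has_vector_derivative \<psi> (x + t *\<^sub>R b)) (at t)"
        by (simp add: has_vector_derivative_def o_def)
      then show "((\<lambda>t. \<phi> (x + t *\<^sub>R b)) has_vector_derivative \<psi> (x + t *\<^sub>R b)) (at t within {0..1})"
        by (rule has_vector_derivative_at_within)
    next
      show "continuous_on {0..1} (\<lambda>t. \<psi> (x + t *\<^sub>R b))"
        by (rule continuous_on_compose2[OF smooth_continuous_on[OF test_function_smooth[OF \<psi>], of UNIV]])
          (auto intro!: continuous_intros)
    qed simp
    then show ?thesis by simp
  qed
  have "0 = (LINT x|lborel. \<phi> (x + b) - \<phi> x)"
    using i\<phi> integrable_lborel_translate[OF i\<phi>, of b] by (simp add: integral_lborel_translate)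
  also have "\<dots> = (LINT x|lborel. LINT t|lborel. indicator {0..1} t *\<^sub>R \<psi> (x + t *\<^sub>R b))"
    by (simp add: FTC)
  also have "\<dots> = (LINT t|lborel. LINT x|lborel. indicator {0..1} t *\<^sub>R \<psi> (x + t *\<^sub>R b))"
  proof (rule lborel_Fubini_swap[symmetric])
    have "(\<integral>\<^sup>+t. \<integral>\<^sup>+x. ennreal (norm (indicator {0..1} t *\<^sub>R \<psi> (x + t *\<^sub>R b))) \<partial>lborel \<partial>lborel)
        = (\<integral>\<^sup>+t. indicator {0..1} t * (\<integral>\<^sup>+x. ennreal (norm (\<psi> (x + t *\<^sub>R b))) \<partial>lborel) \<partial>(lborel::real measure))"
      by (auto simp: indicator_def intro!: nn_integral_cong)
    also have "\<dots> = (\<integral>\<^sup>+t. indicator {0..1} t * (\<integral>\<^sup>+x. ennreal (norm (\<psi> x)) \<partial>lborel) \<partial>(lborel::real measure))"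
      by (subst nn_integral_lborel_translate) auto
    also have "\<dots> < \<infinity>"
      using nn_integral_norm_finite[OF i\<psi>] by (simp add: nn_integral_multc)
    finally show "(\<integral>\<^sup>+t. \<integral>\<^sup>+x. ennreal (norm (indicator {0..1} t *\<^sub>R \<psi> (x + t *\<^sub>R b))) \<partial>lborel \<partial>(lborel::real measure)) < \<infinity>" .
  qed measurable
  also have "\<dots> = (LINT t|lborel. indicator {0..1::real} t *\<^sub>R (LINT x|lborel. \<psi> x))"
    by (simp add: integral_lborel_translate)
  also have "\<dots> = (LINT x|lborel. \<psi> x)" by (subst integral_scaleR_left) auto
  finally show ?thesis by (simp add: \<psi>_def)
qed

lemma partial_deriv_cis_inner:
  "partial_deriv b (\<lambda>x. cis (- (\<xi> \<bullet> x))) x = - \<i> * complex_of_real (\<xi> \<bullet> b) * cis (- (\<xi> \<bullet> x))"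
proof -
  have "((\<lambda>x. cis (- (\<xi> \<bullet> x))) has_derivative
      (\<lambda>h. - \<i> * complex_of_real (\<xi> \<bullet> h) * cis (- (\<xi> \<bullet> x)))) (at x)"
    unfolding cis_conv_exp
    by (rule has_derivative_eq_rhs, rule has_derivative_compose[OF _ DERIV_exp[unfolded has_field_derivative_def]])
      (auto intro!: derivative_eq_intros simp: mult_ac)
  then show ?thesis by (simp add: frechet_derivative_at[symmetric])
qed

lemma fourier_partial_deriv:
  fixes \<phi> :: "'a::euclidean_space \<Rightarrow> complex"
  assumes \<phi>: "\<phi> \<in> test_functions" and b: "b \<in> Basis"
  shows "fourier (partial_deriv b \<phi>) \<xi> = \<i> * complex_of_real (\<xi> \<bullet> b) * fourier \<phi> \<xi>"
proof -
  let ?e = "\<lambda>x. cis (- (\<xi> \<bullet> x))"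
  have \<psi>: "partial_deriv b \<phi> \<in> test_functions" by (rule test_partial_deriv[OF \<phi> b])
  have i: "integrable lborel (\<lambda>x. ?e x * \<phi> x)" "integrable lborel (\<lambda>x. ?e x * partial_deriv b \<phi> x)"
    using \<phi> \<psi> by (simp_all add: integrable_cis_mult test_function_integrable)
  have "0 = (LINT x|lborel. partial_deriv b (\<lambda>x. ?e x * \<phi> x) x)"
    using integral_partial_deriv_zero[OF test_mult_smooth[OF \<phi> smooth_cis_inner] b] by simp
  also have "\<dots> = (LINT x|lborel. ?e x * partial_deriv b \<phi> x - (\<i> * complex_of_real (\<xi> \<bullet> b)) * (?e x * \<phi> x))"
    using smooth_differentiable[OF smooth_cis_inner] smooth_differentiable[OF test_function_smooth[OF \<phi>]]
    by (subst partial_deriv_bilinear[OF _ _ bounded_bilinear_mult])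
      (auto simp: partial_deriv_cis_inner mult_ac)
  also have "\<dots> = fourier (partial_deriv b \<phi>) \<xi> - (\<i> * complex_of_real (\<xi> \<bullet> b)) * fourier \<phi> \<xi>"
    unfolding fourier_lborel[OF test_function_borel[OF \<phi>]] fourier_lborel[OF test_function_borel[OF \<psi>]]
      integral_mult_right_zero[symmetric]
    by (rule Bochner_Integration.integral_diff[OF i(2) integrable_mult_right[OF i(1)]])
  finally show ?thesis by simp
qed

lemma fourier_add:
  assumes "integrable lborel f" "integrable lborel g"
  shows "fourier (\<lambda>x. f x + g x) \<xi> = fourier f \<xi> + fourier g \<xi>"
  using assms integrable_cis_mult[OF assms(1), of "\<lambda>x. - (\<xi> \<bullet> x)"] integrable_cis_mult[OF assms(2), of "\<lambda>x. - (\<xi> \<bullet> x)"]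
  by (simp add: fourier_lborel ring_distribs)

lemma fourier_diff:
  assumes "integrable lborel f" "integrable lborel g"
  shows "fourier (\<lambda>x. f x - g x) \<xi> = fourier f \<xi> - fourier g \<xi>"
  using assms integrable_cis_mult[OF assms(1), of "\<lambda>x. - (\<xi> \<bullet> x)"] integrable_cis_mult[OF assms(2), of "\<lambda>x. - (\<xi> \<bullet> x)"]
  by (simp add: fourier_lborel ring_distribs)

lemma fourier_sum:
  assumes "\<And>i. i \<in> I \<Longrightarrow> integrable lborel (f i)"
  shows "fourier (\<lambda>x. \<Sum>i\<in>I. f i x) \<xi> = (\<Sum>i\<in>I. fourier (f i) \<xi>)"
  using assms
proof (induction I rule: infinite_finite_induct)
  case (insert i I)
  then show ?case by (simp add: fourier_add)
qed (auto simp: fourier_lborel)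

text \<open>The operator 1 minus the Laplacian preserves test functions and becomes multiplication
  by \<open>(jap \<xi>)\<^sup>2\<close>, so each application gains two powers.\<close>

lemma fourier_decay:
  fixes \<phi> :: "'a::euclidean_space \<Rightarrow> complex"
  assumes "\<phi> \<in> test_functions"
  shows "\<exists>C\<ge>0. \<forall>\<xi>. jap \<xi> ^ (2 * m) * norm (fourier \<phi> \<xi>) \<le> C"
  using assms
proof (induction m arbitrary: \<phi>)
  case 0
  then show ?case
    using norm_fourier_le[OF test_function_integrable[OF 0]]
    by (intro exI[of _ "LINT x|lborel. norm (\<phi> x)"]) auto
next
  case (Suc m)
  define \<psi> where "\<psi> x = \<phi> x - (\<Sum>b\<in>Basis. partial_deriv b (partial_deriv b \<phi>) x)" for x
  have t: "partial_deriv b (partial_deriv b \<phi>) \<in> test_functions" if "b \<in> Basis" for b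
    using Suc that by (intro test_partial_deriv)
  have \<psi>: "\<psi> \<in> test_functions"
    unfolding \<psi>_def using t Suc by (intro test_diff test_sum)
  have "fourier \<psi> \<xi> = complex_of_real ((jap \<xi>)\<^sup>2) * fourier \<phi> \<xi>" for \<xi>
  proof -
    have "fourier \<psi> \<xi> = fourier \<phi> \<xi> - (\<Sum>b\<in>Basis. fourier (partial_deriv b (partial_deriv b \<phi>)) \<xi>)"
      unfolding \<psi>_def using t Suc.prems
      by (simp add: fourier_diff fourier_sum test_function_integrable)
    also have "\<dots> = fourier \<phi> \<xi> + (\<Sum>b\<in>Basis. complex_of_real ((\<xi> \<bullet> b)\<^sup>2)) * fourier \<phi> \<xi>"
      using Suc.prems
      by (simp add: fourier_partial_deriv test_partial_deriv sum_distrib_left power2_eq_square mult_ac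
          flip: sum_negf)
    also have "(\<Sum>b\<in>Basis. complex_of_real ((\<xi> \<bullet> b)\<^sup>2)) = complex_of_real ((norm \<xi>)\<^sup>2)"
      by (simp only: of_real_sum[symmetric] power2_norm_eq_inner) (simp add: euclidean_inner[of \<xi> \<xi>] power2_eq_square)
    finally show ?thesis by (simp add: jap_def ring_distribs)
  qed
  then have "jap \<xi> ^ (2 * Suc m) * norm (fourier \<phi> \<xi>) = jap \<xi> ^ (2 * m) * norm (fourier \<psi> \<xi>)" for \<xi>
    using jap_pos[of \<xi>] by (simp add: norm_mult norm_power power2_eq_square mult_ac)
  with Suc.IH[OF \<psi>] show ?case by presburger
qed

lemma fourier_decay_powr:
  fixes \<phi> :: "'a::euclidean_space \<Rightarrow> complex"
  assumes "\<phi> \<in> test_functions"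
  shows "\<exists>C\<ge>0. \<forall>\<xi>. norm (fourier \<phi> \<xi>) \<le> C * jap \<xi> powr (- real m)"
proof -
  obtain C where C: "C \<ge> 0" "\<And>\<xi>. jap \<xi> ^ (2 * m) * norm (fourier \<phi> \<xi>) \<le> C"
    using fourier_decay[OF assms] by blast
  have "norm (fourier \<phi> \<xi>) \<le> C * jap \<xi> powr (- real m)" for \<xi>
  proof -
    have "jap \<xi> ^ m * norm (fourier \<phi> \<xi>) \<le> jap \<xi> ^ (2 * m) * norm (fourier \<phi> \<xi>)"
      using jap_ge_1[of \<xi>] by (intro mult_right_mono power_increasing) auto
    also have "\<dots> \<le> C" by (rule C)
    finally show ?thesis
      using jap_pos[of \<xi>] by (simp add: powr_minus powr_realpow field_simps)
  qed
  with C(1) show ?thesis by blast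
qed

lemma integrable_fourier_test:
  fixes \<phi> :: "'a::euclidean_space \<Rightarrow> complex"
  assumes "\<phi> \<in> test_functions"
  shows "integrable lborel (fourier \<phi>)"
proof -
  have [measurable]: "\<phi> \<in> borel_measurable borel" by (rule test_function_borel[OF assms])
  obtain C where C: "C \<ge> 0" "\<And>\<xi>. norm (fourier \<phi> \<xi>) \<le> C * jap \<xi> powr (- real (DIM('a) + 1))"
    using fourier_decay_powr[OF assms, of "DIM('a) + 1"] by blast
  show ?thesis
  proof (rule Bochner_Integration.integrable_bound)
    show "integrable lborel (\<lambda>\<xi>::'a. C * jap \<xi> powr (- real (DIM('a) + 1)))"
      by (intro integrable_mult_right integrable_jap_powr) simp
    show "AE \<xi> in lborel. norm (fourier \<phi> \<xi>) \<le> norm (C * jap \<xi> powr (- real (DIM('a) + 1)))"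
      using C by (intro AE_I2) (auto simp: abs_mult intro: order_trans)
  qed simp
qed

lemma integrable_inv_fourier_test:
  fixes \<phi> :: "'a::euclidean_space \<Rightarrow> complex"
  assumes "\<phi> \<in> test_functions"
  shows "integrable lborel (inv_fourier \<phi>)"
  unfolding inv_fourier_eq_fourier[abs_def]
  using integrable_lborel_reflect[OF integrable_fourier_test[OF assms], of 0] by simp

section \<open>Transforms of test functions are Schwartz functions\<close>

lemma has_derivative_quadratic_bound:
  assumes "bounded_linear D" "\<And>h. norm (f (x + h) - f x - D h) \<le> C * (norm h)\<^sup>2"
  shows "(f has_derivative D) (at x)"
  unfolding has_derivative_at
proof
  show "(\<lambda>h. norm (f (x + h) - f x - D h) / norm h) \<midarrow>0\<rightarrow> 0"
  proof (rule Lim_null_comparison)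
    show "\<forall>\<^sub>F h in at 0. norm (norm (f (x + h) - f x - D h) / norm h) \<le> C * norm h"
      using assms(2) by (intro eventually_at_topological[THEN iffD2] exI[of _ UNIV])
        (auto simp: divide_simps power2_eq_square mult_ac)
    show "(\<lambda>h. C * norm h) \<midarrow>0\<rightarrow> 0"
      by (auto intro!: tendsto_eq_intros)
  qed
qed fact

lemma norm_cis_minus_linear_le: "norm (cis t - 1 - \<i> * complex_of_real t) \<le> t\<^sup>2"
proof -
  have "norm (cis t - (\<Sum>k\<le>1. (\<i> * complex_of_real t) ^ k / fact k)) \<le> \<bar>t\<bar> ^ Suc 1 / fact (Suc 1)"
    using iexp_approx1[of t 1] by (simp add: cis_conv_exp)
  also have "\<dots> \<le> t\<^sup>2" by (simp add: power2_eq_square)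
  finally show ?thesis by (simp add: algebra_simps)
qed

text \<open>Differentiation under the integral with an explicit remainder: the first-order expansion
  of the exponential leaves at most \<open>(h \<bullet> x)\<^sup>2\<close>, and on the support this
  is at most \<open>R\<^sup>2 * (norm h)\<^sup>2\<close>.\<close>

lemma fourier_test_has_derivative:
  fixes \<phi> :: "'a::euclidean_space \<Rightarrow> complex"
  assumes \<phi>: "\<phi> \<in> test_functions"
  shows "(fourier \<phi> has_derivative
    (\<lambda>h. \<Sum>b\<in>Basis. complex_of_real (h \<bullet> b) * fourier (\<lambda>x. (- \<i> * complex_of_real (x \<bullet> b)) * \<phi> x) \<xi>)) (at \<xi>)"
proof -
  obtain R where R: "0 < R" "\<And>x. R \<le> norm x \<Longrightarrow> \<phi> x = 0"
    using \<phi> by (rule test_functionE) blast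
  show ?thesis
  proof (rule has_derivative_quadratic_bound)
    let ?M = "\<lambda>b x. (- \<i> * complex_of_real (x \<bullet> b)) * \<phi> x"
    show "bounded_linear (\<lambda>h. \<Sum>b\<in>Basis. complex_of_real (h \<bullet> b) * fourier (?M b) \<xi>)"
      by (intro bounded_linear_sum bounded_linear_mult_const bounded_linear_compose[OF bounded_linear_of_real]
          bounded_linear_inner_left)
    have [measurable]: "\<phi> \<in> borel_measurable borel" by (rule test_function_borel[OF \<phi>])
    have M: "?M b \<in> test_functions" for b
      by (intro test_mult_smooth \<phi> smooth_mult smooth_of_real smooth_inner_left smooth_const)
    have iM: "integrable lborel (\<lambda>x. cis (- (\<xi> \<bullet> x)) * ?M b x)" for b
      by (intro integrable_cis_mult test_function_integrable M) auto
    have i: "integrable lborel (\<lambda>x. cis (- (z \<bullet> x)) * \<phi> x)" for z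
      by (intro integrable_cis_mult test_function_integrable \<phi>) auto
    fix h :: 'a
    have D: "(\<Sum>b\<in>Basis. complex_of_real (h \<bullet> b) * fourier (?M b) \<xi>)
      = (LINT x|lborel. cis (- (\<xi> \<bullet> x)) * (- \<i> * complex_of_real (h \<bullet> x)) * \<phi> x)" (is "?D = _")
    proof -
      have "?D = (LINT x|lborel. (\<Sum>b\<in>Basis. complex_of_real (h \<bullet> b) * (cis (- (\<xi> \<bullet> x)) * ?M b x)))"
        using iM by (subst Bochner_Integration.integral_sum) (auto simp: fourier_lborel)
      also have "\<dots> = (LINT x|lborel. cis (- (\<xi> \<bullet> x)) * (- \<i> * complex_of_real (h \<bullet> x)) * \<phi> x)"
        by (intro Bochner_Integration.integral_cong refl, subst (2) euclidean_inner)
          (auto simp: sum_distrib_left sum_distrib_right mult_ac intro!: sum.cong)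
      finally show ?thesis .
    qed
    have iD: "integrable lborel (\<lambda>x. cis (- (\<xi> \<bullet> x)) * (- \<i> * complex_of_real (h \<bullet> x)) * \<phi> x)"
    proof -
      have "(\<lambda>x. (- \<i> * complex_of_real (x \<bullet> h)) * \<phi> x) \<in> test_functions"
        by (intro test_mult_smooth \<phi> smooth_mult smooth_of_real smooth_inner_left smooth_const)
      from integrable_cis_mult[OF test_function_integrable[OF this], of "\<lambda>x. - (\<xi> \<bullet> x)"]
      show ?thesis by (simp add: inner_commute mult_ac)
    qed
    have "fourier \<phi> (\<xi> + h) - fourier \<phi> \<xi> - ?D
      = (LINT x|lborel. cis (- ((\<xi> + h) \<bullet> x)) * \<phi> x - cis (- (\<xi> \<bullet> x)) * \<phi> x
          - cis (- (\<xi> \<bullet> x)) * (- \<i> * complex_of_real (h \<bullet> x)) * \<phi> x)"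
      unfolding D using i[of "\<xi> + h"] i[of \<xi>] iD by (simp add: fourier_lborel)
    also have "\<dots> = (LINT x|lborel. cis (- (\<xi> \<bullet> x)) * (cis (- (h \<bullet> x)) - 1 - \<i> * complex_of_real (- (h \<bullet> x))) * \<phi> x)"
      by (intro Bochner_Integration.integral_cong refl)
        (simp add: algebra_simps inner_add_left cis_mult)
    finally have E: "fourier \<phi> (\<xi> + h) - fourier \<phi> \<xi> - ?D = \<dots>" .
    have "norm (fourier \<phi> (\<xi> + h) - fourier \<phi> \<xi> - ?D) \<le> (LINT x|lborel. (R\<^sup>2 * (norm h)\<^sup>2) * norm (\<phi> x))"
      unfolding E
    proof (rule order_trans[OF integral_norm_bound integral_mono[OF integrable_norm]])
      show "integrable lborel (\<lambda>x. cis (- (\<xi> \<bullet> x)) * (cis (- (h \<bullet> x)) - 1 - \<i> * complex_of_real (- (h \<bullet> x))) * \<phi> x)"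
        using Bochner_Integration.integrable_diff[OF Bochner_Integration.integrable_diff[OF i[of "\<xi> + h"] i[of \<xi>]] iD]
        by (rule Bochner_Integration.integrable_cong[THEN iffD1, OF refl, rotated])
          (simp add: algebra_simps inner_add_left cis_mult)
      show "integrable lborel (\<lambda>x. (R\<^sup>2 * (norm h)\<^sup>2) * norm (\<phi> x))"
        using test_function_integrable[OF \<phi>] by auto
      fix x
      show "norm (cis (- (\<xi> \<bullet> x)) * (cis (- (h \<bullet> x)) - 1 - \<i> * complex_of_real (- (h \<bullet> x))) * \<phi> x)
        \<le> (R\<^sup>2 * (norm h)\<^sup>2) * norm (\<phi> x)"
      proof (cases "R \<le> norm x")
        case False
        have "\<bar>h \<bullet> x\<bar> \<le> norm h * R"
          using Cauchy_Schwarz_ineq2[of h x] False mult_left_mono[of "norm x" R "norm h"] by auto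
        then have "(h \<bullet> x)\<^sup>2 \<le> (norm h * R)\<^sup>2" using R(1) by (intro power2_le_iff_abs_le[THEN iffD2]) auto
        then have "norm (cis (- (h \<bullet> x)) - 1 - \<i> * complex_of_real (- (h \<bullet> x))) \<le> R\<^sup>2 * (norm h)\<^sup>2"
          using norm_cis_minus_linear_le[of "- (h \<bullet> x)"] by (simp add: power_mult_distrib mult.commute)
        then show ?thesis by (simp add: norm_mult mult_right_mono)
      qed (simp add: R)
    qed
    then show "norm (fourier \<phi> (\<xi> + h) - fourier \<phi> \<xi> - ?D)
        \<le> (R\<^sup>2 * (LINT x|lborel. norm (\<phi> x))) * (norm h)\<^sup>2"
      by (simp add: mult_ac)
  qed
qed

lemma partial_deriv_fourier_test:
  fixes \<phi> :: "'a::euclidean_space \<Rightarrow> complex"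
  assumes "\<phi> \<in> test_functions" "b \<in> Basis"
  shows "partial_deriv b (fourier \<phi>) = fourier (\<lambda>x. (- \<i> * complex_of_real (x \<bullet> b)) * \<phi> x)"
proof
  fix \<xi>
  have "partial_deriv b (fourier \<phi>) \<xi>
    = (\<Sum>b'\<in>Basis. complex_of_real (b \<bullet> b') * fourier (\<lambda>x. (- \<i> * complex_of_real (x \<bullet> b')) * \<phi> x) \<xi>)"
    unfolding frechet_derivative_at[OF fourier_test_has_derivative[OF assms(1)], symmetric] ..
  also have "\<dots> = (\<Sum>b'\<in>Basis. if b' = b then fourier (\<lambda>x. (- \<i> * complex_of_real (x \<bullet> b')) * \<phi> x) \<xi> else 0)"
    using assms(2) by (intro sum.cong) (auto simp: inner_Basis)
  also have "\<dots> = fourier (\<lambda>x. (- \<i> * complex_of_real (x \<bullet> b)) * \<phi> x) \<xi>"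
    using assms(2) by simp
  finally show "partial_deriv b (fourier \<phi>) \<xi> = fourier (\<lambda>x. (- \<i> * complex_of_real (x \<bullet> b)) * \<phi> x) \<xi>" .
qed

text \<open>Every derivative of the transform is the transform of another test function, so one
  decay estimate for such transforms covers all derivatives.\<close>

lemma iter_partial_fourier_test:
  fixes \<phi> :: "'a::euclidean_space \<Rightarrow> complex"
  assumes "\<phi> \<in> test_functions" "bs \<in> lists Basis"
  shows "\<exists>\<psi>\<in>test_functions. iter_partial bs (fourier \<phi>) = fourier \<psi>"
  using assms(2)
proof (induction bs)
  case (Cons b bs)
  then obtain \<psi> where \<psi>: "\<psi> \<in> test_functions" "iter_partial bs (fourier \<phi>) = fourier \<psi>" by auto
  have "(\<lambda>x. (- \<i> * complex_of_real (x \<bullet> b)) * \<psi> x) \<in> test_functions"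
    by (intro test_mult_smooth \<psi> smooth_mult smooth_of_real smooth_inner_left smooth_const)
  then show ?case using \<psi> Cons partial_deriv_fourier_test[OF \<psi>(1), of b] by auto
qed (use assms in auto)

lemma fourier_test_schwartz:
  fixes \<phi> :: "'a::euclidean_space \<Rightarrow> complex"
  assumes "\<phi> \<in> test_functions"
  shows "fourier \<phi> \<in> schwartz"
proof -
  have "iter_partial bs (fourier \<phi>) differentiable (at x)" if bs: "bs \<in> lists Basis" for bs x
  proof -
    obtain \<psi> where "\<psi> \<in> test_functions" "iter_partial bs (fourier \<phi>) = fourier \<psi>"
      using iter_partial_fourier_test[OF assms bs] by blast
    then show ?thesis unfolding differentiable_def using fourier_test_has_derivative[of \<psi> x] by auto
  qed
  moreover have "bdd_above (range (\<lambda>x. (1 + norm x) ^ N * norm (iter_partial bs (fourier \<phi>) x)))"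
    if bs: "bs \<in> lists Basis" for bs N
  proof -
    obtain \<psi> where \<psi>: "\<psi> \<in> test_functions" "iter_partial bs (fourier \<phi>) = fourier \<psi>"
      using iter_partial_fourier_test[OF assms bs] by blast
    obtain C where C: "C \<ge> 0" "\<And>\<xi>. norm (fourier \<psi> \<xi>) \<le> C * jap \<xi> powr (- real N)"
      using fourier_decay_powr[OF \<psi>(1)] by blast
    have "(1 + norm x) ^ N * norm (fourier \<psi> x) \<le> 2 ^ N * C" for x
    proof -
      have "(1 + norm x) ^ N * norm (fourier \<psi> x) \<le> (2 * jap x) ^ N * (C * jap x powr (- real N))"
        using jap_ge_1[of x] norm_le_jap[of x] C(2)[of x] by (intro mult_mono power_mono) auto
      also have "\<dots> = 2 ^ N * C"
        using jap_pos[of x] by (simp add: powr_minus powr_realpow power_mult_distrib field_simps)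
      finally show ?thesis .
    qed
    then show ?thesis unfolding \<psi>(2) by (intro bdd_aboveI[of _ "2 ^ N * C"]) auto
  qed
  ultimately show ?thesis by (auto simp: schwartz_def smooth_def)
qed

section \<open>Gaussians and Fourier inversion\<close>

definition gauss :: "'a::euclidean_space \<Rightarrow> complex" where
  "gauss x = complex_of_real (exp (- (norm x)\<^sup>2 / 2))"

lemma gauss_borel [measurable]: "gauss \<in> borel_measurable borel"
  unfolding gauss_def by measurable

lemma norm_gauss_le: "norm (gauss x) \<le> 1"
  by (simp add: gauss_def)

lemma cis_sum: "finite I \<Longrightarrow> cis (\<Sum>i\<in>I. f i) = (\<Prod>i\<in>I. cis (f i))"
  by (induction I rule: finite_induct) (auto simp: cis_mult[symmetric])

text \<open>Up to normalisation this is the characteristic function of the standard normal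
  distribution.\<close>

lemma gauss_1d:
  fixes t :: real
  shows "integrable lborel (\<lambda>x. cis (- (t * x)) * complex_of_real (exp (- x\<^sup>2 / 2)))"
    and "(LINT x|lborel. cis (- (t * x)) * complex_of_real (exp (- x\<^sup>2 / 2)))
      = complex_of_real (sqrt (2 * pi) * exp (- t\<^sup>2 / 2))"
proof -
  have eq: "cis (- (t * x)) * complex_of_real (exp (- x\<^sup>2 / 2))
      = complex_of_real (sqrt (2 * pi)) * (cis (- (t * x)) * complex_of_real (std_normal_density x))" for x
    by (simp add: std_normal_density_def)
  have i: "integrable lborel (\<lambda>x. cis (- (t * x)) * complex_of_real (std_normal_density x))"
    by (rule integrable_cis_mult) auto
  then show "integrable lborel (\<lambda>x. cis (- (t * x)) * complex_of_real (exp (- x\<^sup>2 / 2)))"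
    unfolding eq by (rule integrable_mult_right)
  have "(LINT x|lborel. cis (- (t * x)) * complex_of_real (std_normal_density x)) = char std_normal_distribution (- t)"
    unfolding char_def
    by (subst integral_density) (auto simp: cis_conv_exp scaleR_conv_of_real mult.commute)
  also have "\<dots> = complex_of_real (exp (- t\<^sup>2 / 2))"
    by (simp add: char_std_normal_distribution)
  finally show "(LINT x|lborel. cis (- (t * x)) * complex_of_real (exp (- x\<^sup>2 / 2)))
      = complex_of_real (sqrt (2 * pi) * exp (- t\<^sup>2 / 2))"
    unfolding eq by simp
qed

text \<open>The integral of \<open>gauss\<close>. It depends on the space through its dimension
  alone, hence the type as argument.\<close>

definition gauss_const :: "'a::euclidean_space itself \<Rightarrow> real" where
  "gauss_const _ = sqrt (2 * pi) ^ DIM('a)"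

lemma gauss_const_pos: "0 < gauss_const TYPE('a::euclidean_space)"
  by (simp add: gauss_const_def)

lemma gauss_const_square: "(gauss_const TYPE('a::euclidean_space))\<^sup>2 = (2 * pi) ^ DIM('a)"
proof -
  have "(gauss_const TYPE('a))\<^sup>2 = ((sqrt (2 * pi))\<^sup>2) ^ DIM('a)"
    unfolding gauss_const_def by (simp only: power_mult[symmetric] mult.commute)
  then show ?thesis by simp
qed

text \<open>Both the exponential and the Gaussian factor over the coordinates, and Lebesgue measure
  is the image of the product of its one-dimensional versions.\<close>

lemma gauss_nd:
  fixes \<xi> :: "'a::euclidean_space"
  shows "integrable lborel (\<lambda>x. cis (- (\<xi> \<bullet> x)) * gauss x)"
    and "(LINT x|lborel. cis (- (\<xi> \<bullet> x)) * gauss x) = complex_of_real (gauss_const TYPE('a)) * gauss \<xi>"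
proof -
  interpret product_sigma_finite "\<lambda>_::'a. lborel::real measure" ..
  define k where "k b t = cis (- ((\<xi> \<bullet> b) * t)) * complex_of_real (exp (- t\<^sup>2 / 2))" for b t
  have [measurable]: "k b \<in> borel_measurable borel" for b unfolding k_def by measurable
  have k: "integrable lborel (k b)"
    "integral\<^sup>L lborel (k b) = complex_of_real (sqrt (2 * pi) * exp (- (\<xi> \<bullet> b)\<^sup>2 / 2))" for b
    using gauss_1d[of "\<xi> \<bullet> b"] by (auto simp: k_def[abs_def])
  have sq: "(norm x)\<^sup>2 = (\<Sum>b\<in>Basis. (x \<bullet> b)\<^sup>2)" for x :: 'a
    unfolding power2_norm_eq_inner by (subst euclidean_inner) (simp add: power2_eq_square)
  have g: "gauss x = (\<Prod>b\<in>Basis. complex_of_real (exp (- (x \<bullet> b)\<^sup>2 / 2)))" for x :: 'a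
    unfolding gauss_def sq by (simp add: exp_sum[symmetric] sum_negf[symmetric] sum_divide_distrib flip: of_real_prod)
  have eq: "cis (- (\<xi> \<bullet> x)) * gauss x = (\<Prod>b\<in>Basis. k b (x \<bullet> b))" for x
  proof -
    have "cis (- (\<xi> \<bullet> x)) = (\<Prod>b\<in>Basis. cis (- ((\<xi> \<bullet> b) * (x \<bullet> b))))"
      by (subst euclidean_inner) (simp add: cis_sum[symmetric] sum_negf[symmetric])
    then show ?thesis unfolding g k_def prod.distrib by simp
  qed
  have rep: "(\<Sum>b\<in>Basis. f b *\<^sub>R b) \<bullet> c = f c" if "c \<in> Basis" for f and c :: 'a
    using that by (simp add: inner_sum_left inner_Basis if_distrib[of "\<lambda>x. _ * x"] cong: if_cong)
  have [measurable]: "(\<lambda>x::'a. \<Prod>b\<in>Basis. k b (x \<bullet> b)) \<in> borel_measurable borel"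
    by measurable
  have [measurable]: "(\<lambda>f. \<Sum>b\<in>Basis. f b *\<^sub>R b) \<in> (\<Pi>\<^sub>M b\<in>(Basis::'a set). lborel) \<rightarrow>\<^sub>M borel"
    by measurable
  show "integrable lborel (\<lambda>x. cis (- (\<xi> \<bullet> x)) * gauss x)"
    unfolding eq
    by (subst lborel_eq, subst integrable_distr_eq)
      (auto simp: rep intro!: product_integrable_prod k cong: prod.cong)
  have "(LINT x|lborel. cis (- (\<xi> \<bullet> x)) * gauss x) = (\<Prod>b\<in>(Basis::'a set). integral\<^sup>L lborel (k b))"
    unfolding eq
    by (subst lborel_eq, subst integral_distr)
      (auto simp: rep intro!: product_integral_prod k cong: prod.cong)
  also have "\<dots> = complex_of_real (gauss_const TYPE('a)) * gauss \<xi>"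
    by (simp add: k(2) g prod.distrib gauss_const_def)
  finally show "(LINT x|lborel. cis (- (\<xi> \<bullet> x)) * gauss x) = complex_of_real (gauss_const TYPE('a)) * gauss \<xi>" .
qed

lemma integrable_gauss: "integrable lborel (gauss :: 'a::euclidean_space \<Rightarrow> complex)"
  using gauss_nd(1)[of 0] by simp

lemma integral_gauss:
  "(LINT x|(lborel::'a::euclidean_space measure). gauss x) = complex_of_real (gauss_const TYPE('a))"
  using gauss_nd(2)[of "0::'a"] by (simp add: gauss_def)

lemma fourier_gauss_scaled:
  fixes \<xi> :: "'a::euclidean_space"
  assumes s: "0 < s"
  shows "integrable lborel (\<lambda>x::'a. gauss (s *\<^sub>R x))"
    and "fourier (\<lambda>x. gauss (s *\<^sub>R x)) \<xi>
      = complex_of_real (gauss_const TYPE('a) / s ^ DIM('a)) * gauss (\<xi> /\<^sub>R s)"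
proof -
  have "integrable lborel (\<lambda>x::'a. gauss x :: complex)" by (rule integrable_gauss)
  then have "(\<integral>\<^sup>+x. ennreal (norm (gauss x)) \<partial>(lborel::'a measure)) < \<infinity>"
    by (rule nn_integral_norm_finite)
  then have "ennreal (\<bar>s\<bar> ^ DIM('a)) * (\<integral>\<^sup>+x. ennreal (norm (gauss (s *\<^sub>R x))) \<partial>(lborel::'a measure)) < \<infinity>"
    using s nn_integral_lborel_affine[of "\<lambda>x::'a. ennreal (norm (gauss x))" s 0] by simp
  then show "integrable lborel (\<lambda>x::'a. gauss (s *\<^sub>R x))"
    using s by (intro integrableI_bounded) (auto simp: ennreal_mult_less_top)
  have F: "fourier (\<lambda>x. gauss (s *\<^sub>R x)) \<xi>
      = complex_of_real (\<bar>inverse s\<bar> ^ DIM('a)) * (LINT x|lborel. cis (- ((\<xi> /\<^sub>R s) \<bullet> x)) * gauss x)"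
    using s integral_lborel_affine[of "\<lambda>x. cis (- (\<xi> \<bullet> x)) * gauss (s *\<^sub>R x)" "inverse s" 0]
    by (simp add: fourier_lborel)
  show "fourier (\<lambda>x. gauss (s *\<^sub>R x)) \<xi>
      = complex_of_real (gauss_const TYPE('a) / s ^ DIM('a)) * gauss (\<xi> /\<^sub>R s)"
    unfolding F gauss_nd(2) using s by (simp add: power_inverse divide_inverse mult_ac)
qed

text \<open>The multiplication formula for a modulated wide Gaussian, whose transform is a narrow
  Gaussian centred at \<open>y\<close>. As \<open>s\<close> tends to 0, the left side approaches an
  inverse transform at \<open>y\<close> and the right side a multiple of
  \<open>\<phi> y\<close>.\<close>

lemma gauss_fourier_identity:
  fixes \<phi> :: "'a::euclidean_space \<Rightarrow> complex"
  assumes \<phi>: "integrable lborel \<phi>" and s: "0 < s"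
  shows "(LINT \<xi>|lborel. fourier \<phi> \<xi> * (cis (\<xi> \<bullet> y) * gauss (s *\<^sub>R \<xi>)))
    = complex_of_real (gauss_const TYPE('a)) * (LINT z|lborel. \<phi> (y + s *\<^sub>R z) * gauss z)"
proof -
  have [measurable]: "\<phi> \<in> borel_measurable borel" using \<phi> by auto
  have "integrable lborel (\<lambda>\<xi>. cis (\<xi> \<bullet> y) * gauss (s *\<^sub>R \<xi>))"
    by (intro integrable_cis_mult fourier_gauss_scaled s) auto
  then have "(LINT \<xi>|lborel. fourier \<phi> \<xi> * (cis (\<xi> \<bullet> y) * gauss (s *\<^sub>R \<xi>)))
      = (LINT x|lborel. \<phi> x * fourier (\<lambda>\<xi>. cis (y \<bullet> \<xi>) * gauss (s *\<^sub>R \<xi>)) x)"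
    using fourier_multiplication[OF \<phi>] by (simp add: inner_commute)
  also have "\<dots> = (LINT x|lborel. \<phi> x * (complex_of_real (gauss_const TYPE('a) / s ^ DIM('a)) * gauss ((x - y) /\<^sub>R s)))"
    by (subst fourier_cis_mult) (auto simp: fourier_gauss_scaled(2)[OF s])
  also have "\<dots> = complex_of_real (s ^ DIM('a)) *
      (LINT z|lborel. \<phi> (y + s *\<^sub>R z) * (complex_of_real (gauss_const TYPE('a) / s ^ DIM('a)) * gauss z))"
    using s by (subst integral_lborel_affine[of _ s y]) auto
  also have "\<dots> = complex_of_real (s ^ DIM('a)) *
      (LINT z|lborel. complex_of_real (gauss_const TYPE('a) / s ^ DIM('a)) * (\<phi> (y + s *\<^sub>R z) * gauss z))"
    by (simp add: mult_ac)
  also have "\<dots> = complex_of_real (gauss_const TYPE('a)) * (LINT z|lborel. \<phi> (y + s *\<^sub>R z) * gauss z)"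
    using s by simp
  finally show ?thesis .
qed

text \<open>Both sides of the Gaussian identity converge by dominated convergence. The factor
  \<open>gauss_const\<close> occurs twice, once from the transform of the Gaussian and once from its
  integral, and the square is the constant in the definition of \<open>inv_fourier\<close>.\<close>

lemma fourier_inversion_continuous:
  fixes \<phi> :: "'a::euclidean_space \<Rightarrow> complex"
  assumes \<phi>: "integrable lborel \<phi>" and c: "continuous_on UNIV \<phi>" and b: "\<And>x. norm (\<phi> x) \<le> M"
    and f: "integrable lborel (fourier \<phi>)"
  shows "inv_fourier (fourier \<phi>) y = \<phi> y"
proof -
  have [measurable]: "\<phi> \<in> borel_measurable borel" using \<phi> by auto
  define s where "s n = inverse (real (Suc n))" for n
  have s: "0 < s n" "s \<longlonglongrightarrow> 0" for n
    using LIMSEQ_inverse_real_of_nat by (simp_all add: s_def[abs_def])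
  let ?g = "complex_of_real (gauss_const TYPE('a))"
  have 1: "(\<lambda>n. LINT \<xi>|lborel. fourier \<phi> \<xi> * (cis (\<xi> \<bullet> y) * gauss (s n *\<^sub>R \<xi>)))
      \<longlonglongrightarrow> (LINT \<xi>|lborel. fourier \<phi> \<xi> * (cis (\<xi> \<bullet> y) * 1))"
  proof (rule integral_dominated_convergence[where w="\<lambda>\<xi>. norm (fourier \<phi> \<xi>)"])
    show "AE \<xi> in lborel. (\<lambda>n. fourier \<phi> \<xi> * (cis (\<xi> \<bullet> y) * gauss (s n *\<^sub>R \<xi>)))
        \<longlonglongrightarrow> fourier \<phi> \<xi> * (cis (\<xi> \<bullet> y) * 1)"
    proof (intro AE_I2 tendsto_mult tendsto_const)
      fix \<xi> :: 'a
      have "(\<lambda>n. s n *\<^sub>R \<xi>) \<longlonglongrightarrow> 0 *\<^sub>R \<xi>" by (intro tendsto_intros s)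
      moreover have "continuous_on UNIV (gauss :: 'a \<Rightarrow> complex)"
        unfolding gauss_def by (intro continuous_intros) auto
      ultimately have "(\<lambda>n. gauss (s n *\<^sub>R \<xi>)) \<longlonglongrightarrow> gauss (0 *\<^sub>R \<xi>)"
        by (intro continuous_on_tendsto_compose[of UNIV gauss]) auto
      then show "(\<lambda>n. gauss (s n *\<^sub>R \<xi>)) \<longlonglongrightarrow> 1" by (simp add: gauss_def)
    qed
    show "AE \<xi> in lborel. norm (fourier \<phi> \<xi> * (cis (\<xi> \<bullet> y) * gauss (s n *\<^sub>R \<xi>))) \<le> norm (fourier \<phi> \<xi>)" for n
      by (intro AE_I2) (auto simp: norm_mult intro!: mult_left_le norm_gauss_le)
  qed (use f in auto)
  have 2: "(\<lambda>n. LINT z|lborel. \<phi> (y + s n *\<^sub>R z) * gauss z) \<longlonglongrightarrow> (LINT z|(lborel::'a measure). \<phi> y * gauss z)"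
  proof (rule integral_dominated_convergence[where w="\<lambda>z. M * norm (gauss z)"])
    show "AE z in lborel. (\<lambda>n. \<phi> (y + s n *\<^sub>R z) * gauss z) \<longlonglongrightarrow> \<phi> y * gauss z"
    proof (intro AE_I2 tendsto_mult_right)
      fix z
      have "(\<lambda>n. y + s n *\<^sub>R z) \<longlonglongrightarrow> y + 0 *\<^sub>R z" by (intro tendsto_intros s)
      then show "(\<lambda>n. \<phi> (y + s n *\<^sub>R z)) \<longlonglongrightarrow> \<phi> y"
        using c by (intro continuous_on_tendsto_compose[of UNIV \<phi>]) auto
    qed
    show "integrable lborel (\<lambda>z::'a. M * norm (gauss z))"
      by (intro integrable_mult_right integrable_norm integrable_gauss)
    show "AE z in lborel. norm (\<phi> (y + s n *\<^sub>R z) * gauss z) \<le> M * norm (gauss z)" for n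
      using b by (intro AE_I2) (auto simp: norm_mult intro: mult_right_mono)
  qed auto
  have "(\<lambda>n. ?g * (LINT z|lborel. \<phi> (y + s n *\<^sub>R z) * gauss z)) \<longlonglongrightarrow> (LINT \<xi>|lborel. fourier \<phi> \<xi> * (cis (\<xi> \<bullet> y) * 1))"
    using 1 by (simp add: gauss_fourier_identity[OF \<phi> s(1)])
  moreover have "(\<lambda>n. ?g * (LINT z|lborel. \<phi> (y + s n *\<^sub>R z) * gauss z)) \<longlonglongrightarrow> ?g * (\<phi> y * ?g)"
    using tendsto_mult_left[OF 2, of ?g] by (simp add: integral_gauss)
  ultimately have "(LINT \<xi>|lborel. fourier \<phi> \<xi> * (cis (\<xi> \<bullet> y) * 1)) = ?g * (\<phi> y * ?g)"
    by (rule LIMSEQ_unique)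
  then have "fourier (fourier \<phi>) (- y) = complex_of_real ((gauss_const TYPE('a))\<^sup>2) * \<phi> y"
    by (simp add: fourier_lborel inner_commute power2_eq_square mult_ac)
  then show ?thesis
    unfolding inv_fourier_eq_fourier gauss_const_square by simp
qed

lemma inv_fourier_fourier_test:
  fixes \<phi> :: "'a::euclidean_space \<Rightarrow> complex"
  assumes \<phi>: "\<phi> \<in> test_functions"
  shows "inv_fourier (fourier \<phi>) y = \<phi> y"
proof -
  obtain M where "\<And>x. norm (\<phi> x) \<le> M"
    using \<phi> by (rule test_function_bounded) blast
  then show ?thesis
    using \<phi> by (intro fourier_inversion_continuous test_function_integrable integrable_fourier_test
        smooth_continuous_on test_function_smooth)
qed

lemma fourier_inv_fourier_test:
  fixes \<phi> :: "'a::euclidean_space \<Rightarrow> complex"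
  assumes \<phi>: "\<phi> \<in> test_functions"
  shows "fourier (inv_fourier \<phi>) y = \<phi> y"
proof -
  let ?c = "complex_of_real ((2 * pi) ^ DIM('a))"
  have [measurable]: "\<phi> \<in> borel_measurable borel" by (rule test_function_borel[OF \<phi>])
  have "fourier (inv_fourier \<phi>) y = (LINT x|lborel. cis (- (y \<bullet> x)) * fourier \<phi> (- x)) / ?c"
    by (subst fourier_lborel) (auto simp: inv_fourier_eq_fourier)
  also have "(LINT x|lborel. cis (- (y \<bullet> x)) * fourier \<phi> (- x)) = (LINT x|lborel. cis (y \<bullet> x) * fourier \<phi> x)"
    using integral_lborel_reflect[of "\<lambda>x. cis (y \<bullet> x) * fourier \<phi> x" 0] by simp
  also have "\<dots> / ?c = inv_fourier (fourier \<phi>) y"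
    by (simp add: inv_fourier_eq_fourier fourier_lborel)
  finally show ?thesis using inv_fourier_fourier_test[OF \<phi>] by simp
qed

text \<open>Moves a pairing to the Fourier side for every integrable \<open>v\<close>; the inverse
  transform of the test function provides the integrability.\<close>

lemma integral_mult_test:
  fixes v \<phi> :: "'a::euclidean_space \<Rightarrow> complex"
  assumes v: "integrable lborel v" and \<phi>: "\<phi> \<in> test_functions"
  shows "(LINT x|lborel. v x * \<phi> x) = (LINT x|lborel. fourier v x * inv_fourier \<phi> x)"
  using fourier_multiplication[OF v integrable_inv_fourier_test[OF \<phi>]]
  by (simp add: fourier_inv_fourier_test[OF \<phi>])

lemma integrable_mult_test:
  fixes v \<phi> :: "'a::euclidean_space \<Rightarrow> complex"
  assumes v: "integrable lborel v" and \<phi>: "\<phi> \<in> test_functions"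
  shows "integrable lborel (\<lambda>x. v x * \<phi> x)"
proof -
  obtain M where M: "\<And>x. norm (\<phi> x) \<le> M"
    using \<phi> by (rule test_function_bounded) blast
  have [measurable]: "\<phi> \<in> borel_measurable borel" "v \<in> borel_measurable borel"
    using v test_function_borel[OF \<phi>] by auto
  show ?thesis
    by (rule Bochner_Integration.integrable_bound[OF integrable_mult_right[OF integrable_norm[OF v], of M]])
      (auto simp: norm_mult abs_mult mult.commute[of "cmod (v _)"]
        intro!: AE_I2 mult_right_mono order_trans[OF M abs_ge_self])
qed

lemma integrable_indicator_bounded:
  fixes w :: "'a::euclidean_space \<Rightarrow> complex"
  assumes [measurable]: "w \<in> borel_measurable borel" and b: "\<And>x. norm (w x) \<le> M"
  shows "integrable lborel (\<lambda>x. indicator (box a b) x *\<^sub>R w x)"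
proof -
  have "integrable lborel (\<lambda>x. indicator (box a b) x *\<^sub>R M)"
    using emeasure_lborel_box_finite[of a b] by (intro integrable_scaleR_left integrable_real_indicator) auto
  then show ?thesis
    by (rule Bochner_Integration.integrable_bound)
      (auto simp: indicator_def intro!: order_trans[OF b abs_ge_self])
qed

text \<open>Both sides have the same pairings with test functions: \<open>v\<close> is moved to the
  Fourier side, and the inverse transform is moved back onto \<open>fourier v\<close>. This version
  serves kernels and potentials that are not known to be continuous.\<close>

lemma (in smooth_cutoff) fourier_inversion_AE:
  fixes v :: "'a::euclidean_space \<Rightarrow> complex"
  assumes v: "integrable lborel v" and f: "integrable lborel (fourier v)"
  shows "AE x in lborel. v x = inv_fourier (fourier v) x"
proof -
  let ?w = "inv_fourier (fourier v)"
  have [measurable]: "v \<in> borel_measurable borel" using v by auto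
  have w: "norm (?w x) \<le> (LINT x|lborel. norm (fourier v x))" for x
    by (rule norm_inv_fourier_le[OF f])
  have "AE x in lborel. v x - ?w x = 0"
  proof (rule fundamental_lemma)
    show "integrable lborel (\<lambda>x. indicator (box a b) x *\<^sub>R (v x - ?w x))" for a b
      unfolding scaleR_right_diff_distrib
      by (intro Bochner_Integration.integrable_diff integrable_mult_indicator v integrable_indicator_bounded[OF _ w]) auto
    fix \<phi> :: "'a \<Rightarrow> complex" assume \<phi>: "\<phi> \<in> test_functions"
    have [measurable]: "\<phi> \<in> borel_measurable borel" by (rule test_function_borel[OF \<phi>])
    have i: "integrable lborel (\<lambda>x. ?w x * \<phi> x)"
      by (rule Bochner_Integration.integrable_bound[OF integrable_mult_right[OF integrable_norm[OF test_function_integrable[OF \<phi>]]]])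
        (auto simp: norm_mult abs_mult intro!: AE_I2 mult_right_mono order_trans[OF w abs_ge_self])
    have "(LINT x|lborel. v x * \<phi> x) = (LINT x|lborel. ?w x * \<phi> x)"
      using integral_mult_test[OF v \<phi>] inv_fourier_multiplication[OF f test_function_integrable[OF \<phi>]] by simp
    then show "(LINT x|lborel. (v x - ?w x) * \<phi> x) = 0"
      using integrable_mult_test[OF v \<phi>] i by (simp add: ring_distribs)
  qed measurable
  then show ?thesis by eventually_elim simp
qed

section \<open>Square integrability from the Fourier transform\<close>

lemma norm_integral_le_nn_integral:
  fixes f :: "_ \<Rightarrow> 'b::{banach, second_countable_topology}"
  shows "ennreal (norm (integral\<^sup>L M f)) \<le> (\<integral>\<^sup>+x. ennreal (norm (f x)) \<partial>M)"
  by (cases "integrable M f") (auto simp: integral_norm_bound_ennreal not_integrable_integral_eq)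

lemma ennreal_tendsto_0_le:
  fixes f g :: "nat \<Rightarrow> ennreal"
  assumes "g \<longlonglongrightarrow> 0" "\<And>n. f n \<le> g n"
  shows "f \<longlonglongrightarrow> 0"
  by (rule tendsto_sandwich[OF _ _ tendsto_const assms(1)]) (auto simp: assms(2))

text \<open>Outer regularity: for each \<open>x\<close> in \<open>A\<close> the point
  \<open>x + h n\<close> eventually lies in an open \<open>U\<close> that is only slightly larger
  than \<open>A\<close>. Shifted points in \<open>U\<close> but outside \<open>A\<close> are
  controlled by the measure of \<open>U - A\<close>, whatever the shift.\<close>

lemma indicator_translation_tendsto:
  fixes A :: "'a::euclidean_space set" and h :: "nat \<Rightarrow> 'a"
  assumes A: "A \<in> sets borel" "emeasure lborel A < \<infinity>" and h: "h \<longlonglongrightarrow> 0"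
  shows "(\<lambda>n. \<integral>\<^sup>+x. indicator A x * indicator (- A) (x + h n) \<partial>lborel) \<longlonglongrightarrow> 0"
proof (rule order_tendstoI)
  fix e :: ennreal assume "0 < e"
  then obtain d where d: "0 < d" "ennreal d + ennreal d \<le> e"
  proof -
    obtain r where r: "0 < r" "ennreal r \<le> e"
      using \<open>0 < e\<close> by (cases e) (auto intro: that[of 1])
    have "ennreal (r / 2) + ennreal (r / 2) \<le> e" using r by (simp flip: ennreal_plus)
    with r show ?thesis by (intro that[of "r / 2"]) auto
  qed
  obtain U where U: "open U" "A \<subseteq> U" "emeasure lborel (U - A) < ennreal d"
    using outer_regular_lborel[OF A(1) d(1)] by blast
  have [measurable]: "A \<in> sets borel" "U \<in> sets borel" using A U by auto
  have "(\<lambda>n. \<integral>\<^sup>+x. indicator A x * indicator (- U) (x + h n) \<partial>lborel) \<longlonglongrightarrow> (\<integral>\<^sup>+x. 0 \<partial>(lborel :: 'a measure))"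
  proof (rule nn_integral_dominated_convergence[where w="indicator A"])
    show "AE x in lborel. (\<lambda>n. indicator A x * indicator (- U) (x + h n) :: ennreal) \<longlonglongrightarrow> 0"
    proof (intro AE_I2)
      fix x
      show "(\<lambda>n. indicator A x * indicator (- U) (x + h n) :: ennreal) \<longlonglongrightarrow> 0"
      proof (cases "x \<in> A")
        case True
        have "(\<lambda>n. x + h n) \<longlonglongrightarrow> x + 0" by (intro tendsto_intros h)
        then have "\<forall>\<^sub>F n in sequentially. x + h n \<in> U"
          using True U by (intro topological_tendstoD) auto
        then have "\<forall>\<^sub>F n in sequentially. indicator A x * indicator (- U) (x + h n) = (0 :: ennreal)"
          by eventually_elim simp
        then show ?thesis by (rule tendsto_eventually)
      qed simp
    qed
  qed (use A in \<open>auto split: split_indicator\<close>)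
  then have "(\<lambda>n. \<integral>\<^sup>+x. indicator A x * indicator (- U) (x + h n) \<partial>lborel) \<longlonglongrightarrow> 0" by simp
  moreover have "0 < ennreal d" using d by simp
  ultimately have "\<forall>\<^sub>F n in sequentially. (\<integral>\<^sup>+x. indicator A x * indicator (- U) (x + h n) \<partial>lborel) < ennreal d"
    by (rule order_tendstoD)
  then show "\<forall>\<^sub>F n in sequentially. (\<integral>\<^sup>+x. indicator A x * indicator (- A) (x + h n) \<partial>lborel) < e"
  proof eventually_elim
    case (elim n)
    have "(\<integral>\<^sup>+x. indicator A x * indicator (- A) (x + h n) \<partial>lborel)
        \<le> (\<integral>\<^sup>+x. indicator A x * indicator (- U) (x + h n) + indicator (U - A) (x + h n) \<partial>lborel)"
      by (intro nn_integral_mono) (auto simp: indicator_def)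
    also have "\<dots> = (\<integral>\<^sup>+x. indicator A x * indicator (- U) (x + h n) \<partial>lborel)
        + (\<integral>\<^sup>+x. indicator (U - A) (x + h n) \<partial>lborel)"
      by (intro nn_integral_add) auto
    also have "(\<integral>\<^sup>+x. indicator (U - A) (x + h n) \<partial>lborel) = emeasure lborel (U - A)"
      by (subst nn_integral_lborel_translate) auto
    also have "(\<integral>\<^sup>+x. indicator A x * indicator (- U) (x + h n) \<partial>lborel) + emeasure lborel (U - A)
        < ennreal d + ennreal d"
      using elim U(3) by (rule add_strict_mono)
    finally show ?case using d(2) by order
  qed
qed simp

text \<open>The modulus of continuity of \<open>f\<close> in L1.\<close>

definition L1_shift :: "('a::euclidean_space \<Rightarrow> complex) \<Rightarrow> 'a \<Rightarrow> ennreal" where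
  "L1_shift f h = (\<integral>\<^sup>+x. ennreal (norm (f (x + h) - f x)) \<partial>lborel)"

lemma L1_shift_borel [measurable]:
  assumes [measurable]: "f \<in> borel_measurable borel"
  shows "L1_shift f \<in> borel_measurable borel"
  unfolding L1_shift_def[abs_def] by measurable

lemma L1_shift_le:
  assumes [measurable]: "f \<in> borel_measurable borel"
  shows "L1_shift f h \<le> 2 * (\<integral>\<^sup>+x. ennreal (norm (f x)) \<partial>lborel)"
proof -
  have "L1_shift f h \<le> (\<integral>\<^sup>+x. ennreal (norm (f (x + h))) + ennreal (norm (f x)) \<partial>lborel)"
    unfolding L1_shift_def
    by (intro nn_integral_mono) (auto simp: norm_triangle_ineq4 simp flip: ennreal_plus intro!: ennreal_leI)
  also have "\<dots> = (\<integral>\<^sup>+x. ennreal (norm (f (x + h))) \<partial>lborel) + (\<integral>\<^sup>+x. ennreal (norm (f x)) \<partial>lborel)"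
    by (intro nn_integral_add) auto
  also have "(\<integral>\<^sup>+x. ennreal (norm (f (x + h))) \<partial>lborel) = (\<integral>\<^sup>+x. ennreal (norm (f x)) \<partial>lborel)"
    by (intro nn_integral_lborel_translate) auto
  finally show ?thesis by (simp add: mult_2)
qed

lemma L1_shift_triangle:
  assumes [measurable]: "f \<in> borel_measurable borel" "g \<in> borel_measurable borel"
  shows "L1_shift (\<lambda>x. f x + g x) h \<le> L1_shift f h + L1_shift g h"
proof -
  have le: "norm (f (x + h) + g (x + h) - (f x + g x)) \<le> norm (f (x + h) - f x) + norm (g (x + h) - g x)" for x
    by (rule norm_diff_triangle_ineq)
  have "L1_shift (\<lambda>x. f x + g x) h
      \<le> (\<integral>\<^sup>+x. ennreal (norm (f (x + h) - f x)) + ennreal (norm (g (x + h) - g x)) \<partial>lborel)"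
    unfolding L1_shift_def
    by (intro nn_integral_mono) (auto simp: le simp flip: ennreal_plus intro!: ennreal_leI)
  also have "\<dots> = L1_shift f h + L1_shift g h"
    unfolding L1_shift_def by (intro nn_integral_add) auto
  finally show ?thesis .
qed

text \<open>Continuity of translation in L1, first for indicators, then for sums and limits. In the
  limit case \<open>L1_shift_le\<close> bounds the shift of the error by twice its L1 norm,
  uniformly in the shift.\<close>

lemma L1_shift_tendsto:
  fixes f :: "'a::euclidean_space \<Rightarrow> complex"
  assumes f: "integrable lborel f" and h: "h \<longlonglongrightarrow> 0"
  shows "(\<lambda>n. L1_shift f (h n)) \<longlonglongrightarrow> 0"
  using f
proof (induction f rule: integrable_induct)
  case (base A c)
  then have A: "A \<in> sets borel" "emeasure lborel A < \<infinity>" by auto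
  have [measurable]: "A \<in> sets borel" by fact
  let ?E = "\<lambda>h. \<integral>\<^sup>+x. indicator A x * indicator (- A) (x + h) \<partial>lborel"
  have le: "L1_shift (\<lambda>x. indicator A x *\<^sub>R c) h \<le> ennreal (norm c) * (?E h + ?E (- h))" for h :: 'a
  proof -
    have "L1_shift (\<lambda>x. indicator A x *\<^sub>R c) h
        \<le> (\<integral>\<^sup>+x. ennreal (norm c) * (indicator A x * indicator (- A) (x + h) + indicator (- A) x * indicator A (x + h)) \<partial>lborel)"
      unfolding L1_shift_def by (intro nn_integral_mono) (auto simp: indicator_def)
    also have "\<dots> = ennreal (norm c) * (?E h + (\<integral>\<^sup>+x. indicator (- A) x * indicator A (x + h) \<partial>lborel))"
      by (simp add: nn_integral_cmult nn_integral_add)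
    \<comment> \<open>Points that enter \<open>A\<close> under the shift by \<open>h\<close> become,
      after translation, points that leave \<open>A\<close> under the shift by
      \<open>- h\<close>.\<close>
    also have "(\<integral>\<^sup>+x. indicator (- A) x * indicator A (x + h) \<partial>lborel) = ?E (- h)"
      using nn_integral_lborel_translate[of "\<lambda>x. indicator (- A) x * indicator A (x + h)" "- h"]
      by (simp add: mult.commute)
    finally show ?thesis .
  qed
  have "(\<lambda>n. ennreal (norm c) * (?E (h n) + ?E (- h n))) \<longlonglongrightarrow> ennreal (norm c) * (0 + 0)"
    using tendsto_minus[OF h] by (intro ennreal_tendsto_cmult tendsto_add indicator_translation_tendsto A h) auto
  then have "(\<lambda>n. ennreal (norm c) * (?E (h n) + ?E (- h n))) \<longlonglongrightarrow> 0" by simp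
  then show ?case by (rule ennreal_tendsto_0_le) (rule le)
next
  case (add f g)
  then have "(\<lambda>n. L1_shift f (h n) + L1_shift g (h n)) \<longlonglongrightarrow> 0 + 0" by (intro tendsto_add)
  then have "(\<lambda>n. L1_shift f (h n) + L1_shift g (h n)) \<longlonglongrightarrow> 0" by simp
  then show ?case
    using add by (rule_tac ennreal_tendsto_0_le) (auto intro: L1_shift_triangle)
next
  case (lim f s)
  have [measurable]: "f \<in> borel_measurable borel" "s i \<in> borel_measurable borel" for i
    using lim by auto
  have s_le: "norm (s i x) \<le> 2 * norm (f x)" and s_lim: "(\<lambda>i. s i x) \<longlonglongrightarrow> f x"
    and s_shift: "(\<lambda>n. L1_shift (s i) (h n)) \<longlonglongrightarrow> 0" for i x
    using lim by auto
  have "(\<lambda>i. \<integral>\<^sup>+x. ennreal (norm (f x - s i x)) \<partial>lborel) \<longlonglongrightarrow> (\<integral>\<^sup>+x. 0 \<partial>(lborel::'a measure))"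
  proof (rule nn_integral_dominated_convergence[where w="\<lambda>x. ennreal (3 * norm (f x))"])
    show "AE x in lborel. ennreal (norm (f x - s i x)) \<le> ennreal (3 * norm (f x))" for i
      using s_le[of i] by (intro AE_I2 ennreal_leI) (smt (verit) norm_triangle_ineq4)
    show "(\<integral>\<^sup>+x. ennreal (3 * norm (f x)) \<partial>lborel) < \<infinity>"
      using nn_integral_norm_finite[of lborel "\<lambda>x. 3 * f x"] lim by (simp add: norm_mult)
    show "AE x in lborel. (\<lambda>i. ennreal (norm (f x - s i x))) \<longlonglongrightarrow> 0"
    proof (intro AE_I2)
      fix x
      have "(\<lambda>i. ennreal (norm (f x - s i x))) \<longlonglongrightarrow> ennreal (norm (f x - f x))"
        by (intro tendsto_intros s_lim)
      then show "(\<lambda>i. ennreal (norm (f x - s i x))) \<longlonglongrightarrow> 0" by simp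
    qed
  qed auto
  then have lim0: "(\<lambda>i. \<integral>\<^sup>+x. ennreal (norm (f x - s i x)) \<partial>lborel) \<longlonglongrightarrow> 0" by simp
  show ?case
  proof (rule order_tendstoI)
    fix e :: ennreal assume "0 < e"
    then obtain d where d: "0 < d" "2 * ennreal d + ennreal d \<le> e"
    proof -
      obtain r where r: "0 < r" "ennreal r \<le> e"
        using \<open>0 < e\<close> by (cases e) (auto intro: that[of 1])
      have "2 * ennreal (r / 3) + ennreal (r / 3) = ennreal (r / 3 + r / 3 + r / 3)"
        unfolding mult_2 using r by (simp flip: ennreal_plus)
      with r show ?thesis by (intro that[of "r / 3"]) auto
    qed
    obtain i where i: "(\<integral>\<^sup>+x. ennreal (norm (f x - s i x)) \<partial>lborel) < ennreal d"
      using order_tendstoD(2)[OF lim0, of "ennreal d"] d by (auto simp: eventually_sequentially)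
    have "\<forall>\<^sub>F n in sequentially. L1_shift (s i) (h n) < ennreal d"
      using order_tendstoD(2)[OF s_shift[of i], of "ennreal d"] d by auto
    then show "\<forall>\<^sub>F n in sequentially. L1_shift f (h n) < e"
    proof eventually_elim
      case (elim n)
      have "L1_shift f (h n) = L1_shift (\<lambda>x. (f x - s i x) + s i x) (h n)" by simp
      also have "\<dots> \<le> L1_shift (\<lambda>x. f x - s i x) (h n) + L1_shift (s i) (h n)"
        by (rule L1_shift_triangle) auto
      also have "L1_shift (\<lambda>x. f x - s i x) (h n) \<le> 2 * (\<integral>\<^sup>+x. ennreal (norm (f x - s i x)) \<partial>lborel)"
        by (rule L1_shift_le) auto
      also have "2 * (\<integral>\<^sup>+x. ennreal (norm (f x - s i x)) \<partial>lborel) + L1_shift (s i) (h n) < 2 * ennreal d + ennreal d"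
        using i elim by (intro add_strict_mono) (auto simp: mult_2 intro: add_strict_mono)
      finally show ?case using d(2) by (simp add: add_right_mono)
    qed
  qed simp
qed

text \<open>By inversion the conjugate of \<open>f\<close> is itself a transform, namely that of the
  conjugate of \<open>fourier f\<close> divided by the constant, and the multiplication formula
  yields Plancherel's identity. Dropping the constant, which is at least 1, leaves the
  inequality.\<close>

lemma (in smooth_cutoff) Plancherel_le:
  fixes f :: "'a::euclidean_space \<Rightarrow> complex"
  assumes f: "integrable lborel f" and ff: "integrable lborel (fourier f)"
  shows "(\<integral>\<^sup>+x. ennreal ((norm (f x))\<^sup>2) \<partial>lborel) \<le> (\<integral>\<^sup>+\<xi>. ennreal ((norm (fourier f \<xi>))\<^sup>2) \<partial>lborel)"
proof -
  let ?c = "(2 * pi) ^ DIM('a)"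
  let ?g = "fourier f"
  have [measurable]: "f \<in> borel_measurable borel" using f by auto
  have [measurable]: "(\<lambda>x. cnj (h x)) \<in> borel_measurable borel"
    if [measurable]: "h \<in> borel_measurable borel" for h :: "'a \<Rightarrow> complex"
    by (rule measurable_compose[OF that]) (intro borel_measurable_continuous_onI continuous_intros)
  have 1: "1 \<le> ?c" using pi_gt3 by (intro one_le_power) auto
  obtain M where M: "\<And>\<xi>. norm (?g \<xi>) \<le> M" using norm_fourier_le[OF f] by blast
  have ae: "AE x in lborel. f x = inv_fourier ?g x" by (rule fourier_inversion_AE[OF f ff])
  have icg: "integrable lborel (\<lambda>\<xi>. cnj (?g \<xi>))" using ff by simp
  have cnj_inv: "cnj (inv_fourier ?g x) = fourier (\<lambda>\<xi>. cnj (?g \<xi>)) x / complex_of_real ?c" for x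
  proof -
    have "cnj (fourier ?g (- x)) = fourier (\<lambda>\<xi>. cnj (?g \<xi>)) x"
      by (simp add: fourier_lborel Bochner_Integration.integral_cnj[symmetric] cis_cnj)
    then show ?thesis by (simp add: inv_fourier_eq_fourier)
  qed
  have ig2: "integrable lborel (\<lambda>\<xi>. ?g \<xi> * cnj (?g \<xi>))"
    by (rule Bochner_Integration.integrable_bound[OF integrable_mult_right[OF integrable_norm[OF ff], of M]])
      (auto simp: norm_mult abs_mult intro!: AE_I2 mult_right_mono order_trans[OF M abs_ge_self])
  have "(LINT x|lborel. f x * cnj (f x)) = (LINT x|lborel. f x * (fourier (\<lambda>\<xi>. cnj (?g \<xi>)) x / complex_of_real ?c))"
    using ae by (intro integral_cong_AE) (auto elim!: eventually_mono simp: cnj_inv)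
  also have "\<dots> = (LINT x|lborel. ?g x * cnj (?g x)) / complex_of_real ?c"
    using fourier_multiplication[OF f icg] by simp
  finally have eq: "(LINT x|lborel. f x * cnj (f x)) = (LINT x|lborel. ?g x * cnj (?g x)) / complex_of_real ?c" .
  have nf: "norm (inv_fourier ?g x) \<le> (LINT \<xi>|lborel. norm (?g \<xi>))" for x by (rule norm_inv_fourier_le[OF ff])
  have if2: "integrable lborel (\<lambda>x. (norm (f x))\<^sup>2)"
  proof (rule Bochner_Integration.integrable_bound[OF integrable_mult_right[OF integrable_norm[OF f], of "LINT \<xi>|lborel. norm (?g \<xi>)"]])
    show "AE x in lborel. norm ((norm (f x))\<^sup>2) \<le> norm ((LINT \<xi>|lborel. norm (?g \<xi>)) * norm (f x))"
      using ae
    proof eventually_elim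
      case (elim x)
      then show ?case using nf[of x] by (auto simp: power2_eq_square abs_mult intro!: mult_right_mono)
    qed
  qed auto
  have eqR: "(LINT x|lborel. (norm (f x))\<^sup>2) = (LINT x|lborel. (norm (?g x))\<^sup>2) / ?c"
  proof -
    have "complex_of_real (LINT x|lborel. (norm (f x))\<^sup>2) = complex_of_real ((LINT x|lborel. (norm (?g x))\<^sup>2) / ?c)"
      using eq by (simp add: complex_norm_square[symmetric] flip: integral_complex_of_real of_real_power)
    then show ?thesis by (simp only: of_real_eq_iff)
  qed
  have ig2': "integrable lborel (\<lambda>x. (norm (?g x))\<^sup>2)"
    using integrable_norm[OF ig2] by (simp add: norm_mult power2_eq_square)
  have "(\<integral>\<^sup>+x. ennreal ((norm (f x))\<^sup>2) \<partial>lborel) = ennreal ((LINT x|lborel. (norm (?g x))\<^sup>2) / ?c)"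
    using if2 by (simp add: nn_integral_eq_integral eqR)
  also have "\<dots> \<le> ennreal (LINT x|lborel. (norm (?g x))\<^sup>2)"
    using 1 mult_left_mono[OF 1, of "LINT x|lborel. (norm (?g x))\<^sup>2"]
    by (intro ennreal_leI) (simp add: divide_le_eq)
  also have "\<dots> = (\<integral>\<^sup>+\<xi>. ennreal ((norm (?g \<xi>))\<^sup>2) \<partial>lborel)"
    using ig2' by (simp add: nn_integral_eq_integral)
  finally show ?thesis .
qed

text \<open>Smoothing by Gaussians multiplies the transform by a function of modulus at most 1, so
  the smoothed functions satisfy the Plancherel bound uniformly. They converge to \<open>f\<close>
  in L1, hence almost everywhere along a subsequence, and Fatou's lemma carries the bound over to
  \<open>f\<close>.\<close>

lemma (in smooth_cutoff) square_integrable_of_fourier: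
  fixes f :: "'a::euclidean_space \<Rightarrow> complex"
  assumes f: "integrable lborel f" and F: "(\<integral>\<^sup>+\<xi>. ennreal ((norm (fourier f \<xi>))\<^sup>2) \<partial>lborel) < \<infinity>"
  shows "(\<integral>\<^sup>+x. ennreal ((norm (f x))\<^sup>2) \<partial>lborel) < \<infinity>"
proof -
  have [measurable]: "f \<in> borel_measurable borel" using f by auto
  define s where "s n = inverse (real (Suc n))" for n
  have s: "0 < s n" "s \<longlonglongrightarrow> 0" for n
    using LIMSEQ_inverse_real_of_nat by (simp_all add: s_def[abs_def])
  define c where "c = gauss_const TYPE('a)"
  have c: "0 < c" unfolding c_def by (rule gauss_const_pos)
  \<comment> \<open>Normalised to integral 1; its transform is a wide Gaussian, which makes the
    smoothed transform integrable.\<close>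
  define k where "k n x = complex_of_real (1 / (c * s n ^ DIM('a))) * gauss ((1 / s n) *\<^sub>R x)" for n and x :: 'a
  have [measurable]: "k n \<in> borel_measurable borel" for n unfolding k_def by measurable
  have k: "integrable lborel (k n)" for n
    unfolding k_def using s(1) by (intro integrable_mult_right fourier_gauss_scaled) auto
  have fk: "fourier (k n) \<xi> = gauss (s n *\<^sub>R \<xi>)" for n \<xi>
  proof -
    have "fourier (k n) \<xi> = complex_of_real (1 / (c * s n ^ DIM('a))) * fourier (\<lambda>x. gauss ((1 / s n) *\<^sub>R x)) \<xi>"
      unfolding k_def by (simp add: fourier_lborel mult.left_commute)
    then show ?thesis
      using s(1)[of n] c by (simp add: fourier_gauss_scaled(2) c_def power_divide)
  qed
  define q where "q n = conv f (k n)" for n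
  have q: "integrable lborel (q n)" for n unfolding q_def by (rule integrable_conv[OF f k])
  have [measurable]: "q n \<in> borel_measurable borel" for n using q by auto
  have fq: "fourier (q n) \<xi> = fourier f \<xi> * gauss (s n *\<^sub>R \<xi>)" for n \<xi>
    unfolding q_def by (simp add: fourier_conv[OF f k] fk)
  have ifq: "integrable lborel (fourier (q n))" for n
  proof -
    obtain M where M: "\<And>\<xi>. norm (fourier f \<xi>) \<le> M" using norm_fourier_le[OF f] by blast
    show ?thesis unfolding fq[abs_def]
      by (rule Bochner_Integration.integrable_bound[OF integrable_mult_right[OF integrable_norm[OF fourier_gauss_scaled(1)[OF s(1)[of n]]], of M]])
        (auto simp: norm_mult abs_mult intro!: AE_I2 mult_right_mono order_trans[OF M abs_ge_self])
  qed
  have bound: "(\<integral>\<^sup>+x. ennreal ((norm (q n x))\<^sup>2) \<partial>lborel) \<le> (\<integral>\<^sup>+\<xi>. ennreal ((norm (fourier f \<xi>))\<^sup>2) \<partial>lborel)" for n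
    by (rule order_trans[OF Plancherel_le[OF q ifq]])
      (auto intro!: nn_integral_mono ennreal_leI power_mono mult_left_le norm_gauss_le simp: fq norm_mult)
  \<comment> \<open>As \<open>k n\<close> has integral 1, the error at a point is a Gaussian average
    of differences of translates of \<open>f\<close>. Exchanging the integrals turns its L1 norm
    into an average of L1 shifts, which tends to 0.\<close>
  have diff: "(\<integral>\<^sup>+x. ennreal (norm (q n x - f x)) \<partial>lborel)
      \<le> (\<integral>\<^sup>+z. ennreal (norm (gauss z) / c) * L1_shift f (- (s n *\<^sub>R z)) \<partial>lborel)" for n
  proof -
    have qn: "q n x - f x = (LINT z|lborel. (f (x - s n *\<^sub>R z) - f x) * (gauss z / complex_of_real c))"
      if i: "integrable lborel (\<lambda>y. f (x - y) * k n y)" for x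
    proof -
      have eq: "(LINT y|lborel. g y * k n y) = (LINT z|lborel. g (s n *\<^sub>R z) * (gauss z / complex_of_real c))"
        if [measurable]: "g \<in> borel_measurable borel" for g
      proof -
        have "(LINT y|lborel. g y * k n y) = complex_of_real (s n ^ DIM('a)) * (LINT z|lborel. g (s n *\<^sub>R z) * k n (s n *\<^sub>R z))"
          using s(1)[of n] integral_lborel_affine[of "\<lambda>y. g y * k n y" "s n" 0] by simp
        also have "\<dots> = (LINT z|lborel. complex_of_real (s n ^ DIM('a)) * (g (s n *\<^sub>R z) * k n (s n *\<^sub>R z)))"
          by simp
        also have "\<dots> = (LINT z|lborel. g (s n *\<^sub>R z) * (gauss z / complex_of_real c))"
          using s(1)[of n] c by (simp add: k_def field_simps)
        finally show ?thesis .
      qed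
      have ik: "integrable lborel (\<lambda>y. f x * k n y)" using k by simp
      have "(LINT y|lborel. k n y) = 1"
        using eq[of "\<lambda>_. 1"] c by (simp add: integral_gauss c_def)
      then have "q n x - f x = (LINT y|lborel. f (x - y) * k n y) - (LINT y|lborel. f x * k n y)"
        by (simp add: q_def conv_def)
      then have "q n x - f x = (LINT y|lborel. f (x - y) * k n y - f x * k n y)"
        using i ik by simp
      also have "\<dots> = (LINT y|lborel. (f (x - y) - f x) * k n y)" by (simp add: ring_distribs)
      also have "\<dots> = (LINT z|lborel. (f (x - s n *\<^sub>R z) - f x) * (gauss z / complex_of_real c))"
        by (rule eq) measurable
      finally show ?thesis .
    qed
    have "(\<lambda>(y, x). f (x - y) * k n y) \<in> borel_measurable (borel \<Otimes>\<^sub>M borel)" by measurable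
    then have "integrable (lborel \<Otimes>\<^sub>M lborel) (\<lambda>(y, x). f (x - y) * k n y)"
      using conv_nn_integral_finite[OF f k] by (intro lborel_Fubini_integrable) auto
    then have ae: "AE x in lborel. integrable lborel (\<lambda>y. f (x - y) * k n y)"
      using lborel_pair.AE_integrable_snd by fastforce
    have "(\<integral>\<^sup>+x. ennreal (norm (q n x - f x)) \<partial>lborel)
        \<le> (\<integral>\<^sup>+x. \<integral>\<^sup>+z. ennreal (norm (f (x - s n *\<^sub>R z) - f x)) * ennreal (norm (gauss z) / c) \<partial>lborel \<partial>lborel)"
    proof (rule nn_integral_mono_AE, use ae in eventually_elim)
      case (elim x)
      have "ennreal (norm (q n x - f x))
          \<le> (\<integral>\<^sup>+z. ennreal (norm ((f (x - s n *\<^sub>R z) - f x) * (gauss z / complex_of_real c))) \<partial>lborel)"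
        unfolding qn[OF elim] by (rule norm_integral_le_nn_integral)
      then show ?case using c by (simp add: norm_mult norm_divide ennreal_mult'[symmetric])
    qed
    also have "\<dots> = (\<integral>\<^sup>+z. \<integral>\<^sup>+x. ennreal (norm (f (x - s n *\<^sub>R z) - f x)) * ennreal (norm (gauss z) / c) \<partial>lborel \<partial>lborel)"
      by (rule lborel_pair.Fubini') measurable
    also have "\<dots> = (\<integral>\<^sup>+z. ennreal (norm (gauss z) / c) * L1_shift f (- (s n *\<^sub>R z)) \<partial>lborel)"
      by (simp add: L1_shift_def nn_integral_cmult mult.commute)
    finally show ?thesis .
  qed
  have "(\<lambda>n. \<integral>\<^sup>+z. ennreal (norm (gauss z) / c) * L1_shift f (- (s n *\<^sub>R z)) \<partial>lborel) \<longlonglongrightarrow> (\<integral>\<^sup>+z. 0 \<partial>(lborel :: 'a measure))"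
  proof (rule nn_integral_dominated_convergence[where
        w="\<lambda>z. ennreal (norm (gauss z) / c) * (2 * (\<integral>\<^sup>+x. ennreal (norm (f x)) \<partial>lborel))"])
    show "(\<integral>\<^sup>+z. ennreal (norm (gauss z) / c) * (2 * (\<integral>\<^sup>+x. ennreal (norm (f x)) \<partial>lborel)) \<partial>(lborel :: 'a measure)) < \<infinity>"
      using nn_integral_norm_finite[OF f] c
        nn_integral_norm_finite[OF integrable_divide_zero[OF integrable_gauss[where 'a='a], where c="complex_of_real c"]]
      by (simp add: nn_integral_multc norm_divide ennreal_mult_less_top)
    show "AE z in lborel. (\<lambda>n. ennreal (norm (gauss z) / c) * L1_shift f (- (s n *\<^sub>R z))) \<longlonglongrightarrow> 0"
    proof (intro AE_I2)
      fix z :: 'a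
      have "(\<lambda>n. - (s n *\<^sub>R z)) \<longlonglongrightarrow> - (0 *\<^sub>R z)" by (intro tendsto_intros s)
      then have "(\<lambda>n. L1_shift f (- (s n *\<^sub>R z))) \<longlonglongrightarrow> 0" by (intro L1_shift_tendsto[OF f]) simp
      then have "(\<lambda>n. ennreal (norm (gauss z) / c) * L1_shift f (- (s n *\<^sub>R z))) \<longlonglongrightarrow> ennreal (norm (gauss z) / c) * 0"
        by (intro ennreal_tendsto_cmult) auto
      then show "(\<lambda>n. ennreal (norm (gauss z) / c) * L1_shift f (- (s n *\<^sub>R z))) \<longlonglongrightarrow> 0" by simp
    qed
    show "AE z in lborel. ennreal (norm (gauss z) / c) * L1_shift f (- (s n *\<^sub>R z))
        \<le> ennreal (norm (gauss z) / c) * (2 * (\<integral>\<^sup>+x. ennreal (norm (f x)) \<partial>lborel))" for n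
      by (intro AE_I2 mult_left_mono L1_shift_le) auto
  qed measurable
  then have "(\<lambda>n. \<integral>\<^sup>+x. ennreal (norm (q n x - f x)) \<partial>lborel) \<longlonglongrightarrow> 0"
    by (simp add: ennreal_tendsto_0_le[OF _ diff])
  then have "(\<lambda>n. LINT x|lborel. norm (q n x - f x)) \<longlonglongrightarrow> 0"
    using q f by (subst (asm) nn_integral_eq_integral) (auto simp: ennreal_tendsto_0_iff)
  then obtain r :: "nat \<Rightarrow> nat" where r: "AE x in lborel. (\<lambda>n. q (r n) x - f x) \<longlonglongrightarrow> 0"
    using tendsto_L1_AE_subseq[of lborel "\<lambda>n x. q n x - f x"] q f by auto
  have "(\<integral>\<^sup>+x. ennreal ((norm (f x))\<^sup>2) \<partial>lborel) = (\<integral>\<^sup>+x. liminf (\<lambda>n. ennreal ((norm (q (r n) x))\<^sup>2)) \<partial>lborel)"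
  proof (rule nn_integral_cong_AE, use r in eventually_elim)
    case (elim x)
    then have "(\<lambda>n. q (r n) x) \<longlonglongrightarrow> f x" by (simp add: LIM_zero_iff)
    then have "(\<lambda>n. ennreal ((norm (q (r n) x))\<^sup>2)) \<longlonglongrightarrow> ennreal ((norm (f x))\<^sup>2)" by (intro tendsto_intros)
    then show ?case by (rule lim_imp_Liminf[OF sequentially_bot, symmetric])
  qed
  also have "\<dots> \<le> liminf (\<lambda>n. \<integral>\<^sup>+x. ennreal ((norm (q (r n) x))\<^sup>2) \<partial>lborel)"
    by (rule nn_integral_liminf) measurable
  also have "\<dots> \<le> (\<integral>\<^sup>+\<xi>. ennreal ((norm (fourier f \<xi>))\<^sup>2) \<partial>lborel)"
    by (rule order_trans[OF Liminf_le_Limsup]) (auto intro!: Limsup_bounded always_eventually bound)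
  finally show ?thesis using F by order
qed

section \<open>Functions as distributions\<close>

lemma cball_in_borel [measurable]: "cball (x::'a::metric_space) r \<in> sets borel"
  by simp

lemma
  fixes f F :: "'a::euclidean_space \<Rightarrow> complex"
  assumes [measurable]: "F \<in> borel_measurable borel" and ae: "AE x in lborel. f x = F x"
  shows lebesgue_integral_eq_lborel: "(LINT x|lebesgue. f x) = (LINT x|lborel. F x)"
    and integrable_lebesgue_iff_lborel: "integrable lebesgue f \<longleftrightarrow> integrable lborel F"
    and lebesgue_measurable_of_AE: "f \<in> borel_measurable lebesgue"
proof -
  have F: "F \<in> borel_measurable lebesgue" by (rule measurable_completion) simp
  have ae': "AE x in lebesgue. F x = f x" using AE_completion[OF ae] by eventually_elim simp
  show f: "f \<in> borel_measurable lebesgue" by (rule borel_measurable_AE[OF F ae'])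
  have "(LINT x|lebesgue. f x) = (LINT x|lebesgue. F x)"
    using ae' by (intro integral_cong_AE f F) (auto elim: eventually_mono)
  then show "(LINT x|lebesgue. f x) = (LINT x|lborel. F x)" by (simp add: integral_completion)
  have "integrable lebesgue f \<longleftrightarrow> integrable lebesgue F"
    using ae' by (intro integrable_cong_AE f F) (auto elim: eventually_mono)
  then show "integrable lebesgue f \<longleftrightarrow> integrable lborel F" by (simp add: integrable_completion)
qed

text \<open>Local integrability for Borel functions. Estimates run over \<open>lborel\<close>, so
  Lebesgue measurable functions are first replaced by Borel representatives of this kind.\<close>

definition ball_integrable :: "('a::euclidean_space \<Rightarrow> complex) \<Rightarrow> bool" where
  "ball_integrable g \<longleftrightarrow> g \<in> borel_measurable borel \<and>
     (\<forall>R. integrable lborel (\<lambda>x. indicator (cball 0 R) x *\<^sub>R g x))"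

lemma ball_integrable_borel: "ball_integrable g \<Longrightarrow> g \<in> borel_measurable borel"
  by (simp add: ball_integrable_def)

lemma ball_integrable_diff: "ball_integrable f \<Longrightarrow> ball_integrable g \<Longrightarrow> ball_integrable (\<lambda>x. f x - g x)"
  unfolding ball_integrable_def scaleR_right_diff_distrib by auto

lemma ball_integrable_add: "ball_integrable f \<Longrightarrow> ball_integrable g \<Longrightarrow> ball_integrable (\<lambda>x. f x + g x)"
  unfolding ball_integrable_def scaleR_right_distrib by auto

lemma ball_integrable_bounded:
  assumes [measurable]: "g \<in> borel_measurable borel" and b: "\<And>x. norm (g x) \<le> M"
  shows "ball_integrable g"
proof -
  have "integrable lborel (\<lambda>x. indicator (cball 0 R) x *\<^sub>R g x)" for R
    using order_trans[OF norm_ge_zero b]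
    by (intro integrable_of_bounded_compact[where M=M and R="R + 1"])
      (auto simp: indicator_def intro: b)
  then show ?thesis by (simp add: ball_integrable_def)
qed

lemma ball_integrable_mult_test:
  assumes g: "ball_integrable g" and \<phi>: "\<phi> \<in> test_functions"
  shows "integrable lborel (\<lambda>x. g x * \<phi> x)"
proof -
  obtain R where R: "\<And>x. R \<le> norm x \<Longrightarrow> \<phi> x = 0"
    using \<phi> by (rule test_functionE) blast
  have "integrable lborel (\<lambda>x. indicator (cball 0 R) x *\<^sub>R g x)" using g by (simp add: ball_integrable_def)
  from integrable_mult_test[OF this \<phi>] show ?thesis
    by (rule Bochner_Integration.integrable_cong[THEN iffD1, OF refl, rotated])
      (auto simp: indicator_def R)
qed

lemma bounded_ex_cball_0:
  fixes S :: "'a::real_normed_vector set"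
  assumes "bounded S" obtains R where "S \<subseteq> cball 0 R"
proof -
  obtain R where "\<forall>x\<in>S. norm x \<le> R" using assms by (auto simp: bounded_iff)
  then show ?thesis by (intro that[of R]) auto
qed

lemma ball_integrable_box:
  assumes g: "ball_integrable g" shows "integrable lborel (\<lambda>x. indicator (box a b) x *\<^sub>R g x)"
proof -
  obtain R where "box a b \<subseteq> cball 0 R" using bounded_ex_cball_0[OF bounded_box] .
  then have "indicator (box a b) x *\<^sub>R g x = indicator (box a b) x *\<^sub>R (indicator (cball 0 R) x *\<^sub>R g x)" for x
    by (auto simp: indicator_def)
  moreover have "integrable lborel (\<lambda>x. indicator (cball 0 R) x *\<^sub>R g x)"
    using g by (simp add: ball_integrable_def)
  then have "integrable lborel (\<lambda>x. indicator (box a b) x *\<^sub>R (indicator (cball 0 R) x *\<^sub>R g x))"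
    by (rule integrable_mult_indicator[rotated]) simp
  ultimately show ?thesis by presburger
qed

lemma locally_integrable_ex_borel:
  fixes f :: "'a::euclidean_space \<Rightarrow> complex"
  assumes f: "locally_integrable f"
  obtains g where "ball_integrable g" "AE x in lborel. f x = g x"
proof -
  have i: "integrable lebesgue (\<lambda>x. indicator (cball 0 R) x *\<^sub>R f x)" for R
    using f by (simp add: locally_integrable_def set_integrable_def)
  \<comment> \<open>Local integrability yields measurability of the truncations; \<open>f\<close> is
    their pointwise limit.\<close>
  have "f \<in> borel_measurable lebesgue"
  proof (rule borel_measurable_LIMSEQ_metric)
    show "(\<lambda>x. indicator (cball 0 (real n)) x *\<^sub>R f x) \<in> borel_measurable lebesgue" for n
      using i by (rule borel_measurable_integrable)
    fix x :: 'a
    obtain m where "norm x \<le> real m" using real_arch_simple by blast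
    then have "\<forall>\<^sub>F n in sequentially. indicator (cball 0 (real n)) x *\<^sub>R f x = f x"
      by (auto simp: eventually_sequentially intro!: exI[of _ m])
    then show "(\<lambda>n. indicator (cball 0 (real n)) x *\<^sub>R f x) \<longlonglongrightarrow> f x" by (rule tendsto_eventually)
  qed
  then obtain g where g: "g \<in> borel_measurable borel" "AE x in lborel. f x = g x"
    by (rule lebesgue_ex_borel_complex)
  note g(1) [measurable]
  have "integrable lborel (\<lambda>x. indicator (cball 0 R) x *\<^sub>R g x)" for R
  proof (rule integrable_lebesgue_iff_lborel[THEN iffD1, OF _ _ i])
    show "AE x in lborel. indicator (cball 0 R) x *\<^sub>R f x = indicator (cball 0 R) x *\<^sub>R g x"
      using g(2) by eventually_elim simp
  qed measurable
  with g show ?thesis by (intro that) (auto simp: ball_integrable_def)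
qed

lemma locally_integrableI:
  assumes g: "ball_integrable g" and ae: "AE x in lborel. f x = g x"
  shows "locally_integrable f"
  unfolding locally_integrable_def set_integrable_def
proof (intro allI impI)
  fix K :: "'a set" assume K: "compact K"
  have [measurable]: "g \<in> borel_measurable borel" by (rule ball_integrable_borel[OF g])
  have [measurable]: "K \<in> sets borel" using K by (simp add: borel_compact)
  obtain R where R: "K \<subseteq> cball 0 R" using bounded_ex_cball_0[OF compact_imp_bounded[OF K]] .
  have "integrable lborel (\<lambda>x. indicator (cball 0 R) x *\<^sub>R g x)"
    using g by (simp add: ball_integrable_def)
  then have "integrable lborel (\<lambda>x. indicator K x *\<^sub>R (indicator (cball 0 R) x *\<^sub>R g x))"
    by (rule integrable_mult_indicator[rotated]) simp
  then have "integrable lborel (\<lambda>x. indicator K x *\<^sub>R g x)"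
    by (rule Bochner_Integration.integrable_cong[THEN iffD1, OF refl, rotated])
      (use R in \<open>auto simp: indicator_def\<close>)
  moreover have "AE x in lborel. indicator K x *\<^sub>R f x = indicator K x *\<^sub>R g x"
    using ae by eventually_elim simp
  ultimately show "integrable lebesgue (\<lambda>x. indicator K x *\<^sub>R f x)"
    by (intro integrable_lebesgue_iff_lborel[where F="\<lambda>x. indicator K x *\<^sub>R g x", THEN iffD2])
      (simp_all add: borel_measurable_integrable)
qed

lemma distr_of_lborel:
  assumes "f \<in> borel_measurable borel" "AE x in lborel. h x = f x" "\<phi> \<in> borel_measurable borel"
  shows "distr_of h \<phi> = (LINT x|lborel. f x * \<phi> x)"
  unfolding distr_of_def
proof (rule lebesgue_integral_eq_lborel)
  show "AE x in lborel. h x * \<phi> x = f x * \<phi> x" using assms(2) by eventually_elim simp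
  note assms(1,3) [measurable]
  show "(\<lambda>x. f x * \<phi> x) \<in> borel_measurable borel" by measurable
qed

lemma is_functionI:
  assumes g: "ball_integrable g" and ae: "AE x in lborel. f x = g x"
    and T: "\<And>\<phi>. \<phi> \<in> test_functions \<Longrightarrow> T \<phi> = (LINT x|lborel. g x * \<phi> x)"
  shows "is_function T f"
  unfolding is_function_def
  using locally_integrableI[OF g ae] T distr_of_lborel[OF ball_integrable_borel[OF g] ae test_function_borel]
  by auto

text \<open>Identifies a function whose existence is merely asserted by a definition, such as the
  density of a Sobolev distribution or the right-hand side of the scattering equation, with an
  explicitly computed one.\<close>

lemma (in smooth_cutoff) is_function_unique_AE:
  fixes f g :: "'a::euclidean_space \<Rightarrow> complex"
  assumes T: "is_function T f" and g: "ball_integrable g"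
    and Tg: "\<And>\<phi>. \<phi> \<in> test_functions \<Longrightarrow> T \<phi> = (LINT x|lborel. g x * \<phi> x)"
  shows "AE x in lborel. f x = g x"
proof -
  obtain F where F: "ball_integrable F" "AE x in lborel. f x = F x"
    using T locally_integrable_ex_borel unfolding is_function_def by metis
  have "AE x in lborel. F x - g x = 0"
  proof (rule fundamental_lemma)
    fix \<phi> :: "'a \<Rightarrow> complex" assume \<phi>: "\<phi> \<in> test_functions"
    have "(LINT x|lborel. F x * \<phi> x) = (LINT x|lborel. g x * \<phi> x)"
      using T Tg[OF \<phi>] \<phi> distr_of_lborel[OF ball_integrable_borel[OF F(1)] F(2) test_function_borel[OF \<phi>]]
      by (simp add: is_function_def)
    then show "(LINT x|lborel. (F x - g x) * \<phi> x) = 0"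
      using ball_integrable_mult_test[OF F(1) \<phi>] ball_integrable_mult_test[OF g \<phi>]
      by (simp add: ring_distribs)
  qed (use ball_integrable_diff[OF F(1) g] in \<open>auto intro: ball_integrable_box ball_integrable_borel\<close>)
  with F(2) show ?thesis by eventually_elim simp
qed

section \<open>Test functions are dense in the Schwartz space\<close>

text \<open>There are finitely many lists of basis vectors of length at most \<open>n\<close>, and
  the sum of their bounds serves all of them. The weight \<open>w\<close> will be constant for a
  cutoff and a power of \<open>1 + norm x\<close> for a Schwartz function.\<close>

lemma iter_partial_bounds_uniform:
  assumes "\<And>bs. bs \<in> lists Basis \<Longrightarrow> \<exists>A. \<forall>x. w x * norm (iter_partial bs f x) \<le> A"
  shows "\<exists>A\<ge>0. \<forall>bs\<in>lists Basis. length bs \<le> n \<longrightarrow> (\<forall>x. w x * norm (iter_partial bs f x) \<le> A)"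
proof -
  define L where "L = {bs :: 'a list. set bs \<subseteq> Basis \<and> length bs \<le> n}"
  have L: "finite L" "\<And>bs. bs \<in> lists Basis \<Longrightarrow> length bs \<le> n \<Longrightarrow> bs \<in> L"
    unfolding L_def by (auto intro: finite_lists_length_le)
  obtain A where A: "\<And>bs x. bs \<in> lists Basis \<Longrightarrow> w x * norm (iter_partial bs f x) \<le> A bs"
    using assms by metis
  have "w x * norm (iter_partial bs f x) \<le> (\<Sum>bs\<in>L. \<bar>A bs\<bar>)" if "bs \<in> lists Basis" "length bs \<le> n" for bs x
  proof -
    have "w x * norm (iter_partial bs f x) \<le> \<bar>A bs\<bar>" using A[OF that(1), of x] by linarith
    also have "\<dots> \<le> (\<Sum>bs\<in>L. \<bar>A bs\<bar>)" using L that by (intro member_le_sum) auto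
    finally show ?thesis .
  qed
  then show ?thesis by (intro exI[of _ "\<Sum>bs\<in>L. \<bar>A bs\<bar>"]) (auto intro: sum_nonneg)
qed

lemma test_iter_partial: "\<phi> \<in> test_functions \<Longrightarrow> bs \<in> lists Basis \<Longrightarrow> iter_partial bs \<phi> \<in> test_functions"
  by (induction bs) (auto intro: test_partial_deriv)

lemma test_subset_schwartz:
  fixes \<phi> :: "'a::euclidean_space \<Rightarrow> complex"
  assumes \<phi>: "\<phi> \<in> test_functions"
  shows "\<phi> \<in> schwartz"
proof -
  have "bdd_above (range (\<lambda>x. (1 + norm x) ^ N * norm (iter_partial bs \<phi> x)))" if "bs \<in> lists Basis" for N bs
  proof -
    have t: "iter_partial bs \<phi> \<in> test_functions" by (rule test_iter_partial[OF \<phi> that])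
    obtain R where R: "0 < R" "\<And>x. R \<le> norm x \<Longrightarrow> iter_partial bs \<phi> x = 0"
      using t by (rule test_functionE) blast
    obtain M where M: "0 < M" "\<And>x. norm (iter_partial bs \<phi> x) \<le> M"
      using t by (rule test_function_bounded) blast
    have "(1 + norm x) ^ N * norm (iter_partial bs \<phi> x) \<le> (1 + R) ^ N * M" for x
    proof (cases "R \<le> norm x")
      case True
      then show ?thesis using R M by simp
    next
      case False
      then show ?thesis using M R(1) by (intro mult_mono power_mono) auto
    qed
    then show ?thesis by (intro bdd_aboveI[of _ "(1 + R) ^ N * M"]) auto
  qed
  then show ?thesis using test_function_smooth[OF \<phi>] by (simp add: schwartz_def)
qed

lemma iter_partial_one_le: "norm (iter_partial bs (\<lambda>x. 1 :: complex) x) \<le> 1"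
  by (cases bs rule: rev_cases) (auto simp: iter_partial_snoc frechet_derivative_const iter_partial_zero)

context smooth_cutoff
begin

text \<open>It vanishes on the unit ball and equals 1 from radius 2 on. The squared norm is used
  because, unlike the norm, it is smooth at the origin.\<close>

definition tail :: "'a::euclidean_space \<Rightarrow> complex" where
  "tail x = complex_of_real (\<eta> (C * (x \<bullet> x)))"

lemma smooth_tail: "smooth tail"
  unfolding tail_def[abs_def]
  by (rule smooth_of_real, rule smooth_compose_real[OF smooth_eta], rule smooth_mult[OF smooth_const smooth_inner_self])

lemma smooth_tail_scaled: "smooth (\<lambda>x. tail (c *\<^sub>R x))"
proof -
  have "smooth (\<lambda>x::'a. C * (c * (c * (x \<bullet> x))))"
    by (intro smooth_mult smooth_const smooth_inner_self)
  from smooth_of_real[OF smooth_compose_real[OF smooth_eta this]]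
  show ?thesis by (simp add: tail_def)
qed

lemma tail_zero: "norm x \<le> 1 \<Longrightarrow> tail x = 0"
  unfolding tail_def using C_pos
  by (auto intro!: eta_zero simp: power2_norm_eq_inner[symmetric] power_le_one)

lemma tail_one:
  assumes "2 \<le> norm x" shows "tail x = 1"
proof -
  have "2 * 2 \<le> norm x * norm x" using assms by (intro mult_mono) auto
  then have "2 * C \<le> C * (x \<bullet> x)"
    using C_pos by (simp add: power2_norm_eq_inner[symmetric] power2_eq_square)
  then show ?thesis by (simp add: tail_def eta_one)
qed

lemma tail_derivs_bounded:
  assumes bs: "bs \<in> lists Basis"
  shows "\<exists>A. \<forall>x::'a::euclidean_space. 1 * norm (iter_partial bs tail x) \<le> A"
proof -
  have "bounded (iter_partial bs (tail :: 'a \<Rightarrow> complex) ` cball 0 2)"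
    by (intro compact_imp_bounded compact_continuous_image smooth_continuous_on smooth_iter_partial smooth_tail bs) auto
  then obtain B where B: "\<And>x. x \<in> cball 0 2 \<Longrightarrow> norm (iter_partial bs (tail :: 'a \<Rightarrow> complex) x) \<le> B"
    by (metis bounded_iff imageI)
  have "norm (iter_partial bs tail x) \<le> max B 1" for x :: 'a
  proof (cases "x \<in> cball 0 2")
    case True
    then show ?thesis using B[of x] by simp
  next
    case False
    then have "iter_partial bs tail x = iter_partial bs (\<lambda>x. 1) x"
      by (intro iter_partial_local[of "- cball 0 2"]) (auto intro!: tail_one)
    then show ?thesis using iter_partial_one_le[of bs x] by simp
  qed
  then show ?thesis by auto
qed

text \<open>The dilated tail vanishes where \<open>norm x\<close> is below \<open>1 / c\<close>, and
  elsewhere a spare power of \<open>1 + norm x\<close> is worth a factor \<open>c\<close>. Its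
  derivatives are bounded uniformly because \<open>c\<close> is at most 1. The order
  \<open>n\<close> and the exponent \<open>N\<close> are kept apart so that membership in
  \<open>schwartz\<close> follows too.\<close>

lemma tail_mult_schwartz_bound:
  fixes \<psi> :: "'a::euclidean_space \<Rightarrow> complex"
  assumes \<psi>: "\<psi> \<in> schwartz"
  shows "\<exists>K\<ge>0. \<forall>c\<in>{0<..1}. \<forall>bs\<in>lists Basis. length bs \<le> n \<longrightarrow>
    (\<forall>x. (1 + norm x) ^ N * norm (iter_partial bs (\<lambda>x. tail (c *\<^sub>R x) * \<psi> x) x) \<le> K * c)"
proof -
  have s\<psi>: "smooth \<psi>" using \<psi> by (simp add: schwartz_def)
  obtain A where A: "A \<ge> 0"
    "\<And>bs x. bs \<in> lists Basis \<Longrightarrow> length bs \<le> n \<Longrightarrow> norm (iter_partial bs (tail :: 'a \<Rightarrow> complex) x) \<le> A"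
    using iter_partial_bounds_uniform[of "\<lambda>_. 1" "tail :: 'a \<Rightarrow> complex" n, OF tail_derivs_bounded] by auto
  have "\<exists>B. \<forall>x. (1 + norm x) ^ Suc N * norm (iter_partial bs \<psi> x) \<le> B" if "bs \<in> lists Basis" for bs
    using \<psi> that unfolding schwartz_def bdd_above_def by (auto simp del: power_Suc)
  then obtain B where B: "B \<ge> 0"
    "\<And>bs x. bs \<in> lists Basis \<Longrightarrow> length bs \<le> n \<Longrightarrow> (1 + norm x) ^ Suc N * norm (iter_partial bs \<psi> x) \<le> B"
    using iter_partial_bounds_uniform[of "\<lambda>x. (1 + norm x) ^ Suc N" \<psi> n] by blast
  have "(1 + norm x) ^ N * norm (iter_partial bs (\<lambda>x. tail (c *\<^sub>R x) * \<psi> x) x) \<le> 2 ^ n * A * B * c"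
    if c: "c \<in> {0<..1}" and bs: "bs \<in> lists Basis" "length bs \<le> n" for c bs x
  proof (cases "norm x < 1 / c")
    case True
    have "iter_partial bs (\<lambda>x. tail (c *\<^sub>R x) * \<psi> x) x = iter_partial bs (\<lambda>x. 0) x"
      using c True by (intro iter_partial_local[of "ball 0 (1 / c)"]) (auto simp: tail_zero field_simps)
    then show ?thesis using A B c by (simp add: iter_partial_zero)
  next
    case False
    have "norm (iter_partial cs (\<lambda>x. tail (c *\<^sub>R x)) z) \<le> A"
      if cs: "cs \<in> lists Basis" "length cs \<le> n" for cs and z :: 'a
    proof -
      have "norm (iter_partial cs (\<lambda>x. tail (c *\<^sub>R x)) z) = c ^ length cs * norm (iter_partial cs tail (c *\<^sub>R z))"
        using c by (simp add: iter_partial_scale[OF cs(1) smooth_tail])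
      also have "\<dots> \<le> 1 * A" using A(2)[OF cs] c by (intro mult_mono power_le_one) auto
      finally show ?thesis by simp
    qed
    moreover have "norm (iter_partial cs \<psi> z) \<le> B / (1 + norm z) ^ Suc N"
      if cs: "cs \<in> lists Basis" "length cs \<le> n" for cs and z :: 'a
    proof -
      have "0 < (1 + norm z) ^ Suc N" by (intro zero_less_power) (simp add: add_pos_nonneg)
      then show ?thesis using B(2)[OF cs, of z] by (simp add: pos_le_divide_eq mult.commute del: power_Suc)
    qed
    moreover note smooth_tail_scaled
    ultimately have "norm (iter_partial bs (\<lambda>x. tail (c *\<^sub>R x) * \<psi> x) x) \<le> 2 ^ n * (A * (B / (1 + norm x) ^ Suc N))"
      using bs s\<psi> A(1) B(1) by (intro iter_partial_mult_bound[where B="\<lambda>z. B / (1 + norm z) ^ Suc N"]) auto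
    then have "(1 + norm x) ^ N * norm (iter_partial bs (\<lambda>x. tail (c *\<^sub>R x) * \<psi> x) x)
        \<le> (1 + norm x) ^ N * (2 ^ n * (A * (B / (1 + norm x) ^ Suc N)))"
      by (intro mult_left_mono) auto
    also have "\<dots> = 2 ^ n * A * B * (1 / (1 + norm x))"
      by (simp add: field_simps add_nonneg_eq_0_iff)
    also have "1 / (1 + norm x) \<le> c"
    proof -
      have "1 \<le> c * norm x" using False c by (simp add: field_simps)
      then have "1 \<le> c * (1 + norm x)" using c by (simp add: distrib_left)
      then show ?thesis by (simp add: divide_le_eq add_pos_nonneg)
    qed
    then have "2 ^ n * A * B * (1 / (1 + norm x)) \<le> 2 ^ n * A * B * c"
      using A B by (intro mult_left_mono) auto
    finally show ?thesis .
  qed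
  then show ?thesis using A B by (intro exI[of _ "2 ^ n * A * B"]) auto
qed

text \<open>The part \<open>tail (c *\<^sub>R x) * \<psi> x\<close> has Schwartz norm of order
  \<open>c\<close>. For small \<open>c\<close> the other part is a test function that agrees with
  \<psi> wherever \<open>q\<close> is nonzero, so the continuity of \<open>T\<close> gives the claim
  as \<open>c\<close> tends to 0.\<close>

lemma tempered_eq_of_eq_on_tests:
  fixes \<psi> q :: "'a::euclidean_space \<Rightarrow> complex"
  assumes T: "tempered_distribution T" and q: "integrable lborel q" "\<And>x. \<rho> < norm x \<Longrightarrow> q x = 0"
    and Tq: "\<And>\<phi>. \<phi> \<in> test_functions \<Longrightarrow> T \<phi> = (LINT x|lborel. q x * \<phi> x)" and \<psi>: "\<psi> \<in> schwartz"
  shows "T \<psi> = (LINT x|lborel. q x * \<psi> x)"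
proof -
  have s\<psi>: "smooth \<psi>" using \<psi> by (simp add: schwartz_def)
  obtain B N where "\<forall>\<phi>\<in>schwartz. norm (T \<phi>) \<le> B * schwartz_norm N \<phi>"
    using T unfolding tempered_distribution_def by (elim conjE exE) (rule that)
  then have BN: "norm (T \<phi>) \<le> B * schwartz_norm N \<phi>" if "\<phi> \<in> schwartz" for \<phi>
    using that by blast
  define L where "L = {bs :: 'a list. bs \<in> lists Basis \<and> length bs \<le> N}"
  obtain K where "K \<ge> 0" and K0: "\<forall>c\<in>{0<..1}. \<forall>bs\<in>lists Basis. length bs \<le> N \<longrightarrow>
    (\<forall>x. (1 + norm x) ^ N * norm (iter_partial bs (\<lambda>x. tail (c *\<^sub>R x) * \<psi> x) x) \<le> K * c)"
    using tail_mult_schwartz_bound[OF \<psi>, of N N] by (elim exE conjE) (rule that)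
  then have K: "K \<ge> 0" "(1 + norm x) ^ N * norm (iter_partial bs (\<lambda>x. tail (c *\<^sub>R x) * \<psi> x) x) \<le> K * c"
    if "c \<in> {0<..1}" "bs \<in> lists Basis" "length bs \<le> N" for c bs x
    using that by blast+
  have main: "norm (T \<psi> - (LINT x|lborel. q x * \<psi> x)) \<le> \<bar>B\<bar> * (real (card L) * K) * c"
    if c: "c \<in> {0<..1}" "c * \<rho> \<le> 1" for c
  proof -
    let ?t = "\<lambda>x. tail (c *\<^sub>R x) * \<psi> x" and ?h = "\<lambda>x. (1 - tail (c *\<^sub>R x)) * \<psi> x"
    have h: "?h \<in> test_functions"
    proof (rule test_functionI_norm[where R="2 / c"])
      show "smooth ?h" by (intro smooth_mult smooth_diff smooth_const smooth_tail_scaled s\<psi>)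
      show "?h x = 0" if "2 / c \<le> norm x" for x
        using that c by (auto simp: tail_one field_simps)
    qed
    have t: "?t \<in> schwartz"
    proof -
      have "bdd_above (range (\<lambda>x. (1 + norm x) ^ M * norm (iter_partial bs ?t x)))" if "bs \<in> lists Basis" for M bs
      proof -
        obtain K' where "\<forall>c\<in>{0<..1}. \<forall>bs'\<in>lists Basis. length bs' \<le> length bs \<longrightarrow>
            (\<forall>x. (1 + norm x) ^ M * norm (iter_partial bs' (\<lambda>x. tail (c *\<^sub>R x) * \<psi> x) x) \<le> K' * c)"
          using tail_mult_schwartz_bound[OF \<psi>, of "length bs" M] by auto
        then have "(1 + norm x) ^ M * norm (iter_partial bs ?t x) \<le> K' * c" for x
          using c that by blast
        then show ?thesis by (intro bdd_aboveI[of _ "K' * c"]) auto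
      qed
      then show ?thesis using smooth_mult[OF smooth_tail_scaled s\<psi>] by (simp add: schwartz_def)
    qed
    have "T \<psi> = T (\<lambda>x. ?h x + ?t x)" by (simp add: ring_distribs)
    also have "\<dots> = T ?h + T ?t"
      by (rule T[unfolded tempered_distribution_def, THEN conjunct1, rule_format, OF test_subset_schwartz[OF h] t])
    also have "T ?h = (LINT x|lborel. q x * \<psi> x)"
    proof -
      have "q x * ?h x = q x * \<psi> x" for x
      proof (cases "\<rho> < norm x")
        case False
        then have "c * norm x \<le> c * \<rho>" using c by (intro mult_left_mono) auto
        from order_trans[OF this c(2)] have "norm (c *\<^sub>R x) \<le> 1" using c by simp
        then show ?thesis by (simp add: tail_zero)
      qed (simp add: q)
      then show ?thesis unfolding Tq[OF h] by presburger
    qed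
    finally have "T \<psi> - (LINT x|lborel. q x * \<psi> x) = T ?t" by simp
    moreover have "schwartz_norm N ?t \<le> (\<Sum>bs\<in>L. K * c)"
      unfolding schwartz_norm_def L_def using K c by (intro sum_mono cSUP_least) auto
    \<comment> \<open>Lets the constant \<open>B\<close>, whose sign is unknown, be replaced by its
      absolute value.\<close>
    moreover have "0 \<le> schwartz_norm N ?t"
      unfolding schwartz_norm_def
    proof (intro sum_nonneg)
      fix bs :: "'a list" assume "bs \<in> {bs. bs \<in> lists Basis \<and> length bs \<le> N}"
      then have "bdd_above (range (\<lambda>x. (1 + norm x) ^ N * norm (iter_partial bs ?t x)))"
        using t by (simp add: schwartz_def)
      then show "0 \<le> (SUP x. (1 + norm x) ^ N * norm (iter_partial bs ?t x))"
        by (rule cSUP_upper2[of _ _ 0]) auto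
    qed
    ultimately have "norm (T \<psi> - (LINT x|lborel. q x * \<psi> x)) \<le> \<bar>B\<bar> * (\<Sum>bs\<in>L. K * c)"
      using BN[OF t] mult_mono[OF abs_ge_self[of B] \<open>schwartz_norm N ?t \<le> _\<close>] by auto
    then show ?thesis by (simp add: mult_ac)
  qed
  have "norm (T \<psi> - (LINT x|lborel. q x * \<psi> x)) \<le> 0"
  proof (rule tendsto_lowerbound)
    show "((\<lambda>c. \<bar>B\<bar> * (real (card L) * K) * c) \<longlongrightarrow> 0) (at_right 0)"
      by (auto intro!: tendsto_eq_intros)
    have "\<forall>\<^sub>F c in at_right 0. c \<in> {0<..<min 1 (1 / (1 + \<bar>\<rho>\<bar>))}"
      by (intro eventually_at_rightI[of 0 "min 1 (1 / (1 + \<bar>\<rho>\<bar>))"]) auto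
    then show "\<forall>\<^sub>F c in at_right 0. norm (T \<psi> - (LINT x|lborel. q x * \<psi> x)) \<le> \<bar>B\<bar> * (real (card L) * K) * c"
    proof eventually_elim
      case (elim c)
      then have c: "0 < c" "c \<le> 1"
        by (simp_all only: greaterThanLessThan_iff min_less_iff_conj less_imp_le)
      have "c * (1 + \<bar>\<rho>\<bar>) \<le> 1" using elim by (simp add: field_simps)
      moreover have "c * \<rho> \<le> c * (1 + \<bar>\<rho>\<bar>)" using c by (intro mult_left_mono) auto
      ultimately have "c * \<rho> \<le> 1" by linarith
      with c show ?case by (intro main) auto
    qed
  qed simp
  then show ?thesis by simp
qed

end

section \<open>Compactly supported Sobolev functions\<close>

lemma compactly_supported_ex_borel:
  fixes q :: "'a::euclidean_space \<Rightarrow> complex"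
  assumes q: "locally_integrable q" "compactly_supported q"
  obtains p \<rho> where "p \<in> borel_measurable borel" "integrable lborel p" "AE x in lborel. q x = p x"
    "0 < \<rho>" "\<And>x. \<rho> < norm x \<Longrightarrow> p x = 0"
proof -
  obtain K where K: "compact K" "AE x in lebesgue. x \<notin> K \<longrightarrow> q x = 0"
    using q(2) unfolding compactly_supported_def by blast
  obtain R where R: "K \<subseteq> cball 0 R" using bounded_ex_cball_0[OF compact_imp_bounded[OF K(1)]] .
  obtain g where g: "ball_integrable g" "AE x in lborel. q x = g x"
    using locally_integrable_ex_borel[OF q(1)] by blast
  define \<rho> where "\<rho> = max R 1"
  define p where "p x = indicator (cball 0 \<rho>) x *\<^sub>R g x" for x
  have p: "integrable lborel p" using g by (simp add: ball_integrable_def p_def[abs_def])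
  have "AE x in lborel. q x = p x"
    using g(2) K(2)[unfolded AE_completion_iff]
  proof eventually_elim
    case (elim x)
    then show ?case using R by (auto simp: p_def \<rho>_def indicator_def)
  qed
  then show ?thesis
    using p by (intro that[of p \<rho>]) (auto simp: \<rho>_def p_def)
qed

text \<open>The distribution in the definition of the Sobolev space is tied to \<open>q\<close> on
  test functions only, while its transform evaluates it at \<open>fourier \<phi>\<close>, which is
  known to be a Schwartz function. The density argument bridges this gap; uniqueness then identifies
  \<open>h\<close> with \<open>fourier p\<close>.\<close>

lemma (in smooth_cutoff) sobolev_fourier_weighted_L2:
  fixes q p :: "'a::euclidean_space \<Rightarrow> complex"
  assumes q: "q \<in> sobolev_fun \<alpha>" and p: "integrable lborel p" "AE x in lborel. q x = p x"
    and \<rho>: "\<And>x. \<rho> < norm x \<Longrightarrow> p x = 0"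
  shows "(\<integral>\<^sup>+\<xi>. ennreal (jap \<xi> powr (2 * \<alpha>) * (norm (fourier p \<xi>))\<^sup>2) \<partial>lborel) < \<infinity>"
proof -
  have [measurable]: "p \<in> borel_measurable borel" using p by auto
  obtain T h where T: "tempered_distribution T" "is_function T q" "is_function (fourier_distr T) h"
    and h: "(\<lambda>\<xi>. complex_of_real ((1 + (norm \<xi>)\<^sup>2) powr (\<alpha> / 2)) * h \<xi>) \<in> L2"
    using q unfolding sobolev_fun_def sobolev_def by auto
  have Tp: "T \<phi> = (LINT x|lborel. p x * \<phi> x)" if "\<phi> \<in> test_functions" for \<phi>
    using T(2) distr_of_lborel[OF _ p(2) test_function_borel[OF that]] that by (simp add: is_function_def)
  have "fourier_distr T \<phi> = (LINT \<xi>|lborel. fourier p \<xi> * \<phi> \<xi>)" if \<phi>: "\<phi> \<in> test_functions" for \<phi>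
    unfolding fourier_distr_def
    using tempered_eq_of_eq_on_tests[OF T(1) p(1) \<rho> Tp fourier_test_schwartz[OF \<phi>]]
      fourier_multiplication[OF p(1) test_function_integrable[OF \<phi>]] by simp
  then have ae: "AE \<xi> in lborel. h \<xi> = fourier p \<xi>"
    using norm_fourier_le[OF p(1)] by (intro is_function_unique_AE[OF T(3)] ball_integrable_bounded) auto
  have "(\<integral>\<^sup>+\<xi>. ennreal (jap \<xi> powr (2 * \<alpha>) * (norm (fourier p \<xi>))\<^sup>2) \<partial>lborel)
    = (\<integral>\<^sup>+\<xi>. ennreal (norm ((norm (complex_of_real ((1 + (norm \<xi>)\<^sup>2) powr (\<alpha> / 2)) * h \<xi>))\<^sup>2)) \<partial>lborel)"
  proof (rule nn_integral_cong_AE, use ae in eventually_elim)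
    case (elim \<xi>)
    have "(jap \<xi> powr \<alpha>)\<^sup>2 = jap \<xi> powr (2 * \<alpha>)"
      by (simp add: power2_eq_square powr_add[symmetric])
    then show ?case by (simp add: elim jap_powr[symmetric] norm_mult power_mult_distrib)
  qed
  also have "\<dots> = (\<integral>\<^sup>+\<xi>. ennreal (norm ((norm (complex_of_real ((1 + (norm \<xi>)\<^sup>2) powr (\<alpha> / 2)) * h \<xi>))\<^sup>2)) \<partial>lebesgue)"
    by (simp add: nn_integral_completion)
  also have "\<dots> < \<infinity>"
    using h unfolding L2_def integrable_iff_bounded by simp
  finally show ?thesis .
qed

section \<open>Radial functions in three dimensions\<close>

text \<open>Splits off the coordinate along which the frequency will point from the orthogonal
  plane, where radial integrals are easy.\<close>

definition coords :: "real \<times> real \<times> real \<Rightarrow> real ^ 3" where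
  "coords p = vector [fst p, fst (snd p), snd (snd p)]"

lemma coords_borel [measurable]: "coords \<in> borel_measurable borel"
proof -
  have "continuous_on UNIV coords"
    unfolding coords_def
  proof (subst continuous_on_componentwise, intro ballI)
    fix b :: "real ^ 3" assume "b \<in> Basis"
    then obtain i where b: "b = axis i 1" by (auto simp: Basis_vec_def)
    have "i = 1 \<or> i = 2 \<or> i = 3" by (rule exhaust_3)
    then show "continuous_on UNIV (\<lambda>p. vector [fst p, fst (snd p), snd (snd p)] \<bullet> b)"
      unfolding b inner_axis by (elim disjE, simp_all, (intro continuous_intros)+)
  qed
  then show ?thesis by (rule borel_measurable_continuous_onI)
qed

lemma prod_Basis_vec_3: "(\<Prod>b\<in>(Basis :: (real ^ 3) set). f b) = f (axis 1 1) * f (axis 2 1) * f (axis 3 1)"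
proof -
  have B: "(Basis :: (real ^ 3) set) = {axis 1 1, axis 2 1, axis 3 1}"
    by (auto simp: Basis_vec_def) (metis exhaust_3)
  have "axis 1 1 \<noteq> (axis 2 1 :: real ^ 3)" "axis 1 1 \<noteq> (axis 3 1 :: real ^ 3)" "axis 2 1 \<noteq> (axis 3 1 :: real ^ 3)"
    by (auto simp: axis_eq_axis)
  then show ?thesis unfolding B by (simp add: mult.assoc)
qed

lemma emeasure_lborel_Times:
  fixes A :: "'a::euclidean_space set" and B :: "'b::euclidean_space set"
  assumes "A \<in> sets borel" "B \<in> sets borel"
  shows "emeasure lborel (A \<times> B) = emeasure lborel A * emeasure lborel B"
  unfolding lborel_prod[symmetric] using assms by (intro lborel.emeasure_pair_measure_Times) auto

lemma lborel_coords: "distr lborel borel coords = lborel"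
proof (rule lborel_eqI[symmetric])
  fix l u :: "real ^ 3" assume le: "\<And>b. b \<in> Basis \<Longrightarrow> l \<bullet> b \<le> u \<bullet> b"
  have le': "l $ i \<le> u $ i" for i using le[of "axis i 1"] by (auto simp: Basis_vec_def inner_axis)
  have "coords -` box l u = {l$1<..<u$1} \<times> ({l$2<..<u$2} \<times> {l$3<..<u$3})"
    by (auto simp: coords_def mem_box_cart forall_3)
  then have "emeasure (distr lborel borel coords) (box l u)
      = emeasure lborel ({l$1<..<u$1} \<times> ({l$2<..<u$2} \<times> {l$3<..<u$3}))"
    by (simp add: emeasure_distr)
  also have "\<dots> = ennreal (u$1 - l$1) * (ennreal (u$2 - l$2) * ennreal (u$3 - l$3))"
    using le' by (simp add: emeasure_lborel_Times borel_open open_Times)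
  also have "\<dots> = ennreal (\<Prod>b\<in>Basis. (u - l) \<bullet> b)"
    using le' by (simp add: prod_Basis_vec_3 inner_axis ennreal_mult'[symmetric] mult.assoc)
  finally show "emeasure (distr lborel borel coords) (box l u) = ennreal (\<Prod>b\<in>Basis. (u - l) \<bullet> b)" .
qed simp

lemma norm_coords: "norm (coords p) = sqrt ((fst p)\<^sup>2 + (norm (snd p))\<^sup>2)"
proof -
  obtain x y z where p: "p = (x, y, z)" by (cases p) auto
  have "(norm (coords p))\<^sup>2 = x\<^sup>2 + (y\<^sup>2 + z\<^sup>2)"
    unfolding power2_norm_eq_inner by (simp add: p coords_def inner_vec_def sum_3 power2_eq_square)
  also have "y\<^sup>2 + z\<^sup>2 = (norm (y, z))\<^sup>2" by (simp add: norm_Pair)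
  finally show ?thesis by (simp add: p real_sqrt_unique)
qed

lemma lborel_orthogonal_transformation:
  fixes P :: "real ^ 3 \<Rightarrow> real ^ 3"
  assumes P: "orthogonal_transformation P"
  shows "distr lborel borel P = lborel"
proof (rule lborel_eqI[symmetric])
  have [measurable]: "P \<in> borel_measurable borel"
    using P by (intro borel_measurable_continuous_onI linear_continuous_on)
      (simp add: linear_conv_bounded_linear[symmetric] orthogonal_transformation_linear)
  fix l u :: "real ^ 3" assume le: "\<And>b. b \<in> Basis \<Longrightarrow> l \<bullet> b \<le> u \<bullet> b"
  have Q: "orthogonal_transformation (inv P)" by (rule orthogonal_transformation_inv[OF P])
  have "P -` box l u = inv P ` box l u"
    by (rule bij_vimage_eq_inv_image[OF orthogonal_transformation_bij[OF P]])
  moreover have "inv P ` box l u \<in> lmeasurable"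
    by (rule measurable_orthogonal_image[OF Q]) simp
  moreover have "P -` box l u \<in> sets borel"
    using measurable_sets[OF \<open>P \<in> borel_measurable borel\<close>, of "box l u"] by simp
  ultimately have S: "inv P ` box l u \<in> lmeasurable" "inv P ` box l u \<in> sets lborel" "P -` box l u = inv P ` box l u"
    by simp_all
  have "emeasure (distr lborel borel P) (box l u) = emeasure lborel (inv P ` box l u)"
    by (subst emeasure_distr) (simp_all add: S(3))
  also have "\<dots> = emeasure lebesgue (inv P ` box l u)"
    using S(2) by simp
  also have "\<dots> = ennreal (measure lebesgue (inv P ` box l u))"
    by (rule emeasure_eq_measure2[OF S(1)])
  also have "\<dots> = ennreal (\<Prod>b\<in>Basis. (u - l) \<bullet> b)"
    using le by (subst measure_orthogonal_image[OF Q]) (auto simp: measure_lborel_box_eq inner_diff_left box_eq_empty)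
  finally show "emeasure (distr lborel borel P) (box l u) = ennreal (\<Prod>b\<in>Basis. (u - l) \<bullet> b)" .
qed simp

text \<open>A disc of squared radius \<open>a\<close> has area \<open>pi * a\<close>, so the squared
  norm has constant density. This takes the place of polar coordinates in the plane.\<close>

lemma distr_norm_square_plane:
  "distr (lborel :: (real \<times> real) measure) borel (\<lambda>y. (norm y)\<^sup>2) = density lborel (\<lambda>u. ennreal pi * indicator {0..} u)"
proof (rule measure_eqI_generator_eq[where E="range (\<lambda>a. {..a::real})" and \<Omega>=UNIV and A="\<lambda>n::nat. {..real n}"])
  show "Int_stable (range (\<lambda>a. {..a::real}))" by (auto simp: Int_stable_def min_def)
  show "sets (distr (lborel :: (real \<times> real) measure) borel (\<lambda>y. (norm y)\<^sup>2)) = sigma_sets UNIV (range (\<lambda>a. {..a}))"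
    "sets (density lborel (\<lambda>u. ennreal pi * indicator {0::real..} u)) = sigma_sets UNIV (range (\<lambda>a. {..a}))"
    by (simp_all add: borel_eq_atMost)
  show "(\<Union>i. {..real i}) = UNIV" using real_arch_simple by auto
  have eq: "emeasure (distr (lborel :: (real \<times> real) measure) borel (\<lambda>y. (norm y)\<^sup>2)) {..a} = ennreal (pi * max a 0)" for a
  proof (cases "0 \<le> a")
    case True
    have "(\<lambda>y::real \<times> real. (norm y)\<^sup>2) -` {..a} = cball 0 (sqrt a)"
      using True by (auto simp: real_le_rsqrt sqrt_ge_absD)
    then show ?thesis using True by (simp add: emeasure_distr emeasure_cball unit_ball_vol_2)
  next
    case False
    have "\<not> (norm y)\<^sup>2 \<le> a" for y :: "real \<times> real"
      using False zero_le_power2[of "norm y"] by linarith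
    then have "(\<lambda>y::real \<times> real. (norm y)\<^sup>2) -` {..a} = {}" by blast
    then show ?thesis using False by (simp add: emeasure_distr)
  qed
  have eq': "emeasure (density lborel (\<lambda>u. ennreal pi * indicator {0::real..} u)) {..a} = ennreal (pi * max a 0)" for a
  proof -
    have "emeasure (density lborel (\<lambda>u. ennreal pi * indicator {0::real..} u)) {..a}
        = (\<integral>\<^sup>+u. ennreal pi * indicator {0..a} u \<partial>lborel)"
      by (auto simp: emeasure_density intro!: nn_integral_cong split: split_indicator)
    also have "\<dots> = ennreal pi * emeasure lborel {0..a}" by (simp add: nn_integral_cmult)
    also have "\<dots> = ennreal (pi * max a 0)" by (cases "0 \<le> a") (auto simp: ennreal_mult')
    finally show ?thesis .
  qed
  show "emeasure (distr (lborel :: (real \<times> real) measure) borel (\<lambda>y. (norm y)\<^sup>2)) {..real i} \<noteq> \<infinity>" for i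
    unfolding eq by simp
  show "emeasure (distr (lborel :: (real \<times> real) measure) borel (\<lambda>y. (norm y)\<^sup>2)) X
      = emeasure (density lborel (\<lambda>u. ennreal pi * indicator {0..} u)) X" if "X \<in> range (\<lambda>a. {..a})" for X
    using that eq eq' by auto
qed auto

lemma integral_plane_radial:
  fixes g :: "real \<Rightarrow> complex"
  assumes [measurable]: "g \<in> borel_measurable borel"
  shows "(LINT y|(lborel :: (real \<times> real) measure). g ((norm y)\<^sup>2))
    = complex_of_real pi * (LINT u|lborel. indicator {0..} u *\<^sub>R g u)"
proof -
  have "(LINT y|(lborel :: (real \<times> real) measure). g ((norm y)\<^sup>2))
      = (LINT u|density lborel (\<lambda>u. ennreal (pi * indicator {0..} u)). g u)"
    using distr_norm_square_plane
    by (subst integral_distr[where g="\<lambda>y::real \<times> real. (norm y)\<^sup>2" and N=borel, symmetric])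
      (auto simp: ennreal_mult' ennreal_indicator)
  also have "\<dots> = (LINT u|lborel. (pi * indicator {0..} u) *\<^sub>R g u)"
    by (subst integral_density) auto
  also have "\<dots> = (LINT u|lborel. complex_of_real pi * (indicator {0..} u *\<^sub>R g u))"
    by (intro Bochner_Integration.integral_cong) (auto simp: scaleR_conv_of_real)
  finally show ?thesis unfolding integral_mult_right_zero .
qed

text \<open>After a rotation \<xi> points along the first axis. The exponential is then constant on
  each plane orthogonal to this axis, and the squared distance to the axis has constant density pi
  there.\<close>

lemma fourier_radial:
  fixes g :: "real \<Rightarrow> complex" and \<xi> :: "real ^ 3"
  assumes [measurable]: "g \<in> borel_measurable borel"
    and i: "integrable lborel (\<lambda>x::real ^ 3. g ((norm x)\<^sup>2))"
  shows "fourier (\<lambda>x. g ((norm x)\<^sup>2)) \<xi> = (LINT t|lborel. cis (- (norm \<xi> * t)) *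
      (complex_of_real pi * (LINT u|lborel. indicator {0..} u *\<^sub>R g (t\<^sup>2 + u))))"
proof -
  obtain P :: "real ^ 3 \<Rightarrow> real ^ 3" where P: "orthogonal_transformation P" "P (axis 1 (norm \<xi>)) = \<xi>"
    using orthogonal_transformation_exists[of "axis 1 (norm \<xi>)" \<xi>] by (auto simp: norm_axis_1 norm_eq_sqrt_inner inner_axis_axis)
  have [measurable]: "P \<in> borel_measurable borel"
    using P by (intro borel_measurable_continuous_onI linear_continuous_on)
      (simp add: linear_conv_bounded_linear[symmetric] orthogonal_transformation_linear)
  define H where "H x = cis (- (norm \<xi> * (x $ 1))) * g ((norm x)\<^sup>2)" for x :: "real ^ 3"
  have [measurable]: "(\<lambda>x::real ^ 3. x $ 1) \<in> borel_measurable borel"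
    by (intro borel_measurable_continuous_onI continuous_intros)
  have H[measurable]: "H \<in> borel_measurable borel" unfolding H_def by measurable
  have iH: "integrable lborel H" unfolding H_def[abs_def] by (intro integrable_cis_mult i) measurable
  have HP: "cis (- (\<xi> \<bullet> P x)) * g ((norm (P x))\<^sup>2) = H x" for x
  proof -
    have "\<xi> \<bullet> P x = axis 1 (norm \<xi>) \<bullet> x"
      using P by (metis orthogonal_transformation_def)
    then show ?thesis
      using orthogonal_transformation_norm[OF P(1)] by (simp add: H_def inner_axis' )
  qed
  have "fourier (\<lambda>x. g ((norm x)\<^sup>2)) \<xi> = (LINT x|distr lborel borel P. cis (- (\<xi> \<bullet> x)) * g ((norm x)\<^sup>2))"
    by (simp add: fourier_lborel lborel_orthogonal_transformation[OF P(1)])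
  also have "\<dots> = (LINT x|lborel. H x)"
    by (subst integral_distr) (auto simp: HP)
  also have "\<dots> = (LINT p|lborel. H (coords p))"
    by (subst lborel_coords[symmetric], subst integral_distr) auto
  also have "\<dots> = (LINT p|(lborel \<Otimes>\<^sub>M lborel). H (coords p))" by (simp add: lborel_prod)
  also have "\<dots> = (LINT t|lborel. LINT y|lborel. H (coords (t, y)))"
  proof (rule lborel_pair.integral_fst'[symmetric])
    have "integrable (distr lborel borel coords) H" by (simp add: lborel_coords iH)
    then have "integrable lborel (\<lambda>p. H (coords p))" by (subst (asm) integrable_distr_eq) auto
    then show "integrable (lborel \<Otimes>\<^sub>M lborel) (\<lambda>p. H (coords p))" by (simp add: lborel_prod)
  qed
  also have "\<dots> = (LINT t|lborel. cis (- (norm \<xi> * t)) *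
      (complex_of_real pi * (LINT u|lborel. indicator {0..} u *\<^sub>R g (t\<^sup>2 + u))))"
  proof (rule Bochner_Integration.integral_cong[OF refl])
    fix t :: real
    have "H (coords (t, y)) = cis (- (norm \<xi> * t)) * g (t\<^sup>2 + (norm y)\<^sup>2)" for y
      by (simp add: H_def norm_coords) (simp add: coords_def)
    then show "(LINT y|lborel. H (coords (t, y))) = cis (- (norm \<xi> * t)) *
      (complex_of_real pi * (LINT u|lborel. indicator {0..} u *\<^sub>R g (t\<^sup>2 + u)))"
      by (simp add: integral_plane_radial[of "\<lambda>u. g (t\<^sup>2 + u)"])
  qed
  finally show ?thesis .
qed

text \<open>The dyadic argument for \<open>integrable_jap_powr\<close>, now with balls shrinking to
  the singularity instead of growing to infinity.\<close>

lemma nn_integral_norm_powr_finite: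
  assumes p: "0 \<le> p" "p < real DIM('a)" and D: "0 < D"
  shows "(\<integral>\<^sup>+x. ennreal (norm x powr (- p)) * indicator (cball 0 D) x \<partial>(lborel :: 'a::euclidean_space measure)) < \<infinity>"
proof -
  let ?V = "unit_ball_vol (DIM('a))"
  define r where "r = 2 powr (p - real DIM('a))"
  have "r < 2 powr 0" unfolding r_def using p by (intro powr_less_mono) auto
  then have r: "0 \<le> r" "r < 1" by (auto simp: r_def)
  \<comment> \<open>The constant is the value of the weight at half the radius of the ball. The
    ratio \<open>r\<close> of the masses is below 1 because the exponent is below the
    dimension.\<close>
  define F :: "nat \<Rightarrow> 'a \<Rightarrow> ennreal"
    where "F n x = ennreal (D powr (- p) * 2 powr (p * real (Suc n))) * indicator (cball 0 (D / 2 ^ n)) x" for n x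
  have F_borel: "F n \<in> borel_measurable lborel" for n
    unfolding F_def by (intro borel_measurable_times_ennreal borel_measurable_indicator) auto
  have le: "ennreal (norm x powr (- p)) * indicator (cball 0 D) x \<le> (\<Sum>n. F n x)" for x :: 'a
  \<comment> \<open>At the origin the weight is 0, since \<open>0 powr (- p) = 0\<close>.\<close>
  proof (cases "x = 0 \<or> D < norm x")
    case False
    then have x: "0 < norm x" "norm x \<le> D" by auto
    obtain m where m: "D / norm x < 2 ^ m" using real_arch_pow[of 2 "D / norm x"] by auto
    define k where "k = (LEAST n. D / norm x < 2 ^ n)"
    have k: "D / norm x < 2 ^ k" unfolding k_def by (rule LeastI[of _ m]) fact
    have "k \<noteq> 0" using k x by (cases k) (auto simp: divide_less_eq)
    then obtain n where n: "k = Suc n" using not0_implies_Suc by blast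
    have "\<not> D / norm x < 2 ^ n" using not_less_Least[of n "\<lambda>n. D / norm x < 2 ^ n"] n by (auto simp: k_def)
    then have xn: "norm x \<le> D / 2 ^ n" using x by (simp add: field_simps)
    have "D / 2 ^ Suc n \<le> norm x" using k x n by (simp add: field_simps)
    then have "norm x powr (- p) \<le> (D / 2 ^ Suc n) powr (- p)"
      using p D by (intro powr_mono2') auto
    also have "\<dots> = D powr (- p) * 2 powr (p * real (Suc n))"
      using D by (simp add: powr_divide powr_realpow[symmetric] powr_powr powr_minus_divide mult.commute del: of_nat_Suc power_Suc)
    finally have "ennreal (norm x powr (- p)) * indicator (cball 0 D) x \<le> F n x"
      using xn x(2) unfolding F_def by (auto intro!: ennreal_leI)
    also have "F n x \<le> (\<Sum>n. F n x)"
    proof -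
      have "(\<Sum>n\<in>{n}. F n x) \<le> (\<Sum>n. F n x)" by (intro sum_le_suminf summableI) auto
      then show ?thesis by simp
    qed
    finally show ?thesis .
  qed auto
  have "(\<integral>\<^sup>+x. ennreal (norm x powr (- p)) * indicator (cball 0 D) x \<partial>(lborel :: 'a measure)) \<le> (\<integral>\<^sup>+x. (\<Sum>n. F n x) \<partial>lborel)"
    using le by (intro nn_integral_mono) simp
  also have "\<dots> = (\<Sum>n. \<integral>\<^sup>+x. F n x \<partial>lborel)"
    by (intro nn_integral_suminf F_borel)
  also have "\<dots> = (\<Sum>n. ennreal (D powr (- p) * 2 powr (p * real (Suc n))) * ennreal (?V * (D / 2 ^ n) ^ DIM('a)))"
    unfolding F_def using D by (intro suminf_cong) (simp add: nn_integral_cmult_indicator emeasure_cball)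
  also have "\<dots> = (\<Sum>n. ennreal (D powr (- p) * 2 powr p * ?V * D ^ DIM('a) * r ^ n))"
  proof (intro suminf_cong)
    fix n
    have "2 powr (p * real (Suc n)) * (D / 2 ^ n) ^ DIM('a) = 2 powr p * D ^ DIM('a) * (2 powr (p * real n) / (2 ^ n) ^ DIM('a))"
      by (simp add: powr_add[symmetric] power_divide algebra_simps)
    also have "2 powr (p * real n) / (2 ^ n) ^ DIM('a) = r ^ n"
      by (simp add: r_def powr_realpow[symmetric] powr_powr powr_diff[symmetric] algebra_simps)
    finally have "2 powr (p * real (Suc n)) * (D / 2 ^ n) ^ DIM('a) = 2 powr p * D ^ DIM('a) * r ^ n" .
    then have "(D powr (- p) * 2 powr (p * real (Suc n))) * (?V * (D / 2 ^ n) ^ DIM('a))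
        = D powr (- p) * ?V * (2 powr p * D ^ DIM('a) * r ^ n)"
      by (simp only: mult_ac)
    also have "\<dots> = D powr (- p) * 2 powr p * ?V * D ^ DIM('a) * r ^ n"
      by (simp only: mult_ac)
    finally have *: "(D powr (- p) * 2 powr (p * real (Suc n))) * (?V * (D / 2 ^ n) ^ DIM('a))
        = D powr (- p) * 2 powr p * ?V * D ^ DIM('a) * r ^ n" .
    show "ennreal (D powr (- p) * 2 powr (p * real (Suc n))) * ennreal (?V * (D / 2 ^ n) ^ DIM('a))
        = ennreal (D powr (- p) * 2 powr p * ?V * D ^ DIM('a) * r ^ n)"
      unfolding *[symmetric] by (rule ennreal_mult'[symmetric]) simp
  qed
  also have "\<dots> < \<infinity>"
    using r D unit_ball_vol_nonneg[of "DIM('a)"]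
    by (subst suminf_ennreal2) (auto intro!: summable_mult summable_geometric mult_nonneg_nonneg zero_le_power)
  finally show ?thesis .
qed

section \<open>The outgoing fundamental solution\<close>

definition green :: "complex \<Rightarrow> real ^ 3 \<Rightarrow> complex" where
  "green \<kappa> x = - exp (\<i> * \<kappa> * complex_of_real (norm x)) / complex_of_real (4 * pi * norm x)"

definition tgreen :: "real \<Rightarrow> complex \<Rightarrow> real ^ 3 \<Rightarrow> complex" where
  "tgreen D \<kappa> x = indicator (cball 0 D) x *\<^sub>R green \<kappa> x"

lemma green_borel [measurable]: "green \<kappa> \<in> borel_measurable borel"
  unfolding green_def by measurable

lemma tgreen_borel [measurable]: "tgreen D \<kappa> \<in> borel_measurable borel"
  unfolding tgreen_def[abs_def] by measurable

lemma green_minus: "green \<kappa> (- x) = green \<kappa> x"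
  by (simp add: green_def)

lemma tgreen_minus: "tgreen D \<kappa> (- x) = tgreen D \<kappa> x"
  by (simp add: tgreen_def green_minus indicator_def)

lemma norm_green_le:
  assumes "0 \<le> Im \<kappa>" shows "norm (green \<kappa> x) \<le> 1 / norm x"
proof -
  have e: "norm (exp (\<i> * \<kappa> * complex_of_real (norm x))) \<le> 1"
    using assms by (simp add: norm_exp_eq_Re)
  have "norm (green \<kappa> x) = norm (exp (\<i> * \<kappa> * complex_of_real (norm x))) / (4 * pi * norm x)"
    by (simp add: green_def norm_divide norm_mult)
  also have "\<dots> \<le> 1 / (4 * pi * norm x)" using e by (intro divide_right_mono) auto
  also have "\<dots> \<le> 1 / norm x"
    using pi_gt3 by (cases "x = 0") (auto simp: field_simps)
  finally show ?thesis .
qed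

lemma norm_powr_minus_1: "norm x powr (- 1) = 1 / norm x"
  by (cases "x = 0") (auto simp: powr_minus_divide)

lemma norm_tgreen_le: "0 \<le> Im \<kappa> \<Longrightarrow> norm (tgreen D \<kappa> x) \<le> norm x powr (- 1) * indicator (cball 0 D) x"
  using norm_green_le[of \<kappa> x] by (simp add: tgreen_def indicator_def norm_powr_minus_1)

lemma integrable_tgreen:
  assumes "0 \<le> Im \<kappa>" "0 < D" shows "integrable lborel (tgreen D \<kappa>)"
proof (rule integrableI_bounded)
  have "(\<integral>\<^sup>+x. ennreal (norm (tgreen D \<kappa> x)) \<partial>lborel)
      \<le> (\<integral>\<^sup>+x. ennreal (norm x powr (- 1)) * indicator (cball 0 D) x \<partial>(lborel :: (real ^ 3) measure))"
  proof (intro nn_integral_mono)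
    fix x :: "real ^ 3"
    have "ennreal (norm (tgreen D \<kappa> x)) \<le> ennreal (norm x powr (- 1) * indicator (cball 0 D) x)"
      by (intro ennreal_leI norm_tgreen_le assms)
    also have "\<dots> = ennreal (norm x powr (- 1)) * indicator (cball 0 D) x"
      by (auto simp: indicator_def)
    finally show "ennreal (norm (tgreen D \<kappa> x)) \<le> ennreal (norm x powr (- 1)) * indicator (cball 0 D) x" .
  qed
  also have "\<dots> < \<infinity>" using assms by (intro nn_integral_norm_powr_finite) auto
  finally show "(\<integral>\<^sup>+x. ennreal (norm (tgreen D \<kappa> x)) \<partial>lborel) < \<infinity>" .
qed simp

lemma tgreen_square_integrable:
  assumes "0 \<le> Im \<kappa>" "0 < D" shows "(\<integral>\<^sup>+x. (ennreal (norm (tgreen D \<kappa> x)))\<^sup>2 \<partial>lborel) < \<infinity>"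
proof -
  have "(\<integral>\<^sup>+x. (ennreal (norm (tgreen D \<kappa> x)))\<^sup>2 \<partial>lborel)
      \<le> (\<integral>\<^sup>+x. ennreal (norm x powr (- 2)) * indicator (cball 0 D) x \<partial>(lborel :: (real ^ 3) measure))"
  proof (intro nn_integral_mono)
    fix x :: "real ^ 3"
    have "(norm (tgreen D \<kappa> x))\<^sup>2 \<le> (norm x powr (- 1) * indicator (cball 0 D) x)\<^sup>2"
      by (intro power_mono norm_tgreen_le assms) auto
    also have "\<dots> = (norm x powr (- 1))\<^sup>2 * indicator (cball 0 D) x"
      by (auto simp: indicator_def)
    also have "(norm x powr (- 1))\<^sup>2 = norm x powr (- 2)"
      unfolding power2_eq_square powr_add[symmetric] by simp
    finally show "(ennreal (norm (tgreen D \<kappa> x)))\<^sup>2 \<le> ennreal (norm x powr (- 2)) * indicator (cball 0 D) x"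
      by (auto simp: ennreal_power indicator_def intro!: ennreal_leI split: if_splits)
  qed
  also have "\<dots> < \<infinity>" using assms by (intro nn_integral_norm_powr_finite) auto
  finally show ?thesis .
qed

lemma has_vector_derivative_exp_ii:
  "((\<lambda>t. exp (\<i> * \<kappa> * complex_of_real t)) has_vector_derivative (\<i> * \<kappa> * exp (\<i> * \<kappa> * complex_of_real t))) (at t within S)"
  by (rule has_vector_derivative_real_field) (auto intro!: derivative_eq_intros)

text \<open>Differentiating the exponential of the square root produces, by the chain rule, exactly
  the denominator of the kernel. Hence the integral over a planar slice is elementary.\<close>

lemma radial_green_integral:
  assumes \<kappa>: "\<kappa> \<noteq> 0" and t: "t \<noteq> 0" "\<bar>t\<bar> \<le> D"
  shows "(LINT u|lborel. indicator {0..D\<^sup>2 - t\<^sup>2} u *\<^sub>R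
      (- exp (\<i> * \<kappa> * complex_of_real (sqrt (t\<^sup>2 + u))) / complex_of_real (4 * pi * sqrt (t\<^sup>2 + u))))
    = - (exp (\<i> * \<kappa> * complex_of_real D) - exp (\<i> * \<kappa> * complex_of_real \<bar>t\<bar>)) / (2 * complex_of_real pi * \<i> * \<kappa>)"
proof -
  let ?F = "\<lambda>u. - exp (\<i> * \<kappa> * complex_of_real (sqrt (t\<^sup>2 + u))) / (2 * complex_of_real pi * \<i> * \<kappa>)"
  let ?f = "\<lambda>u. - exp (\<i> * \<kappa> * complex_of_real (sqrt (t\<^sup>2 + u))) / complex_of_real (4 * pi * sqrt (t\<^sup>2 + u))"
  have pos: "0 < t\<^sup>2 + u" if "0 \<le> u" for u using t that by (simp add: add_pos_nonneg)
  have tD: "t\<^sup>2 \<le> D\<^sup>2" using t by (metis abs_le_square_iff abs_ge_self order_trans)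
  have "(LINT u|lborel. indicator {0..D\<^sup>2 - t\<^sup>2} u *\<^sub>R ?f u) = ?F (D\<^sup>2 - t\<^sup>2) - ?F 0"
  proof (rule integral_FTC_atLeastAtMost)
    show "0 \<le> D\<^sup>2 - t\<^sup>2" using tD by simp
    fix u assume u: "0 \<le> u" "u \<le> D\<^sup>2 - t\<^sup>2"
    have 1: "((\<lambda>u. sqrt (t\<^sup>2 + u)) has_real_derivative inverse (sqrt (t\<^sup>2 + u)) / 2) (at u within {0..D\<^sup>2 - t\<^sup>2})"
      using pos[OF u(1)] by (auto intro!: derivative_eq_intros)
    have "((\<lambda>t. exp (\<i> * \<kappa> * complex_of_real t)) \<circ> (\<lambda>u. sqrt (t\<^sup>2 + u)) has_vector_derivative
        (inverse (sqrt (t\<^sup>2 + u)) / 2) *\<^sub>R (\<i> * \<kappa> * exp (\<i> * \<kappa> * complex_of_real (sqrt (t\<^sup>2 + u)))))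
        (at u within {0..D\<^sup>2 - t\<^sup>2})"
      by (rule vector_diff_chain_within[OF 1[unfolded has_real_derivative_iff_has_vector_derivative] has_vector_derivative_exp_ii])
    then have "((\<lambda>u. - exp (\<i> * \<kappa> * complex_of_real (sqrt (t\<^sup>2 + u))) / (2 * complex_of_real pi * \<i> * \<kappa>)) has_vector_derivative
        - ((inverse (sqrt (t\<^sup>2 + u)) / 2) *\<^sub>R (\<i> * \<kappa> * exp (\<i> * \<kappa> * complex_of_real (sqrt (t\<^sup>2 + u))))) / (2 * complex_of_real pi * \<i> * \<kappa>))
        (at u within {0..D\<^sup>2 - t\<^sup>2})"
      by (intro has_vector_derivative_divide has_vector_derivative_minus) (simp add: o_def)
    moreover have "- ((inverse (sqrt (t\<^sup>2 + u)) / 2) *\<^sub>R (\<i> * \<kappa> * exp (\<i> * \<kappa> * complex_of_real (sqrt (t\<^sup>2 + u))))) / (2 * complex_of_real pi * \<i> * \<kappa>) = ?f u"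
      using \<kappa> pos[OF u(1)] by (simp add: scaleR_conv_of_real field_simps)
    ultimately show "(?F has_vector_derivative ?f u) (at u within {0..D\<^sup>2 - t\<^sup>2})" by simp
  next
    show "continuous_on {0..D\<^sup>2 - t\<^sup>2} ?f"
      using pos by (intro continuous_intros) (auto simp: less_imp_neq[THEN not_sym])
  qed
  also have "sqrt (t\<^sup>2 + (D\<^sup>2 - t\<^sup>2)) = D" using t by simp
  also have "?F 0 = - exp (\<i> * \<kappa> * complex_of_real \<bar>t\<bar>) / (2 * complex_of_real pi * \<i> * \<kappa>)" by simp
  finally show ?thesis by (simp add: diff_divide_distrib)
qed

text \<open>Slicing leaves an integral over the interval from \<open>- D\<close> to
  \<open>D\<close>. Apart from the exponential its integrand is even in \<open>t\<close>, so folding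
  at 0 produces the cosine. The difference of exponentials vanishes at \<open>t = D\<close>, the
  edge of the truncation.\<close>

lemma fourier_tgreen:
  assumes \<kappa>: "\<kappa> \<noteq> 0" "0 \<le> Im \<kappa>" and D: "0 < D"
  shows "fourier (tgreen D \<kappa>) \<xi> = - (LINT t|lborel. indicator {0..D} t *\<^sub>R
      (2 * complex_of_real (cos (norm \<xi> * t)) * (exp (\<i> * \<kappa> * complex_of_real D) - exp (\<i> * \<kappa> * complex_of_real t)))) / (2 * \<i> * \<kappa>)"
proof -
  define g where "g v = indicator {..D\<^sup>2} v *\<^sub>R (- exp (\<i> * \<kappa> * complex_of_real (sqrt v)) / complex_of_real (4 * pi * sqrt v))" for v
  define h where "h t = exp (\<i> * \<kappa> * complex_of_real D) - exp (\<i> * \<kappa> * complex_of_real \<bar>t\<bar>)" for t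
  define w where "w t = indicator {-D..D} t *\<^sub>R (cis (- (norm \<xi> * t)) * h t)" for t
  have [measurable]: "g \<in> borel_measurable borel" unfolding g_def by measurable
  have [measurable]: "h \<in> borel_measurable borel" unfolding h_def by measurable
  have [measurable]: "w \<in> borel_measurable borel" unfolding w_def by measurable
  have tg: "tgreen D \<kappa> x = g ((norm x)\<^sup>2)" for x
    using D by (auto simp: g_def tgreen_def green_def indicator_def power2_le_iff_abs_le)
  have "fourier (tgreen D \<kappa>) \<xi> = (LINT t|lborel. cis (- (norm \<xi> * t)) *
      (complex_of_real pi * (LINT u|lborel. indicator {0..} u *\<^sub>R g (t\<^sup>2 + u))))"
    unfolding tg[abs_def] using integrable_tgreen[OF \<kappa>(2) D] by (intro fourier_radial) (simp_all add: tg[abs_def])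
  also have "\<dots> = (LINT t|lborel. - w t / (2 * \<i> * \<kappa>))"
  proof (rule integral_cong_AE)
    \<comment> \<open>The slice through the origin meets the singularity; it corresponds to a single
      value of \<open>t\<close>.\<close>
    have "AE t in lborel. t \<noteq> (0::real)" by (rule AE_lborel_singleton)
    then show "AE t in lborel. cis (- (norm \<xi> * t)) *
      (complex_of_real pi * (LINT u|lborel. indicator {0..} u *\<^sub>R g (t\<^sup>2 + u))) = - w t / (2 * \<i> * \<kappa>)"
    proof eventually_elim
      case (elim t)
      have eq: "indicator {0..} u *\<^sub>R g (t\<^sup>2 + u) = indicator {0..D\<^sup>2 - t\<^sup>2} u *\<^sub>R
        (- exp (\<i> * \<kappa> * complex_of_real (sqrt (t\<^sup>2 + u))) / complex_of_real (4 * pi * sqrt (t\<^sup>2 + u)))" for u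
        by (auto simp: g_def indicator_def)
      show ?case
      proof (cases "\<bar>t\<bar> \<le> D")
        case True
        have "complex_of_real pi * (LINT u|lborel. indicator {0..} u *\<^sub>R g (t\<^sup>2 + u))
            = complex_of_real pi * (- h t / (2 * complex_of_real pi * \<i> * \<kappa>))"
          unfolding eq radial_green_integral[OF \<kappa>(1) elim True] h_def ..
        also have "\<dots> = - h t / (2 * \<i> * \<kappa>)" by simp
        finally show ?thesis using True by (simp add: w_def indicator_def abs_le_iff)
      next
        case False
        then have "D\<^sup>2 < t\<^sup>2" using D by (metis abs_le_square_iff abs_of_pos not_less)
        then have "{0..D\<^sup>2 - t\<^sup>2} = {}" by simp
        moreover have "t \<notin> {-D..D}" using False by auto
        ultimately show ?thesis unfolding eq by (simp add: w_def)
      qed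
    qed
  qed measurable
  also have "\<dots> = - (LINT t|lborel. w t) / (2 * \<i> * \<kappa>)" by simp
  also have "(LINT t|lborel. w t) = (LINT t|lborel. indicator {0..D} t *\<^sub>R
      (2 * complex_of_real (cos (norm \<xi> * t)) * (exp (\<i> * \<kappa> * complex_of_real D) - exp (\<i> * \<kappa> * complex_of_real t))))"
  proof -
    have b: "norm (h t) \<le> 2" for t
    proof -
      have "norm (h t) \<le> norm (exp (\<i> * \<kappa> * complex_of_real D)) + norm (exp (\<i> * \<kappa> * complex_of_real \<bar>t\<bar>))"
        unfolding h_def by (rule norm_triangle_ineq4)
      also have "\<dots> \<le> 1 + 1" using \<kappa> D by (intro add_mono) (auto simp: norm_exp_eq_Re)
      finally show ?thesis by simp
    qed
    have iw: "integrable lborel (\<lambda>t. indicator A t *\<^sub>R w t)" if [measurable]: "A \<in> sets borel" for A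
      by (rule integrable_of_bounded_compact[where M=2 and R="D + 1"])
        (use b in \<open>auto simp: w_def indicator_def norm_mult\<close>)
    have "(LINT t|lborel. w t) = (LINT t|lborel. indicator {0..} t *\<^sub>R w t + indicator {..<0} t *\<^sub>R w t)"
      by (rule Bochner_Integration.integral_cong) (auto simp: indicator_def)
    also have "\<dots> = (LINT t|lborel. indicator {0..} t *\<^sub>R w t) + (LINT t|lborel. indicator {..<0} t *\<^sub>R w t)"
      by (intro Bochner_Integration.integral_add iw) auto
    also have "(LINT t|lborel. indicator {..<0} t *\<^sub>R w t) = (LINT t|lborel. indicator {0<..} t *\<^sub>R w (- t))"
      using integral_lborel_reflect[of "\<lambda>t. indicator {..<0} t *\<^sub>R w t" 0] by (simp add: indicator_def)
    also have "\<dots> = (LINT t|lborel. indicator {0..} t *\<^sub>R w (- t))"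
    proof (rule integral_cong_AE)
      show "AE t in lborel. indicator {0<..} t *\<^sub>R w (- t) = indicator {0..} t *\<^sub>R w (- t)"
        using AE_lborel_singleton[of "0::real"] by eventually_elim (auto simp: indicator_def)
    qed measurable
    also have "(LINT t|lborel. indicator {0..} t *\<^sub>R w t) + (LINT t|lborel. indicator {0..} t *\<^sub>R w (- t))
        = (LINT t|lborel. indicator {0..} t *\<^sub>R w t + indicator {0..} t *\<^sub>R w (- t))"
    proof (rule Bochner_Integration.integral_add[symmetric])
      show "integrable lborel (\<lambda>t. indicator {0..} t *\<^sub>R w (- t))"
        using integrable_lborel_reflect[OF iw[of "{..0}"], of 0] by (simp add: indicator_def)
    qed (simp add: iw)
    also have "\<dots> = (LINT t|lborel. indicator {0..D} t *\<^sub>R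
      (2 * complex_of_real (cos (norm \<xi> * t)) * (exp (\<i> * \<kappa> * complex_of_real D) - exp (\<i> * \<kappa> * complex_of_real t))))"
    proof (rule Bochner_Integration.integral_cong[OF refl])
      fix t
      have "cis (- (norm \<xi> * t)) + cis (norm \<xi> * t) = 2 * complex_of_real (cos (norm \<xi> * t))"
        by (simp add: complex_eq_iff)
      then have "cis (- (norm \<xi> * t)) * z + cis (norm \<xi> * t) * z = 2 * complex_of_real (cos (norm \<xi> * t)) * z" for z
        by (metis distrib_right)
      then show "indicator {0..} t *\<^sub>R w t + indicator {0..} t *\<^sub>R w (- t) = indicator {0..D} t *\<^sub>R
        (2 * complex_of_real (cos (norm \<xi> * t)) * (exp (\<i> * \<kappa> * complex_of_real D) - exp (\<i> * \<kappa> * complex_of_real t)))"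
        by (auto simp: w_def h_def indicator_def)
    qed
    finally show ?thesis .
  qed
  finally show ?thesis .
qed

lemma norm_integral_Icc_le:
  fixes f :: "real \<Rightarrow> complex"
  assumes "continuous_on {0..D} f" "\<And>t. 0 \<le> t \<Longrightarrow> t \<le> D \<Longrightarrow> norm (f t) \<le> M" "0 \<le> D"
  shows "norm (LINT t|lborel. indicator {0..D} t *\<^sub>R f t) \<le> D * M"
proof -
  have i: "integrable lborel (\<lambda>t. indicator {0..D} t *\<^sub>R f t)"
    using borel_integrable_atLeastAtMost'[OF assms(1)] by (simp add: set_integrable_def)
  have "norm (LINT t|lborel. indicator {0..D} t *\<^sub>R f t) \<le> (LINT t|lborel. indicator {0..D} t *\<^sub>R M)"
  proof (rule order_trans[OF integral_norm_bound integral_mono[OF integrable_norm[OF i]]])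
    show "integrable lborel (\<lambda>t. indicator {0..D} t *\<^sub>R M)"
      by (intro integrable_scaleR_left integrable_real_indicator) (auto simp: emeasure_lborel_Icc_eq)
  qed (use assms in \<open>auto simp: indicator_def\<close>)
  also have "\<dots> = D * M" using assms(3) by simp
  finally show ?thesis .
qed

text \<open>The first bound estimates the one-dimensional integrand by its supremum. For the second,
  the derivative of the exponential costs a factor \<open>k\<close>, which the denominator absorbs,
  while integrating the cosine gains \<open>1 / norm \<xi>\<close>.\<close>

lemma norm_fourier_tgreen_le:
  assumes k: "0 < k" and D: "0 < D"
  shows "norm (fourier (tgreen D (complex_of_real k)) \<xi>) \<le> 2 * D / k"
    and "norm (fourier (tgreen D (complex_of_real k)) \<xi>) * norm \<xi> \<le> D"
proof -
  let ?\<kappa> = "complex_of_real k" and ?s = "norm \<xi>"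
  let ?h = "\<lambda>t. exp (\<i> * ?\<kappa> * complex_of_real D) - exp (\<i> * ?\<kappa> * complex_of_real t)"
  let ?f = "\<lambda>t. 2 * complex_of_real (cos (?s * t)) * ?h t"
  have e: "norm (exp (\<i> * ?\<kappa> * complex_of_real t)) = 1" for t by (simp add: norm_exp_eq_Re)
  have hb: "norm (?h t) \<le> 2" for t
    using norm_triangle_ineq4[of "exp (\<i> * ?\<kappa> * complex_of_real D)" "exp (\<i> * ?\<kappa> * complex_of_real t)"] by (simp add: e)
  have F: "norm (fourier (tgreen D ?\<kappa>) \<xi>) = norm (LINT t|lborel. indicator {0..D} t *\<^sub>R ?f t) / (2 * k)"
    using k D by (subst fourier_tgreen) (auto simp: norm_divide norm_mult)
  have "norm (LINT t|lborel. indicator {0..D} t *\<^sub>R ?f t) \<le> D * 4"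
  proof (rule norm_integral_Icc_le)
    fix t
    have "norm (?f t) = 2 * \<bar>cos (?s * t)\<bar> * norm (?h t)" by (simp add: norm_mult)
    also have "\<dots> \<le> 2 * 1 * 2" by (intro mult_mono hb abs_cos_le_one) auto
    finally show "norm (?f t) \<le> 4" by simp
  qed (use D in \<open>auto intro!: continuous_intros\<close>)
  then show "norm (fourier (tgreen D ?\<kappa>) \<xi>) \<le> 2 * D / k"
    unfolding F using k by (simp add: field_simps)
  \<comment> \<open>Integration by parts; both boundary terms vanish.\<close>
  show "norm (fourier (tgreen D ?\<kappa>) \<xi>) * ?s \<le> D"
  proof (cases "?s = 0")
    case True
    then show ?thesis using D by simp
  next
    case False
    then have s: "0 < ?s" by (metis norm_ge_zero order_le_less)
    let ?G = "\<lambda>t. 2 * complex_of_real (sin (?s * t) / ?s) * ?h t"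
    let ?g = "\<lambda>t. 2 * complex_of_real (sin (?s * t) / ?s) * (\<i> * ?\<kappa> * exp (\<i> * ?\<kappa> * complex_of_real t))"
    have c: "continuous_on {0..D} ?f" "continuous_on {0..D} ?g"
      using False by (auto intro!: continuous_intros)
    have i: "integrable lborel (\<lambda>t. indicator {0..D} t *\<^sub>R ?f t)" "integrable lborel (\<lambda>t. indicator {0..D} t *\<^sub>R ?g t)"
      using c[THEN borel_integrable_atLeastAtMost'] by (simp_all add: set_integrable_def)
    have "(LINT t|lborel. indicator {0..D} t *\<^sub>R (?f t - ?g t)) = ?G D - ?G 0"
    proof (rule integral_FTC_atLeastAtMost)
      fix t assume "0 \<le> t" "t \<le> D"
      have "((\<lambda>t. sin (?s * t) / ?s) has_real_derivative cos (?s * t)) (at t within {0..D})"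
        using s by (auto intro!: derivative_eq_intros)
      then have 1: "((\<lambda>t. complex_of_real (sin (?s * t) / ?s)) has_vector_derivative complex_of_real (cos (?s * t))) (at t within {0..D})"
        by (intro has_vector_derivative_of_real) (simp add: has_real_derivative_iff_has_vector_derivative)
      have 2: "(?h has_vector_derivative (0 - \<i> * ?\<kappa> * exp (\<i> * ?\<kappa> * complex_of_real t))) (at t within {0..D})"
        by (intro has_vector_derivative_diff has_vector_derivative_const has_vector_derivative_exp_ii)
      have "(?G has_vector_derivative
        (2 * complex_of_real (sin (?s * t) / ?s) * (0 - \<i> * ?\<kappa> * exp (\<i> * ?\<kappa> * complex_of_real t)) + 2 * complex_of_real (cos (?s * t)) * ?h t)) (at t within {0..D})"
        by (intro has_vector_derivative_mult has_vector_derivative_mult_right 1 2)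
      then show "(?G has_vector_derivative (?f t - ?g t)) (at t within {0..D})"
        by (rule has_vector_derivative_eq_rhs) (simp add: algebra_simps)
    qed (use D c in \<open>auto intro!: continuous_on_diff\<close>)
    also have "\<dots> = 0" by simp
    finally have "(LINT t|lborel. indicator {0..D} t *\<^sub>R ?f t) = (LINT t|lborel. indicator {0..D} t *\<^sub>R ?g t)"
      using i by (simp add: scaleR_right_diff_distrib)
    moreover have "norm (LINT t|lborel. indicator {0..D} t *\<^sub>R ?g t) \<le> D * (2 * (1 / ?s) * k)"
    proof (rule norm_integral_Icc_le[OF c(2)])
      fix t
      have "norm (?g t) = 2 * (\<bar>sin (?s * t)\<bar> / ?s) * k" using s k by (simp add: norm_mult norm_divide e)
      also have "\<dots> \<le> 2 * (1 / ?s) * k"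
        using s k by (intro mult_right_mono mult_left_mono divide_right_mono abs_sin_le_one) auto
      finally show "norm (?g t) \<le> 2 * (1 / ?s) * k" .
    qed (use D in auto)
    ultimately have "norm (fourier (tgreen D ?\<kappa>) \<xi>) \<le> D * (2 * (1 / ?s) * k) / (2 * k)"
      unfolding F using k by (intro divide_right_mono) auto
    then show ?thesis using s k by (simp add: field_simps)
  qed
qed

text \<open>One of the two factors is estimated by \<open>2 * D / k\<close> and the other one by
  \<open>4 * D / jap \<xi>\<close>, so that the square decays in \<open>k\<close> and in \<xi> at
  the same time.\<close>

lemma fourier_tgreen_square_le:
  assumes k: "1 \<le> k" and D: "0 < D"
  shows "(norm (fourier (tgreen D (complex_of_real k)) \<xi>))\<^sup>2 \<le> 8 * D\<^sup>2 / k * jap \<xi> powr (- 1)"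
proof -
  let ?K = "norm (fourier (tgreen D (complex_of_real k)) \<xi>)"
  have 1: "?K \<le> 2 * D / k" and 2: "?K * norm \<xi> \<le> D"
    using norm_fourier_tgreen_le[of k D \<xi>] k D by auto
  have 3: "2 * D / k \<le> 2 * D" using k D by (simp add: divide_le_eq mult_le_cancel_left1)
  have "?K * jap \<xi> \<le> 4 * D"
  proof -
    have "?K * jap \<xi> \<le> ?K * (1 + norm \<xi>)" by (intro mult_left_mono jap_le) auto
    also have "\<dots> \<le> 2 * D + D" using 1 2 3 by (simp add: distrib_left)
    finally show ?thesis using D by simp
  qed
  then have "?K * (?K * jap \<xi>) \<le> (2 * D / k) * (4 * D)"
    using 1 jap_pos[of \<xi>] D k by (rule_tac mult_mono) auto
  then have "?K\<^sup>2 * jap \<xi> \<le> 8 * D\<^sup>2 / k"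
    by (simp add: power2_eq_square mult_ac)
  then have "?K\<^sup>2 \<le> 8 * D\<^sup>2 / k / jap \<xi>"
    by (rule pos_le_divide_eq[OF jap_pos, THEN iffD2])
  also have "\<dots> = 8 * D\<^sup>2 / k * jap \<xi> powr (- 1)"
    using jap_pos[of \<xi>] by (simp add: powr_minus_divide)
  finally show ?thesis .
qed

lemma norm_green: "norm (green \<kappa> x) = exp (- Im \<kappa> * norm x) / (4 * pi * norm x)"
  by (simp add: green_def norm_divide norm_mult norm_exp_eq_Re)

lemma integrable_green:
  assumes \<kappa>: "0 < Im \<kappa>" shows "integrable lborel (green \<kappa>)"
proof (rule Bochner_Integration.integrable_bound)
  let ?m = "Im \<kappa>"
  \<comment> \<open>Comes from exp t \<ge> (t / 4)^4 with t the product of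
    \<open>Im \<kappa>\<close> and \<open>norm x\<close>, and from
    \<open>jap x \<le> 2 * norm x\<close> outside the unit ball. The fourth power exceeds the
    dimension 3.\<close>
  define c where "c = (8 / ?m) ^ 4"
  have "(\<integral>\<^sup>+x. ennreal (norm (indicator (cball 0 1) x *\<^sub>R norm x powr (- 1))) \<partial>(lborel :: (real ^ 3) measure))
      = (\<integral>\<^sup>+x. ennreal (norm x powr (- 1)) * indicator (cball 0 1) x \<partial>(lborel :: (real ^ 3) measure))"
    by (intro nn_integral_cong) (auto simp: indicator_def)
  also have "\<dots> < \<infinity>" by (intro nn_integral_norm_powr_finite) auto
  finally have "integrable lborel (\<lambda>x::real ^ 3. indicator (cball 0 1) x *\<^sub>R norm x powr (- 1))"
    by (intro integrableI_bounded) auto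
  then show "integrable lborel (\<lambda>x::real ^ 3. indicator (cball 0 1) x *\<^sub>R norm x powr (- 1) + c * jap x powr (- 4))"
    by (intro Bochner_Integration.integrable_add integrable_mult_right integrable_jap_powr) auto
  show "AE x in lborel. norm (green \<kappa> x) \<le> norm (indicator (cball 0 1) x *\<^sub>R norm x powr (- 1) + c * jap x powr (- 4))"
  proof (intro AE_I2)
    fix x :: "real ^ 3"
    have c: "0 \<le> c" using \<kappa> by (simp add: c_def)
    show "norm (green \<kappa> x) \<le> norm (indicator (cball 0 1) x *\<^sub>R norm x powr (- 1) + c * jap x powr (- 4))"
    proof (cases "norm x \<le> 1")
      case True
      have "norm (green \<kappa> x) \<le> norm x powr (- 1)"
        using norm_green_le[of \<kappa> x] \<kappa> by (simp only: norm_powr_minus_1)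
      moreover have "0 \<le> c * jap x powr (- 4)" using c by simp
      ultimately show ?thesis using True by (simp only: indicator_def mem_cball_0 of_bool_eq scaleR_one real_norm_def)
    next
      case False
      let ?r = "norm x"
      have r: "1 < ?r" using False by simp
      have "?m * ?r / 4 \<le> exp (?m * ?r / 4)" using exp_ge_add_one_self[of "?m * ?r / 4"] by linarith
      then have "(?m * ?r / 4) ^ 4 \<le> exp (?m * ?r / 4) ^ 4" using \<kappa> by (intro power_mono) auto
      also have "\<dots> = exp (?m * ?r)" by (simp flip: exp_of_nat_mult)
      finally have e: "(?m * ?r / 4) ^ 4 \<le> exp (?m * ?r)" .
      have mr: "0 < ?m * ?r" using r \<kappa> by (intro mult_pos_pos) auto
      have j: "jap x \<le> 2 * ?r" using jap_le[of x] r by simp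
      have "1 * 1 \<le> (4 * pi) * ?r" using r pi_gt3 by (intro mult_mono) auto
      then have "norm (green \<kappa> x) \<le> exp (- (?m * ?r)) / 1"
        unfolding norm_green minus_mult_left using r by (intro divide_left_mono) auto
      also have "\<dots> = 1 / exp (?m * ?r)" by (simp add: exp_minus divide_inverse)
      also have "\<dots> \<le> 1 / (?m * ?r / 4) ^ 4"
        using mr by (intro divide_left_mono e mult_pos_pos zero_less_power) auto
      also have "\<dots> \<le> 1 / (?m * jap x / 8) ^ 4"
        using j \<kappa> jap_pos[of x] mr by (intro divide_left_mono power_mono mult_pos_pos zero_less_power) (auto simp: field_simps)
      also have "\<dots> = c * jap x powr (- 4)"
        using jap_pos[of x] \<kappa> by (simp add: c_def powr_minus_divide powr_numeral power_divide power_mult_distrib)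
      also have "\<dots> \<le> norm (indicator (cball 0 1) x *\<^sub>R norm x powr (- 1) + c * jap x powr (- 4))"
        using False by simp
      finally show ?thesis .
    qed
  qed
qed simp

text \<open>The limit of the truncated kernels for growing radius. Positive imaginary part makes the
  terms at the far end decay exponentially, even against the linear growth allowed for
  \<open>P D\<close>, and what remains is the contribution of \<open>A 0\<close>.\<close>

lemma fourier_green:
  assumes \<kappa>: "0 < Im \<kappa>"
  shows "fourier (green \<kappa>) \<xi> = 1 / (\<kappa>\<^sup>2 - complex_of_real ((norm \<xi>)\<^sup>2))"
proof -
  let ?s = "complex_of_real (norm \<xi>)"
  let ?E = "\<lambda>z t. exp (\<i> * z * complex_of_real t)"
  have nz: "\<kappa> \<noteq> 0" "\<kappa> + ?s \<noteq> 0" "\<kappa> - ?s \<noteq> 0"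
    using \<kappa> by (auto simp: complex_eq_iff)
  \<comment> \<open>The antiderivative of twice the cosine times the exponential, with the cosine
    written as two exponentials.\<close>
  define A where "A t = ?E (\<kappa> + ?s) t / (\<i> * (\<kappa> + ?s)) + ?E (\<kappa> - ?s) t / (\<i> * (\<kappa> - ?s))" for t
  define P where "P D = (LINT t|lborel. indicator {0..D} t *\<^sub>R (2 * complex_of_real (cos (norm \<xi> * t))))" for D
  have dec: "((\<lambda>n. ?E z (real (Suc n))) \<longlongrightarrow> 0) sequentially" if "Im z = Im \<kappa>" for z
  proof (rule tendsto_norm_zero_cancel)
    have "(\<lambda>n. exp (- Im \<kappa> * real (Suc n))) \<longlonglongrightarrow> 0" using \<kappa> by real_asymp
    then show "(\<lambda>n. norm (?E z (real (Suc n)))) \<longlonglongrightarrow> 0" using that by (simp add: norm_exp_eq_Re)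
  qed
  have formula: "fourier (tgreen D \<kappa>) \<xi> = - (?E \<kappa> D * P D - (A D - A 0)) / (2 * \<i> * \<kappa>)" if D: "0 < D" for D
  proof -
    have c: "continuous_on {0..D} (\<lambda>t. 2 * complex_of_real (cos (norm \<xi> * t)))"
      "continuous_on {0..D} (\<lambda>t. 2 * complex_of_real (cos (norm \<xi> * t)) * ?E \<kappa> t)"
      by (intro continuous_intros)+
    have i: "integrable lborel (\<lambda>t. indicator {0..D} t *\<^sub>R (2 * complex_of_real (cos (norm \<xi> * t))))"
      "integrable lborel (\<lambda>t. indicator {0..D} t *\<^sub>R (2 * complex_of_real (cos (norm \<xi> * t)) * ?E \<kappa> t))"
      using c[THEN borel_integrable_atLeastAtMost'] by (simp_all only: set_integrable_def)
    have "(LINT t|lborel. indicator {0..D} t *\<^sub>R (2 * complex_of_real (cos (norm \<xi> * t)) * ?E \<kappa> t)) = A D - A 0"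
    proof (rule integral_FTC_atLeastAtMost)
      fix t
      have "(A has_vector_derivative (\<i> * (\<kappa> + ?s) * ?E (\<kappa> + ?s) t / (\<i> * (\<kappa> + ?s))
          + \<i> * (\<kappa> - ?s) * ?E (\<kappa> - ?s) t / (\<i> * (\<kappa> - ?s)))) (at t within {0..D})"
        unfolding A_def
        by (intro has_vector_derivative_add has_vector_derivative_divide has_vector_derivative_exp_ii)
      also have "\<i> * (\<kappa> + ?s) * ?E (\<kappa> + ?s) t / (\<i> * (\<kappa> + ?s)) + \<i> * (\<kappa> - ?s) * ?E (\<kappa> - ?s) t / (\<i> * (\<kappa> - ?s))
          = ?E (\<kappa> + ?s) t + ?E (\<kappa> - ?s) t"
        using nz by simp
      also have "\<dots> = 2 * complex_of_real (cos (norm \<xi> * t)) * ?E \<kappa> t"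
      proof -
        have "?E (\<kappa> + ?s) t = ?E \<kappa> t * cis (norm \<xi> * t)" "?E (\<kappa> - ?s) t = ?E \<kappa> t * cis (- (norm \<xi> * t))"
          by (simp_all add: cis_conv_exp flip: exp_add) (simp_all add: algebra_simps)
        moreover have "cis (norm \<xi> * t) + cis (- (norm \<xi> * t)) = 2 * complex_of_real (cos (norm \<xi> * t))"
          by (simp add: complex_eq_iff)
        ultimately have "?E (\<kappa> + ?s) t + ?E (\<kappa> - ?s) t = ?E \<kappa> t * (2 * complex_of_real (cos (norm \<xi> * t)))"
          by (simp only: distrib_left[symmetric])
        then show ?thesis by (simp only: mult.commute)
      qed
      finally show "(A has_vector_derivative 2 * complex_of_real (cos (norm \<xi> * t)) * ?E \<kappa> t) (at t within {0..D})" .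
    qed (use D c in auto)
    moreover have "(LINT t|lborel. indicator {0..D} t *\<^sub>R (2 * complex_of_real (cos (norm \<xi> * t)) * (?E \<kappa> D - ?E \<kappa> t)))
        = (LINT t|lborel. ?E \<kappa> D * (indicator {0..D} t *\<^sub>R (2 * complex_of_real (cos (norm \<xi> * t))))
            - indicator {0..D} t *\<^sub>R (2 * complex_of_real (cos (norm \<xi> * t)) * ?E \<kappa> t))"
      by (rule Bochner_Integration.integral_cong) (auto simp: indicator_def algebra_simps)
    moreover have "\<dots> = ?E \<kappa> D * P D - (LINT t|lborel. indicator {0..D} t *\<^sub>R (2 * complex_of_real (cos (norm \<xi> * t)) * ?E \<kappa> t))"
      unfolding P_def integral_mult_right_zero[symmetric]
      by (rule Bochner_Integration.integral_diff[OF integrable_mult_right[OF i(1)] i(2)])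
    ultimately show ?thesis
      using \<kappa> nz D by (simp only: fourier_tgreen[OF nz(1) less_imp_le[OF \<kappa>] D])
  qed
  have lim1: "(\<lambda>n. fourier (tgreen (real (Suc n)) \<kappa>) \<xi>) \<longlonglongrightarrow> fourier (green \<kappa>) \<xi>"
    unfolding fourier_lborel[OF green_borel] fourier_lborel[OF tgreen_borel]
  proof (rule integral_dominated_convergence[where w="\<lambda>x. norm (green \<kappa> x)"])
    show "integrable lborel (\<lambda>x. norm (green \<kappa> x))" by (intro integrable_norm integrable_green \<kappa>)
    show "AE x in lborel. (\<lambda>n. cis (- (\<xi> \<bullet> x)) * tgreen (real (Suc n)) \<kappa> x) \<longlonglongrightarrow> cis (- (\<xi> \<bullet> x)) * green \<kappa> x"
    proof (intro AE_I2)
      fix x :: "real ^ 3"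
      obtain m where "norm x \<le> real m" using real_arch_simple by blast
      then have "\<forall>\<^sub>F n in sequentially. cis (- (\<xi> \<bullet> x)) * tgreen (real (Suc n)) \<kappa> x = cis (- (\<xi> \<bullet> x)) * green \<kappa> x"
        unfolding eventually_sequentially by (intro exI[of _ m]) (auto simp: tgreen_def)
      then show "(\<lambda>n. cis (- (\<xi> \<bullet> x)) * tgreen (real (Suc n)) \<kappa> x) \<longlonglongrightarrow> cis (- (\<xi> \<bullet> x)) * green \<kappa> x"
        by (rule tendsto_eventually)
    qed
    show "AE x in lborel. norm (cis (- (\<xi> \<bullet> x)) * tgreen (real (Suc n)) \<kappa> x) \<le> norm (green \<kappa> x)" for n
      by (intro AE_I2) (auto simp: norm_mult tgreen_def indicator_def)
  qed measurable
  have "(\<lambda>n. ?E \<kappa> (real (Suc n)) * P (real (Suc n))) \<longlonglongrightarrow> 0"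
  proof (rule Lim_null_comparison)
    show "\<forall>\<^sub>F n in sequentially. norm (?E \<kappa> (real (Suc n)) * P (real (Suc n))) \<le> exp (- Im \<kappa> * real (Suc n)) * (real (Suc n) * 2)"
    proof (intro always_eventually allI)
      fix n
      have "norm (P (real (Suc n))) \<le> real (Suc n) * 2"
        unfolding P_def by (rule norm_integral_Icc_le) (auto intro!: continuous_intros simp: norm_mult)
      then show "norm (?E \<kappa> (real (Suc n)) * P (real (Suc n))) \<le> exp (- Im \<kappa> * real (Suc n)) * (real (Suc n) * 2)"
        unfolding norm_mult by (intro mult_mono) (auto simp: norm_exp_eq_Re)
    qed
    show "(\<lambda>n. exp (- Im \<kappa> * real (Suc n)) * (real (Suc n) * 2)) \<longlonglongrightarrow> 0" using \<kappa> by real_asymp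
  qed
  moreover have "(\<lambda>n. A (real (Suc n))) \<longlonglongrightarrow> 0 / (\<i> * (\<kappa> + ?s)) + 0 / (\<i> * (\<kappa> - ?s))"
    unfolding A_def using nz by (intro tendsto_intros dec) auto
  ultimately have "(\<lambda>n. - (?E \<kappa> (real (Suc n)) * P (real (Suc n)) - (A (real (Suc n)) - A 0)) / (2 * \<i> * \<kappa>))
      \<longlonglongrightarrow> - (0 - ((0 / (\<i> * (\<kappa> + ?s)) + 0 / (\<i> * (\<kappa> - ?s))) - A 0)) / (2 * \<i> * \<kappa>)"
    using nz by (intro tendsto_intros) auto
  then have "(\<lambda>n. fourier (tgreen (real (Suc n)) \<kappa>) \<xi>) \<longlonglongrightarrow> - A 0 / (2 * \<i> * \<kappa>)"
    by (simp add: formula)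
  then have "fourier (green \<kappa>) \<xi> = - A 0 / (2 * \<i> * \<kappa>)" by (rule LIMSEQ_unique[OF lim1])
  also have "A 0 = - \<i> * (2 * \<kappa>) / ((\<kappa> + ?s) * (\<kappa> - ?s))"
  proof -
    have "1 / (\<i> * a) + 1 / (\<i> * b) = - \<i> * (a + b) / (a * b)" if "a \<noteq> 0" "b \<noteq> 0" for a b :: complex
    proof -
      have "1 / (\<i> * a) + 1 / (\<i> * b) = - \<i> * (1 / a + 1 / b)" by (simp add: divide_inverse distrib_left)
      also have "1 / a + 1 / b = (a + b) / (a * b)" using that by (simp add: add_divide_distrib)
      finally show ?thesis by simp
    qed
    from this[OF nz(2,3)] show ?thesis by (simp add: A_def)
  qed
  also have "- (- \<i> * (2 * \<kappa>) / ((\<kappa> + ?s) * (\<kappa> - ?s))) / (2 * \<i> * \<kappa>) = 1 / ((\<kappa> + ?s) * (\<kappa> - ?s))"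
  proof -
    have "- (- \<i> * (2 * \<kappa>) / X) / (2 * \<i> * \<kappa>) = 1 / X" for X using nz(1) by (cases "X = 0") simp_all
    then show ?thesis .
  qed
  also have "(\<kappa> + ?s) * (\<kappa> - ?s) = \<kappa>\<^sup>2 - complex_of_real ((norm \<xi>)\<^sup>2)"
    by (simp add: power2_eq_square algebra_simps)
  finally show ?thesis .
qed

section \<open>The resolvent as an integral operator\<close>

text \<open>A bound for \<open>green \<kappa>\<close> common to all \<kappa> in the closed upper
  half plane; it serves as dominating function in the limit of vanishing absorption. The factor 1 /
  (4 pi) of the Newton potential is dropped.\<close>

definition newton :: "real ^ 3 \<Rightarrow> real" where
  "newton x = norm x powr (- 1)"

lemma newton_borel [measurable]: "newton \<in> borel_measurable borel"
  unfolding newton_def[abs_def] by measurable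

lemma newton_nonneg [simp]: "0 \<le> newton x"
  by (simp add: newton_def)

lemma newton_le_1: "1 < norm x \<Longrightarrow> newton x \<le> 1"
  unfolding newton_def norm_powr_minus_1 by (simp add: divide_le_eq)

lemma norm_green_le_newton: "0 \<le> Im \<kappa> \<Longrightarrow> norm (green \<kappa> x) \<le> newton x"
  unfolding newton_def norm_powr_minus_1 by (rule norm_green_le)

lemma newton_ball_finite:
  "(\<integral>\<^sup>+x. ennreal (newton x) * indicator (cball 0 1) x \<partial>lborel) < \<infinity>"
  unfolding newton_def by (intro nn_integral_norm_powr_finite) auto

text \<open>Within distance 1 of \<open>y\<close> the function \<open>w\<close> is bounded and the
  kernel integrable; beyond that distance the kernel is at most 1 and \<open>w\<close> integrable.
  Neither estimate depends on \<open>y\<close>.\<close>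

lemma nn_integral_Newton_bound:
  fixes w :: "real ^ 3 \<Rightarrow> complex"
  assumes w: "integrable lborel w" and b: "\<And>x. norm (w x) \<le> M"
  shows "\<exists>B<\<infinity>. \<forall>y. (\<integral>\<^sup>+x. ennreal (norm (w x) * newton (x - y)) \<partial>lborel) \<le> B"
proof -
  have [measurable]: "w \<in> borel_measurable borel" using w by auto
  have M: "0 \<le> M" using order_trans[OF norm_ge_zero b] .
  let ?N = "\<integral>\<^sup>+x. ennreal (newton x) * indicator (cball 0 1) x \<partial>(lborel :: (real ^ 3) measure)"
  let ?W = "\<integral>\<^sup>+x. ennreal (norm (w x)) \<partial>lborel"
  have "(\<integral>\<^sup>+x. ennreal (norm (w x) * newton (x - y)) \<partial>lborel) \<le> ennreal M * ?N + ?W" for y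
  proof -
    have "(\<integral>\<^sup>+x. ennreal (norm (w x) * newton (x - y)) \<partial>lborel)
        \<le> (\<integral>\<^sup>+x. ennreal M * (ennreal (newton (x + - y)) * indicator (cball 0 1) (x + - y)) + ennreal (norm (w x)) \<partial>lborel)"
    proof (intro nn_integral_mono)
      fix x
      show "ennreal (norm (w x) * newton (x - y))
        \<le> ennreal M * (ennreal (newton (x + - y)) * indicator (cball 0 1) (x + - y)) + ennreal (norm (w x))"
      proof (cases "norm (x - y) \<le> 1")
        case True
        have "ennreal (norm (w x) * newton (x - y)) \<le> ennreal (M * newton (x - y))"
          by (intro ennreal_leI mult_right_mono b) auto
        also have "\<dots> \<le> ennreal M * (ennreal (newton (x + - y)) * indicator (cball 0 1) (x + - y)) + ennreal (norm (w x))"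
          using True M by (simp add: ennreal_mult)
        finally show ?thesis .
      next
        case False
        have "newton (x - y) \<le> 1"
          using False by (intro newton_le_1) simp
        then have "norm (w x) * newton (x - y) \<le> norm (w x)" by (intro mult_left_le) auto
        then show ?thesis using False by (simp add: ennreal_leI)
      qed
    qed
    also have "\<dots> = ennreal M * (\<integral>\<^sup>+x. ennreal (newton (x + - y)) * indicator (cball 0 1) (x + - y) \<partial>lborel) + ?W"
      by (simp add: nn_integral_add nn_integral_cmult)
    also have "(\<integral>\<^sup>+x. ennreal (newton (x + - y)) * indicator (cball 0 1) (x + - y) \<partial>lborel) = ?N"
      by (rule nn_integral_lborel_translate[of "\<lambda>x. ennreal (newton x) * indicator (cball 0 1) x"]) measurable
    finally show ?thesis .
  qed
  moreover have "ennreal M * ?N + ?W < \<infinity>"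
    using newton_ball_finite nn_integral_norm_finite[OF w]
    by (simp add: ennreal_mult_less_top)
  ultimately show ?thesis by blast
qed

lemma Newton_product_finite:
  fixes w f :: "real ^ 3 \<Rightarrow> complex"
  assumes w: "integrable lborel w" "\<And>x. norm (w x) \<le> M" and f: "integrable lborel f"
  shows "(\<integral>\<^sup>+y. \<integral>\<^sup>+x. ennreal (norm (w x) * newton (x - y) * norm (f y)) \<partial>lborel \<partial>lborel) < \<infinity>"
proof -
  have [measurable]: "w \<in> borel_measurable borel" "f \<in> borel_measurable borel" using w f by auto
  obtain B where B: "B < \<infinity>" "\<And>y. (\<integral>\<^sup>+x. ennreal (norm (w x) * newton (x - y)) \<partial>lborel) \<le> B"
    using nn_integral_Newton_bound[OF w] by blast
  have "(\<integral>\<^sup>+y. \<integral>\<^sup>+x. ennreal (norm (w x) * newton (x - y) * norm (f y)) \<partial>lborel \<partial>lborel)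
      = (\<integral>\<^sup>+y. (\<integral>\<^sup>+x. ennreal (norm (w x) * newton (x - y)) \<partial>lborel) * ennreal (norm (f y)) \<partial>lborel)"
    by (simp add: ennreal_mult'' nn_integral_multc)
  also have "\<dots> \<le> (\<integral>\<^sup>+y. B * ennreal (norm (f y)) \<partial>lborel)"
    by (intro nn_integral_mono mult_right_mono B) auto
  also have "\<dots> = B * (\<integral>\<^sup>+y. ennreal (norm (f y)) \<partial>lborel)" by (simp add: nn_integral_cmult)
  also have "\<dots> < \<infinity>" using B(1) nn_integral_norm_finite[OF f] by (simp add: ennreal_mult_less_top)
  finally show ?thesis .
qed

lemma green_product_integrable:
  fixes w f :: "real ^ 3 \<Rightarrow> complex"
  assumes \<kappa>: "0 \<le> Im \<kappa>" and w: "integrable lborel w" "\<And>x. norm (w x) \<le> M" and f: "integrable lborel f"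
  shows "integrable (lborel \<Otimes>\<^sub>M lborel) (\<lambda>(y, x). w x * (green \<kappa> (x - y) * f y))"
proof (rule lborel_Fubini_integrable)
  have [measurable]: "w \<in> borel_measurable borel" "f \<in> borel_measurable borel" using w f by auto
  show "(\<lambda>(y, x). w x * (green \<kappa> (x - y) * f y)) \<in> borel_measurable (borel \<Otimes>\<^sub>M borel)" by measurable
  have "(\<integral>\<^sup>+y. \<integral>\<^sup>+x. ennreal (norm (w x * (green \<kappa> (x - y) * f y))) \<partial>lborel \<partial>lborel)
      \<le> (\<integral>\<^sup>+y. \<integral>\<^sup>+x. ennreal (norm (w x) * newton (x - y) * norm (f y)) \<partial>lborel \<partial>lborel)"
    by (intro nn_integral_mono ennreal_leI)
      (auto simp: norm_mult mult.assoc intro!: mult_left_mono mult_right_mono norm_green_le_newton \<kappa>)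
  also have "\<dots> < \<infinity>" by (rule Newton_product_finite[OF w f])
  finally show "(\<integral>\<^sup>+y. \<integral>\<^sup>+x. ennreal (norm (w x * (green \<kappa> (x - y) * f y))) \<partial>lborel \<partial>lborel) < \<infinity>" .
qed

text \<open>For real \<kappa> the kernel has no integrable decay, but testing with the indicator of
  a ball makes the double integral finite.\<close>

lemma ball_integrable_conv_green:
  assumes \<kappa>: "0 \<le> Im \<kappa>" and f: "integrable lborel f"
  shows "ball_integrable (conv (green \<kappa>) f)"
  unfolding ball_integrable_def
proof (intro conjI allI)
  have [measurable]: "f \<in> borel_measurable borel" using f by auto
  show "conv (green \<kappa>) f \<in> borel_measurable borel" by measurable
  fix R
  have "integrable lborel (\<lambda>x::real ^ 3. indicator (cball 0 R) x :: complex)"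
    by (rule integrable_of_bounded_compact[where M=1 and R="R + 1"]) (auto simp: indicator_def)
  then have "integrable (lborel \<Otimes>\<^sub>M lborel) (\<lambda>(y, x). indicator (cball 0 R) x * (green \<kappa> (x - y) * f y))"
    by (intro green_product_integrable[where M=1] \<kappa> f) (auto simp: indicator_def)
  from lborel_pair.integrable_snd[OF this]
  show "integrable lborel (\<lambda>x. indicator (cball 0 R) x *\<^sub>R conv (green \<kappa>) f x)"
    by (rule Bochner_Integration.integrable_cong[THEN iffD1, OF refl, rotated]) (auto simp: conv_def indicator_def)
qed

lemma conv_green_test_Fubini:
  fixes \<phi> f :: "real ^ 3 \<Rightarrow> complex"
  assumes \<kappa>: "0 \<le> Im \<kappa>" and f: "integrable lborel f" and \<phi>: "\<phi> \<in> test_functions"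
  shows "(LINT x|lborel. conv (green \<kappa>) f x * \<phi> x)
    = (LINT p|(lborel \<Otimes>\<^sub>M lborel). (case p of (y, x) \<Rightarrow> \<phi> x * (green \<kappa> (x - y) * f y)))"
proof -
  obtain M where "\<And>x. norm (\<phi> x) \<le> M" using \<phi> by (rule test_function_bounded) blast
  then have "integrable (lborel \<Otimes>\<^sub>M lborel) (\<lambda>(y, x). \<phi> x * (green \<kappa> (x - y) * f y))"
    by (intro green_product_integrable[OF \<kappa> test_function_integrable[OF \<phi>] _ f])
  from lborel_pair.integral_snd[OF this]
  show ?thesis by (simp add: conv_def mult.commute)
qed

text \<open>Limiting absorption. For positive \<epsilon> the symbol is the transform of the Green
  function at the root \<open>\<kappa> \<epsilon>\<close> of k^2 + i \<epsilon>. Its real part is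
  nonnegative, so its imaginary part is positive; as \<epsilon> tends to 0 the root tends to
  \<open>k\<close> and not to \<open>- k\<close>, which selects the outgoing kernel.\<close>

lemma resolvent_eq_conv_green:
  fixes \<phi> F f :: "real ^ 3 \<Rightarrow> complex"
  assumes k: "0 < k" and f: "integrable lborel f" and F: "AE x in lborel. F x = f x" and \<phi>: "\<phi> \<in> test_functions"
  shows "resolvent k F \<phi> = (LINT x|lborel. conv (green (complex_of_real k)) f x * \<phi> x)"
proof -
  have [measurable]: "f \<in> borel_measurable borel" "\<phi> \<in> borel_measurable borel"
    using f test_function_borel[OF \<phi>] by auto
  have "fourier F = fourier f"
    by (intro fourier_cong_AE F lebesgue_measurable_of_AE[OF _ F] measurable_completion) auto
  then have R: "resolvent k F \<phi> = outgoing_symbol k (\<lambda>\<xi>. fourier f \<xi> * inv_fourier \<phi> \<xi>)"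
    by (simp add: resolvent_def inv_fourier_distr_def)
  define \<kappa> where "\<kappa> \<epsilon> = csqrt (complex_of_real (k\<^sup>2) + \<i> * complex_of_real \<epsilon>)" for \<epsilon>
  have \<kappa>2: "(\<kappa> \<epsilon>)\<^sup>2 = complex_of_real (k\<^sup>2) + \<i> * complex_of_real \<epsilon>" for \<epsilon> by (simp add: \<kappa>_def)
  have \<kappa>pos: "0 < Im (\<kappa> \<epsilon>)" if "0 < \<epsilon>" for \<epsilon>
  proof -
    have "Im ((\<kappa> \<epsilon>)\<^sup>2) = \<epsilon>" unfolding \<kappa>2 by simp
    then have "2 * Re (\<kappa> \<epsilon>) * Im (\<kappa> \<epsilon>) = \<epsilon>" by (simp add: power2_eq_square mult_ac)
    moreover have "0 \<le> Re (\<kappa> \<epsilon>)" unfolding \<kappa>_def by (rule Re_csqrt)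
    ultimately show ?thesis using that by (smt (verit) mult_nonneg_nonpos)
  qed
  have I: "(LINT \<xi>|lebesgue. fourier f \<xi> * inv_fourier \<phi> \<xi> / (complex_of_real (- (norm \<xi>)\<^sup>2 + k\<^sup>2) + \<i> * complex_of_real \<epsilon>))
      = (LINT x|lborel. conv (green (\<kappa> \<epsilon>)) f x * \<phi> x)" if \<epsilon>: "0 < \<epsilon>" for \<epsilon>
  proof -
    have "(LINT \<xi>|lebesgue. fourier f \<xi> * inv_fourier \<phi> \<xi> / (complex_of_real (- (norm \<xi>)\<^sup>2 + k\<^sup>2) + \<i> * complex_of_real \<epsilon>))
        = (LINT \<xi>|lborel. fourier f \<xi> * inv_fourier \<phi> \<xi> / (complex_of_real (- (norm \<xi>)\<^sup>2 + k\<^sup>2) + \<i> * complex_of_real \<epsilon>))"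
      by (rule integral_completion) measurable
    also have "\<dots> = (LINT \<xi>|lborel. fourier (conv (green (\<kappa> \<epsilon>)) f) \<xi> * inv_fourier \<phi> \<xi>)"
      by (simp add: fourier_conv[OF integrable_green[OF \<kappa>pos[OF \<epsilon>]] f] fourier_green[OF \<kappa>pos[OF \<epsilon>]] \<kappa>2 algebra_simps)
    also have "\<dots> = (LINT x|lborel. conv (green (\<kappa> \<epsilon>)) f x * \<phi> x)"
      by (rule integral_mult_test[OF integrable_conv[OF integrable_green[OF \<kappa>pos[OF \<epsilon>]] f] \<phi>, symmetric])
    finally show ?thesis .
  qed
  obtain M where M: "\<And>x. norm (\<phi> x) \<le> M" using \<phi> by (rule test_function_bounded) blast
  have lim: "((\<lambda>\<epsilon>. LINT x|lborel. conv (green (\<kappa> \<epsilon>)) f x * \<phi> x) \<longlongrightarrow> (LINT x|lborel. conv (green (complex_of_real k)) f x * \<phi> x)) (at_right 0)"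
  proof (rule tendsto_at_right_sequentially[of 0 1])
    fix s :: "nat \<Rightarrow> real" assume s: "\<And>n. 0 < s n" "s \<longlonglongrightarrow> 0"
    have k': "complex_of_real (k\<^sup>2) \<notin> \<real>\<^sub>\<le>\<^sub>0" using k by (simp del: of_real_power)
    have "(\<lambda>n. \<kappa> (s n)) \<longlonglongrightarrow> csqrt (complex_of_real (k\<^sup>2) + \<i> * complex_of_real 0)"
      unfolding \<kappa>_def using k' s
      by (intro isCont_tendsto_compose[where g=csqrt] tendsto_intros continuous_at_csqrt) auto
    also have "csqrt (complex_of_real (k\<^sup>2) + \<i> * complex_of_real 0) = complex_of_real k"
      using k by (simp add: csqrt_square flip: of_real_power)
    finally have \<kappa>lim: "(\<lambda>n. \<kappa> (s n)) \<longlonglongrightarrow> complex_of_real k" .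
    \<comment> \<open>The limit is taken on the product space, where the Newton kernel gives an
      integrable bound independent of \<epsilon>.\<close>
    have dom: "integrable (lborel \<Otimes>\<^sub>M lborel) (\<lambda>(y, x). norm (\<phi> x) * newton (x - y) * norm (f y))"
    proof (rule integrableI_bounded)
      show "(\<lambda>(y, x). norm (\<phi> x) * newton (x - y) * norm (f y)) \<in> borel_measurable (lborel \<Otimes>\<^sub>M lborel)"
        by measurable
      have "(\<integral>\<^sup>+p. ennreal (norm (case p of (y, x) \<Rightarrow> norm (\<phi> x) * newton (x - y) * norm (f y))) \<partial>(lborel \<Otimes>\<^sub>M lborel))
          = (\<integral>\<^sup>+y. \<integral>\<^sup>+x. ennreal (norm (\<phi> x) * newton (x - y) * norm (f y)) \<partial>lborel \<partial>lborel)"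
        by (subst lborel.nn_integral_fst[symmetric]) auto
      also have "\<dots> < \<infinity>" by (rule Newton_product_finite[OF test_function_integrable[OF \<phi>] M f])
      finally show "(\<integral>\<^sup>+p. ennreal (norm (case p of (y, x) \<Rightarrow> norm (\<phi> x) * newton (x - y) * norm (f y))) \<partial>(lborel \<Otimes>\<^sub>M lborel)) < \<infinity>" .
    qed
    have "(\<lambda>n. LINT p|(lborel \<Otimes>\<^sub>M lborel). (case p of (y, x) \<Rightarrow> \<phi> x * (green (\<kappa> (s n)) (x - y) * f y)))
        \<longlonglongrightarrow> (LINT p|(lborel \<Otimes>\<^sub>M lborel). (case p of (y, x) \<Rightarrow> \<phi> x * (green (complex_of_real k) (x - y) * f y)))"
    proof (rule integral_dominated_convergence[OF _ _ dom])
      show "AE p in lborel \<Otimes>\<^sub>M lborel. (\<lambda>n. case p of (y, x) \<Rightarrow> \<phi> x * (green (\<kappa> (s n)) (x - y) * f y))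
          \<longlonglongrightarrow> (case p of (y, x) \<Rightarrow> \<phi> x * (green (complex_of_real k) (x - y) * f y))"
      proof (intro AE_I2)
        fix p :: "(real ^ 3) \<times> (real ^ 3)"
        obtain y x where p: "p = (y, x)" by (cases p)
        have "(\<lambda>n. green (\<kappa> (s n)) (x - y)) \<longlonglongrightarrow> green (complex_of_real k) (x - y)"
        proof (cases "x = y")
          case False
          then show ?thesis unfolding green_def by (intro tendsto_intros \<kappa>lim) auto
        qed (simp add: green_def)
        then show "(\<lambda>n. case p of (y, x) \<Rightarrow> \<phi> x * (green (\<kappa> (s n)) (x - y) * f y))
          \<longlonglongrightarrow> (case p of (y, x) \<Rightarrow> \<phi> x * (green (complex_of_real k) (x - y) * f y))"
          unfolding p by (simp, intro tendsto_intros)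
      qed
      show "AE p in lborel \<Otimes>\<^sub>M lborel. norm (case p of (y, x) \<Rightarrow> \<phi> x * (green (\<kappa> (s n)) (x - y) * f y))
          \<le> (case p of (y, x) \<Rightarrow> norm (\<phi> x) * newton (x - y) * norm (f y))" for n
        using norm_green_le_newton[OF less_imp_le[OF \<kappa>pos[OF s(1)[of n]]]]
        by (intro AE_I2) (auto simp: norm_mult mult.assoc intro!: mult_left_mono mult_right_mono)
    qed measurable
    then show "(\<lambda>n. LINT x|lborel. conv (green (\<kappa> (s n))) f x * \<phi> x) \<longlonglongrightarrow> (LINT x|lborel. conv (green (complex_of_real k)) f x * \<phi> x)"
      using less_imp_le[OF \<kappa>pos[OF s(1)]] by (simp add: conv_green_test_Fubini[OF _ f \<phi>])
  qed simp
  show ?thesis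
    unfolding R outgoing_symbol_def
  proof (rule tendsto_Lim)
    show "((\<lambda>\<epsilon>. LINT \<xi>|lebesgue. fourier f \<xi> * inv_fourier \<phi> \<xi> / (complex_of_real (- (norm \<xi>)\<^sup>2 + k\<^sup>2) + \<i> * complex_of_real \<epsilon>))
        \<longlongrightarrow> (LINT x|lborel. conv (green (complex_of_real k)) f x * \<phi> x)) (at_right 0)"
      using lim by (rule Lim_transform_eventually)
        (rule eventually_mono[OF eventually_at_right_less], simp only: I)
  qed simp
qed

section \<open>The Born series on the Fourier side\<close>

lemma ennreal_power2_le_imp_le_sqrt:
  assumes "X\<^sup>2 \<le> ennreal y" "0 \<le> y" shows "X \<le> ennreal (sqrt y)"
proof (cases X)
  case (real r)
  then have "r\<^sup>2 \<le> y" using assms by (simp add: ennreal_power)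
  then show ?thesis using real by (simp add: real_le_rsqrt ennreal_leI)
next
  case top
  then show ?thesis using assms by (simp add: power2_eq_square ennreal_top_mult top_unique)
qed

lemma jap_powr_square: "(jap x powr p)\<^sup>2 = jap x powr (2 * p)"
  unfolding power2_eq_square powr_add[symmetric] by simp

text \<open>The weighted inequality of arithmetic and geometric means, without its factor 1 / 2. The
  weight \<open>t\<close> will be a power of 1 / 2, which transfers decay in \<open>n\<close> from
  one summand to the other.\<close>

lemma ennreal_power2_le_imp_AM_GM:
  assumes "(ennreal x)\<^sup>2 \<le> P * R" "0 < t" "0 \<le> x"
  shows "ennreal x \<le> ennreal t * P + R * ennreal (1 / t)"
proof (cases "P = \<top> \<or> R = \<top>")
  case True
  then show ?thesis using assms(2) by (auto simp: ennreal_mult_top ennreal_top_mult)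
next
  case False
  then obtain p r where p: "P = ennreal p" "0 \<le> p" and r: "R = ennreal r" "0 \<le> r"
    by (cases P; cases R) auto
  have "x\<^sup>2 \<le> p * r" using assms p r by (simp add: ennreal_power ennreal_mult[symmetric])
  also have "\<dots> = (t * p) * (r / t)" using assms(2) by simp
  also have "\<dots> \<le> (t * p + r / t)\<^sup>2"
    using assms(2) p r by (simp add: power2_sum)
  finally have "x \<le> t * p + r / t"
    using assms(2) p r by (intro power2_le_imp_le[of x]) auto
  then show ?thesis
    using assms(2) p r by (simp add: ennreal_mult[symmetric] ennreal_plus[symmetric] ennreal_leI del: ennreal_plus)
qed

text \<open>Collects what the Sobolev assumption contributes: an integrable Borel representative
  vanishing everywhere off a ball, and the weighted square integrability of its transform.\<close>

locale potential = smooth_cutoff C \<eta> for C and \<eta> :: "real \<Rightarrow> real" +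
  fixes q :: "real ^ 3 \<Rightarrow> complex" and \<rho> \<alpha> :: real
  assumes q_int: "integrable lborel q" and \<rho>_pos: "0 < \<rho>"
    and q_support: "\<And>x. \<rho> < norm x \<Longrightarrow> q x = 0" and \<alpha>: "1 < \<alpha>"
    and q_weighted: "(\<integral>\<^sup>+\<xi>. ennreal (jap \<xi> powr (2 * \<alpha>) * (norm (fourier q \<xi>))\<^sup>2) \<partial>lborel) < \<infinity>"
begin

lemma q_borel [measurable]: "q \<in> borel_measurable borel"
  using q_int by auto

text \<open>Two points of the ball of radius \<rho> are at most \<open>2 * \<rho>\<close> apart, so
  the truncation is invisible between points of the support.\<close>

definition ker :: "real \<Rightarrow> real ^ 3 \<Rightarrow> complex" where
  "ker k = tgreen (2 * \<rho>) (complex_of_real k)"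

definition kh :: "real \<Rightarrow> real ^ 3 \<Rightarrow> complex" where
  "kh k \<xi> = (LINT x|lborel. cis (- (\<xi> \<bullet> x)) * ker k x)"

definition Q :: "real ^ 3 \<Rightarrow> ennreal" where
  "Q \<xi> = ennreal (jap \<xi> powr (2 * \<alpha>) * (norm (fourier q \<xi>))\<^sup>2)"

definition S :: real where "S = enn2real (\<integral>\<^sup>+\<xi>. Q \<xi> \<partial>lborel)"

text \<open>The integral is finite because \<alpha> > 1 puts the exponent above the dimension
  3.\<close>

definition J :: real where
  "J = enn2real (\<integral>\<^sup>+z. ennreal (jap z powr (- (2 * \<alpha> + 1))) \<partial>(lborel :: (real ^ 3) measure))"

text \<open>The first factors are the constant of \<open>fourier_tgreen_square_le\<close> at
  \<open>D = 2 * \<rho>\<close>; the factor \<open>2 * J\<close> is the mass of the two summands in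
  \<open>jap_product_le\<close>.\<close>

definition A :: real where "A = 8 * (2 * \<rho>)\<^sup>2 * (2 * J)"

lemma ker_borel [measurable]: "ker k \<in> borel_measurable borel"
  unfolding ker_def by measurable

text \<open>Measurability jointly in the wave number is required, because the backscattering
  amplitude at \<xi> is taken at \<open>k = norm \<xi> / 2\<close>.\<close>

lemma ker_borel_pair: "(\<lambda>p. ker (fst p) (snd p)) \<in> borel_measurable (borel \<Otimes>\<^sub>M borel)"
proof -
  have eq: "ker (fst p) (snd p) = indicator (cball 0 (2 * \<rho>)) (snd p) * (- cis (fst p * norm (snd p))) / complex_of_real (4 * pi * norm (snd p))" for p
    by (cases "norm (snd p) \<le> 2 * \<rho>") (simp_all add: ker_def tgreen_def green_def cis_conv_exp indicator_def mult_ac)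
  have [measurable]: "cball (0 :: real ^ 3) (2 * \<rho>) \<in> sets borel" by simp
  show ?thesis unfolding eq by measurable
qed

lemma integrable_ker: "integrable lborel (ker k)"
  unfolding ker_def using \<rho>_pos by (intro integrable_tgreen) auto

lemma kh_eq: "kh k = fourier (ker k)"
  by (rule ext) (simp add: kh_def fourier_lborel)

lemma kh_borel [measurable]: "kh k \<in> borel_measurable borel"
  unfolding kh_eq by measurable

lemma kh_borel_pair [measurable (raw)]:
  assumes "f \<in> borel_measurable N" "g \<in> borel_measurable N"
  shows "(\<lambda>x. kh (f x) (g x)) \<in> borel_measurable N"
proof -
  have [measurable]: "(\<lambda>x. ker (f x) (g x)) \<in> borel_measurable M"
    if [measurable]: "f \<in> borel_measurable M" "g \<in> borel_measurable M" for f g and M :: "'z measure"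
    using measurable_compose[OF measurable_Pair[OF that] ker_borel_pair] by simp
  have "(\<lambda>p. kh (fst p) (snd p)) \<in> borel_measurable (borel \<Otimes>\<^sub>M borel)"
    unfolding kh_def by measurable
  from measurable_compose[OF measurable_Pair[OF assms] this] show ?thesis by simp
qed

lemma kh_minus: "kh k (- \<xi>) = kh k \<xi>"
  using integral_lborel_reflect[of "\<lambda>x. cis (- (\<xi> \<bullet> x)) * ker k x" 0]
  by (simp add: kh_def ker_def tgreen_minus)

lemma Q_borel [measurable]: "Q \<in> borel_measurable borel"
  unfolding Q_def[abs_def] by measurable

lemma nn_integral_Q: "(\<integral>\<^sup>+\<xi>. Q \<xi> \<partial>lborel) = ennreal S"
  unfolding S_def using q_weighted by (simp add: Q_def[abs_def])

lemma S_nonneg [simp]: "0 \<le> S"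
  by (simp add: S_def)

lemma nn_integral_J:
  "(\<integral>\<^sup>+z. ennreal (jap z powr (- (2 * \<alpha> + 1))) \<partial>(lborel :: (real ^ 3) measure)) = ennreal J"
proof -
  have "integrable lborel (\<lambda>z::real ^ 3. jap z powr (- (2 * \<alpha> + 1)))"
    using \<alpha> by (intro integrable_jap_powr) simp
  from nn_integral_norm_finite[OF this] show ?thesis by (simp add: J_def)
qed

lemma J_nonneg [simp]: "0 \<le> J"
  by (simp add: J_def)

lemma A_nonneg [simp]: "0 \<le> A"
  by (simp add: A_def)

lemma norm_kh_square_le: "1 \<le> k \<Longrightarrow> (norm (kh k \<xi>))\<^sup>2 \<le> 8 * (2 * \<rho>)\<^sup>2 / k * jap \<xi> powr (- 1)"
  unfolding kh_eq ker_def using \<rho>_pos by (intro fourier_tgreen_square_le) auto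

text \<open>Give both powers to the smaller of the two brackets. The resulting sum has an integral
  that does not depend on how the two brackets are shifted against each other.\<close>

lemma jap_product_le:
  "jap u powr (- 2 * \<alpha>) * jap v powr (- 1) \<le> jap u powr (- (2 * \<alpha> + 1)) + jap v powr (- (2 * \<alpha> + 1))"
proof (cases "jap u \<le> jap v")
  case True
  then have "jap v powr (- 1) \<le> jap u powr (- 1)"
    by (intro powr_mono2') (auto simp: jap_pos)
  then have "jap u powr (- 2 * \<alpha>) * jap v powr (- 1) \<le> jap u powr (- 2 * \<alpha>) * jap u powr (- 1)"
    by (intro mult_left_mono) auto
  also have "\<dots> = jap u powr (- (2 * \<alpha> + 1))" unfolding powr_add[symmetric] by simp
  finally show ?thesis by (rule order_trans) simp
next
  case False
  then have "jap u powr (- 2 * \<alpha>) \<le> jap v powr (- 2 * \<alpha>)"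
    using \<alpha> by (intro powr_mono2') (auto simp: jap_pos)
  then have "jap u powr (- 2 * \<alpha>) * jap v powr (- 1) \<le> jap v powr (- 2 * \<alpha>) * jap v powr (- 1)"
    by (intro mult_right_mono) auto
  also have "\<dots> = jap v powr (- (2 * \<alpha> + 1))" unfolding powr_add[symmetric] by simp
  finally show ?thesis by (rule order_trans) simp
qed

lemma weighted_kernel_bound:
  assumes k: "1 \<le> k"
  shows "(\<integral>\<^sup>+z. ennreal (jap (z - a) powr (- 2 * \<alpha>) * (norm (kh k (z + c)))\<^sup>2) \<partial>lborel) \<le> ennreal (A / k)"
proof -
  let ?e = "- (2 * \<alpha> + 1)" and ?m = "8 * (2 * \<rho>)\<^sup>2 / k"
  have m: "0 \<le> ?m" using k by simp
  have shift: "(\<integral>\<^sup>+z. ennreal (jap (z + b) powr ?e) \<partial>(lborel :: (real ^ 3) measure)) = ennreal J" for b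
    unfolding nn_integral_J[symmetric] by (rule nn_integral_lborel_translate) measurable
  have "(\<integral>\<^sup>+z. ennreal (jap (z - a) powr (- 2 * \<alpha>) * (norm (kh k (z + c)))\<^sup>2) \<partial>lborel)
      \<le> (\<integral>\<^sup>+z. ennreal ?m * (ennreal (jap (z + - a) powr ?e) + ennreal (jap (z + c) powr ?e)) \<partial>lborel)"
  proof (intro nn_integral_mono)
    fix z
    have "jap (z - a) powr (- 2 * \<alpha>) * (norm (kh k (z + c)))\<^sup>2
        \<le> jap (z - a) powr (- 2 * \<alpha>) * (?m * jap (z + c) powr (- 1))"
      by (intro mult_left_mono norm_kh_square_le k) auto
    also have "\<dots> = ?m * (jap (z - a) powr (- 2 * \<alpha>) * jap (z + c) powr (- 1))" by (simp add: mult_ac)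
    also have "\<dots> \<le> ?m * (jap (z - a) powr ?e + jap (z + c) powr ?e)"
      by (intro mult_left_mono jap_product_le m)
    finally have "ennreal (jap (z - a) powr (- 2 * \<alpha>) * (norm (kh k (z + c)))\<^sup>2)
        \<le> ennreal (?m * (jap (z - a) powr ?e + jap (z + c) powr ?e))" by (rule ennreal_leI)
    also have "\<dots> = ennreal ?m * (ennreal (jap (z + - a) powr ?e) + ennreal (jap (z + c) powr ?e))"
      using m by (simp only: ennreal_mult'[OF m] ennreal_plus[OF powr_ge_zero powr_ge_zero] diff_conv_add_uminus)
    finally show "ennreal (jap (z - a) powr (- 2 * \<alpha>) * (norm (kh k (z + c)))\<^sup>2)
        \<le> ennreal ?m * (ennreal (jap (z + - a) powr ?e) + ennreal (jap (z + c) powr ?e))" .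
  qed
  also have "\<dots> = ennreal ?m * ((\<integral>\<^sup>+z. ennreal (jap (z + - a) powr ?e) \<partial>lborel) + (\<integral>\<^sup>+z. ennreal (jap (z + c) powr ?e) \<partial>lborel))"
    by (subst nn_integral_cmult, measurable, subst nn_integral_add) auto
  also have "\<dots> = ennreal ?m * (ennreal J + ennreal J)" unfolding shift ..
  also have "\<dots> = ennreal (A / k)"
    using m by (simp add: A_def ennreal_mult[symmetric] flip: ennreal_plus)
  finally show ?thesis .
qed

section \<open>The contraction on bounded functions\<close>

definition \<theta> :: "real \<Rightarrow> real" where "\<theta> k = sqrt (S * (A / k))"

text \<open>In the Cauchy-Schwarz inequality the weight goes to \<open>fourier q\<close>, where it
  yields the mass \<open>S\<close>, and the inverse weight to \<open>kh k\<close>, whose weighted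
  square has an integral bounded uniformly in \<zeta>.\<close>

lemma product_kernel_bound:
  assumes k: "1 \<le> k"
  shows "(\<integral>\<^sup>+\<eta>. ennreal (norm (fourier q (\<zeta> - \<eta>) * kh k \<eta>)) \<partial>lborel) \<le> ennreal (\<theta> k)"
proof -
  define f where "f \<eta> = ennreal (jap (\<zeta> - \<eta>) powr \<alpha> * norm (fourier q (\<zeta> - \<eta>)))" for \<eta>
  define g where "g \<eta> = ennreal (jap (\<zeta> - \<eta>) powr (- \<alpha>) * norm (kh k \<eta>))" for \<eta>
  have [measurable]: "f \<in> borel_measurable borel" "g \<in> borel_measurable borel"
    unfolding f_def[abs_def] g_def[abs_def] by measurable
  have "ennreal (norm (fourier q (\<zeta> - \<eta>) * kh k \<eta>)) = f \<eta> * g \<eta>" for \<eta>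
    using jap_pos[of "\<zeta> - \<eta>"]
    by (simp add: f_def g_def ennreal_mult'[symmetric] norm_mult powr_minus_divide)
  then have "(\<integral>\<^sup>+\<eta>. ennreal (norm (fourier q (\<zeta> - \<eta>) * kh k \<eta>)) \<partial>lborel)\<^sup>2
      \<le> (\<integral>\<^sup>+\<eta>. (f \<eta>)\<^sup>2 \<partial>lborel) * (\<integral>\<^sup>+\<eta>. (g \<eta>)\<^sup>2 \<partial>lborel)"
    using Cauchy_Schwarz_nn_integral[of f lborel g] by simp
  also have "(\<integral>\<^sup>+\<eta>. (f \<eta>)\<^sup>2 \<partial>lborel) = (\<integral>\<^sup>+\<eta>. Q (\<zeta> - \<eta>) \<partial>lborel)"
    by (intro nn_integral_cong)
      (simp add: f_def Q_def ennreal_power power_mult_distrib jap_powr_square)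
  also have "\<dots> = ennreal S"
    unfolding nn_integral_Q[symmetric] by (rule nn_integral_lborel_reflect) measurable
  also have "(\<integral>\<^sup>+\<eta>. (g \<eta>)\<^sup>2 \<partial>lborel) \<le> ennreal (A / k)"
  proof -
    have "(g \<eta>)\<^sup>2 = ennreal (jap (\<eta> - \<zeta>) powr (- 2 * \<alpha>) * (norm (kh k (\<eta> + 0)))\<^sup>2)" for \<eta>
      using jap_minus[of "\<eta> - \<zeta>"]
      by (simp add: g_def ennreal_power power_mult_distrib jap_powr_square)
    then show ?thesis using weighted_kernel_bound[OF k, of \<zeta> 0] by simp
  qed
  also have "ennreal S * ennreal (A / k) = ennreal (S * (A / k))" by (rule ennreal_mult'[symmetric]) simp
  finally have "(\<integral>\<^sup>+\<eta>. ennreal (norm (fourier q (\<zeta> - \<eta>) * kh k \<eta>)) \<partial>lborel)\<^sup>2 \<le> ennreal (S * (A / k))"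
    by (simp add: mult_left_mono)
  then show ?thesis unfolding \<theta>_def using k by (intro ennreal_power2_le_imp_le_sqrt) auto
qed

lemma integrable_product_kernel:
  assumes k: "1 \<le> k"
  shows "integrable lborel (\<lambda>\<eta>. fourier q (\<zeta> - \<eta>) * kh k \<eta>)"
  using product_kernel_bound[OF k, of \<zeta>] by (intro integrableI_bounded) (auto intro: le_less_trans)

lemma integral_product_kernel_le:
  assumes k: "1 \<le> k"
  shows "(LINT \<eta>|lborel. norm (fourier q (\<zeta> - \<eta>) * kh k \<eta>)) \<le> \<theta> k"
proof -
  have "ennreal (LINT \<eta>|lborel. norm (fourier q (\<zeta> - \<eta>) * kh k \<eta>)) \<le> ennreal (\<theta> k)"
    using product_kernel_bound[OF k, of \<zeta>] integrable_product_kernel[OF k]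
    by (subst nn_integral_eq_integral[symmetric]) auto
  then show ?thesis using k by (simp add: \<theta>_def)
qed

text \<open>On the Fourier side, convolution with \<open>ker k\<close> followed by multiplication by
  \<open>q\<close>; the constant is the one with which products become convolutions.\<close>

definition T :: "real \<Rightarrow> (real ^ 3 \<Rightarrow> complex) \<Rightarrow> real ^ 3 \<Rightarrow> complex" where
  "T k w \<zeta> = (LINT \<eta>|lborel. fourier q (\<zeta> - \<eta>) * kh k \<eta> * w \<eta>) / complex_of_real ((2 * pi) ^ 3)"

lemma integrable_T_integrand:
  assumes k: "1 \<le> k" and [measurable]: "w \<in> borel_measurable borel" and w: "\<And>\<eta>. norm (w \<eta>) \<le> M"
  shows "integrable lborel (\<lambda>\<eta>. fourier q (\<zeta> - \<eta>) * kh k \<eta> * w \<eta>)"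
  by (rule Bochner_Integration.integrable_bound[OF integrable_mult_right[OF integrable_norm[OF integrable_product_kernel[OF k, of \<zeta>]], of M]])
    (auto simp: norm_mult abs_mult mult.commute[of _ "norm (w _)"] intro!: AE_I2 mult_right_mono order_trans[OF w abs_ge_self])

lemma norm_divide_2pi_le: "norm (z / complex_of_real ((2 * pi) ^ 3)) \<le> norm z"
proof -
  have "1 \<le> (2 * pi) ^ 3" using pi_gt3 by (intro one_le_power) auto
  then show ?thesis
    by (simp add: norm_divide norm_mult norm_power power_mult_distrib divide_le_eq mult_le_cancel_left1)
qed

lemma norm_T_le:
  assumes k: "1 \<le> k" and [measurable]: "w \<in> borel_measurable borel" and w: "\<And>\<eta>. norm (w \<eta>) \<le> M"
  shows "norm (T k w \<zeta>) \<le> \<theta> k * M"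
proof -
  have M: "0 \<le> M" using order_trans[OF norm_ge_zero w] .
  have "norm (T k w \<zeta>) \<le> norm (LINT \<eta>|lborel. fourier q (\<zeta> - \<eta>) * kh k \<eta> * w \<eta>)"
    unfolding T_def by (rule norm_divide_2pi_le)
  also have "\<dots> \<le> (LINT \<eta>|lborel. norm (fourier q (\<zeta> - \<eta>) * kh k \<eta>) * M)"
  proof (rule order_trans[OF integral_norm_bound integral_mono[OF integrable_norm]])
    show "integrable lborel (\<lambda>\<eta>. fourier q (\<zeta> - \<eta>) * kh k \<eta> * w \<eta>)"
      by (rule integrable_T_integrand[OF k _ w]) measurable
    show "integrable lborel (\<lambda>\<eta>. norm (fourier q (\<zeta> - \<eta>) * kh k \<eta>) * M)"
      by (intro integrable_mult_left integrable_norm integrable_product_kernel k)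
    show "norm (fourier q (\<zeta> - \<eta>) * kh k \<eta> * w \<eta>) \<le> norm (fourier q (\<zeta> - \<eta>) * kh k \<eta>) * M" for \<eta>
      unfolding norm_mult[of _ "w \<eta>"] by (intro mult_left_mono w) auto
  qed
  also have "\<dots> = (LINT \<eta>|lborel. norm (fourier q (\<zeta> - \<eta>) * kh k \<eta>)) * M" by simp
  also have "\<dots> \<le> \<theta> k * M" by (intro mult_right_mono integral_product_kernel_le k M)
  finally show ?thesis .
qed

text \<open>The weight is at least 1, so the transform is square integrable. The purpose is the
  pairing of \<open>q\<close> with the kernel, which is square integrable as well but
  unbounded.\<close>

lemma q_square_integrable: "(\<integral>\<^sup>+x. (ennreal (norm (q x)))\<^sup>2 \<partial>lborel) < \<infinity>"
proof -
  have "(\<integral>\<^sup>+\<xi>. ennreal ((norm (fourier q \<xi>))\<^sup>2) \<partial>lborel) \<le> (\<integral>\<^sup>+\<xi>. Q \<xi> \<partial>lborel)"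
    unfolding Q_def using \<alpha>
    by (intro nn_integral_mono ennreal_leI) (simp add: mult_le_cancel_right1 ge_one_powr_ge_zero jap_ge_1)
  then have "(\<integral>\<^sup>+\<xi>. ennreal ((norm (fourier q \<xi>))\<^sup>2) \<partial>lborel) < \<infinity>"
    unfolding nn_integral_Q by (rule le_less_trans) simp
  from square_integrable_of_fourier[OF q_int this] show ?thesis by (simp add: ennreal_power)
qed

text \<open>Cauchy-Schwarz: |x|^(-2) is integrable over balls in dimension 3, so the truncated
  kernel is square integrable, and translations leave its norm unchanged.\<close>

lemma q_ker_bound: "\<exists>B<\<infinity>. \<forall>z. (\<integral>\<^sup>+x. ennreal (norm (q x * ker k (x - z))) \<partial>lborel) \<le> B"
proof -
  let ?q = "\<integral>\<^sup>+x. (ennreal (norm (q x)))\<^sup>2 \<partial>lborel" and ?k = "\<integral>\<^sup>+x. (ennreal (norm (ker k x)))\<^sup>2 \<partial>lborel"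
  have fin: "?q < \<infinity>" "?k < \<infinity>"
    using q_square_integrable tgreen_square_integrable[of "complex_of_real k" "2 * \<rho>"] \<rho>_pos by (auto simp: ker_def)
  then have B: "?q * ?k = ennreal (enn2real (?q * ?k))" by (simp add: ennreal_mult_less_top)
  have "(\<integral>\<^sup>+x. ennreal (norm (q x * ker k (x - z))) \<partial>lborel) \<le> ennreal (sqrt (enn2real (?q * ?k)))" for z
  proof (rule ennreal_power2_le_imp_le_sqrt)
    have "(\<integral>\<^sup>+x. ennreal (norm (q x * ker k (x - z))) \<partial>lborel)\<^sup>2
        = (\<integral>\<^sup>+x. ennreal (norm (q x)) * ennreal (norm (ker k (x + - z))) \<partial>lborel)\<^sup>2"
      by (simp add: norm_mult ennreal_mult)
    also have "\<dots> \<le> ?q * (\<integral>\<^sup>+x. (ennreal (norm (ker k (x + - z))))\<^sup>2 \<partial>lborel)"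
      by (rule Cauchy_Schwarz_nn_integral) measurable
    also have "(\<integral>\<^sup>+x. (ennreal (norm (ker k (x + - z))))\<^sup>2 \<partial>lborel) = ?k"
      by (rule nn_integral_lborel_translate) measurable
    finally show "(\<integral>\<^sup>+x. ennreal (norm (q x * ker k (x - z))) \<partial>lborel)\<^sup>2 \<le> ennreal (enn2real (?q * ?k))"
      by (simp only: B[symmetric])
  qed simp
  then show ?thesis by (intro exI[of _ "ennreal (sqrt (enn2real (?q * ?k)))"]) simp
qed

lemma q_conv_ker_finite:
  assumes h: "integrable lborel h"
  shows "(\<integral>\<^sup>+z. \<integral>\<^sup>+x. ennreal (norm (q x * ker k (x - z) * h z)) \<partial>lborel \<partial>lborel) < \<infinity>"
proof -
  have [measurable]: "h \<in> borel_measurable borel" using h by auto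
  obtain B where B: "B < \<infinity>" "\<And>z. (\<integral>\<^sup>+x. ennreal (norm (q x * ker k (x - z))) \<partial>lborel) \<le> B"
    using q_ker_bound by blast
  have "(\<integral>\<^sup>+z. \<integral>\<^sup>+x. ennreal (norm (q x * ker k (x - z) * h z)) \<partial>lborel \<partial>lborel)
      = (\<integral>\<^sup>+z. (\<integral>\<^sup>+x. ennreal (norm (q x * ker k (x - z))) \<partial>lborel) * ennreal (norm (h z)) \<partial>lborel)"
    unfolding norm_mult[of _ "h _"] by (simp add: ennreal_mult nn_integral_multc)
  also have "\<dots> \<le> (\<integral>\<^sup>+z. B * ennreal (norm (h z)) \<partial>lborel)"
    by (intro nn_integral_mono mult_right_mono B) auto
  also have "\<dots> < \<infinity>"
    using B(1) nn_integral_norm_finite[OF h] by (simp add: nn_integral_cmult ennreal_mult_less_top)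
  finally show ?thesis .
qed

text \<open>Since \<open>h\<close> is merely integrable, its transform need not be, and inversion
  cannot be applied to it. Instead the kernel is moved onto \<open>p\<close>, the modulated
  potential: the transform \<open>g\<close> of \<open>conv (ker k) p\<close> is integrable by the
  contraction estimate, so this convolution can be inverted and paired with
  \<open>h\<close>.\<close>

lemma fourier_q_conv_ker:
  assumes k: "1 \<le> k" and h: "integrable lborel h"
  shows "integrable lborel (\<lambda>x. q x * conv (ker k) h x)"
    and "fourier (\<lambda>x. q x * conv (ker k) h x) \<zeta> = T k (fourier h) \<zeta>"
proof -
  have [measurable]: "h \<in> borel_measurable borel" using h by auto
  let ?c = "complex_of_real ((2 * pi) ^ 3)"
  define p where "p x = cis ((- \<zeta>) \<bullet> x) * q x" for x
  have p: "integrable lborel p" unfolding p_def[abs_def] by (intro integrable_cis_mult q_int) measurable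
  have [measurable]: "p \<in> borel_measurable borel" using p by auto
  have F: "integrable (lborel \<Otimes>\<^sub>M lborel) (\<lambda>(z, x). q x * ker k (x - z) * h z)"
    using q_conv_ker_finite[OF h] by (intro lborel_Fubini_integrable) auto
  from lborel_pair.integrable_snd[OF this]
  show "integrable lborel (\<lambda>x. q x * conv (ker k) h x)"
    by (simp add: conv_def mult.assoc)
  define g where "g \<eta> = fourier q (\<zeta> + \<eta>) * kh k \<eta>" for \<eta>
  have [measurable]: "g \<in> borel_measurable borel" unfolding g_def[abs_def] by measurable
  have g: "integrable lborel g"
    using integrable_lborel_reflect[OF integrable_product_kernel[OF k, of \<zeta>], of 0] by (simp add: g_def[abs_def] kh_minus)
  have fp: "fourier (conv (ker k) p) \<eta> = g \<eta>" for \<eta>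
  proof -
    have "fourier p \<eta> = fourier q (\<eta> - - \<zeta>)"
      unfolding p_def[abs_def] by (rule fourier_cis_mult) measurable
    then show ?thesis using fourier_conv[OF integrable_ker[of k] p, of \<eta>] by (simp add: g_def kh_eq add.commute)
  qed
  have inv: "AE z in lborel. conv (ker k) p z = inv_fourier g z"
  proof -
    have "fourier (conv (ker k) p) = g" by (rule ext) (rule fp)
    then show ?thesis using fourier_inversion_AE[OF integrable_conv[OF integrable_ker[of k] p]] g by simp
  qed
  have "fourier (\<lambda>x. q x * conv (ker k) h x) \<zeta> = (LINT x|lborel. LINT z|lborel. p x * ker k (x - z) * h z)"
    by (subst fourier_lborel) (auto simp: p_def conv_def mult.assoc)
  also have "\<dots> = (LINT z|lborel. LINT x|lborel. p x * ker k (x - z) * h z)"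
    using q_conv_ker_finite[OF h] by (intro lborel_Fubini_swap[symmetric]) (auto simp: p_def norm_mult)
  also have "\<dots> = (LINT z|lborel. conv (ker k) p z * h z)"
  proof (rule Bochner_Integration.integral_cong[OF refl])
    fix z
    have "ker k (x - z) = ker k (z - x)" for x
      using tgreen_minus[of "2 * \<rho>" "complex_of_real k" "x - z"] by (simp add: ker_def)
    then show "(LINT x|lborel. p x * ker k (x - z) * h z) = conv (ker k) p z * h z"
      by (simp add: conv_def mult_ac)
  qed
  also have "\<dots> = (LINT z|lborel. inv_fourier g z * h z)"
    using inv by (intro integral_cong_AE) (auto elim: eventually_mono)
  also have "\<dots> = (LINT \<eta>|lborel. g \<eta> * inv_fourier h \<eta>)"
    by (rule inv_fourier_multiplication[OF g h])
  also have "\<dots> = (LINT \<eta>|lborel. g (- \<eta>) * inv_fourier h (- \<eta>))"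
    using integral_lborel_reflect[of "\<lambda>\<eta>. g \<eta> * inv_fourier h \<eta>" 0] by simp
  also have "\<dots> = (LINT \<eta>|lborel. fourier q (\<zeta> - \<eta>) * kh k \<eta> * fourier h \<eta> / ?c)"
    by (simp add: g_def kh_minus inv_fourier_eq_fourier)
  also have "\<dots> = T k (fourier h) \<zeta>" by (simp add: T_def)
  finally show "fourier (\<lambda>x. q x * conv (ker k) h x) \<zeta> = T k (fourier h) \<zeta>" .
qed

text \<open>Here \<open>c\<close> is the wave vector of the incident wave: its direction times \<open>k\<close>.\<close>

primrec born :: "nat \<Rightarrow> real ^ 3 \<Rightarrow> real \<Rightarrow> real ^ 3 \<Rightarrow> complex" where
  "born 0 c k \<zeta> = fourier q (\<zeta> - c)"
| "born (Suc n) c k \<zeta> = T k (born n c k) \<zeta>"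

lemma born_borel_triple:
  "(\<lambda>p. born n (fst p) (fst (snd p)) (snd (snd p))) \<in> borel_measurable (borel \<Otimes>\<^sub>M (borel \<Otimes>\<^sub>M borel))"
proof (induction n)
  case 0
  then show ?case by simp
next
  case (Suc n)
  note Suc [measurable]
  have [measurable]: "(\<lambda>x. born n (f x) (g x) (h x)) \<in> borel_measurable M"
    if [measurable]: "f \<in> borel_measurable M" "g \<in> borel_measurable M" "h \<in> borel_measurable M" for f g h and M :: "'z measure"
    using measurable_compose[OF measurable_Pair[OF that(1) measurable_Pair[OF that(2,3)]] Suc] by simp
  show ?case unfolding born.simps T_def
    by (intro borel_measurable_divide lborel.borel_measurable_lebesgue_integral) measurable
qed

lemma born_borel [measurable (raw)]:
  assumes "f \<in> borel_measurable M" "g \<in> borel_measurable M" "h \<in> borel_measurable M"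
  shows "(\<lambda>x. born n (f x) (g x) (h x)) \<in> borel_measurable M"
  using measurable_compose[OF measurable_Pair[OF assms(1) measurable_Pair[OF assms(2,3)]] born_borel_triple] by simp

definition M :: real where "M = (LINT x|lborel. norm (q x))"

lemma norm_born_le:
  assumes k: "1 \<le> k" shows "norm (born n c k \<zeta>) \<le> M * \<theta> k ^ n"
proof (induction n arbitrary: \<zeta>)
  case 0
  then show ?case using norm_fourier_le[OF q_int] by (simp add: M_def)
next
  case (Suc n)
  have "norm (T k (born n c k) \<zeta>) \<le> \<theta> k * (M * \<theta> k ^ n)"
    by (rule norm_T_le[OF k _ Suc]) measurable
  then show ?case by (simp add: mult_ac)
qed

primrec \<sigma> :: "nat \<Rightarrow> real ^ 3 \<Rightarrow> ennreal" where
  "\<sigma> 0 \<zeta> = Q \<zeta>"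
| "\<sigma> (Suc n) \<zeta> = (\<integral>\<^sup>+z. Q (\<zeta> - z) * \<sigma> n z \<partial>lborel)"

lemma \<sigma>_borel [measurable]: "\<sigma> n \<in> borel_measurable borel"
proof (induction n)
  case (Suc n)
  note Suc [measurable]
  show ?case unfolding \<sigma>.simps by measurable
qed simp

text \<open>By Tonelli's theorem each convolution with \<open>Q\<close> multiplies the mass by
  \<open>S\<close>.\<close>

lemma nn_integral_\<sigma>: "(\<integral>\<^sup>+\<zeta>. \<sigma> n \<zeta> \<partial>lborel) = ennreal (S ^ Suc n)"
proof (induction n)
  case 0
  then show ?case by (simp add: nn_integral_Q)
next
  case (Suc n)
  have "(\<integral>\<^sup>+\<zeta>. \<sigma> (Suc n) \<zeta> \<partial>lborel) = (\<integral>\<^sup>+z. \<integral>\<^sup>+\<zeta>. Q (\<zeta> + - z) * \<sigma> n z \<partial>lborel \<partial>lborel)"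
    unfolding \<sigma>.simps using lborel_pair.Fubini'[of "\<lambda>z \<zeta>. Q (\<zeta> - z) * \<sigma> n z"] by simp
  also have "\<dots> = (\<integral>\<^sup>+z. (\<integral>\<^sup>+\<zeta>. Q (\<zeta> + - z) \<partial>lborel) * \<sigma> n z \<partial>lborel)"
    by (simp add: nn_integral_multc)
  also have "\<dots> = (\<integral>\<^sup>+z. ennreal S * \<sigma> n z \<partial>lborel)"
    by (subst nn_integral_lborel_translate) (auto simp: nn_integral_Q)
  also have "\<dots> = ennreal (S ^ Suc (Suc n))"
    by (simp add: nn_integral_cmult Suc ennreal_mult' mult_ac)
  finally show ?case .
qed

text \<open>The power of 4 comes from distributing the weight in \<open>jap_split\<close>, and
  \<open>2 * A\<close> from the two kernel integrals that this produces.\<close>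

definition b :: real where "b = 4 powr \<alpha> * (2 * A)"

lemma b_nonneg [simp]: "0 \<le> b"
  by (simp add: b_def)

text \<open>The bracket of \<zeta> is at most twice the larger of the brackets of \<zeta> - z and z,
  so its power cancels the inverse weight belonging to that one.\<close>

lemma jap_split:
  "jap \<zeta> powr (2 * \<alpha>) * (jap (\<zeta> - z) powr (- 2 * \<alpha>) * jap z powr (- 2 * \<alpha>))
    \<le> 4 powr \<alpha> * (jap z powr (- 2 * \<alpha>) + jap (\<zeta> - z) powr (- 2 * \<alpha>))"
proof -
  let ?u = "jap (\<zeta> - z)" and ?v = "jap z"
  have pos: "0 < ?u" "0 < ?v" by (simp_all add: jap_pos)
  have "jap \<zeta> \<le> ?u + ?v" using jap_triangle[of "\<zeta> - z" z] by simp
  also have "\<dots> \<le> 2 * max ?u ?v" by simp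
  finally have "jap \<zeta> powr (2 * \<alpha>) \<le> (2 * max ?u ?v) powr (2 * \<alpha>)"
    using \<alpha> jap_pos[of \<zeta>] by (intro powr_mono2) auto
  also have "\<dots> = 4 powr \<alpha> * max ?u ?v powr (2 * \<alpha>)"
    using pos by (simp add: powr_mult powr_powr[symmetric])
  also have "max ?u ?v powr (2 * \<alpha>) \<le> ?u powr (2 * \<alpha>) + ?v powr (2 * \<alpha>)"
    by (simp add: max_def)
  finally have "jap \<zeta> powr (2 * \<alpha>) \<le> 4 powr \<alpha> * (?u powr (2 * \<alpha>) + ?v powr (2 * \<alpha>))" by simp
  then have "jap \<zeta> powr (2 * \<alpha>) * (?u powr (- 2 * \<alpha>) * ?v powr (- 2 * \<alpha>))
      \<le> 4 powr \<alpha> * (?u powr (2 * \<alpha>) + ?v powr (2 * \<alpha>)) * (?u powr (- 2 * \<alpha>) * ?v powr (- 2 * \<alpha>))"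
    by (intro mult_right_mono) auto
  also have "\<dots> = 4 powr \<alpha> * (?v powr (- 2 * \<alpha>) + ?u powr (- 2 * \<alpha>))"
    using pos by (simp add: powr_minus_divide field_simps)
  finally show ?thesis .
qed

text \<open>The bound can be integrated over \<open>\<zeta>\<close> even though \<open>c\<close> and \<open>k\<close> will vary with \<open>\<zeta>\<close>, because
  \<open>\<sigma> n\<close> does not depend on them.\<close>

lemma born_weighted_bound:
  assumes k: "1 \<le> k"
  shows "ennreal (jap \<zeta> powr (2 * \<alpha>) * (norm (born n c k (\<zeta> + c)))\<^sup>2) \<le> ennreal ((b / k) ^ n) * \<sigma> n \<zeta>"
proof (induction n arbitrary: \<zeta>)
  case 0
  then show ?case by (simp add: Q_def)
next
  case (Suc n)
  \<comment> \<open>The weights of both convolved factors go into \<open>f\<close>, whose square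
    integrates to the next iterated convolution; the inverse weights stay with the kernel in
    \<open>g\<close>.\<close>
  define f where "f z = ennreal (jap (\<zeta> - z) powr \<alpha> * norm (fourier q (\<zeta> - z)) * (jap z powr \<alpha> * norm (born n c k (z + c))))" for z
  define g where "g z = ennreal (jap (\<zeta> - z) powr (- \<alpha>) * jap z powr (- \<alpha>) * norm (kh k (z + c)))" for z
  have [measurable]: "f \<in> borel_measurable borel" "g \<in> borel_measurable borel"
    unfolding f_def[abs_def] g_def[abs_def] by measurable
  have "ennreal (norm (born (Suc n) c k (\<zeta> + c))) \<le> ennreal (norm (LINT \<eta>|lborel. fourier q (\<zeta> + c - \<eta>) * kh k \<eta> * born n c k \<eta>))"
    unfolding born.simps T_def by (intro ennreal_leI norm_divide_2pi_le)
  also have "\<dots> \<le> (\<integral>\<^sup>+\<eta>. ennreal (norm (fourier q (\<zeta> + c - \<eta>) * kh k \<eta> * born n c k \<eta>)) \<partial>lborel)"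
    by (rule norm_integral_le_nn_integral)
  \<comment> \<open>Shifting by \<open>c\<close> brings \<open>born\<close> back to an argument of
    the form \<open>z + c\<close>, as the induction hypothesis requires. The vector \<open>c\<close>
    survives only in the kernel, whose bounds are uniform in it.\<close>
  also have "\<dots> = (\<integral>\<^sup>+z. ennreal (norm (fourier q (\<zeta> - z) * kh k (z + c) * born n c k (z + c))) \<partial>lborel)"
    using nn_integral_lborel_translate[of "\<lambda>\<eta>. ennreal (norm (fourier q (\<zeta> + c - \<eta>) * kh k \<eta> * born n c k \<eta>))" c]
    by simp
  also have "\<dots> = (\<integral>\<^sup>+z. f z * g z \<partial>lborel)"
  proof (rule nn_integral_cong)
    fix z
    have "jap x powr \<alpha> * jap x powr (- \<alpha>) = 1" for x :: "real ^ 3"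
      using jap_pos[of x] by (simp add: powr_add[symmetric])
    then have 1: "jap (\<zeta> - z) powr \<alpha> * a * (jap z powr \<alpha> * a') * (jap (\<zeta> - z) powr (- \<alpha>) * jap z powr (- \<alpha>) * a'') = a * a'' * a'" for a a' a''
      by (metis (no_types, opaque_lifting) mult.assoc mult.commute mult.left_commute mult_1)
    show "ennreal (norm (fourier q (\<zeta> - z) * kh k (z + c) * born n c k (z + c))) = f z * g z"
      unfolding f_def g_def norm_mult by (subst ennreal_mult'[symmetric]) (simp_all only: 1 norm_ge_zero powr_ge_zero mult_nonneg_nonneg)
  qed
  finally have "(ennreal (norm (born (Suc n) c k (\<zeta> + c))))\<^sup>2 \<le> (\<integral>\<^sup>+z. f z * g z \<partial>lborel)\<^sup>2"
    by (rule power_mono) simp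
  also have "\<dots> \<le> (\<integral>\<^sup>+z. (f z)\<^sup>2 \<partial>lborel) * (\<integral>\<^sup>+z. (g z)\<^sup>2 \<partial>lborel)"
    by (rule Cauchy_Schwarz_nn_integral) measurable
  finally have CS: "(ennreal (norm (born (Suc n) c k (\<zeta> + c))))\<^sup>2 \<le> (\<integral>\<^sup>+z. (f z)\<^sup>2 \<partial>lborel) * (\<integral>\<^sup>+z. (g z)\<^sup>2 \<partial>lborel)" .
  have "(\<integral>\<^sup>+z. (f z)\<^sup>2 \<partial>lborel) = (\<integral>\<^sup>+z. Q (\<zeta> - z) * ennreal (jap z powr (2 * \<alpha>) * (norm (born n c k (z + c)))\<^sup>2) \<partial>lborel)"
    by (intro nn_integral_cong) (simp add: f_def Q_def ennreal_power power_mult_distrib jap_powr_square ennreal_mult'[symmetric] mult_ac)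
  also have "\<dots> \<le> (\<integral>\<^sup>+z. Q (\<zeta> - z) * (ennreal ((b / k) ^ n) * \<sigma> n z) \<partial>lborel)"
    by (intro nn_integral_mono mult_left_mono Suc) auto
  also have "\<dots> = ennreal ((b / k) ^ n) * \<sigma> (Suc n) \<zeta>"
    by (simp add: nn_integral_cmult[symmetric] mult_ac)
  finally have f: "(\<integral>\<^sup>+z. (f z)\<^sup>2 \<partial>lborel) \<le> ennreal ((b / k) ^ n) * \<sigma> (Suc n) \<zeta>" .
  \<comment> \<open>The outer weight is charged to the kernel integral: there one of the two inverse
    weights absorbs it and the other one keeps the integral finite.\<close>
  have "ennreal (jap \<zeta> powr (2 * \<alpha>)) * (\<integral>\<^sup>+z. (g z)\<^sup>2 \<partial>lborel)
      = (\<integral>\<^sup>+z. ennreal (jap \<zeta> powr (2 * \<alpha>)) * (g z)\<^sup>2 \<partial>lborel)"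
    by (simp add: nn_integral_cmult)
  also have "\<dots> \<le> (\<integral>\<^sup>+z. ennreal (4 powr \<alpha>) * (ennreal (jap (z - 0) powr (- 2 * \<alpha>) * (norm (kh k (z + c)))\<^sup>2)
      + ennreal (jap (z - \<zeta>) powr (- 2 * \<alpha>) * (norm (kh k (z + c)))\<^sup>2)) \<partial>lborel)"
  proof (rule nn_integral_mono)
    fix z
    let ?K = "(norm (kh k (z + c)))\<^sup>2"
    have j: "jap (z - \<zeta>) = jap (\<zeta> - z)" using jap_minus[of "z - \<zeta>"] by simp
    have "ennreal (jap \<zeta> powr (2 * \<alpha>)) * (g z)\<^sup>2
        = ennreal (jap \<zeta> powr (2 * \<alpha>) * (jap (\<zeta> - z) powr (- 2 * \<alpha>) * jap z powr (- 2 * \<alpha>)) * ?K)"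
      by (simp add: g_def ennreal_power power_mult_distrib jap_powr_square ennreal_mult'[symmetric] mult_ac)
    also have "\<dots> \<le> ennreal (4 powr \<alpha> * (jap z powr (- 2 * \<alpha>) + jap (\<zeta> - z) powr (- 2 * \<alpha>)) * ?K)"
      by (intro ennreal_leI mult_right_mono jap_split) auto
    also have "\<dots> = ennreal (4 powr \<alpha>) * (ennreal (jap (z - 0) powr (- 2 * \<alpha>) * ?K) + ennreal (jap (z - \<zeta>) powr (- 2 * \<alpha>) * ?K))"
      by (simp add: j ennreal_plus[symmetric] ennreal_mult'[symmetric] distrib_right mult.assoc del: ennreal_plus)
    finally show "ennreal (jap \<zeta> powr (2 * \<alpha>)) * (g z)\<^sup>2 \<le> ennreal (4 powr \<alpha>) * (ennreal (jap (z - 0) powr (- 2 * \<alpha>) * ?K)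
        + ennreal (jap (z - \<zeta>) powr (- 2 * \<alpha>) * ?K))" .
  qed
  also have "\<dots> = ennreal (4 powr \<alpha>) * ((\<integral>\<^sup>+z. ennreal (jap (z - 0) powr (- 2 * \<alpha>) * (norm (kh k (z + c)))\<^sup>2) \<partial>lborel)
      + (\<integral>\<^sup>+z. ennreal (jap (z - \<zeta>) powr (- 2 * \<alpha>) * (norm (kh k (z + c)))\<^sup>2) \<partial>lborel))"
    by (subst nn_integral_cmult, measurable, subst nn_integral_add) auto
  also have "\<dots> \<le> ennreal (4 powr \<alpha>) * (ennreal (A / k) + ennreal (A / k))"
    by (intro mult_left_mono add_mono weighted_kernel_bound k) auto
  also have "\<dots> = ennreal (b / k)"
    using k by (simp add: b_def ennreal_plus[symmetric] ennreal_mult'[symmetric] del: ennreal_plus)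
  finally have g: "ennreal (jap \<zeta> powr (2 * \<alpha>)) * (\<integral>\<^sup>+z. (g z)\<^sup>2 \<partial>lborel) \<le> ennreal (b / k)" .
  have "ennreal (jap \<zeta> powr (2 * \<alpha>) * (norm (born (Suc n) c k (\<zeta> + c)))\<^sup>2)
      = ennreal (jap \<zeta> powr (2 * \<alpha>)) * (ennreal (norm (born (Suc n) c k (\<zeta> + c))))\<^sup>2"
    by (simp add: ennreal_mult' ennreal_power del: born.simps)
  also have "\<dots> \<le> ennreal (jap \<zeta> powr (2 * \<alpha>)) * ((\<integral>\<^sup>+z. (f z)\<^sup>2 \<partial>lborel) * (\<integral>\<^sup>+z. (g z)\<^sup>2 \<partial>lborel))"
    by (intro mult_left_mono CS) auto
  also have "\<dots> = (\<integral>\<^sup>+z. (f z)\<^sup>2 \<partial>lborel) * (ennreal (jap \<zeta> powr (2 * \<alpha>)) * (\<integral>\<^sup>+z. (g z)\<^sup>2 \<partial>lborel))"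
    by (simp add: mult_ac)
  also have "\<dots> \<le> (ennreal ((b / k) ^ n) * \<sigma> (Suc n) \<zeta>) * ennreal (b / k)"
    by (intro mult_mono f g) auto
  also have "\<dots> = ennreal ((b / k) ^ Suc n) * \<sigma> (Suc n) \<zeta>"
  proof -
    have "ennreal ((b / k) ^ Suc n) = ennreal ((b / k) ^ n) * ennreal (b / k)"
      using k by (subst ennreal_mult'[symmetric]) (simp_all add: mult.commute)
    then show ?thesis by (simp add: mult_ac del: \<sigma>.simps power_Suc)
  qed
  finally show ?case .
qed

end

section \<open>Scattering solutions at high frequency\<close>

context potential
begin

text \<open>The term \<open>4 * S * A\<close> makes \<open>\<theta> k\<close> at most 1 / 2. The
  term \<open>4 * b * S\<close> makes \<open>b / k * S\<close> at most 1 / 4, so that the ratio 1 /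
  2 remains both after taking a square root and after losing a factor 2.\<close>

definition k\<^sub>0 :: real where "k\<^sub>0 = max 1 (max (4 * S * A) (4 * b * S))"

lemma k\<^sub>0_ge_1: "1 \<le> k\<^sub>0"
  by (simp add: k\<^sub>0_def)

lemma k\<^sub>0_D:
  assumes "k\<^sub>0 \<le> k" shows "1 \<le> k" "0 \<le> \<theta> k" "\<theta> k \<le> 1 / 2" "b / k * S \<le> 1 / 4"
proof -
  have k: "1 \<le> k" "4 * S * A \<le> k" "4 * b * S \<le> k" using assms by (simp_all add: k\<^sub>0_def)
  then have "S * (A / k) \<le> (1 / 2)\<^sup>2" by (simp add: power2_eq_square divide_le_eq)
  then show "\<theta> k \<le> 1 / 2" unfolding \<theta>_def by (rule real_le_lsqrt[rotated -1]) simp_all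
  show "1 \<le> k" "0 \<le> \<theta> k" "b / k * S \<le> 1 / 4" using k by (simp_all add: divide_le_eq \<theta>_def)
qed

lemma M_nonneg [simp]: "0 \<le> M"
  by (simp add: M_def)

lemma norm_born_le_half:
  assumes k: "k\<^sub>0 \<le> k" shows "norm (born n c k \<zeta>) \<le> M * (1 / 2) ^ n"
  using norm_born_le[OF k\<^sub>0_D(1)[OF k]] by (rule order_trans) (intro mult_left_mono power_mono k\<^sub>0_D[OF k] M_nonneg)

lemma summable_geometric_half: "summable (\<lambda>n. a * (1 / 2 :: real) ^ n)"
  by (intro summable_mult summable_geometric) simp

lemma summable_norm_born:
  assumes k: "k\<^sub>0 \<le> k" shows "summable (\<lambda>n. norm (born n c k \<zeta>))"
  by (rule summable_comparison_test'[OF summable_geometric_half[of M], of 0]) (simp add: norm_born_le_half[OF k])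

definition w :: "real ^ 3 \<Rightarrow> real \<Rightarrow> real ^ 3 \<Rightarrow> complex" where
  "w c k \<zeta> = (\<Sum>n. born n c k \<zeta>)"

lemma w_borel [measurable (raw)]:
  assumes [measurable]: "f \<in> borel_measurable N" "g \<in> borel_measurable N" "h \<in> borel_measurable N"
  shows "(\<lambda>x. w (f x) (g x) (h x)) \<in> borel_measurable N"
  unfolding w_def by measurable

lemma norm_w_le:
  assumes k: "k\<^sub>0 \<le> k" shows "norm (w c k \<zeta>) \<le> M * 2"
proof -
  have "norm (w c k \<zeta>) \<le> (\<Sum>n. norm (born n c k \<zeta>))"
    unfolding w_def by (rule summable_norm[OF summable_norm_born[OF k]])
  also have "\<dots> \<le> (\<Sum>n. M * (1 / 2) ^ n)"
    by (intro suminf_le norm_born_le_half[OF k] summable_norm_born[OF k] summable_geometric_half)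
  also have "\<dots> = M * 2"
    by (subst suminf_mult) (auto simp: suminf_geometric)
  finally show ?thesis .
qed

text \<open>Applying \<open>T k\<close> to the series shifts it by one term. Integration term by
  term is justified because the integrals of the norms form a geometric series.\<close>

lemma w_fixed_point:
  assumes k: "k\<^sub>0 \<le> k" shows "w c k \<zeta> = fourier q (\<zeta> - c) + T k (w c k) \<zeta>"
proof -
  note k1 = k\<^sub>0_D(1)[OF k]
  let ?f = "\<lambda>n \<eta>. fourier q (\<zeta> - \<eta>) * kh k \<eta> * born n c k \<eta>"
  have s: "(\<Sum>n. ?f n \<eta>) = fourier q (\<zeta> - \<eta>) * kh k \<eta> * w c k \<eta>" for \<eta>
    unfolding w_def by (rule suminf_mult[OF summable_norm_cancel[OF summable_norm_born[OF k]]])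
  have int: "integrable lborel (?f n)" for n
    by (rule integrable_T_integrand[OF k1 _ norm_born_le[OF k1]]) measurable
  have bound: "(LINT \<eta>|lborel. norm (?f n \<eta>)) \<le> (1 / 2 * M) * (1 / 2) ^ n" for n
  proof -
    have "(LINT \<eta>|lborel. norm (?f n \<eta>)) \<le> (LINT \<eta>|lborel. norm (fourier q (\<zeta> - \<eta>) * kh k \<eta>) * (M * (1 / 2) ^ n))"
      unfolding norm_mult[of _ "born _ _ _ _"]
      by (intro integral_mono integrable_mult_left integrable_norm integrable_product_kernel[OF k1] mult_left_mono norm_born_le_half[OF k] norm_ge_zero
          integrable_norm[OF int, unfolded norm_mult[of _ "born _ _ _ _"]])
    also have "\<dots> = (LINT \<eta>|lborel. norm (fourier q (\<zeta> - \<eta>) * kh k \<eta>)) * (M * (1 / 2) ^ n)"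
      by (rule integral_mult_left_zero)
    also have "\<dots> \<le> 1 / 2 * (M * (1 / 2) ^ n)"
      using integral_product_kernel_le[OF k1, of \<zeta>] k\<^sub>0_D(3)[OF k] by (intro mult_right_mono) auto
    finally show ?thesis by simp
  qed
  have "(\<lambda>n. LINT \<eta>|lborel. ?f n \<eta>) sums (LINT \<eta>|lborel. (\<Sum>n. ?f n \<eta>))"
  proof (rule sums_integral[OF int])
    show "AE \<eta> in lborel. summable (\<lambda>n. norm (?f n \<eta>))"
      unfolding norm_mult[of _ "born _ _ _ _"] by (intro AE_I2 summable_mult summable_norm_born[OF k])
    show "summable (\<lambda>n. LINT \<eta>|lborel. norm (?f n \<eta>))"
      by (rule summable_comparison_test'[OF summable_geometric_half[of "1 / 2 * M"], of 0]) (use bound in auto)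
  qed
  from sums_divide[OF this, of "complex_of_real ((2 * pi) ^ 3)"]
  have "(\<lambda>n. born (Suc n) c k \<zeta>) sums T k (w c k) \<zeta>"
    unfolding s by (simp add: T_def)
  then have "(\<lambda>n. born n c k \<zeta>) sums (T k (w c k) \<zeta> + born 0 c k \<zeta>)" by (rule sums_Suc)
  then show ?thesis unfolding w_def by (simp add: sums_unique[symmetric] add.commute)
qed

text \<open>Boundedness of \<open>w\<close> is too weak, as the bounds on \<open>kh k\<close> do not
  make it integrable. Cauchy-Schwarz with the weight \<open>jap z powr \<alpha>\<close>, centred at
  the wave vector \<open>c\<close>, is applied to each Born term; the masses of the iterated
  convolutions then give summability with ratio 1 / 2.\<close>

lemma integrable_kh_w:
  assumes k: "k\<^sub>0 \<le> k" shows "integrable lborel (\<lambda>\<zeta>. kh k \<zeta> * w c k \<zeta>)"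
proof -
  note k1 = k\<^sub>0_D(1)[OF k]
  have bound: "(\<integral>\<^sup>+\<zeta>. ennreal (norm (kh k \<zeta> * born n c k \<zeta>)) \<partial>lborel) \<le> ennreal (\<theta> k * (1 / 2) ^ n)" for n
  proof -
    define f where "f z = ennreal (jap z powr (- \<alpha>) * norm (kh k (z + c)))" for z
    define g where "g z = ennreal (jap z powr \<alpha> * norm (born n c k (z + c)))" for z
    have [measurable]: "f \<in> borel_measurable borel" "g \<in> borel_measurable borel"
      unfolding f_def[abs_def] g_def[abs_def] by measurable
    have "(\<integral>\<^sup>+\<zeta>. ennreal (norm (kh k \<zeta> * born n c k \<zeta>)) \<partial>lborel)
        = (\<integral>\<^sup>+z. ennreal (norm (kh k (z + c) * born n c k (z + c))) \<partial>lborel)"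
      by (rule nn_integral_lborel_translate[symmetric]) measurable
    also have "\<dots> = (\<integral>\<^sup>+z. f z * g z \<partial>lborel)"
    proof (rule nn_integral_cong)
      fix z :: "real ^ 3"
      have "jap z powr (- \<alpha>) * jap z powr \<alpha> = 1"
        using jap_pos[of z] by (simp add: powr_add[symmetric])
      then have 1: "jap z powr (- \<alpha>) * x * (jap z powr \<alpha> * y) = x * y" for x y
        by (metis (no_types, opaque_lifting) mult.assoc mult.commute mult_1)
      show "ennreal (norm (kh k (z + c) * born n c k (z + c))) = f z * g z"
        unfolding f_def g_def norm_mult by (subst ennreal_mult'[symmetric]) (simp_all only: 1 norm_ge_zero powr_ge_zero mult_nonneg_nonneg)
    qed
    finally have "(\<integral>\<^sup>+\<zeta>. ennreal (norm (kh k \<zeta> * born n c k \<zeta>)) \<partial>lborel)\<^sup>2 \<le> (\<integral>\<^sup>+z. (f z)\<^sup>2 \<partial>lborel) * (\<integral>\<^sup>+z. (g z)\<^sup>2 \<partial>lborel)"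
      by (simp only:) (rule Cauchy_Schwarz_nn_integral; measurable)
    also have "\<dots> \<le> ennreal (A / k) * ennreal ((b / k) ^ n * S ^ Suc n)"
    proof (rule mult_mono)
      have "(f z)\<^sup>2 = ennreal (jap (z - 0) powr (- 2 * \<alpha>) * (norm (kh k (z + c)))\<^sup>2)" for z
        by (simp add: f_def ennreal_power power_mult_distrib jap_powr_square)
      then show "(\<integral>\<^sup>+z. (f z)\<^sup>2 \<partial>lborel) \<le> ennreal (A / k)" using weighted_kernel_bound[OF k1, of 0 c] by simp
      have "(g z)\<^sup>2 \<le> ennreal ((b / k) ^ n) * \<sigma> n z" for z
        using born_weighted_bound[OF k1, of z n c] by (simp add: g_def ennreal_power power_mult_distrib jap_powr_square)
      then have "(\<integral>\<^sup>+z. (g z)\<^sup>2 \<partial>lborel) \<le> (\<integral>\<^sup>+z. ennreal ((b / k) ^ n) * \<sigma> n z \<partial>lborel)" by (rule nn_integral_mono)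
      also have "\<dots> = ennreal ((b / k) ^ n * S ^ Suc n)"
        using k1 by (simp add: nn_integral_cmult nn_integral_\<sigma> ennreal_mult'[symmetric] del: power_Suc)
      finally show "(\<integral>\<^sup>+z. (g z)\<^sup>2 \<partial>lborel) \<le> ennreal ((b / k) ^ n * S ^ Suc n)" .
    qed simp_all
    also have "\<dots> = ennreal (S * (A / k) * (b / k * S) ^ n)"
      using k1 by (subst ennreal_mult'[symmetric]) (simp_all add: power_mult_distrib mult_ac power_divide)
    also have "\<dots> \<le> ennreal (S * (A / k) * (1 / 4) ^ n)"
      using k1 by (intro ennreal_leI mult_left_mono power_mono k\<^sub>0_D(4)[OF k]) simp_all
    also have "\<dots> = ennreal ((\<theta> k * (1 / 2) ^ n)\<^sup>2)"
    proof -
      have "((1 / 2 :: real) ^ n)\<^sup>2 = (1 / 4) ^ n" by (simp add: power2_eq_square flip: power_mult_distrib)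
      then show ?thesis using k1 by (simp add: power_mult_distrib \<theta>_def)
    qed
    finally show ?thesis
      using ennreal_power2_le_imp_le_sqrt[of _ "(\<theta> k * (1 / 2) ^ n)\<^sup>2"] k\<^sub>0_D(2)[OF k] by simp
  qed
  have int: "integrable lborel (\<lambda>\<zeta>. kh k \<zeta> * born n c k \<zeta>)" for n
    using bound[of n] by (intro integrableI_bounded) (auto intro: le_less_trans)
  have s: "w c k \<zeta> = (\<Sum>n. born n c k \<zeta>)" for \<zeta> by (simp add: w_def)
  have "integrable lborel (\<lambda>\<zeta>. \<Sum>n. kh k \<zeta> * born n c k \<zeta>)"
  proof (rule integrable_suminf[OF int])
    show "AE \<zeta> in lborel. summable (\<lambda>n. norm (kh k \<zeta> * born n c k \<zeta>))"
      unfolding norm_mult by (intro AE_I2 summable_mult summable_norm_born[OF k])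
    have "(LINT \<zeta>|lborel. norm (kh k \<zeta> * born n c k \<zeta>)) \<le> \<theta> k * (1 / 2) ^ n" for n
    proof -
      have "ennreal (LINT \<zeta>|lborel. norm (kh k \<zeta> * born n c k \<zeta>)) \<le> ennreal (\<theta> k * (1 / 2) ^ n)"
        using bound[of n] integrable_norm[OF int[of n]] by (subst nn_integral_eq_integral[symmetric]) auto
      then show ?thesis using k\<^sub>0_D(2)[OF k] by simp
    qed
    then show "summable (\<lambda>n. LINT \<zeta>|lborel. norm (kh k \<zeta> * born n c k \<zeta>))"
      by (intro summable_comparison_test'[OF summable_geometric_half[of "\<theta> k"], of 0]) auto
  qed
  then show ?thesis
    by (simp add: s suminf_mult[OF summable_norm_cancel[OF summable_norm_born[OF k]], symmetric])
qed

section \<open>Existence and uniqueness for the Lippmann-Schwinger equation\<close>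

lemma fourier_q_inv_fourier:
  assumes h: "integrable lborel h"
  shows "fourier (\<lambda>x. q x * inv_fourier h x) \<zeta>
    = (LINT \<eta>|lborel. fourier q (\<zeta> - \<eta>) * h \<eta>) / complex_of_real ((2 * pi) ^ 3)"
proof -
  have [measurable]: "h \<in> borel_measurable borel" using h by auto
  have [measurable]: "inv_fourier h \<in> borel_measurable borel"
    using continuous_inv_fourier[OF h] by (rule borel_measurable_continuous_onI)
  let ?g = "\<lambda>x. cis ((- \<zeta>) \<bullet> x) * q x"
  have g: "integrable lborel ?g" by (intro integrable_cis_mult q_int) measurable
  have "fourier (\<lambda>x. q x * inv_fourier h x) \<zeta> = (LINT x|lborel. inv_fourier h x * ?g x)"
    by (subst fourier_lborel) (auto simp: mult_ac)
  also have "\<dots> = (LINT \<eta>|lborel. h \<eta> * inv_fourier ?g \<eta>)"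
    by (rule inv_fourier_multiplication[OF h g])
  also have "\<dots> = (LINT \<eta>|lborel. fourier q (\<zeta> - \<eta>) * h \<eta> / complex_of_real ((2 * pi) ^ 3))"
  proof (rule Bochner_Integration.integral_cong[OF refl])
    fix \<eta>
    have "fourier ?g (- \<eta>) = fourier q (- \<eta> - - \<zeta>)" by (rule fourier_cis_mult) measurable
    then show "h \<eta> * inv_fourier ?g \<eta> = fourier q (\<zeta> - \<eta>) * h \<eta> / complex_of_real ((2 * pi) ^ 3)"
      by (simp add: inv_fourier_eq_fourier)
  qed
  finally show ?thesis by simp
qed

lemma conv_green_eq_conv_ker:
  assumes f: "\<And>y. \<rho> < norm y \<Longrightarrow> f y = 0" and x: "norm x \<le> \<rho>"
  shows "conv (green (complex_of_real k)) f x = conv (ker k) f x"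
  unfolding conv_def
proof (rule Bochner_Integration.integral_cong[OF refl])
  fix y
  show "green (complex_of_real k) (x - y) * f y = ker k (x - y) * f y"
  proof (cases "\<rho> < norm y")
    case True
    then show ?thesis by (simp add: f)
  next
    case False
    then have "x - y \<in> cball 0 (2 * \<rho>)" using norm_triangle_ineq4[of x y] x by simp
    then show ?thesis by (simp add: ker_def tgreen_def)
  qed
qed

lemma q_conv_green: "(\<And>y. \<rho> < norm y \<Longrightarrow> f y = 0) \<Longrightarrow> q x * conv (green (complex_of_real k)) f x = q x * conv (ker k) f x"
  using conv_green_eq_conv_ker[of f x k] q_support[of x] by (cases "norm x \<le> \<rho>") auto

text \<open>The series \<open>w\<close> should be the transform of \<open>q\<close> times the
  solution, so \<open>kh k\<close> times \<open>w\<close> should be that of the scattered wave near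
  the support. Its inverse transform \<open>v\<close> defines the source \<open>f\<close>; the fixed
  point equation confirms that \<open>f\<close> has transform \<open>w\<close>, whence
  \<open>v\<close> is indeed the convolution of the truncated kernel with \<open>f\<close>.\<close>

lemma lippmann_schwinger_ex:
  assumes k: "k\<^sub>0 \<le> k" and Q: "AE x in lborel. q' x = q x"
  shows "\<exists>u. lippmann_schwinger q' d k u"
proof -
  note k1 = k\<^sub>0_D(1)[OF k]
  define c where "c = k *\<^sub>R d"
  have e: "plane_wave k d x = cis (c \<bullet> x)" for x
    by (simp add: plane_wave_def c_def cis_conv_exp inner_commute)
  define h where "h = (\<lambda>\<eta>. kh k \<eta> * w c k \<eta>)"
  have h: "integrable lborel h" unfolding h_def by (rule integrable_kh_w[OF k])
  define v where "v = inv_fourier h"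
  have [measurable]: "v \<in> borel_measurable borel"
    using continuous_inv_fourier[OF h] unfolding v_def by (rule borel_measurable_continuous_onI)
  define f where "f x = q x * (cis (c \<bullet> x) + v x)" for x
  have [measurable]: "f \<in> borel_measurable borel" unfolding f_def[abs_def] by measurable
  define B where "B = (LINT \<eta>|lborel. norm (h \<eta>))"
  have vB: "norm (v x) \<le> B" for x unfolding v_def B_def by (rule norm_inv_fourier_le[OF h])
  have i1: "integrable lborel (\<lambda>x. cis (c \<bullet> x) * q x)" by (intro integrable_cis_mult q_int) measurable
  have i2: "integrable lborel (\<lambda>x. q x * v x)"
    by (rule Bochner_Integration.integrable_bound[OF integrable_mult_right[OF q_int, of "complex_of_real B"]])
      (auto simp: norm_mult mult.commute[of _ "norm (v _)"] intro!: AE_I2 mult_right_mono order_trans[OF vB abs_ge_self])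
  have f: "integrable lborel f"
    using Bochner_Integration.integrable_add[OF i1 i2] by (simp add: f_def[abs_def] algebra_simps)
  have Ff: "fourier f \<zeta> = w c k \<zeta>" for \<zeta>
  proof -
    have "fourier f \<zeta> = fourier (\<lambda>x. cis (c \<bullet> x) * q x + q x * v x) \<zeta>"
      by (simp add: f_def[abs_def] algebra_simps)
    also have "\<dots> = fourier (\<lambda>x. cis (c \<bullet> x) * q x) \<zeta> + fourier (\<lambda>x. q x * v x) \<zeta>"
      by (rule fourier_add[OF i1 i2])
    also have "\<dots> = fourier q (\<zeta> - c) + T k (w c k) \<zeta>"
      unfolding v_def fourier_q_inv_fourier[OF h]
      by (subst fourier_cis_mult) (auto simp: T_def h_def mult.assoc)
    finally show ?thesis using w_fixed_point[OF k] by simp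
  qed
  have Fcf: "fourier (conv (ker k) f) = h"
    by (rule ext) (simp add: fourier_conv[OF integrable_ker f] Ff h_def kh_eq)
  have cf: "AE x in lborel. conv (ker k) f x = v x"
    using fourier_inversion_AE[OF integrable_conv[OF integrable_ker[of k] f]] h unfolding Fcf v_def by simp
  have f0: "\<rho> < norm y \<Longrightarrow> f y = 0" for y by (simp add: f_def q_support)
  define g where "g = conv (green (complex_of_real k)) f"
  have g: "ball_integrable g" unfolding g_def by (rule ball_integrable_conv_green[OF _ f]) simp
  \<comment> \<open>The full kernel enters here: the equation has to hold on the whole space,
    whereas \<open>v\<close> is the scattered wave only where \<open>q\<close> is nonzero.\<close>
  define u where "u x = plane_wave k d x + g x" for x
  have qu: "AE x in lborel. q' x * u x = f x"
    using Q cf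
  proof eventually_elim
    case (elim x)
    have "q x * g x = q x * conv (ker k) f x" unfolding g_def by (rule q_conv_green) (rule f0)
    then have "q x * g x = q x * v x" using elim by simp
    then show ?case by (simp add: elim u_def e f_def distrib_left)
  qed
  have b: "ball_integrable u"
    unfolding u_def[abs_def] e by (intro ball_integrable_add g ball_integrable_bounded[where M=1]) auto
  show ?thesis
  proof (intro exI, unfold lippmann_schwinger_def, intro conjI)
    show "locally_integrable u" by (rule locally_integrableI[OF b]) simp
    have "(\<lambda>x. q' x * u x) \<in> borel_measurable lebesgue"
      by (rule lebesgue_measurable_of_AE[OF _ qu]) measurable
    moreover have "integrable lebesgue f" using f by (rule integrable_completion[THEN iffD2, rotated]) measurable
    moreover have "AE x in lebesgue. f x = q' x * u x" using AE_completion[OF qu] by eventually_elim simp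
    ultimately show "integrable lebesgue (\<lambda>x. q' x * u x)"
      using integrable_cong_AE_imp by blast
    show "is_function (resolvent k (\<lambda>x. q' x * u x)) (\<lambda>x. u x - plane_wave k d x)"
      using resolvent_eq_conv_green[OF _ f qu] k1
      by (intro is_functionI[OF g]) (simp_all add: u_def g_def)
  qed
qed

text \<open>For any solution the transform of \<open>q' u\<close> is bounded and satisfies the same
  fixed point equation as \<open>w\<close>. The difference is a bounded fixed point of the
  contraction \<open>T k\<close>, hence zero.\<close>

lemma lippmann_schwinger_fourier:
  assumes k: "k\<^sub>0 \<le> k" and Q: "AE x in lborel. q' x = q x" and LS: "lippmann_schwinger q' d k u"
  shows "fourier (\<lambda>x. q' x * u x) = w (k *\<^sub>R d) k"
proof -
  note k1 = k\<^sub>0_D(1)[OF k]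
  define c where "c = k *\<^sub>R d"
  have e: "plane_wave k d x = cis (c \<bullet> x)" for x
    by (simp add: plane_wave_def c_def cis_conv_exp inner_commute)
  have u: "locally_integrable u" and F: "integrable lebesgue (\<lambda>x. q' x * u x)"
    and R: "is_function (resolvent k (\<lambda>x. q' x * u x)) (\<lambda>x. u x - plane_wave k d x)"
    using LS by (auto simp: lippmann_schwinger_def)
  obtain u' where u': "ball_integrable u'" and uu': "AE x in lborel. u x = u' x"
    using locally_integrable_ex_borel[OF u] by blast
  have [measurable]: "u' \<in> borel_measurable borel" by (rule ball_integrable_borel[OF u'])
  define f where "f x = q x * u' x" for x
  have [measurable]: "f \<in> borel_measurable borel" unfolding f_def[abs_def] by measurable
  have Ff: "AE x in lborel. q' x * u x = f x"
    using Q uu' by eventually_elim (simp add: f_def)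
  have f: "integrable lborel f"
    using F Ff by (subst (asm) integrable_lebesgue_iff_lborel[of f]) auto
  have FF: "fourier (\<lambda>x. q' x * u x) = fourier f"
    by (intro fourier_cong_AE Ff lebesgue_measurable_of_AE[OF _ Ff] measurable_completion) auto
  have "AE x in lborel. u x - plane_wave k d x = conv (green (complex_of_real k)) f x"
    using k1 by (intro is_function_unique_AE[OF R] ball_integrable_conv_green f resolvent_eq_conv_green[OF _ f Ff]) auto
  then have fe: "AE x in lborel. f x = cis (c \<bullet> x) * q x + q x * conv (ker k) f x"
    using uu'
  proof eventually_elim
    case (elim x)
    have "q x * conv (green (complex_of_real k)) f x = q x * conv (ker k) f x"
      by (rule q_conv_green) (simp add: f_def q_support)
    then show ?case using elim by (simp add: f_def e algebra_simps)
  qed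
  have i1: "integrable lborel (\<lambda>x. cis (c \<bullet> x) * q x)" by (intro integrable_cis_mult q_int) measurable
  have i2: "integrable lborel (\<lambda>x. q x * conv (ker k) f x)" by (rule fourier_q_conv_ker(1)[OF k1 f])
  have fp: "fourier f \<zeta> = fourier q (\<zeta> - c) + T k (fourier f) \<zeta>" for \<zeta>
  proof -
    have "fourier f = fourier (\<lambda>x. cis (c \<bullet> x) * q x + q x * conv (ker k) f x)"
      using i1 i2 f by (intro fourier_cong_AE fe measurable_completion) auto
    then show ?thesis
      by (simp add: fourier_add[OF i1 i2] fourier_cis_mult fourier_q_conv_ker(2)[OF k1 f])
  qed
  \<comment> \<open>Iterating \<open>D = T k D\<close> halves the bound \<open>B\<close> each
    time.\<close>
  define D where "D \<zeta> = fourier f \<zeta> - w c k \<zeta>" for \<zeta>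
  have [measurable]: "D \<in> borel_measurable borel" unfolding D_def[abs_def] by measurable
  define B where "B = (LINT x|lborel. norm (f x)) + M * 2"
  have D: "D \<zeta> = T k D \<zeta>" for \<zeta>
  proof -
    have "T k (fourier f) \<zeta> - T k (w c k) \<zeta> = T k D \<zeta>"
      unfolding T_def diff_divide_distrib[symmetric] D_def
      using integrable_T_integrand[OF k1 _ norm_fourier_le[OF f], where \<zeta>=\<zeta>] integrable_T_integrand[OF k1 _ norm_w_le[OF k, where c=c], where \<zeta>=\<zeta>]
      by (simp add: right_diff_distrib)
    then show ?thesis using fp[of \<zeta>] w_fixed_point[OF k, of c \<zeta>] by (simp add: D_def)
  qed
  have "norm (D \<zeta>) \<le> B * (1 / 2) ^ n" for \<zeta> n
  proof (induction n arbitrary: \<zeta>)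
    case 0
    show ?case using norm_fourier_le[OF f, of \<zeta>] norm_w_le[OF k, of c \<zeta>] norm_triangle_ineq4[of "fourier f \<zeta>" "w c k \<zeta>"]
      by (simp add: D_def B_def)
  next
    case (Suc n)
    have B: "0 \<le> B" by (simp add: B_def)
    have "norm (T k D \<zeta>) \<le> \<theta> k * (B * (1 / 2) ^ n)" by (rule norm_T_le[OF k1 _ Suc]) measurable
    also have "\<dots> \<le> 1 / 2 * (B * (1 / 2) ^ n)" using B by (intro mult_right_mono k\<^sub>0_D(3)[OF k]) auto
    finally show ?case using D[of \<zeta>] by simp
  qed
  moreover have "(\<lambda>n. B * (1 / 2) ^ n) \<longlonglongrightarrow> 0" by (intro tendsto_mult_right_zero LIMSEQ_power_zero) simp
  ultimately have "norm (D \<zeta>) \<le> 0" for \<zeta> by (intro LIMSEQ_le_const) auto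
  then show ?thesis unfolding FF by (auto simp: D_def c_def)
qed

text \<open>The choice made in \<open>scattering_solution\<close> has no influence, because the
  amplitude is a value of the transform that all solutions share.\<close>

lemma scattering_amplitude_eq:
  assumes k: "k\<^sub>0 \<le> k" and Q: "AE x in lborel. q' x = q x"
  shows "scattering_amplitude q' (- d) d k = w (k *\<^sub>R d) k (- (k *\<^sub>R d))"
proof -
  have "lippmann_schwinger q' d k (scattering_solution q' d k)"
    unfolding scattering_solution_def by (rule someI_ex[OF lippmann_schwinger_ex[OF k Q]])
  from fun_cong[OF lippmann_schwinger_fourier[OF k Q this], of "- (k *\<^sub>R d)"]
  show ?thesis by (simp add: scattering_amplitude_def fourier_def mult.assoc)
qed

section \<open>Backscattering data at high frequency\<close>

lemma backscattering_data_eq: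
  assumes \<xi>: "2 * k\<^sub>0 \<le> norm \<xi>" and Q: "AE x in lborel. q' x = q x"
  shows "backscattering_data q' \<eta>' \<xi>
    = w (- (\<xi> /\<^sub>R 2)) (norm \<xi> / 2) (\<xi> /\<^sub>R 2) * complex_of_real (\<eta>' (norm \<xi> / 2))"
proof -
  have "\<xi> \<noteq> 0" using \<xi> k\<^sub>0_ge_1 by auto
  then have d: "(norm \<xi> / 2) *\<^sub>R (- (\<xi> /\<^sub>R norm \<xi>)) = - (\<xi> /\<^sub>R 2)" by (simp add: field_simps)
  have "k\<^sub>0 \<le> norm \<xi> / 2" using \<xi> by simp
  from scattering_amplitude_eq[OF this Q, of "- (\<xi> /\<^sub>R norm \<xi>)", unfolded d]
  show ?thesis by (simp add: backscattering_data_def Let_def)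
qed

text \<open>At the wave vector \<open>c = - \<xi> / 2\<close> the evaluation point
  \<open>\<xi> / 2\<close> is \<open>\<xi> + c\<close>, just the point at which
  \<open>born_weighted_bound\<close> puts the weight \<open>jap \<xi>\<close>. This coincidence is
  what singles out backscattering in the argument.\<close>

lemma amplitude_error_finite:
  "(\<integral>\<^sup>+\<xi>. ennreal (norm (w (- (\<xi> /\<^sub>R 2)) (norm \<xi> / 2) (\<xi> /\<^sub>R 2) - fourier q \<xi>)) * indicator {\<xi>. 2 * k\<^sub>0 \<le> norm \<xi>} \<xi> \<partial>lborel) < \<infinity>"
proof -
  let ?E = "\<lambda>\<xi>. norm (w (- (\<xi> /\<^sub>R 2)) (norm \<xi> / 2) (\<xi> /\<^sub>R 2) - fourier q \<xi>)"
  \<comment> \<open>The two summands of the comparison of means with weight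
    \<open>(1 / 2) ^ n\<close>. Of the \<open>n + 1\<close> factors \<open>b / k\<close> in the Born
    bound, one goes to the first summand, where \<open>k\<close> is comparable to
    \<open>jap \<xi>\<close>; the other \<open>n\<close> are estimated at \<open>k\<^sub>0\<close>
    and pay for the factor \<open>2 ^ n\<close> that the weight costs in the second summand.\<close>
  let ?H = "\<lambda>n \<xi>. ennreal ((1 / 2) ^ n) * ennreal (4 * b * jap \<xi> powr (- (2 * \<alpha> + 1))) + ennreal ((b / k\<^sub>0) ^ n * 2 ^ n) * \<sigma> (Suc n) \<xi>"
  have bk: "0 \<le> b / k\<^sub>0" using k\<^sub>0_ge_1 by simp
  have pointwise: "ennreal (?E \<xi>) \<le> (\<Sum>n. ?H n \<xi>)" if \<xi>: "2 * k\<^sub>0 \<le> norm \<xi>" for \<xi>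
  proof -
    define k where "k = norm \<xi> / 2"
    define c where "c = - (\<xi> /\<^sub>R 2)"
    have \<xi>c: "\<xi> /\<^sub>R 2 = \<xi> + c" by (simp add: c_def vec_eq_iff)
    have k: "k\<^sub>0 \<le> k" using \<xi> by (simp add: k_def)
    note k1 = k\<^sub>0_D(1)[OF k]
    have kk: "0 \<le> b / k" "b / k \<le> b / k\<^sub>0" using k k1 k\<^sub>0_ge_1 by (auto intro!: divide_left_mono)
    have step: "ennreal (norm (born (Suc n) c k (\<xi> + c))) \<le> ?H n \<xi>" for n
    proof -
      let ?x = "norm (born (Suc n) c k (\<xi> + c))"
      have "(ennreal ?x)\<^sup>2 = ennreal (jap \<xi> powr (- 2 * \<alpha>)) * ennreal (jap \<xi> powr (2 * \<alpha>) * ?x\<^sup>2)"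
      proof -
        have 1: "jap \<xi> powr (- 2 * \<alpha>) * jap \<xi> powr (2 * \<alpha>) = 1"
          using jap_pos[of \<xi>] by (simp add: powr_add[symmetric])
        have "jap \<xi> powr (- 2 * \<alpha>) * (jap \<xi> powr (2 * \<alpha>) * ?x\<^sup>2) = ?x\<^sup>2"
          unfolding mult.assoc[symmetric] 1 by simp
        then show ?thesis by (subst ennreal_mult'[symmetric]) (simp_all add: ennreal_power del: born.simps)
      qed
      also have "\<dots> \<le> ennreal (jap \<xi> powr (- 2 * \<alpha>)) * (ennreal ((b / k) ^ Suc n) * \<sigma> (Suc n) \<xi>)"
        by (intro mult_left_mono born_weighted_bound k1) simp
      also have "\<dots> = ennreal (jap \<xi> powr (- 2 * \<alpha>)) * ennreal (b / k) * (ennreal ((b / k) ^ n) * \<sigma> (Suc n) \<xi>)"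
      proof -
        have "ennreal ((b / k) ^ Suc n) = ennreal (b / k) * ennreal ((b / k) ^ n)"
          using kk by (subst ennreal_mult'[symmetric]) simp_all
        then show ?thesis by (simp only: mult.assoc)
      qed
      also have "\<dots> \<le> ennreal (4 * b * jap \<xi> powr (- (2 * \<alpha> + 1))) * (ennreal ((b / k\<^sub>0) ^ n) * \<sigma> (Suc n) \<xi>)"
      proof (intro mult_mono ennreal_leI power_mono kk)
        \<comment> \<open>Here \<open>norm \<xi> = 2 * k\<close> and
          \<open>k \<ge> 1\<close>.\<close>
        have "jap \<xi> \<le> 4 * k"
        proof -
          have "jap \<xi> \<le> 1 + norm \<xi>" by (rule jap_le)
          then show ?thesis using k1 by (simp add: k_def)
        qed
        then have "1 / k \<le> 4 / jap \<xi>" using k1 jap_pos[of \<xi>] by (simp add: field_simps)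
        then have "b * (1 / k) \<le> b * (4 / jap \<xi>)" by (rule mult_left_mono) simp
        then have "jap \<xi> powr (- 2 * \<alpha>) * (b / k) \<le> jap \<xi> powr (- 2 * \<alpha>) * (b * (4 / jap \<xi>))"
          by (intro mult_left_mono) simp_all
        also have "\<dots> = 4 * b * (jap \<xi> powr (- 2 * \<alpha>) * jap \<xi> powr (- 1))"
          using jap_pos[of \<xi>] by (simp add: powr_minus_divide)
        also have "jap \<xi> powr (- 2 * \<alpha>) * jap \<xi> powr (- 1) = jap \<xi> powr (- (2 * \<alpha> + 1))"
          unfolding powr_add[symmetric] by simp
        finally show "ennreal (jap \<xi> powr (- 2 * \<alpha>)) * ennreal (b / k) \<le> ennreal (4 * b * jap \<xi> powr (- (2 * \<alpha> + 1)))"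
          by (subst ennreal_mult'[symmetric]) (simp_all only: powr_ge_zero ennreal_leI)
      qed simp_all
      finally have "ennreal ?x \<le> ennreal ((1 / 2) ^ n) * ennreal (4 * b * jap \<xi> powr (- (2 * \<alpha> + 1)))
          + (ennreal ((b / k\<^sub>0) ^ n) * \<sigma> (Suc n) \<xi>) * ennreal (1 / (1 / 2) ^ n)"
        by (rule ennreal_power2_le_imp_AM_GM) simp_all
      also have "\<dots> = ?H n \<xi>"
      proof -
        have "ennreal ((b / k\<^sub>0) ^ n * 2 ^ n) = ennreal ((b / k\<^sub>0) ^ n) * ennreal (1 / (1 / 2) ^ n)"
          using zero_le_power[OF bk, of n] by (subst ennreal_mult'[symmetric]) (simp_all add: power_one_over)
        then show ?thesis by (simp only: mult_ac)
      qed
      finally show ?thesis .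
    qed
    have s: "summable (\<lambda>n. norm (born (Suc n) c k (\<xi> + c)))"
      using summable_norm_born[OF k, of c "\<xi> + c"] by (subst summable_Suc_iff)
    have "w c k (\<xi> + c) - fourier q \<xi> = (\<Sum>n. born (Suc n) c k (\<xi> + c))"
      using suminf_split_head[OF summable_norm_cancel[OF summable_norm_born[OF k, of c "\<xi> + c"]]]
      by (simp add: w_def)
    also have "norm \<dots> \<le> (\<Sum>n. norm (born (Suc n) c k (\<xi> + c)))" by (rule summable_norm[OF s])
    finally have "ennreal (norm (w c k (\<xi> + c) - fourier q \<xi>)) \<le> ennreal (\<Sum>n. norm (born (Suc n) c k (\<xi> + c)))"
      by (rule ennreal_leI)
    also have "\<dots> = (\<Sum>n. ennreal (norm (born (Suc n) c k (\<xi> + c))))"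
      by (rule suminf_ennreal2[symmetric, OF _ s]) simp
    also have "\<dots> \<le> (\<Sum>n. ?H n \<xi>)" by (intro suminf_le step) auto
    finally have "ennreal (norm (w c k (\<xi> /\<^sub>R 2) - fourier q \<xi>)) \<le> (\<Sum>n. ?H n \<xi>)"
      unfolding \<xi>c[symmetric] .
    then show ?thesis unfolding c_def k_def .
  qed
  have "(\<integral>\<^sup>+\<xi>. ennreal (?E \<xi>) * indicator {\<xi>. 2 * k\<^sub>0 \<le> norm \<xi>} \<xi> \<partial>lborel) \<le> (\<integral>\<^sup>+\<xi>. (\<Sum>n. ?H n \<xi>) \<partial>lborel)"
    using pointwise by (intro nn_integral_mono) (simp split: split_indicator)
  also have "\<dots> = (\<Sum>n. \<integral>\<^sup>+\<xi>. ?H n \<xi> \<partial>lborel)"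
    by (rule nn_integral_suminf) measurable
  also have "\<dots> \<le> (\<Sum>n. ennreal ((4 * b * J + S\<^sup>2) * (1 / 2) ^ n))"
  proof (rule suminf_le)
    fix n
    have "(\<integral>\<^sup>+\<xi>. ?H n \<xi> \<partial>lborel) = ennreal ((1 / 2) ^ n) * (\<integral>\<^sup>+\<xi>. ennreal (4 * b * jap \<xi> powr (- (2 * \<alpha> + 1))) \<partial>(lborel :: (real ^ 3) measure))
        + ennreal ((b / k\<^sub>0) ^ n * 2 ^ n) * (\<integral>\<^sup>+\<xi>. \<sigma> (Suc n) \<xi> \<partial>lborel)"
      by (subst nn_integral_add) (auto simp: nn_integral_cmult simp del: \<sigma>.simps)
    also have "(\<integral>\<^sup>+\<xi>. ennreal (4 * b * jap \<xi> powr (- (2 * \<alpha> + 1))) \<partial>(lborel :: (real ^ 3) measure)) = ennreal (4 * b * J)"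
    proof -
      have b: "0 \<le> 4 * b" by simp
      show ?thesis unfolding ennreal_mult'[OF b] nn_integral_J[symmetric] by (rule nn_integral_cmult) measurable
    qed
    also have "ennreal ((1 / 2) ^ n) * ennreal (4 * b * J) + ennreal ((b / k\<^sub>0) ^ n * 2 ^ n) * (\<integral>\<^sup>+\<xi>. \<sigma> (Suc n) \<xi> \<partial>lborel)
        = ennreal ((1 / 2) ^ n * (4 * b * J) + (b / k\<^sub>0) ^ n * 2 ^ n * S ^ Suc (Suc n))"
      unfolding nn_integral_\<sigma> using bk
      by (simp add: ennreal_mult'[symmetric] ennreal_plus[symmetric] del: ennreal_plus power_Suc)
    also have "\<dots> \<le> ennreal ((4 * b * J + S\<^sup>2) * (1 / 2) ^ n)"
    proof (rule ennreal_leI)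
      \<comment> \<open>The mass of \<open>\<sigma> (Suc n)\<close> is a power of \<open>S\<close>
        with two factors more than \<open>n\<close>; these form the constant, and the remaining ones
        join \<open>b / k\<^sub>0\<close>.\<close>
      have "(b / k\<^sub>0) ^ n * 2 ^ n * S ^ Suc (Suc n) = S\<^sup>2 * (b / k\<^sub>0 * S * 2) ^ n"
        by (simp only: power_mult_distrib power_Suc power2_eq_square mult_ac)
      also have "\<dots> \<le> S\<^sup>2 * (1 / 2) ^ n"
      proof -
        define t where "t = b / k\<^sub>0 * S"
        have "0 \<le> t" unfolding t_def by (intro mult_nonneg_nonneg bk S_nonneg)
        moreover have "t \<le> 1 / 4" unfolding t_def by (rule k\<^sub>0_D(4)[OF order_refl])
        ultimately show ?thesis unfolding t_def[symmetric] by (intro mult_left_mono power_mono) simp_all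
      qed
      finally show "(1 / 2) ^ n * (4 * b * J) + (b / k\<^sub>0) ^ n * 2 ^ n * S ^ Suc (Suc n) \<le> (4 * b * J + S\<^sup>2) * (1 / 2) ^ n"
        by (simp add: algebra_simps)
    qed
    finally show "(\<integral>\<^sup>+\<xi>. ?H n \<xi> \<partial>lborel) \<le> ennreal ((4 * b * J + S\<^sup>2) * (1 / 2) ^ n)" .
  qed auto
  also have "\<dots> = ennreal (\<Sum>n. (4 * b * J + S\<^sup>2) * (1 / 2) ^ n)"
    by (rule suminf_ennreal2) (simp, rule summable_geometric_half)
  also have "\<dots> < \<infinity>" by simp
  finally show ?thesis .
qed

end

text \<open>The cutoff of the data is in general not the one of the locale: the latter supplies test
  functions, while the former is a parameter of the claim. The transform \<open>G\<close> of the
  difference is shown to be integrable, so \<open>g\<close> is its inverse transform.\<close>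

lemma (in potential) ex_continuous_difference:
  assumes C\<^sub>0: "k\<^sub>0 < C\<^sub>0" and \<eta>': "high_freq_cutoff C\<^sub>0 \<eta>'" and Q: "AE x in lborel. q' x = q x"
  shows "\<exists>g. continuous_on UNIV g \<and> is_function (\<lambda>\<phi>. distr_of q' \<phi> - born_approximation q' \<eta>' \<phi>) g"
proof -
  \<comment> \<open>Makes vanishing at the endpoint and boundedness available for the cutoff of the
    data too.\<close>
  interpret cut: smooth_cutoff C\<^sub>0 \<eta>'
    using C\<^sub>0 k\<^sub>0_ge_1 \<eta>' by unfold_locales auto
  define W where "W \<xi> = w (- (\<xi> /\<^sub>R 2)) (norm \<xi> / 2) (\<xi> /\<^sub>R 2)" for \<xi>
  define D where "D \<xi> = W \<xi> * complex_of_real (\<eta>' (norm \<xi> / 2))" for \<xi>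
  define G where "G \<xi> = fourier q \<xi> - D \<xi>" for \<xi>
  have [measurable]: "W \<in> borel_measurable borel" unfolding W_def[abs_def] by measurable
  have [measurable]: "D \<in> borel_measurable borel" unfolding D_def[abs_def] by measurable
  have [measurable]: "G \<in> borel_measurable borel" unfolding G_def[abs_def] by measurable
  \<comment> \<open>Below this frequency nothing is known about the chosen solutions; the cutoff
    removes them because \<open>k\<^sub>0 < C\<^sub>0\<close>.\<close>
  have low: "\<eta>' (norm \<xi> / 2) = 0" if "norm \<xi> < 2 * k\<^sub>0" for \<xi> :: "real ^ 3"
    using that C\<^sub>0 by (intro cut.eta_zero) simp
  have data: "backscattering_data q' \<eta>' = D"
  proof
    fix \<xi>
    show "backscattering_data q' \<eta>' \<xi> = D \<xi>"
    proof (cases "2 * k\<^sub>0 \<le> norm \<xi>")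
      case True
      then show ?thesis unfolding D_def W_def by (rule backscattering_data_eq[OF _ Q])
    next
      case False
      then show ?thesis by (simp add: D_def low backscattering_data_def Let_def)
    qed
  qed
  have D_bound: "norm (D \<xi>) \<le> M * 2 * cut.eta_bound" for \<xi>
  proof (cases "2 * k\<^sub>0 \<le> norm \<xi>")
    case True
    then show ?thesis unfolding D_def W_def norm_mult
      by (intro mult_mono norm_w_le) (auto simp: cut.eta_bound)
  next
    case False
    then show ?thesis using cut.eta_bound(1) by (simp add: D_def low)
  qed
  have G: "integrable lborel G"
  proof -
    \<comment> \<open>\<open>G1\<close> is the part of \<open>fourier q\<close> that the cutoff
      removes, bounded and compactly supported. \<open>G2\<close> is the sum of the Born terms from
      the first on, up to sign and damped by the cutoff.\<close>
    define G1 where "G1 \<xi> = fourier q \<xi> * complex_of_real (1 - \<eta>' (norm \<xi> / 2))" for \<xi>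
    define G2 where "G2 \<xi> = (fourier q \<xi> - W \<xi>) * complex_of_real (\<eta>' (norm \<xi> / 2))" for \<xi>
    have [measurable]: "G1 \<in> borel_measurable borel" "G2 \<in> borel_measurable borel"
      unfolding G1_def[abs_def] G2_def[abs_def] by measurable
    have "integrable lborel G1"
    \<comment> \<open>The cutoff is 1 as soon as \<open>norm \<xi> / 2\<close> reaches
      \<open>2 * C\<^sub>0\<close>.\<close>
    proof (rule integrable_of_bounded_compact[where M="M * (1 + cut.eta_bound)" and R="4 * C\<^sub>0"])
      fix \<xi> :: "real ^ 3"
      have "\<bar>1 - \<eta>' (norm \<xi> / 2)\<bar> \<le> 1 + cut.eta_bound"
        using abs_triangle_ineq4[of 1 "\<eta>' (norm \<xi> / 2)"] cut.eta_bound(2)[of "norm \<xi> / 2"] by linarith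
      then show "norm (G1 \<xi>) \<le> M * (1 + cut.eta_bound)"
        unfolding G1_def norm_mult norm_of_real M_def
        by (intro mult_mono norm_fourier_le[OF q_int]) auto
      show "4 * C\<^sub>0 \<le> norm \<xi> \<Longrightarrow> G1 \<xi> = 0" by (simp add: G1_def cut.eta_one)
    qed measurable
    moreover have "integrable lborel G2"
    proof (rule integrableI_bounded)
      let ?E = "\<lambda>\<xi>. ennreal (norm (W \<xi> - fourier q \<xi>)) * indicator {\<xi>. 2 * k\<^sub>0 \<le> norm \<xi>} \<xi>"
      have "(\<integral>\<^sup>+\<xi>. ennreal (norm (G2 \<xi>)) \<partial>lborel) \<le> (\<integral>\<^sup>+\<xi>. ennreal cut.eta_bound * ?E \<xi> \<partial>lborel)"
      proof (rule nn_integral_mono)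
        fix \<xi>
        show "ennreal (norm (G2 \<xi>)) \<le> ennreal cut.eta_bound * ?E \<xi>"
        proof (cases "2 * k\<^sub>0 \<le> norm \<xi>")
          case True
          have "norm (G2 \<xi>) \<le> cut.eta_bound * norm (W \<xi> - fourier q \<xi>)"
            unfolding G2_def norm_mult norm_of_real norm_minus_commute[of "fourier q \<xi>"]
            by (subst mult.commute) (intro mult_right_mono cut.eta_bound norm_ge_zero)
          then have "ennreal (norm (G2 \<xi>)) \<le> ennreal (cut.eta_bound * norm (W \<xi> - fourier q \<xi>))" by (rule ennreal_leI)
          then show ?thesis using True by (simp add: ennreal_mult'')
        next
          case False
          then show ?thesis by (simp add: G2_def low)
        qed
      qed
      also have "\<dots> = ennreal cut.eta_bound * (\<integral>\<^sup>+\<xi>. ?E \<xi> \<partial>lborel)"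
        by (rule nn_integral_cmult) measurable
      also have "\<dots> < \<infinity>" using amplitude_error_finite by (simp add: W_def ennreal_mult_less_top)
      finally show "(\<integral>\<^sup>+\<xi>. ennreal (norm (G2 \<xi>)) \<partial>lborel) < \<infinity>" .
    qed measurable
    ultimately have "integrable lborel (\<lambda>\<xi>. G1 \<xi> + G2 \<xi>)" by (rule Bochner_Integration.integrable_add)
    then show ?thesis by (simp add: G_def[abs_def] G1_def G2_def D_def algebra_simps)
  qed
  define g where "g = inv_fourier G"
  have g: "continuous_on UNIV g" unfolding g_def by (rule continuous_inv_fourier[OF G])
  have T: "distr_of q' \<phi> - born_approximation q' \<eta>' \<phi> = (LINT x|lborel. g x * \<phi> x)"
    if \<phi>: "\<phi> \<in> test_functions" for \<phi>
  proof -
    have \<phi>_int: "integrable lborel \<phi>" by (rule test_function_integrable[OF \<phi>])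
    have i: "integrable lborel (inv_fourier \<phi>)" by (rule integrable_inv_fourier_test[OF \<phi>])
    then have [measurable]: "inv_fourier \<phi> \<in> borel_measurable borel" by auto
    have bounded: "integrable lborel (\<lambda>\<xi>. h \<xi> * inv_fourier \<phi> \<xi>)"
      if [measurable]: "h \<in> borel_measurable borel" and h: "\<And>\<xi>. norm (h \<xi>) \<le> B" for h :: "real ^ 3 \<Rightarrow> complex" and B
      by (rule Bochner_Integration.integrable_bound[OF integrable_mult_right[OF i, of "complex_of_real B"]])
        (auto simp: norm_mult intro!: AE_I2 mult_right_mono order_trans[OF h abs_ge_self])
    have "distr_of q' \<phi> = (LINT x|lborel. q x * \<phi> x)"
      by (intro distr_of_lborel Q test_function_borel[OF \<phi>]) measurable
    also have "\<dots> = (LINT \<xi>|lborel. fourier q \<xi> * inv_fourier \<phi> \<xi>)" by (rule integral_mult_test[OF q_int \<phi>])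
    finally have 1: "distr_of q' \<phi> = (LINT \<xi>|lborel. fourier q \<xi> * inv_fourier \<phi> \<xi>)" .
    have 2: "born_approximation q' \<eta>' \<phi> = (LINT \<xi>|lborel. D \<xi> * inv_fourier \<phi> \<xi>)"
      unfolding born_approximation_def inv_fourier_distr_def data
      by (rule distr_of_lborel) auto
    have "(LINT \<xi>|lborel. fourier q \<xi> * inv_fourier \<phi> \<xi>) - (LINT \<xi>|lborel. D \<xi> * inv_fourier \<phi> \<xi>)
        = (LINT \<xi>|lborel. fourier q \<xi> * inv_fourier \<phi> \<xi> - D \<xi> * inv_fourier \<phi> \<xi>)"
      by (rule Bochner_Integration.integral_diff[symmetric])
        (rule bounded[OF _ norm_fourier_le[OF q_int]], measurable, rule bounded[OF _ D_bound], measurable)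
    also have "\<dots> = (LINT \<xi>|lborel. G \<xi> * inv_fourier \<phi> \<xi>)" by (simp add: G_def left_diff_distrib)
    also have "\<dots> = (LINT x|lborel. g x * \<phi> x)"
      unfolding g_def by (rule inv_fourier_multiplication[OF G \<phi>_int, symmetric])
    finally show ?thesis unfolding 1 2 .
  qed
  have "ball_integrable g"
    by (rule ball_integrable_bounded[OF borel_measurable_continuous_onI[OF g]])
      (unfold g_def, rule norm_inv_fourier_le[OF G])
  from is_functionI[OF this AE_I2[OF refl] T] g show ?thesis by blast
qed

theorem theorem3:
  fixes q :: "real ^ 3 \<Rightarrow> complex" and \<alpha> :: real
  assumes "\<alpha> > 1"
    and "q \<in> sobolev_fun \<alpha>"
    and "compactly_supported q"
  shows "\<exists>k\<^sub>0\<ge>0. \<forall>C\<^sub>0>k\<^sub>0. \<forall>\<eta>. high_freq_cutoff C\<^sub>0 \<eta> \<longrightarrow>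
           (\<exists>g. continuous_on UNIV g \<and>
                is_function (\<lambda>\<phi>. distr_of q \<phi> - born_approximation q \<eta> \<phi>) g)"
proof (cases "\<exists>C>0. \<exists>\<eta>. high_freq_cutoff C \<eta>")
  case True
  \<comment> \<open>Any one cutoff will do: it supplies test functions, whereas the constants behind
    \<open>k\<^sub>0\<close> depend on the potential, \<rho> and \<alpha> alone. Hence the threshold
    is fixed before the cutoff of the data is given.\<close>
  then obtain C \<eta> where "high_freq_cutoff C \<eta>" "0 < C" by blast
  then interpret smooth_cutoff C \<eta> by unfold_locales
  have "locally_integrable q" using assms(2) by (auto simp: sobolev_fun_def is_function_def)
  from compactly_supported_ex_borel[OF this assms(3)] obtain p \<rho> where
    p: "p \<in> borel_measurable borel" "integrable lborel p" "AE x in lborel. q x = p x"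
    and \<rho>: "0 < \<rho>" "\<And>x. \<rho> < norm x \<Longrightarrow> p x = 0" by blast
  interpret potential C \<eta> p \<rho> \<alpha>
    using p(2) \<rho> assms(1) sobolev_fourier_weighted_L2[OF assms(2) p(2,3) \<rho>(2)] by unfold_locales auto
  show ?thesis
    using k\<^sub>0_ge_1 ex_continuous_difference[OF _ _ p(3)] by (intro exI[of _ "k\<^sub>0"]) auto
next
  case False
  then show ?thesis by (intro exI[of _ 0]) auto
qed

end
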